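(* Suppose that: (1) $V$ has a global minimum at $0$, $V(0)=0$ and $V(\mathsf{x})\ge 0$ for all $\mathsf{x}\in\mathbb{R}^d$; (2) $L:=\sup\|\nabla^2V\|<\infty$; (3) there exist $K\in(0,\infty)$ and $R\in[0,\infty)$ such that $(\mathsf{x}-\mathsf{y})\cdot(\nabla V(\mathsf{x})-\nabla V(\mathsf{y}))\ge K|\mathsf{x}-\mathsf{y}|^2$ for all $\mathsf{x},\mathsf{y}\in\mathbb{R}^d$ with $|\mathsf{x}-\mathsf{y}|\ge R$; (4) $\tilde L:=\sup\|\nabla^2W\|<\infty$. Put $\tilde R:=8R\sqrt{(L+K)/K}$. Let $T\in(0,\infty)$ and $h_1\in[0,\infty)$ satisfy $$L(T+h_1)^2\le\frac35\min\Big(\frac14,\frac{3K}{10L},\frac{3}{256\cdot5L\tilde R^2}\Big),$$ and let $\epsilon\in[0,\infty)$ satisfy $$\epsilon\tilde L<\min\Big(\frac K6,\ \frac12\Big(\frac{K(\tilde R+T)}{36\cdot149}\Big)^2\exp\Big(-5\frac{\tilde R}{T}\Big)\Big).$$ Let $c=\frac1{156}KT^2\exp\big(-\frac{5\tilde R}{4T}\big)$ and $M=\exp\big(\frac54(\frac{\tilde R}{T}+2)\big)$. (a) There is a constant $C_2\in(0,\infty)$, depending on $L,\tilde L,\epsilon$ and $T$, such that for all $x\in\mathbb{R}^{dn}$, all $h>0$ with $T/h\in\mathbb{N}$ and all $k\in\mathbb{N}$ with $kh\le T$, $$\mathbb{E}_{\xi\sim\mathcal{N}(0,I_{dn})}\Big[\sum_i|q^i_{kh}(x,\xi)-\tilde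 q^i_{kh}(x,\xi)|\Big]\le hC_2\Big(d^{1/2}n+\sum_i|x^i|\Big),$$ and, with this $C_2$, for every $h\in(0,h_1]$ with $T/h\in\mathbb{N}$, $$\mathcal{W}_{\ell^1}(\mu,\mu_h)\le hc^{-1}MC_2\Big(d^{1/2}n+\int_{\mathbb{R}^{dn}}\sum_i|x^i|\,\mu(\mathrm{d}x)\Big).$$ (b) If additionally $V$ and $W$ are three times differentiable with $L_H:=\sup\|\nabla^3V\|<\infty$ and $\tilde L_H:=\sup\|\nabla^3W\|<\infty$, then there is a constant $\tilde C_2\in(0,\infty)$, depending on $L,\tilde L,\epsilon,L_H,\tilde L_H$ and $T$, such that for all $x\in\mathbb{R}^{dn}$, all $h>0$ with $T/h\in\mathbb{N}$ and all $k\in\mathbb{N}$ with $kh\le T$, $$\mathbb{E}_{\xi\sim\mathcal{N}(0,I_{dn})}\Big[\sum_i|q^i_{kh}(x,\xi)-\tilde q^i_{kh}(x,\xi)|\Big]\le h^2\tilde C_2\Big(dn+\sum_i|x^i|+\sum_i|x^i|^2\Big),$$ and, with this $\tilde C_2$, for every $h\in(0,h_1]$ with $T/h\in\mathbb{N}$, $$\mathcal{W}_{\ell^1}(\mu,\mu_h)\le h^2c^{-1}M\tilde C_2\Big(dn+\int_{\mathbb{R}^{dn}}\sum_i|x^i|\,\mu(\mathrm{d}x)+\int_{\mathbb{R}^{dn}}\sum_i|x^i|^2\,\mu(\mathrm{d}x)\Big).$$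
   Context: Setting. Let $n,d\ge1$ be integers. Points of $\mathbb{R}^{dn}$ are written $x=(x^1,\dots,x^n)$ with $x^i\in\mathbb{R}^d$; $|\cdot|$ is the Euclidean norm and $\|\cdot\|$ the operator norm. $V,W:\mathbb{R}^d\to\mathbb{R}$ are twice continuously differentiable, $\epsilon\in[0,\infty)$, and $$U(x)=\sum_{i=1}^n\Big(V(x^i)+\frac{\epsilon}{n}\sum_{j\ne i}W(x^i-x^j)\Big),\qquad Z=\int_{\mathbb{R}^{dn}}\exp(-U(x))\,\mathrm{d}x<\infty.$$ The target measure is $\mu(\mathrm{d}x)=Z^{-1}\exp(-U(x))\,\mathrm{d}x$. $\nabla_iU(x)\in\mathbb{R}^d$ is the gradient of $U$ with respect to $x^i$. Dynamics. $(q_t(x,v),p_t(x,v))$ is the exact Hamiltonian flow $\frac{\mathrm{d}}{\mathrm{d}t}q^i_t=p^i_t$, $\frac{\mathrm{d}}{\mathrm{d}t}p^i_t=-\nabla_iU(q_t)$, $(q_0,p_0)=(x,v)$. For $h>0$ put $\lfloor t\rfloor_h=\max\{s\in h\mathbb{Z}:s\le t\}$, $\lceil t\rceil_h=\min\{s\in h\mathbb{Z}:s\ge t\}$; $(\tilde q_t(x,v),\tilde p_t(x,v))$ is the velocity Verlet flow with step $h$: $$\frac{\mathrm{d}}{\mathrm{d}t}\tilde q^i_t=\tilde p^i_{\lfloor t\rfloor_h}-\frac h2\nabla_iU(\tilde q_{\lfloor t\rfloor_h}),\qquad\frac{\mathrm{d}}{\mathrm{d}t}\tilde p^i_t=-\frac12\big(\nabla_iU(\tilde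 q_{\lfloor t\rfloor_h})+\nabla_iU(\tilde q_{\lceil t\rceil_h})\big),\qquad(\tilde q_0,\tilde p_0)=(x,v).$$ The unadjusted HMC kernel is $\pi_h(x,B)=P[\tilde q_T(x,\xi)\in B]$ with $\xi\sim\mathcal{N}(0,I_{dn})$, and $\mu_h$ denotes the unique invariant probability measure of $\pi_h$. Distance. $\mathcal{W}_{\ell^1}(\nu,\eta)=\inf_{\omega\in\Gamma(\nu,\eta)}\int\sum_{i=1}^n|x^i-y^i|\,\omega(\mathrm{d}x\,\mathrm{d}y)$, with $\Gamma(\nu,\eta)$ the set of couplings of $\nu$ and $\eta$. When $R=0$ (so $\tilde R=0$), $1/0$ is read as $+\infty$. *)

theory Defs
  imports "HOL-Probability.Probability"
begin

(* The constants in the theorem must not depend on n and d, so both have to be quantified inside the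
   formula and cannot be the sizes of index types.  Every R^d is therefore realised inside the one
   real inner product space of square-summable sequences, as the subspace of sequences supported on
   the first d coordinates; norm, inner, has_derivative and operator norms are the library's. *)

typedef ell2 = "{f :: nat \<Rightarrow> real. summable (\<lambda>i. (f i)\<^sup>2)}"
  morphisms coord Abs_ell2
  by (rule exI[of _ "\<lambda>_. 0"]) simp

lemma summable_coord_sq: "summable (\<lambda>i. (coord x i)\<^sup>2)"
  using coord[of x] by simp

lemma ell2_eqI: "(\<And>i. coord x i = coord y i) \<Longrightarrow> x = y"
  by (metis coord_inject ext)

lemma summable_coord_mult: "summable (\<lambda>i. coord x i * coord y i)"
proof (rule summable_comparison_test')
  show "summable (\<lambda>i. (coord x i)\<^sup>2 + (coord y i)\<^sup>2)"
    by (intro summable_add summable_coord_sq)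
  fix i
  have "0 \<le> (\<bar>coord x i\<bar> - \<bar>coord y i\<bar>)\<^sup>2" by simp
  then have "2 * (\<bar>coord x i\<bar> * \<bar>coord y i\<bar>) \<le> (coord x i)\<^sup>2 + (coord y i)\<^sup>2"
    by (simp add: power2_diff)
  moreover have "0 \<le> \<bar>coord x i\<bar> * \<bar>coord y i\<bar>" by simp
  ultimately show "norm (coord x i * coord y i) \<le> (coord x i)\<^sup>2 + (coord y i)\<^sup>2"
    unfolding real_norm_def abs_mult by linarith
qed

instantiation ell2 :: real_inner
begin

definition zero_ell2 :: ell2 where "zero_ell2 = Abs_ell2 (\<lambda>_. 0)"
definition plus_ell2 :: "ell2 \<Rightarrow> ell2 \<Rightarrow> ell2"
  where "plus_ell2 x y = Abs_ell2 (\<lambda>i. coord x i + coord y i)"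
definition minus_ell2 :: "ell2 \<Rightarrow> ell2 \<Rightarrow> ell2"
  where "minus_ell2 x y = Abs_ell2 (\<lambda>i. coord x i - coord y i)"
definition uminus_ell2 :: "ell2 \<Rightarrow> ell2"
  where "uminus_ell2 x = Abs_ell2 (\<lambda>i. - coord x i)"
definition scaleR_ell2 :: "real \<Rightarrow> ell2 \<Rightarrow> ell2"
  where "scaleR_ell2 r x = Abs_ell2 (\<lambda>i. r * coord x i)"
definition inner_ell2 :: "ell2 \<Rightarrow> ell2 \<Rightarrow> real"
  where "inner_ell2 x y = (\<Sum>i. coord x i * coord y i)"
definition norm_ell2 :: "ell2 \<Rightarrow> real"
  where "norm_ell2 x = sqrt (inner x x)"
definition sgn_ell2 :: "ell2 \<Rightarrow> ell2"
  where "sgn_ell2 x = inverse (norm x) *\<^sub>R x"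
definition dist_ell2 :: "ell2 \<Rightarrow> ell2 \<Rightarrow> real"
  where "dist_ell2 x y = norm (x - y)"
definition uniformity_ell2 :: "(ell2 \<times> ell2) filter"
  where "uniformity_ell2 = (INF e\<in>{0<..}. principal {(x, y). dist x y < e})"
definition open_ell2 :: "ell2 set \<Rightarrow> bool"
  where "open_ell2 S \<longleftrightarrow> (\<forall>x\<in>S. \<forall>\<^sub>F (x', y) in uniformity. x' = x \<longrightarrow> y \<in> S)"

lemma coord_zero: "coord 0 i = 0"
  by (simp add: zero_ell2_def Abs_ell2_inverse)

lemma coord_plus: "coord (x + y) i = coord x i + coord y i"
proof -
  have "summable (\<lambda>i. (coord x i)\<^sup>2 + (coord y i)\<^sup>2 + 2 * (coord x i * coord y i))"
    by (intro summable_add summable_mult summable_coord_sq summable_coord_mult)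
  then have "summable (\<lambda>i. (coord x i + coord y i)\<^sup>2)"
    by (simp add: power2_sum mult.assoc)
  then show ?thesis by (simp add: plus_ell2_def Abs_ell2_inverse)
qed

lemma coord_scaleR: "coord (r *\<^sub>R x) i = r * coord x i"
proof -
  have "summable (\<lambda>i. (r * coord x i)\<^sup>2)"
    unfolding power_mult_distrib by (intro summable_mult summable_coord_sq)
  then show ?thesis by (simp add: scaleR_ell2_def Abs_ell2_inverse)
qed

lemma coord_uminus: "coord (- x) i = - coord x i"
  using summable_coord_sq[of x] by (simp add: uminus_ell2_def Abs_ell2_inverse)

lemma coord_minus: "coord (x - y) i = coord x i - coord y i"
proof -
  have "x - y = x + - y"
    by (simp add: minus_ell2_def plus_ell2_def coord_uminus)
  then show ?thesis by (simp add: coord_plus coord_uminus)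
qed

instance
proof
  fix x y z :: ell2 and a b :: real
  note coords = coord_zero coord_plus coord_scaleR coord_uminus coord_minus
  show "x + y + z = x + (y + z)" "x + y = y + x" "0 + x = x" "- x + x = 0" "x - y = x + - y"
    "a *\<^sub>R (x + y) = a *\<^sub>R x + a *\<^sub>R y" "(a + b) *\<^sub>R x = a *\<^sub>R x + b *\<^sub>R x"
    "a *\<^sub>R b *\<^sub>R x = (a * b) *\<^sub>R x" "1 *\<^sub>R x = x"
    by (auto intro!: ell2_eqI simp: coords algebra_simps)
  show "sgn x = inverse (norm x) *\<^sub>R x" by (rule sgn_ell2_def)
  show "dist x y = norm (x - y)" by (rule dist_ell2_def)
  show "(uniformity :: (ell2 \<times> ell2) filter) = (INF e\<in>{0<..}. principal {(x, y). dist x y < e})"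
    by (rule uniformity_ell2_def)
  show "open S \<longleftrightarrow> (\<forall>x\<in>S. \<forall>\<^sub>F (x', y) in uniformity. x' = x \<longrightarrow> y \<in> S)" for S :: "ell2 set"
    by (rule open_ell2_def)
  show "inner x y = inner y x" by (simp add: inner_ell2_def mult.commute)
  show "inner (x + y) z = inner x z + inner y z"
    unfolding inner_ell2_def coords
    by (simp add: distrib_right suminf_add summable_coord_mult)
  show "inner (a *\<^sub>R x) y = a * inner x y"
    unfolding inner_ell2_def coords
    by (simp add: mult.assoc suminf_mult summable_coord_mult)
  show "0 \<le> inner x x"
    unfolding inner_ell2_def by (intro suminf_nonneg summable_coord_mult) simp
  have "inner x x = 0 \<longleftrightarrow> (\<forall>i. coord x i * coord x i = 0)"
    unfolding inner_ell2_def by (intro suminf_eq_zero_iff summable_coord_mult) simp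
  also have "\<dots> \<longleftrightarrow> x = 0" by (auto intro: ell2_eqI simp: coords)
  finally show "inner x x = 0 \<longleftrightarrow> x = 0" .
  show "norm x = sqrt (inner x x)" by (rule norm_ell2_def)
qed

end

definition Rspace :: "nat \<Rightarrow> ell2 set"
  where "Rspace d = {x. \<forall>i\<ge>d. coord x i = 0}"

definition embed :: "nat \<Rightarrow> (nat \<Rightarrow> real) \<Rightarrow> ell2"
  where "embed d f = Abs_ell2 (\<lambda>i. if i < d then f i else 0)"

lemma coord_embed: "coord (embed d f) i = (if i < d then f i else 0)"
proof -
  have "summable (\<lambda>i. (if i < d then f i else 0)\<^sup>2)"
    by (rule summable_finite[of "{..<d}"]) auto
  then show ?thesis by (simp add: embed_def Abs_ell2_inverse)
qed

lemma inner_Rspace: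
  assumes "x \<in> Rspace d"
  shows "inner x y = (\<Sum>i<d. coord x i * coord y i)"
  unfolding inner_ell2_def
  by (rule suminf_finite) (use assms in \<open>auto simp: Rspace_def\<close>)

lemma norm_Rspace:
  assumes "x \<in> Rspace d"
  shows "norm x = sqrt (\<Sum>i<d. (coord x i)\<^sup>2)"
  by (simp add: norm_eq_sqrt_inner inner_Rspace[OF assms] power2_eq_square)


(* A function on R^d is represented by its extension to ell2 that ignores the coordinates from d on.
   Its Frechet derivatives on ell2 then ignore these coordinates in all arguments, so the gradient
   lies in R^d and norms of the derivatives are the operator norms of the derivatives on R^d. *)

definition on_Rspace :: "nat \<Rightarrow> (ell2 \<Rightarrow> real) \<Rightarrow> bool"
  where "on_Rspace d f \<longleftrightarrow> (\<forall>x. f x = f (embed d (coord x)))"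

definition grad :: "(ell2 \<Rightarrow> real) \<Rightarrow> ell2 \<Rightarrow> ell2"
  where "grad f x = (THE g. GDERIV f x :> g)"

definition hess :: "(ell2 \<Rightarrow> real) \<Rightarrow> ell2 \<Rightarrow> ell2 \<Rightarrow>\<^sub>L ell2"
  where "hess f x = Blinfun (frechet_derivative (grad f) (at x))"

definition third_deriv :: "(ell2 \<Rightarrow> real) \<Rightarrow> ell2 \<Rightarrow> ell2 \<Rightarrow>\<^sub>L (ell2 \<Rightarrow>\<^sub>L ell2)"
  where "third_deriv f x = Blinfun (frechet_derivative (hess f) (at x))"

definition twice_cont_differentiable :: "(ell2 \<Rightarrow> real) \<Rightarrow> bool"
  where "twice_cont_differentiable f \<longleftrightarrow>
    (\<forall>x. f differentiable (at x)) \<and> (\<forall>x. grad f differentiable (at x)) \<and> continuous_on UNIV (hess f)"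

definition thrice_differentiable :: "(ell2 \<Rightarrow> real) \<Rightarrow> bool"
  where "thrice_differentiable f \<longleftrightarrow>
    (\<forall>x. f differentiable (at x)) \<and> (\<forall>x. grad f differentiable (at x)) \<and>
    (\<forall>x. hess f differentiable (at x))"

definition finite_sup :: "(ell2 \<Rightarrow> 'b::real_normed_vector) \<Rightarrow> real \<Rightarrow> bool"
  where "finite_sup D B \<longleftrightarrow> bdd_above (range (\<lambda>x. norm (D x))) \<and> B = (SUP x. norm (D x))"


(* Points of R^{dn} are extensional families of n points of R^d. *)

type_synonym config = "nat \<Rightarrow> ell2"

definition configs :: "nat \<Rightarrow> nat \<Rightarrow> config set"
  where "configs n d = ({..<n} \<rightarrow>\<^sub>E Rspace d)"

definition iid_measure :: "nat \<Rightarrow> nat \<Rightarrow> real measure \<Rightarrow> config measure"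
  where "iid_measure n d m =
    PiM {..<n} (\<lambda>_. distr (PiM {..<d} (\<lambda>_. m)) (restrict_space borel (Rspace d)) (embed d))"

definition lebesgue_config :: "nat \<Rightarrow> nat \<Rightarrow> config measure"
  where "lebesgue_config n d = iid_measure n d lborel"

definition gauss_config :: "nat \<Rightarrow> nat \<Rightarrow> config measure"
  where "gauss_config n d = iid_measure n d std_normal_distribution"

definition potential :: "nat \<Rightarrow> (ell2 \<Rightarrow> real) \<Rightarrow> (ell2 \<Rightarrow> real) \<Rightarrow> real \<Rightarrow> config \<Rightarrow> real"
  where "potential n V W eps x =
    (\<Sum>i<n. V (x i) + eps / real n * (\<Sum>j\<in>{..<n} - {i}. W (x i - x j)))"

definition partial_grad :: "(config \<Rightarrow> real) \<Rightarrow> nat \<Rightarrow> config \<Rightarrow> ell2"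
  where "partial_grad U i x = grad (\<lambda>y. U (x(i := y))) (x i)"

definition gibbs :: "nat \<Rightarrow> nat \<Rightarrow> (config \<Rightarrow> real) \<Rightarrow> config measure"
  where "gibbs n d U =
    (let Z = (\<integral>x. exp (- U x) \<partial>lebesgue_config n d)
     in density (lebesgue_config n d) (\<lambda>x. ennreal (exp (- U x) / Z)))"


type_synonym flow = "real \<Rightarrow> config \<Rightarrow> config \<Rightarrow> config"

definition hamiltonian_flow :: "nat \<Rightarrow> nat \<Rightarrow> (config \<Rightarrow> real) \<Rightarrow> flow \<Rightarrow> flow \<Rightarrow> bool"
  where "hamiltonian_flow n d U q p \<longleftrightarrow>
    (\<forall>x\<in>configs n d. \<forall>v\<in>configs n d.
      q 0 x v = x \<and> p 0 x v = v \<and>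
      (\<forall>t\<ge>0. q t x v \<in> configs n d \<and> p t x v \<in> configs n d \<and>
        (\<forall>i<n.
          ((\<lambda>s. q s x v i) has_vector_derivative p t x v i) (at t within {0..}) \<and>
          ((\<lambda>s. p s x v i) has_vector_derivative - partial_grad U i (q t x v)) (at t within {0..}))))"

definition grid :: "real \<Rightarrow> real set"
  where "grid h = range (\<lambda>k::int. h * of_int k)"

definition grid_floor :: "real \<Rightarrow> real \<Rightarrow> real"
  where "grid_floor h t = (GREATEST s. s \<in> grid h \<and> s \<le> t)"

definition grid_ceiling :: "real \<Rightarrow> real \<Rightarrow> real"
  where "grid_ceiling h t = (LEAST s. s \<in> grid h \<and> t \<le> s)"

(* The right-hand sides jump at the grid points, so the flow is the continuous curve that satisfies
   the differential equations off the grid. *)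

definition verlet_flow :: "nat \<Rightarrow> nat \<Rightarrow> (config \<Rightarrow> real) \<Rightarrow> real \<Rightarrow> flow \<Rightarrow> flow \<Rightarrow> bool"
  where "verlet_flow n d U h q p \<longleftrightarrow>
    (\<forall>x\<in>configs n d. \<forall>v\<in>configs n d.
      q 0 x v = x \<and> p 0 x v = v \<and>
      (\<forall>t\<ge>0. q t x v \<in> configs n d \<and> p t x v \<in> configs n d) \<and>
      (\<forall>i<n. continuous_on {0..} (\<lambda>t. q t x v i) \<and> continuous_on {0..} (\<lambda>t. p t x v i)) \<and>
      (\<forall>t>0. t \<notin> grid h \<longrightarrow> (\<forall>i<n.
        ((\<lambda>s. q s x v i) has_vector_derivative
          p (grid_floor h t) x v i - (h / 2) *\<^sub>R partial_grad U i (q (grid_floor h t) x v)) (at t) \<and>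
        ((\<lambda>s. p s x v i) has_vector_derivative
          - ((1 / 2) *\<^sub>R (partial_grad U i (q (grid_floor h t) x v) +
                         partial_grad U i (q (grid_ceiling h t) x v)))) (at t))))"

definition hmc_kernel :: "nat \<Rightarrow> nat \<Rightarrow> real \<Rightarrow> flow \<Rightarrow> config \<Rightarrow> config measure"
  where "hmc_kernel n d T q x = distr (gauss_config n d) (lebesgue_config n d) (\<lambda>v. q T x v)"

definition invariant_prob :: "'a measure \<Rightarrow> ('a \<Rightarrow> 'a measure) \<Rightarrow> 'a measure \<Rightarrow> bool"
  where "invariant_prob S \<kappa> \<nu> \<longleftrightarrow>
    prob_space \<nu> \<and> sets \<nu> = sets S \<and>
    (\<forall>B\<in>sets S. (\<integral>\<^sup>+x. emeasure (\<kappa> x) B \<partial>\<nu>) = emeasure \<nu> B)"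

definition couplings :: "'a measure \<Rightarrow> 'a measure \<Rightarrow> ('a \<times> 'a) measure set"
  where "couplings \<nu> \<eta> =
    {\<omega>. sets \<omega> = sets (\<nu> \<Otimes>\<^sub>M \<eta>) \<and> distr \<omega> \<nu> fst = \<nu> \<and> distr \<omega> \<eta> snd = \<eta>}"

definition wasserstein_l1 :: "nat \<Rightarrow> config measure \<Rightarrow> config measure \<Rightarrow> ennreal"
  where "wasserstein_l1 n \<nu> \<eta> =
    (INF \<omega>\<in>couplings \<nu> \<eta>. \<integral>\<^sup>+z. ennreal (\<Sum>i<n. norm (fst z i - snd z i)) \<partial>\<omega>)"


definition R_tilde :: "real \<Rightarrow> real \<Rightarrow> real \<Rightarrow> real"
  where "R_tilde L K R = 8 * R * sqrt ((L + K) / K)"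

definition rate :: "real \<Rightarrow> real \<Rightarrow> real \<Rightarrow> real \<Rightarrow> real"
  where "rate L K R T = 1 / 156 * K * T\<^sup>2 * exp (- (5 * R_tilde L K R / (4 * T)))"

definition prefactor :: "real \<Rightarrow> real \<Rightarrow> real \<Rightarrow> real \<Rightarrow> real"
  where "prefactor L K R T = exp (5 / 4 * (R_tilde L K R / T + 2))"

(* For R_tilde = 0 the last entry of the first minimum is read as infinity, hence the case split. *)

definition step_condition :: "real \<Rightarrow> real \<Rightarrow> real \<Rightarrow> real \<Rightarrow> real \<Rightarrow> bool"
  where "step_condition L K R T h1 \<longleftrightarrow>
    L * (T + h1)\<^sup>2 \<le> 3 / 5 *
      (if R_tilde L K R = 0 then min (1 / 4) (3 * K / (10 * L))
       else min (1 / 4) (min (3 * K / (10 * L)) (3 / (256 * 5 * L * (R_tilde L K R)\<^sup>2))))"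

definition interaction_condition :: "real \<Rightarrow> real \<Rightarrow> real \<Rightarrow> real \<Rightarrow> real \<Rightarrow> real \<Rightarrow> bool"
  where "interaction_condition L Lt K R T eps \<longleftrightarrow>
    eps * Lt < min (K / 6)
      (1 / 2 * (K * (R_tilde L K R + T) / (36 * 149))\<^sup>2 * exp (- (5 * (R_tilde L K R / T))))"

definition hmc_setting ::
  "nat \<Rightarrow> nat \<Rightarrow> (ell2 \<Rightarrow> real) \<Rightarrow> (ell2 \<Rightarrow> real) \<Rightarrow>
   real \<Rightarrow> real \<Rightarrow> real \<Rightarrow> real \<Rightarrow> real \<Rightarrow> real \<Rightarrow> real \<Rightarrow> bool"
  where "hmc_setting n d V W eps L Lt K R T h1 \<longleftrightarrow>
    n \<ge> 1 \<and> d \<ge> 1 \<and> on_Rspace d V \<and> on_Rspace d W \<and>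
    twice_cont_differentiable V \<and> twice_cont_differentiable W \<and>
    integrable (lebesgue_config n d) (\<lambda>x. exp (- potential n V W eps x)) \<and>
    V 0 = 0 \<and> (\<forall>x\<in>Rspace d. V x \<ge> 0) \<and>
    finite_sup (hess V) L \<and>
    K > 0 \<and> R \<ge> 0 \<and>
    (\<forall>x\<in>Rspace d. \<forall>y\<in>Rspace d. norm (x - y) \<ge> R \<longrightarrow>
      inner (x - y) (grad V x - grad V y) \<ge> K * (norm (x - y))\<^sup>2) \<and>
    finite_sup (hess W) Lt \<and>
    T > 0 \<and> h1 \<ge> 0 \<and> step_condition L K R T h1 \<and>
    eps \<ge> 0 \<and> interaction_condition L Lt K R T eps"

end

theory Submission
  imports Defs
begin

text \<open>
  Both transition kernels move the particles for the time \<open>T\<close> after drawing Gaussian velocities, one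
  along the exact Hamiltonian flow and one along velocity Verlet. The bounds follow from three
  facts.

  First, the two flows stay close, with constants that depend neither on the dimension nor on the
  number of particles. All quantities are measured in the sum of the particle distances, and in this
  norm the mean-field force has a Lipschitz constant in which the interaction enters as \<open>eps * Lt\<close>
  only. Under the step condition an orbit over the time \<open>T\<close> is bounded by its initial data, so
  Taylor expansion bounds the local errors of one step, with one more power of the step size once
  the Hessians are Lipschitz. A discrete Gronwall argument adds them up (\<open>first_order_error\<close>,
  \<open>second_order_error\<close>); taking Gaussian expectations gives the strong error bounds.

  Second, the exact kernel preserves the Gibbs measure (\<open>flow_invariant\<close>). One Verlet step is a
  composition of shears and therefore preserves phase space volume, the Verlet flows converge to the
  exact flow, and the exact flow conserves the energy. Fatou's lemma turns this into an inequality
  between integrals of test functions, and a test function together with its complement to one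
  yields equality.

  Third, the Verlet kernel is a contraction for a suitable distance (\<open>one_step_contraction\<close>).
  Particles that are far apart receive the same velocity, and the convexity of \<open>V\<close> at large distance
  brings them together. Particles at distance less than \<open>Rt\<close> receive velocities that differ by a
  shift towards each other; with a small probability the shift is rejected and the velocity is
  reflected instead, which keeps both marginals Gaussian. The failure is affordable because
  distances are measured by the concave function \<open>fc\<close>, for which a jump from \<open>r\<close> costs at most
  \<open>T exp (- r / T)\<close> besides a small linear term, while the shift earns a multiple of the slope
  \<open>exp (- r / T)\<close>.

  These facts combine in \<open>push_coupling\<close>. Given any coupling of the Gibbs measure and an invariant
  measure of the Verlet kernel, one exact transition on the left and one coupled Verlet transition
  on the right produce another such coupling, whose cost is at most \<open>(1 - 2 * cc)\<close> times the old
  cost plus twice the mean strong error. If the Gibbs measure has no first moment, the bound is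
  trivial. Otherwise the infimum \<open>a\<close> of the costs is finite, because a drift argument gives the
  other measure a first moment as well (\<open>muh_moment\<close>), so \<open>a \<le> (1 - 2 * cc) * a + 2 * err\<close>, that is
  \<open>a \<le> err / cc\<close>. The prefactor in the theorem is the reciprocal of the least slope of \<open>fc\<close>, which
  compares the cost with the Wasserstein distance.
\<close>

section \<open>Coordinates of the sequence space\<close>

lemmas coord_simps = coord_zero coord_plus coord_minus coord_uminus coord_scaleR

lemma coord_sum: "coord (\<Sum>i\<in>A. f i) k = (\<Sum>i\<in>A. coord (f i) k)"
  by (induction A rule: infinite_finite_induct) (auto simp: coord_simps)

definition basis_vec :: "nat \<Rightarrow> ell2"
  where "basis_vec k = embed (Suc k) (\<lambda>i. if i = k then 1 else 0)"

lemma coord_basis_vec: "coord (basis_vec k) i = (if i = k then 1 else 0)"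
  by (auto simp: basis_vec_def coord_embed)

lemma embed_eq_sum: "embed d f = (\<Sum>i<d. f i *\<^sub>R basis_vec i)"
  by (rule ell2_eqI)
     (auto simp: coord_embed coord_sum coord_simps coord_basis_vec if_distrib sum.delta cong: if_cong)

lemma embed_in_Rspace [simp]: "embed d f \<in> Rspace d"
  by (auto simp: Rspace_def coord_embed)

lemma embed_coord: "x \<in> Rspace d \<Longrightarrow> embed d (coord x) = x"
  by (rule ell2_eqI) (auto simp: coord_embed Rspace_def)

lemma subspace_Rspace: "subspace (Rspace d)"
  by (auto simp: subspace_def Rspace_def coord_simps)

lemma Rspace_closed [simp]:
  "0 \<in> Rspace d" "x \<in> Rspace d \<Longrightarrow> y \<in> Rspace d \<Longrightarrow> x + y \<in> Rspace d"
  "x \<in> Rspace d \<Longrightarrow> y \<in> Rspace d \<Longrightarrow> x - y \<in> Rspace d"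
  "x \<in> Rspace d \<Longrightarrow> c *\<^sub>R x \<in> Rspace d"
  "x \<in> Rspace d \<Longrightarrow> - x \<in> Rspace d"
  by (auto simp: Rspace_def coord_simps)

lemma Rspace_sum [simp]: "(\<And>i. i \<in> A \<Longrightarrow> f i \<in> Rspace d) \<Longrightarrow> sum f A \<in> Rspace d"
  by (rule subspace_sum[OF subspace_Rspace])

lemma inner_basis_vec: "inner x (basis_vec k) = coord x k"
proof -
  have "basis_vec k \<in> Rspace (Suc k)" by (simp add: basis_vec_def)
  then have "inner (basis_vec k) x = coord x k"
    by (simp add: inner_Rspace coord_basis_vec if_distrib[of "\<lambda>c. c * _"] sum.delta cong: if_cong)
  then show ?thesis by (simp add: inner_commute)
qed

lemma basis_vec_in_Rspace: "k < d \<Longrightarrow> basis_vec k \<in> Rspace d"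
  by (auto simp: Rspace_def coord_basis_vec)

lemma bounded_linear_coord: "bounded_linear (\<lambda>x. coord x i)"
  using bounded_linear_inner_left[of "basis_vec i"] by (simp add: inner_basis_vec)

lemma norm_sq_eq_suminf: "(norm x)\<^sup>2 = (\<Sum>i. (coord x i)\<^sup>2)" for x :: ell2
  unfolding power2_norm_eq_inner inner_ell2_def by (simp add: power2_eq_square)

text \<open>Finitely supported sequences approximate, because the tails of a convergent series vanish.\<close>

lemma embed_approximates: "(\<lambda>d. embed d (coord x)) \<longlonglongrightarrow> x"
proof -
  have "(\<lambda>d. norm (embed d (coord x) - x)) \<longlonglongrightarrow> 0"
  proof -
    have eq: "(norm (embed d (coord x) - x))\<^sup>2 = (\<Sum>i. (coord x i)\<^sup>2) - (\<Sum>i<d. (coord x i)\<^sup>2)" for d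
    proof -
      have "(norm (embed d (coord x) - x))\<^sup>2 = (\<Sum>i. if i < d then 0 else (coord x i)\<^sup>2)"
        unfolding norm_sq_eq_suminf
        by (intro arg_cong[where f=suminf] ext) (auto simp: coord_simps coord_embed)
      also have "\<dots> = (\<Sum>i. (coord x i)\<^sup>2 - (if i < d then (coord x i)\<^sup>2 else 0))"
        by (intro arg_cong[where f=suminf] ext) auto
      also have "\<dots> = (\<Sum>i. (coord x i)\<^sup>2) - (\<Sum>i. if i < d then (coord x i)\<^sup>2 else 0)"
        by (rule suminf_diff[symmetric])
           (auto intro: summable_coord_sq summable_finite[of "{..<d}"])
      also have "(\<Sum>i. if i < d then (coord x i)\<^sup>2 else 0) = (\<Sum>i<d. (coord x i)\<^sup>2)"
        by (subst suminf_finite[of "{..<d}"]) auto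
      finally show ?thesis .
    qed
    have "(\<lambda>d. (\<Sum>i. (coord x i)\<^sup>2) - (\<Sum>i<d. (coord x i)\<^sup>2)) \<longlonglongrightarrow> (\<Sum>i. (coord x i)\<^sup>2) - (\<Sum>i. (coord x i)\<^sup>2)"
      by (intro tendsto_intros summable_LIMSEQ summable_coord_sq)
    then have "(\<lambda>d. (norm (embed d (coord x) - x))\<^sup>2) \<longlonglongrightarrow> 0" by (simp add: eq)
    then have "(\<lambda>d. sqrt ((norm (embed d (coord x) - x))\<^sup>2)) \<longlonglongrightarrow> sqrt 0"
      by (rule tendsto_real_sqrt)
    then show ?thesis by simp
  qed
  then show ?thesis by (simp add: LIM_zero_cancel tendsto_norm_zero_iff)
qed

lemma countable_dense_ell2: "\<exists>D :: ell2 set. countable D \<and> (\<forall>x. \<forall>e>0. \<exists>y\<in>D. dist y x < e)"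
proof -
  define D where "D = (\<Union>d. (\<lambda>l. embed d (\<lambda>i. of_rat (l ! i))) ` {l::rat list. length l = d})"
  have "countable D" unfolding D_def by auto
  moreover have "\<exists>y\<in>D. dist y x < e" if e: "e > 0" for x e
  proof -
    from embed_approximates[of x] e have "\<forall>\<^sub>F d in sequentially. dist (embed d (coord x)) x < e/2"
      unfolding tendsto_iff by (meson half_gt_zero)
    then obtain d where d: "dist (embed d (coord x)) x < e/2"
      by (auto simp: eventually_sequentially)
    define \<epsilon> where "\<epsilon> = e / (2 * (real d + 1))"
    have "\<epsilon> > 0" using e by (simp add: \<epsilon>_def)
    have "\<exists>r. \<bar>of_rat r - coord x i\<bar> < \<epsilon>" for i
    proof -
      obtain r where "coord x i < of_rat r" "of_rat r < coord x i + \<epsilon>"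
        using of_rat_dense[of "coord x i" "coord x i + \<epsilon>"] \<open>\<epsilon> > 0\<close> by auto
      then show ?thesis by (intro exI[of _ r]) auto
    qed
    then obtain r where r: "\<And>i. \<bar>of_rat (r i) - coord x i\<bar> < \<epsilon>" by metis
    define y where "y = embed d (\<lambda>i. of_rat (map r [0..<d] ! i))"
    have y: "y = (\<Sum>i<d. of_rat (r i) *\<^sub>R basis_vec i)"
      unfolding y_def embed_eq_sum by (intro sum.cong) auto
    have nb: "norm (basis_vec i) = 1" for i
      by (simp add: norm_eq_sqrt_inner inner_basis_vec coord_basis_vec)
    have "norm (y - embed d (coord x)) = norm (\<Sum>i<d. (of_rat (r i) - coord x i) *\<^sub>R basis_vec i)"
      by (simp add: y embed_eq_sum sum_subtractf scaleR_diff_left)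
    also have "\<dots> \<le> (\<Sum>i<d. \<epsilon>)"
      using r by (intro sum_norm_le) (auto simp: nb intro: less_imp_le)
    also have "\<dots> < e/2" using e by (simp add: \<epsilon>_def field_simps)
    finally have "dist y x < e" using d dist_triangle[of y x "embed d (coord x)"]
      by (simp add: dist_norm)
    moreover have "y \<in> D" unfolding D_def y_def
      by (intro UN_I[of d] imageI) auto
    ultimately show ?thesis by auto
  qed
  ultimately show ?thesis by blast
qed

text \<open>Second countability makes the Borel \<open>\<sigma>\<close>-algebra of the sequence space compatible with sums,
  inner products and norms of measurable functions.\<close>

instance ell2 :: second_countable_topology
proof
  obtain D :: "ell2 set" where D: "countable D" "\<And>x e. e > 0 \<Longrightarrow> \<exists>y\<in>D. dist y x < e"
    using countable_dense_ell2 by auto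
  define B where "B = (\<lambda>(y, k::nat). ball y (1 / (real k + 1))) ` (D \<times> UNIV)"
  have "topological_basis B"
  proof (rule topological_basisI)
    fix b assume "b \<in> B" then show "open b" by (auto simp: B_def)
  next
    fix O' :: "ell2 set" and x assume "open O'" "x \<in> O'"
    then obtain e where e: "e > 0" "ball x e \<subseteq> O'" by (meson openE)
    obtain k :: nat where k: "1 / (real k + 1) < e / 2"
      using reals_Archimedean[of "e/2"] e by (auto simp: inverse_eq_divide add.commute)
    obtain y where y: "y \<in> D" "dist y x < 1 / (real k + 1)" using D(2)[of "1 / (real k + 1)" x] by auto
    have "ball y (1 / (real k + 1)) \<subseteq> ball x e"
    proof
      fix z assume "z \<in> ball y (1 / (real k + 1))"
      then show "z \<in> ball x e" using y k dist_triangle[of x z y] by (auto simp: dist_commute)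
    qed
    then show "\<exists>B'\<in>B. x \<in> B' \<and> B' \<subseteq> O'"
      using y e by (intro bexI[of _ "ball y (1 / (real k + 1))"]) (auto simp: B_def)
  qed
  moreover have "countable B" unfolding B_def using D(1) by auto
  ultimately show "\<exists>B::ell2 set set. countable B \<and> open = generate_topology B"
    using topological_basis_imp_subbasis by blast
qed

section \<open>Gradients of functions of finitely many coordinates\<close>

text \<open>The derivative vanishes in the directions that the function ignores, so it is the inner
  product with the finite sum of its values on the basis vectors.\<close>

lemma on_Rspace_GDERIV:
  assumes "on_Rspace d f" and "f differentiable (at x)"
  shows "GDERIV f x :> grad f x \<and> grad f x \<in> Rspace d"
proof -
  let ?P = "\<lambda>x. embed d (coord x)"
  obtain f' where f': "(f has_derivative f') (at x)" using assms(2) by (auto simp: differentiable_def)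
  then have lin: "bounded_linear f'" by (rule has_derivative_bounded_linear)
  then interpret f': bounded_linear f' .
  have proj: "f' h = f' (?P h)" for h
  proof -
    have ray: "((\<lambda>t. f (x + t *\<^sub>R h)) has_derivative (\<lambda>t. f' (t *\<^sub>R h))) (at 0)" for h
      by (rule has_derivative_compose[of "\<lambda>t. x + t *\<^sub>R h" "\<lambda>t. t *\<^sub>R h" 0 UNIV f f'])
         (auto intro!: derivative_eq_intros simp: f')
    have PP: "?P (x + t *\<^sub>R h) = ?P (x + t *\<^sub>R ?P h)" for t
      by (rule ell2_eqI) (auto simp: coord_embed coord_simps)
    have "f (x + t *\<^sub>R h) = f (x + t *\<^sub>R ?P h)" for t
      using assms(1) PP[of t] unfolding on_Rspace_def by metis
    then have "((\<lambda>t. f (x + t *\<^sub>R h)) has_derivative (\<lambda>t. f' (t *\<^sub>R ?P h))) (at 0)"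
      using ray[of "?P h"] by simp
    with ray[of h] have "(\<lambda>t. f' (t *\<^sub>R h)) = (\<lambda>t. f' (t *\<^sub>R ?P h))"
      by (rule has_derivative_unique)
    from fun_cong[OF this, of 1] show ?thesis by simp
  qed
  define g where "g = (\<Sum>i<d. f' (basis_vec i) *\<^sub>R basis_vec i)"
  have fg: "f' h = inner h g" for h
  proof -
    have "f' h = (\<Sum>i<d. coord h i * f' (basis_vec i))"
      by (subst proj) (simp add: embed_eq_sum f'.sum f'.scaleR)
    also have "\<dots> = inner h g"
      by (simp add: g_def inner_sum_right inner_basis_vec mult.commute)
    finally show ?thesis .
  qed
  have g: "GDERIV f x :> g" unfolding gderiv_def using f' ext[of f' "\<lambda>h. inner h g"] fg by simp
  have uniq: "g' = g" if "GDERIV f x :> g'" for g'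
  proof -
    have "(\<lambda>h. inner h g') = (\<lambda>h. inner h g)"
      using that g unfolding gderiv_def by (rule has_derivative_unique)
    then have "inner h (g' - g) = 0" for h by (metis inner_diff_right right_minus_eq)
    from this[of "g' - g"] show ?thesis by simp
  qed
  have "grad f x = g" unfolding grad_def using g uniq by (rule the_equality)
  moreover have "g \<in> Rspace d" unfolding g_def by (intro Rspace_sum Rspace_closed basis_vec_in_Rspace) auto
  ultimately show ?thesis using g by simp
qed

lemma grad_eqI:
  assumes "GDERIV f x :> g" shows "grad f x = g"
  unfolding grad_def
proof (rule the_equality)
  show "GDERIV f x :> g" by fact
next
  fix g' assume "GDERIV f x :> g'"
  then have "(\<lambda>h. inner h g') = (\<lambda>h. inner h g)"
    using assms unfolding gderiv_def by (rule has_derivative_unique)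
  then have "inner h (g' - g) = 0" for h by (metis inner_diff_right right_minus_eq)
  from this[of "g' - g"] show "g' = g" by simp
qed

lemma grad_zero_at_min:
  assumes "on_Rspace d f" "f differentiable (at 0)" "f 0 = 0" "\<And>x. x \<in> Rspace d \<Longrightarrow> f x \<ge> 0"
  shows "grad f 0 = 0"
proof -
  have "f x \<ge> 0" for x using assms(1,4)[unfolded on_Rspace_def] by (metis embed_in_Rspace)
  then have "\<forall>y\<in>UNIV. f 0 \<le> f y" using assms(3) by simp
  moreover have "(f has_derivative (\<lambda>h. inner h (grad f 0))) (at 0)"
    using on_Rspace_GDERIV[OF assms(1,2)] by (simp add: gderiv_def)
  ultimately have "(\<lambda>h. inner h (grad f 0)) = (\<lambda>h. 0)"
    by (intro differential_zero_maxmin[where S=UNIV and f=f]) auto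
  then have "inner (grad f 0) (grad f 0) = 0" by meson
  then show ?thesis by simp
qed

lemma has_derivative_Blinfun:
  assumes "f differentiable (at x)"
  shows "(f has_derivative blinfun_apply (Blinfun (frechet_derivative f (at x)))) (at x)"
proof -
  have "(f has_derivative frechet_derivative f (at x)) (at x)"
    using assms by (simp add: frechet_derivative_works)
  moreover from this have "bounded_linear (frechet_derivative f (at x))"
    by (rule has_derivative_bounded_linear)
  ultimately show ?thesis by (simp add: bounded_linear_Blinfun_apply)
qed

lemma lipschitz_of_bounded_derivative:
  fixes f :: "'a::real_normed_vector \<Rightarrow> 'b::real_normed_vector"
  assumes "\<And>x. f differentiable (at x)"
    and "\<And>x. norm (Blinfun (frechet_derivative f (at x))) \<le> B"
  shows "norm (f x - f y) \<le> B * norm (x - y)"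
proof (rule differentiable_bound[where S=UNIV and f'="\<lambda>x. blinfun_apply (Blinfun (frechet_derivative f (at x)))"])
  fix x
  show "(f has_derivative blinfun_apply (Blinfun (frechet_derivative f (at x)))) (at x within UNIV)"
    using has_derivative_Blinfun[OF assms(1)] by simp
  show "onorm (blinfun_apply (Blinfun (frechet_derivative f (at x)))) \<le> B"
    using assms(2)[of x] by (simp add: norm_blinfun.rep_eq)
qed auto

lemma finite_sup_le: "finite_sup D B \<Longrightarrow> norm (D x) \<le> B"
  unfolding finite_sup_def by (auto intro: cSUP_upper)

lemma finite_sup_nonneg: "finite_sup D B \<Longrightarrow> 0 \<le> B"
  using finite_sup_le[of D B undefined] norm_ge_zero order_trans by blast

lemma grad_lipschitz:
  assumes "twice_cont_differentiable f" "finite_sup (hess f) B"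
  shows "norm (grad f x - grad f y) \<le> B * norm (x - y)"
  by (rule lipschitz_of_bounded_derivative)
     (use assms finite_sup_le[OF assms(2)] in \<open>auto simp: twice_cont_differentiable_def hess_def\<close>)

lemma grad_has_derivative:
  assumes "twice_cont_differentiable f"
  shows "(grad f has_derivative blinfun_apply (hess f x)) (at x)"
  unfolding hess_def
  by (rule has_derivative_Blinfun) (use assms in \<open>auto simp: twice_cont_differentiable_def\<close>)

lemma hess_lipschitz:
  assumes "thrice_differentiable f" "finite_sup (third_deriv f) B"
  shows "norm (hess f x - hess f y) \<le> B * norm (x - y)"
  by (rule lipschitz_of_bounded_derivative)
     (use assms finite_sup_le[OF assms(2)] in \<open>auto simp: thrice_differentiable_def third_deriv_def\<close>)

section \<open>Curves and time grids\<close>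

text \<open>The differential equations hold in the interior of the time intervals only, so the mean value
  inequality is needed in the form that asks for a derivative on the open interval and continuity on
  the closed one.\<close>

lemma mean_value_bound:
  fixes f :: "real \<Rightarrow> 'a::real_normed_vector"
  assumes "a \<le> b" "continuous_on {a..b} f"
    and "\<And>s. a < s \<Longrightarrow> s < b \<Longrightarrow> (f has_vector_derivative f' s) (at s)"
    and "\<And>s. a < s \<Longrightarrow> s < b \<Longrightarrow> norm (f' s) \<le> B"
  shows "norm (f b - f a) \<le> B * (b - a)"
proof (cases "a = b")
  case False
  with assms(1) have "a < b" by simp
  have "norm (f b - f a) \<le> B * b - B * a"
  proof (rule differentiable_bound_general[OF \<open>a < b\<close> assms(2)])
    show "continuous_on {a..b} (\<lambda>s. B * s)" by (intro continuous_intros)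
    show "((\<lambda>s. B * s) has_vector_derivative B) (at s)" for s
      by (auto intro!: derivative_eq_intros)
  qed (use assms in auto)
  then show ?thesis by (simp add: right_diff_distrib)
qed simp

lemma constant_derivative_increment:
  fixes f :: "real \<Rightarrow> 'a::real_normed_vector"
  assumes "a \<le> b" "continuous_on {a..b} f"
    and "\<And>s. a < s \<Longrightarrow> s < b \<Longrightarrow> (f has_vector_derivative c) (at s)"
  shows "f b = f a + (b - a) *\<^sub>R c"
proof -
  have "norm ((f b - b *\<^sub>R c) - (f a - a *\<^sub>R c)) \<le> 0 * (b - a)"
    by (rule mean_value_bound[where f'="\<lambda>_. 0"])
       (use assms in \<open>auto intro!: continuous_intros derivative_eq_intros\<close>)
  then show ?thesis by (simp add: algebra_simps)
qed

lemma has_vector_derivative_halfline: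
  assumes "(f has_vector_derivative f') (at t within {0..})" "(t::real) > 0"
  shows "(f has_vector_derivative f') (at t)"
proof -
  have "at t within {0..} = at t"
    by (rule at_within_open_subset[of t "{0<..}"]) (use assms in auto)
  then show ?thesis using assms by simp
qed

lemma grid_floor_between:
  assumes "h > 0" "real k * h < t" "t < real (Suc k) * h"
  shows "grid_floor h t = real k * h" "grid_ceiling h t = real (Suc k) * h" "t \<notin> grid h"
proof -
  have le: "j \<le> int k" if "h * of_int j \<le> t" for j
  proof -
    have "h * of_int j < h * (real k + 1)" using that assms(3) by (simp add: algebra_simps)
    then have "of_int j < real k + 1" using assms(1) by simp
    then show ?thesis by linarith
  qed
  have ge: "j \<ge> int k + 1" if "t \<le> h * of_int j" for j
  proof -
    have "h * real k < h * of_int j" using that assms(2) by (simp add: algebra_simps)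
    then have "real k < of_int j" using assms(1) by simp
    then show ?thesis by linarith
  qed
  show "t \<notin> grid h" using le ge by (fastforce simp: grid_def)
  show "grid_floor h t = real k * h" unfolding grid_floor_def
  proof (rule Greatest_equality)
    show "real k * h \<in> grid h \<and> real k * h \<le> t"
      using assms(2) by (auto simp: grid_def mult.commute intro!: image_eqI[of _ _ "int k"])
    fix y assume "y \<in> grid h \<and> y \<le> t"
    then obtain j where "y = h * of_int j" "h * of_int j \<le> t" by (auto simp: grid_def)
    moreover from this have "real_of_int j \<le> real k" using le[of j] by linarith
    ultimately show "y \<le> real k * h" using assms(1) by (simp add: mult.commute)
  qed
  show "grid_ceiling h t = real (Suc k) * h" unfolding grid_ceiling_def
  proof (rule Least_equality)
    show "real (Suc k) * h \<in> grid h \<and> t \<le> real (Suc k) * h"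
      using assms(3) by (auto simp: grid_def mult.commute intro!: image_eqI[of _ _ "int (Suc k)"])
    fix y assume "y \<in> grid h \<and> t \<le> y"
    then obtain j where "y = h * of_int j" "t \<le> h * of_int j" by (auto simp: grid_def)
    moreover from this have "real_of_int j \<ge> real (Suc k)" using ge[of j] by linarith
    ultimately show "real (Suc k) * h \<le> y" using assms(1) by (simp add: mult.commute)
  qed
qed

section \<open>The mean-field force\<close>

locale mean_field =
  fixes n d :: nat and V W :: "ell2 \<Rightarrow> real" and eps L Lt :: real
  assumes n_pos: "n \<ge> 1"
    and V_space: "on_Rspace d V" and W_space: "on_Rspace d W"
    and V_C2: "twice_cont_differentiable V" and W_C2: "twice_cont_differentiable W"
    and hess_V: "finite_sup (hess V) L" and hess_W: "finite_sup (hess W) Lt"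
    and eps_nonneg: "eps \<ge> 0"
    and grad_V_zero: "grad V 0 = 0"
begin

abbreviation U :: "config \<Rightarrow> real" where "U \<equiv> potential n V W eps"

definition force :: "nat \<Rightarrow> config \<Rightarrow> ell2"
  where "force i x = grad V (x i) +
    (eps / real n) *\<^sub>R (\<Sum>j\<in>{..<n} - {i}. grad W (x i - x j) - grad W (x j - x i))"

text \<open>\<open>Lip\<close> is the Lipschitz constant of the force in the sum of the particle norms, and \<open>coup a s\<close>
  bounds the change of the force on a particle that moves by \<open>a\<close> while all particles together move
  by \<open>s\<close>. Summed over the particles, the latter gives the former (\<open>sum_coup\<close>).\<close>

definition Lip :: real where "Lip = L + 4 * (eps * Lt)"

definition coup :: "real \<Rightarrow> real \<Rightarrow> real"
  where "coup a s = (L + 2 * (eps * Lt)) * a + 2 * (eps * Lt) / real n * s"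

lemma L_nonneg: "0 \<le> L" and Lt_nonneg: "0 \<le> Lt"
  using finite_sup_nonneg hess_V hess_W by blast+

lemma epsLt_nonneg: "0 \<le> eps * Lt" using eps_nonneg Lt_nonneg by simp

lemma Lip_nonneg: "0 \<le> Lip" using L_nonneg epsLt_nonneg by (simp add: Lip_def)

lemma coup_nonneg: "0 \<le> a \<Longrightarrow> 0 \<le> s \<Longrightarrow> 0 \<le> coup a s"
  unfolding coup_def using L_nonneg epsLt_nonneg by simp

lemma coup_mono: "a \<le> a' \<Longrightarrow> s \<le> s' \<Longrightarrow> coup a s \<le> coup a' s'"
  unfolding coup_def using L_nonneg epsLt_nonneg
  by (intro add_mono mult_left_mono divide_nonneg_nonneg) auto

lemma sum_coup: "(\<Sum>i<n. coup (a i) (\<Sum>j<n. a j)) = Lip * (\<Sum>i<n. a i)"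
  using n_pos by (simp add: coup_def sum.distrib sum_distrib_left[symmetric] Lip_def distrib_right)

lemma coup_scale: "coup (c * a) (c * s) = c * coup a s"
  by (simp add: coup_def algebra_simps)

lemma V_GDERIV: "GDERIV V x :> grad V x" and gradV_Rspace [simp]: "grad V x \<in> Rspace d"
  using on_Rspace_GDERIV[OF V_space] V_C2 by (auto simp: twice_cont_differentiable_def)

lemma W_GDERIV: "GDERIV W x :> grad W x" and gradW_Rspace [simp]: "grad W x \<in> Rspace d"
  using on_Rspace_GDERIV[OF W_space] W_C2 by (auto simp: twice_cont_differentiable_def)

lemma force_Rspace [simp]: "force i x \<in> Rspace d"
  unfolding force_def by (intro Rspace_closed Rspace_sum) auto

lemma gradV_lipschitz: "norm (grad V x - grad V y) \<le> L * norm (x - y)"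
  by (rule grad_lipschitz[OF V_C2 hess_V])

lemma gradW_lipschitz: "norm (grad W x - grad W y) \<le> Lt * norm (x - y)"
  by (rule grad_lipschitz[OF W_C2 hess_W])

text \<open>Every pair interaction is differentiated in both of its arguments. Exchanging the summation
  indices in the second contribution collects the two into the force on one particle.\<close>

lemma potential_chain:
  assumes y: "\<And>k. k < n \<Longrightarrow> ((\<lambda>s. y s k) has_derivative y' k) (at s within S)"
  shows "((\<lambda>s. U (y s)) has_derivative (\<lambda>h. \<Sum>k<n. inner (y' k h) (force k (y s)))) (at s within S)"
proof -
  have V: "((\<lambda>s. V (y s k)) has_derivative (\<lambda>h. inner (y' k h) (grad V (y s k)))) (at s within S)"
    if "k < n" for k
    using has_derivative_compose[OF y[OF that] V_GDERIV[of "y s k", unfolded gderiv_def]] .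
  have W: "((\<lambda>s. W (y s k - y s j)) has_derivative
      (\<lambda>h. inner (y' k h - y' j h) (grad W (y s k - y s j)))) (at s within S)"
    if "k < n" "j < n" for k j
    using has_derivative_compose[OF has_derivative_diff[OF y[OF that(1)] y[OF that(2)]]
        W_GDERIV[of "y s k - y s j", unfolded gderiv_def]] .
  have D: "((\<lambda>s. U (y s)) has_derivative
      (\<lambda>h. \<Sum>k<n. inner (y' k h) (grad V (y s k)) + eps / real n *
         (\<Sum>j\<in>{..<n} - {k}. inner (y' k h - y' j h) (grad W (y s k - y s j))))) (at s within S)"
    unfolding potential_def
    by (intro has_derivative_sum has_derivative_add V has_derivative_mult_right W) auto
  have "(\<Sum>k<n. inner (y' k h) (grad V (y s k)) + eps / real n *
         (\<Sum>j\<in>{..<n} - {k}. inner (y' k h - y' j h) (grad W (y s k - y s j))))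
      = (\<Sum>k<n. inner (y' k h) (force k (y s)))" for h
  proof -
    let ?a = "\<lambda>k j. inner (y' k h) (grad W (y s k - y s j))"
    let ?b = "\<lambda>k j. inner (y' j h) (grad W (y s k - y s j))"
    have off: "(\<Sum>j\<in>{..<n} - {k}. g j) = (\<Sum>j<n. if j = k then 0 else g j)" for g :: "nat \<Rightarrow> real" and k
      by (rule sum.mono_neutral_cong_left) auto
    have swap: "(\<Sum>k<n. \<Sum>j\<in>{..<n} - {k}. ?b k j) = (\<Sum>k<n. \<Sum>j\<in>{..<n} - {k}. ?b j k)"
      unfolding off by (subst sum.swap) (auto intro!: sum.cong)
    have "(\<Sum>k<n. \<Sum>j\<in>{..<n} - {k}. inner (y' k h - y' j h) (grad W (y s k - y s j)))
        = (\<Sum>k<n. \<Sum>j\<in>{..<n} - {k}. ?a k j) - (\<Sum>k<n. \<Sum>j\<in>{..<n} - {k}. ?b k j)"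
      by (simp add: inner_diff_left sum_subtractf)
    also have "\<dots> = (\<Sum>k<n. \<Sum>j\<in>{..<n} - {k}. ?a k j - ?b j k)"
      unfolding swap by (simp add: sum_subtractf)
    finally have *: "(\<Sum>k<n. \<Sum>j\<in>{..<n} - {k}. inner (y' k h - y' j h) (grad W (y s k - y s j)))
        = (\<Sum>k<n. inner (y' k h) (\<Sum>j\<in>{..<n} - {k}. grad W (y s k - y s j) - grad W (y s j - y s k)))"
      by (simp add: inner_sum_right inner_diff_right)
    have "(\<Sum>k<n. inner (y' k h) (grad V (y s k)) + eps / real n *
         (\<Sum>j\<in>{..<n} - {k}. inner (y' k h - y' j h) (grad W (y s k - y s j))))
      = (\<Sum>k<n. inner (y' k h) (grad V (y s k))) + eps / real n *
        (\<Sum>k<n. \<Sum>j\<in>{..<n} - {k}. inner (y' k h - y' j h) (grad W (y s k - y s j)))"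
      by (simp add: sum.distrib sum_distrib_left)
    then show ?thesis unfolding *
      by (simp add: force_def inner_add_right sum.distrib sum_distrib_left)
  qed
  then show ?thesis using D by simp
qed

lemma partial_grad_eq_force:
  assumes "i < n" shows "partial_grad U i x = force i x"
proof -
  have D: "((\<lambda>y. U (x(i := y))) has_derivative
     (\<lambda>h. \<Sum>k<n. inner (if k = i then h else 0) (force k (x(i := x i))))) (at (x i))"
  proof (rule potential_chain)
    fix k
    show "((\<lambda>y. (x(i := y)) k) has_derivative (\<lambda>h. if k = i then h else 0)) (at (x i))"
      by (cases "k = i") auto
  qed
  have "(\<lambda>h. \<Sum>k<n. inner (if k = i then h else 0) (force k (x(i := x i))))
     = (\<lambda>h. inner h (force i x))"
    using assms by (auto simp: if_distrib[of "\<lambda>u. inner u _"] sum.delta cong: if_cong)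
  with D have "GDERIV (\<lambda>y. U (x(i := y))) (x i) :> force i x" unfolding gderiv_def by metis
  then show ?thesis unfolding partial_grad_def by (rule grad_eqI)
qed

lemma interaction_lipschitz:
  assumes "i < n"
  shows "norm ((force i x - force i y) - (grad V (x i) - grad V (y i)))
    \<le> 2 * (eps * Lt) * norm (x i - y i) + 2 * (eps * Lt) / real n * (\<Sum>j<n. norm (x j - y j))"
proof -
  let ?z = "\<lambda>i. norm (x i - y i)"
  let ?t = "\<lambda>x j. grad W (x i - x j) - grad W (x j - x i)"
  have t: "norm (?t x j - ?t y j) \<le> 2 * Lt * (?z i + ?z j)" for j
  proof -
    have "norm ((x i - x j) - (y i - y j)) \<le> ?z i + ?z j"
      using norm_triangle_ineq4[of "x i - y i" "x j - y j"] by (simp add: algebra_simps)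
    moreover have "norm ((x j - x i) - (y j - y i)) \<le> ?z i + ?z j"
      using norm_triangle_ineq4[of "x j - y j" "x i - y i"] by (simp add: algebra_simps)
    ultimately have "norm (grad W (x i - x j) - grad W (y i - y j)) \<le> Lt * (?z i + ?z j)"
      "norm (grad W (x j - x i) - grad W (y j - y i)) \<le> Lt * (?z i + ?z j)"
      using gradW_lipschitz Lt_nonneg by (meson mult_left_mono order_trans)+
    moreover have "?t x j - ?t y j = (grad W (x i - x j) - grad W (y i - y j))
        - (grad W (x j - x i) - grad W (y j - y i))" by simp
    ultimately show ?thesis
      using norm_triangle_ineq4[of "grad W (x i - x j) - grad W (y i - y j)"
          "grad W (x j - x i) - grad W (y j - y i)"] by (simp add: algebra_simps)
  qed
  have "norm ((\<Sum>j\<in>{..<n} - {i}. ?t x j) - (\<Sum>j\<in>{..<n} - {i}. ?t y j))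
      \<le> (\<Sum>j\<in>{..<n} - {i}. 2 * Lt * (?z i + ?z j))"
    unfolding sum_subtractf[symmetric] using t by (intro sum_norm_le) auto
  also have "\<dots> \<le> (\<Sum>j<n. 2 * Lt * (?z i + ?z j))"
    using Lt_nonneg by (intro sum_mono2) auto
  also have "\<dots> = 2 * Lt * (real n * ?z i + (\<Sum>j<n. ?z j))"
    by (simp add: sum_distrib_left[symmetric] sum.distrib)
  finally have s: "norm ((\<Sum>j\<in>{..<n} - {i}. ?t x j) - (\<Sum>j\<in>{..<n} - {i}. ?t y j))
      \<le> 2 * Lt * (real n * ?z i + (\<Sum>j<n. ?z j))" .
  have "norm ((force i x - force i y) - (grad V (x i) - grad V (y i)))
      = eps / real n * norm ((\<Sum>j\<in>{..<n} - {i}. ?t x j) - (\<Sum>j\<in>{..<n} - {i}. ?t y j))"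
  proof -
    have "(force i x - force i y) - (grad V (x i) - grad V (y i))
       = (eps / real n) *\<^sub>R ((\<Sum>j\<in>{..<n} - {i}. ?t x j) - (\<Sum>j\<in>{..<n} - {i}. ?t y j))"
      by (simp add: force_def algebra_simps)
    then show ?thesis using eps_nonneg by simp
  qed
  also have "\<dots> \<le> eps / real n * (2 * Lt * (real n * ?z i + (\<Sum>j<n. ?z j)))"
    using eps_nonneg s by (intro mult_left_mono) auto
  also have "\<dots> = 2 * (eps * Lt) * ?z i + 2 * (eps * Lt) / real n * (\<Sum>j<n. ?z j)"
    using n_pos by (simp add: field_simps)
  finally show ?thesis .
qed

lemma force_lipschitz:
  assumes "i < n"
  shows "norm (force i x - force i y) \<le> coup (norm (x i - y i)) (\<Sum>j<n. norm (x j - y j))"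
proof -
  have "norm (force i x - force i y) \<le> norm (grad V (x i) - grad V (y i))
      + norm ((force i x - force i y) - (grad V (x i) - grad V (y i)))" by (rule norm_triangle_sub)
  then show ?thesis
    using gradV_lipschitz[of "x i" "y i"] interaction_lipschitz[OF assms, of x y]
    by (simp add: coup_def algebra_simps)
qed

lemma force_zero: "(\<And>j. j < n \<Longrightarrow> x j = 0) \<Longrightarrow> i < n \<Longrightarrow> force i x = 0"
  by (simp add: force_def grad_V_zero)

lemma force_bound:
  assumes "i < n" shows "norm (force i x) \<le> coup (norm (x i)) (\<Sum>j<n. norm (x j))"
  using force_lipschitz[OF assms, of x "\<lambda>_. 0"] by (simp add: force_zero[OF _ assms])

section \<open>Velocity Verlet steps\<close>

type_synonym (in -) phase = "config \<times> config"

definition drift :: "real \<Rightarrow> phase \<Rightarrow> phase"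
  where "drift h z = ((\<lambda>i\<in>{..<n}. fst z i + h *\<^sub>R snd z i), snd z)"

definition kick :: "real \<Rightarrow> phase \<Rightarrow> phase"
  where "kick h z = (fst z, (\<lambda>i\<in>{..<n}. snd z i - h *\<^sub>R force i (fst z)))"

definition vstep :: "real \<Rightarrow> phase \<Rightarrow> phase"
  where "vstep h z = kick (h / 2) (drift h (kick (h / 2) z))"

definition verlet :: "real \<Rightarrow> nat \<Rightarrow> phase \<Rightarrow> phase"
  where "verlet h k z = (vstep h ^^ k) z"

lemma verlet_0 [simp]: "verlet h 0 z = z" by (simp add: verlet_def)

lemma verlet_Suc: "verlet h (Suc k) z = vstep h (verlet h k z)" by (simp add: verlet_def)

lemma fst_vstep: "i < n \<Longrightarrow> fst (vstep h z) i = fst z i + h *\<^sub>R snd z i - (h\<^sup>2 / 2) *\<^sub>R force i (fst z)"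
  by (simp add: vstep_def drift_def kick_def algebra_simps power2_eq_square)

lemma snd_vstep: "i < n \<Longrightarrow> snd (vstep h z) i =
   snd z i - (h / 2) *\<^sub>R (force i (fst z) + force i (fst (vstep h z)))"
  by (simp add: vstep_def drift_def kick_def algebra_simps)

lemma vstep_configs:
  "fst z \<in> configs n d \<Longrightarrow> snd z \<in> configs n d \<Longrightarrow> fst (vstep h z) \<in> configs n d \<and> snd (vstep h z) \<in> configs n d"
  by (auto simp: vstep_def drift_def kick_def configs_def PiE_iff)

lemma verlet_configs:
  "fst z \<in> configs n d \<Longrightarrow> snd z \<in> configs n d \<Longrightarrow>
   fst (verlet h k z) \<in> configs n d \<and> snd (verlet h k z) \<in> configs n d"
  by (induction k) (auto simp: verlet_Suc vstep_configs)

lemma configs_eqI: "x \<in> configs n d \<Longrightarrow> y \<in> configs n d \<Longrightarrow> (\<And>i. i < n \<Longrightarrow> x i = y i) \<Longrightarrow> x = y"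
  unfolding configs_def by (rule PiE_ext) auto

text \<open>Between two grid points both right-hand sides are constant, the second one because the
  position at the next grid point is already determined. The increments of the flow are therefore
  those of a kick, a drift and a kick.\<close>

lemma verlet_flow_grid:
  assumes vf: "verlet_flow n d U h qt pt" and h: "h > 0"
    and x: "x \<in> configs n d" and v: "v \<in> configs n d"
  shows "qt (real k * h) x v = fst (verlet h k (x, v)) \<and> pt (real k * h) x v = snd (verlet h k (x, v))"
proof (induction k)
  case 0
  then show ?case using vf x v by (simp add: verlet_flow_def)
next
  case (Suc k)
  let ?a = "real k * h" and ?b = "real (Suc k) * h" and ?z = "verlet h k (x, v)"
  have a: "?a \<ge> 0" "?a \<le> ?b" "?b - ?a = h" using h by (auto simp: algebra_simps)
  have ode: "((\<lambda>s. qt s x v i) has_vector_derivative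
          pt (grid_floor h t) x v i - (h / 2) *\<^sub>R partial_grad U i (qt (grid_floor h t) x v)) (at t) \<and>
        ((\<lambda>s. pt s x v i) has_vector_derivative
          - ((1 / 2) *\<^sub>R (partial_grad U i (qt (grid_floor h t) x v) +
                         partial_grad U i (qt (grid_ceiling h t) x v)))) (at t)"
    if "t > 0" "t \<notin> grid h" "i < n" for t i
    using vf x v that unfolding verlet_flow_def by blast
  have q: "qt ?b x v i = fst (vstep h ?z) i" if i: "i < n" for i
  proof -
    have "qt ?b x v i = qt ?a x v i + (?b - ?a) *\<^sub>R (pt ?a x v i - (h / 2) *\<^sub>R partial_grad U i (qt ?a x v))"
    proof (rule constant_derivative_increment[where f="\<lambda>t. qt t x v i"])
      have "continuous_on {0..} (\<lambda>t. qt t x v i)" using vf x v i by (simp add: verlet_flow_def)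
      then show "continuous_on {?a..?b} (\<lambda>t. qt t x v i)"
        by (rule continuous_on_subset) (use a in auto)
      fix s assume s: "?a < s" "s < ?b"
      have "s > 0" using s(1) a(1) by linarith
      then show "((\<lambda>t. qt t x v i) has_vector_derivative
          pt ?a x v i - (h / 2) *\<^sub>R partial_grad U i (qt ?a x v)) (at s)"
        using ode[OF _ _ i, of s] by (simp only: grid_floor_between[OF h s] not_False_eq_True simp_thms)
    qed (use a in auto)
    then show ?thesis
      using i by (simp only: a(3) Suc fst_vstep partial_grad_eq_force[OF i])
        (simp add: algebra_simps power2_eq_square)
  qed
  have "fst (vstep h ?z) \<in> configs n d" "snd (vstep h ?z) \<in> configs n d"
    using vstep_configs[of ?z] verlet_configs[of "(x, v)"] x v by auto
  moreover have "qt ?b x v \<in> configs n d" "pt ?b x v \<in> configs n d"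
    using vf x v h unfolding verlet_flow_def by auto
  ultimately have qb: "qt ?b x v = fst (vstep h ?z)" and pc: "snd (vstep h ?z) \<in> configs n d" "pt ?b x v \<in> configs n d"
    using configs_eqI[of "qt ?b x v"] q by auto
  have p: "pt ?b x v i = snd (vstep h ?z) i" if i: "i < n" for i
  proof -
    have "pt ?b x v i = pt ?a x v i + (?b - ?a) *\<^sub>R (- ((1 / 2) *\<^sub>R (partial_grad U i (qt ?a x v) + partial_grad U i (qt ?b x v))))"
    proof (rule constant_derivative_increment[where f="\<lambda>t. pt t x v i"])
      have "continuous_on {0..} (\<lambda>t. pt t x v i)" using vf x v i by (simp add: verlet_flow_def)
      then show "continuous_on {?a..?b} (\<lambda>t. pt t x v i)"
        by (rule continuous_on_subset) (use a in auto)
      fix s assume s: "?a < s" "s < ?b"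
      have "s > 0" using s(1) a(1) by linarith
      then show "((\<lambda>t. pt t x v i) has_vector_derivative
          - ((1 / 2) *\<^sub>R (partial_grad U i (qt ?a x v) + partial_grad U i (qt ?b x v)))) (at s)"
        using ode[OF _ _ i, of s] by (simp only: grid_floor_between[OF h s] not_False_eq_True simp_thms)
    qed (use a in auto)
    then show ?thesis
      by (simp only: a(3) Suc snd_vstep[OF i] qb partial_grad_eq_force[OF i])
         (simp add: algebra_simps)
  qed
  then have "pt ?b x v = snd (vstep h ?z)" using configs_eqI pc by blast
  then show ?case using qb by (simp add: verlet_Suc)
qed

end

section \<open>Bounds along an exact orbit\<close>

lemma discrete_gronwall:
  fixes S :: "nat \<Rightarrow> real"
  assumes "S 0 = 0" "b \<ge> 0" "r \<ge> 0" and step: "\<And>k. k < m \<Longrightarrow> S (Suc k) \<le> (1 + b) * S k + r"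
  shows "k \<le> m \<Longrightarrow> S k \<le> real k * r * (1 + b) ^ k"
proof (induction k)
  case (Suc k)
  have "S (Suc k) \<le> (1 + b) * S k + r" using Suc.prems by (intro step) auto
  also have "\<dots> \<le> (1 + b) * (real k * r * (1 + b) ^ k) + r * (1 + b) ^ Suc k"
    using Suc assms(2,3) one_le_power[of "1 + b" "Suc k"]
    by (intro add_mono mult_left_mono) (auto intro: mult_left_mono[of 1 _ r, simplified])
  also have "\<dots> = real (Suc k) * r * (1 + b) ^ Suc k" by (simp add: algebra_simps)
  finally show ?case .
qed (use assms in simp)

context mean_field
begin

text \<open>Up to the factor \<open>Lip\<close>, the value of \<open>coup\<close> is a convex combination of \<open>a i\<close> and the mean of
  all \<open>a j\<close>, and squaring is convex.\<close>

lemma sum_coup_squares: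
  "(\<Sum>i<n. (coup (a i) (\<Sum>j<n. a j))\<^sup>2) \<le> Lip\<^sup>2 * (\<Sum>i<n. (a i)\<^sup>2)"
proof -
  define p where "p = L + 2 * (eps * Lt)"
  define q where "q = 2 * (eps * Lt)"
  define m where "m = (\<Sum>j<n. a j) / real n"
  have pq: "p \<ge> 0" "q \<ge> 0" "Lip = p + q"
    using L_nonneg epsLt_nonneg by (auto simp: p_def q_def Lip_def)
  have "(coup (a i) (\<Sum>j<n. a j))\<^sup>2 \<le> Lip * (p * (a i)\<^sup>2 + q * m\<^sup>2)" for i
  proof -
    have c: "coup (a i) (\<Sum>j<n. a j) = p * a i + q * m" by (simp add: coup_def p_def q_def m_def)
    have "Lip * (p * (a i)\<^sup>2 + q * m\<^sup>2) - (p * a i + q * m)\<^sup>2 = p * q * (a i - m)\<^sup>2"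
      unfolding pq(3) by (simp add: power2_eq_square algebra_simps)
    also have "\<dots> \<ge> 0" using pq by simp
    finally show ?thesis unfolding c by simp
  qed
  then have "(\<Sum>i<n. (coup (a i) (\<Sum>j<n. a j))\<^sup>2) \<le> (\<Sum>i<n. Lip * (p * (a i)\<^sup>2 + q * m\<^sup>2))"
    by (intro sum_mono)
  also have "\<dots> = Lip * (p * (\<Sum>i<n. (a i)\<^sup>2) + q * (real n * m\<^sup>2))"
    by (simp add: sum_distrib_left[symmetric] sum.distrib)
  also have "\<dots> \<le> Lip * (p * (\<Sum>i<n. (a i)\<^sup>2) + q * (\<Sum>i<n. (a i)\<^sup>2))"
  proof -
    have "(\<Sum>j<n. a j)\<^sup>2 \<le> real n * (\<Sum>i<n. (a i)\<^sup>2)"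
      using sum_squared_le_sum_of_squares[of a "{..<n}"] by (simp add: mult.commute)
    then have "real n * m\<^sup>2 \<le> (\<Sum>i<n. (a i)\<^sup>2)"
      using n_pos by (simp add: m_def power_divide field_simps power2_eq_square)
    then show ?thesis using pq Lip_nonneg by (intro mult_left_mono add_left_mono) auto
  qed
  also have "\<dots> = Lip\<^sup>2 * (\<Sum>i<n. (a i)\<^sup>2)" unfolding pq(3) by (simp add: power2_eq_square algebra_simps)
  finally show ?thesis .
qed

end

locale orbit = mean_field +
  fixes T :: real and Q P :: "real \<Rightarrow> config"
  assumes T_pos: "T > 0" and Lip_T: "Lip * T\<^sup>2 \<le> 1 / 4"
    and Q_deriv: "\<And>t i. t \<ge> 0 \<Longrightarrow> i < n \<Longrightarrow> ((\<lambda>s. Q s i) has_vector_derivative P t i) (at t within {0..})"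
    and P_deriv: "\<And>t i. t \<ge> 0 \<Longrightarrow> i < n \<Longrightarrow> ((\<lambda>s. P s i) has_vector_derivative - force i (Q t)) (at t within {0..})"
begin

lemma Q_deriv': "t > 0 \<Longrightarrow> i < n \<Longrightarrow> ((\<lambda>s. Q s i) has_vector_derivative P t i) (at t)"
  and P_deriv': "t > 0 \<Longrightarrow> i < n \<Longrightarrow> ((\<lambda>s. P s i) has_vector_derivative - force i (Q t)) (at t)"
  using Q_deriv P_deriv by (auto intro: has_vector_derivative_halfline)

lemma Q_cont: "i < n \<Longrightarrow> S \<subseteq> {0..} \<Longrightarrow> continuous_on S (\<lambda>s. Q s i)"
  and P_cont: "i < n \<Longrightarrow> S \<subseteq> {0..} \<Longrightarrow> continuous_on S (\<lambda>s. P s i)"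
  using continuous_on_vector_derivative[of "{0..}" "\<lambda>s. Q s i" "\<lambda>t. P t i"]
    continuous_on_vector_derivative[of "{0..}" "\<lambda>s. P s i" "\<lambda>t. - force i (Q t)"] Q_deriv P_deriv
  by (auto intro: continuous_on_subset)

text \<open>For one particle and times in \<open>[0, T]\<close>, the constants \<open>A\<close>, \<open>G\<close> and \<open>B\<close> bound the position, the
  force and the velocity, and \<open>a0\<close> is the bound on the position in free flight. Sums over the
  particles are estimated from \<open>A i \<le> a0 i + T\<^sup>2 * G i\<close>, where the condition on \<open>Lip * T\<^sup>2\<close> lets the
  force term be absorbed.\<close>

definition A :: "nat \<Rightarrow> real" where "A i = (SUP s\<in>{0..T}. norm (Q s i))"
definition G :: "nat \<Rightarrow> real" where "G i = coup (A i) (\<Sum>j<n. A j)"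
definition B :: "nat \<Rightarrow> real" where "B i = norm (P 0 i) + T * G i"
definition a0 :: "nat \<Rightarrow> real" where "a0 i = norm (Q 0 i) + T * norm (P 0 i)"

lemma A_attained: "i < n \<Longrightarrow> \<exists>s\<in>{0..T}. A i = norm (Q s i)"
  and Q_le_A: "i < n \<Longrightarrow> s \<in> {0..T} \<Longrightarrow> norm (Q s i) \<le> A i"
proof -
  assume i: "i < n"
  obtain s0 where s0: "s0 \<in> {0..T}" "\<And>s. s \<in> {0..T} \<Longrightarrow> norm (Q s i) \<le> norm (Q s0 i)"
    using continuous_attains_sup[of "{0..T}" "\<lambda>s. norm (Q s i)"] T_pos
      continuous_on_norm[OF Q_cont[OF i, of "{0..T}"]] by auto
  then have "A i = norm (Q s0 i)" unfolding A_def
    by (intro cSup_eq_maximum) auto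
  then show "\<exists>s\<in>{0..T}. A i = norm (Q s i)" "s \<in> {0..T} \<Longrightarrow> norm (Q s i) \<le> A i" using s0 by auto
qed

lemma A_nonneg: "i < n \<Longrightarrow> 0 \<le> A i" using A_attained by force

lemma G_nonneg: "i < n \<Longrightarrow> 0 \<le> G i"
  unfolding G_def by (intro coup_nonneg sum_nonneg A_nonneg) auto

lemma force_le_G: assumes "i < n" "s \<in> {0..T}" shows "norm (force i (Q s)) \<le> G i"
proof -
  have "norm (force i (Q s)) \<le> coup (norm (Q s i)) (\<Sum>j<n. norm (Q s j))" by (rule force_bound[OF assms(1)])
  also have "\<dots> \<le> G i" unfolding G_def using assms by (intro coup_mono sum_mono Q_le_A) auto
  finally show ?thesis .
qed

lemma P_increment:
  assumes "i < n" "0 \<le> s" "s \<le> t" "t \<le> T" shows "norm (P t i - P s i) \<le> G i * (t - s)"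
  by (rule mean_value_bound[where f="\<lambda>s. P s i" and f'="\<lambda>s. - force i (Q s)"])
     (use assms force_le_G P_deriv' P_cont[OF assms(1), of "{s..t}"] in auto)

lemma P_le_B: assumes "i < n" "s \<in> {0..T}" shows "norm (P s i) \<le> B i"
proof -
  have "norm (P s i) \<le> norm (P 0 i) + norm (P s i - P 0 i)" by (metis norm_triangle_sub)
  also have "norm (P s i - P 0 i) \<le> G i * s" using P_increment[of i 0 s] assms by auto
  also have "\<dots> \<le> T * G i" using assms G_nonneg by (simp add: mult.commute mult_right_mono)
  finally show ?thesis by (simp add: B_def)
qed

lemma Q_increment:
  assumes "i < n" "0 \<le> s" "s \<le> t" "t \<le> T" shows "norm (Q t i - Q s i) \<le> B i * (t - s)"
  by (rule mean_value_bound[where f="\<lambda>s. Q s i" and f'="\<lambda>s. P s i"])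
     (use assms P_le_B Q_deriv' Q_cont[OF assms(1), of "{s..t}"] in auto)

lemma A_le: assumes i: "i < n" shows "A i \<le> a0 i + T\<^sup>2 * G i"
proof -
  obtain t where t: "t \<in> {0..T}" "A i = norm (Q t i)" using A_attained[OF i] by auto
  have "norm ((Q t i - t *\<^sub>R P 0 i) - (Q 0 i - 0 *\<^sub>R P 0 i)) \<le> (T * G i) * (t - 0)"
  proof (rule mean_value_bound[where f="\<lambda>s. Q s i - s *\<^sub>R P 0 i" and f'="\<lambda>s. P s i - P 0 i"])
    show "continuous_on {0..t} (\<lambda>s. Q s i - s *\<^sub>R P 0 i)"
      by (intro continuous_intros Q_cont i) auto
    fix s assume s: "0 < s" "s < t"
    show "((\<lambda>s. Q s i - s *\<^sub>R P 0 i) has_vector_derivative P s i - P 0 i) (at s)"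
      using Q_deriv'[OF s(1) i] by (auto intro!: derivative_eq_intros)
    have "norm (P s i - P 0 i) \<le> G i * s" using P_increment[of i 0 s] s t i by auto
    also have "\<dots> \<le> T * G i" using s t G_nonneg[OF i] by (simp add: mult.commute mult_right_mono)
    finally show "norm (P s i - P 0 i) \<le> T * G i" .
  qed (use t in auto)
  also have "\<dots> \<le> T\<^sup>2 * G i"
    using t G_nonneg[OF i] T_pos by (simp add: power2_eq_square mult.assoc mult_left_mono mult_right_mono mult.commute)
  finally have *: "norm (Q t i - t *\<^sub>R P 0 i - Q 0 i) \<le> T\<^sup>2 * G i" by simp
  have "norm (Q t i) \<le> norm (Q t i - t *\<^sub>R P 0 i - Q 0 i) + norm (t *\<^sub>R P 0 i + Q 0 i)"
    using norm_triangle_ineq[of "Q t i - t *\<^sub>R P 0 i - Q 0 i" "t *\<^sub>R P 0 i + Q 0 i"] by simp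
  also have "norm (t *\<^sub>R P 0 i + Q 0 i) \<le> T * norm (P 0 i) + norm (Q 0 i)"
    using t by (intro order_trans[OF norm_triangle_ineq]) (auto intro: mult_right_mono)
  finally show ?thesis using * t by (simp add: a0_def)
qed

lemma sum_G: "(\<Sum>i<n. G i) = Lip * (\<Sum>i<n. A i)"
  unfolding G_def by (rule sum_coup)

lemma sum_A_le: "(\<Sum>i<n. A i) \<le> 2 * (\<Sum>i<n. a0 i)"
proof -
  have "(\<Sum>i<n. A i) \<le> (\<Sum>i<n. a0 i + T\<^sup>2 * G i)" by (intro sum_mono A_le) auto
  also have "\<dots> = (\<Sum>i<n. a0 i) + (Lip * T\<^sup>2) * (\<Sum>i<n. A i)"
    by (simp add: sum.distrib sum_distrib_left[symmetric] sum_G)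
  also have "\<dots> \<le> (\<Sum>i<n. a0 i) + 1 / 4 * (\<Sum>i<n. A i)"
    by (intro add_left_mono mult_right_mono Lip_T sum_nonneg A_nonneg) auto
  finally show ?thesis using sum_nonneg[of "{..<n}" A] A_nonneg by auto
qed

lemma sum_G_squares: "(\<Sum>i<n. (G i)\<^sup>2) \<le> Lip\<^sup>2 * (\<Sum>i<n. (A i)\<^sup>2)"
  unfolding G_def by (rule sum_coup_squares)

lemma sum_A_squares: "(\<Sum>i<n. (A i)\<^sup>2) \<le> 3 * (\<Sum>i<n. (a0 i)\<^sup>2)"
proof -
  have "(\<Sum>i<n. (A i)\<^sup>2) \<le> (\<Sum>i<n. 2 * (a0 i)\<^sup>2 + 2 * (T\<^sup>2)\<^sup>2 * (G i)\<^sup>2)"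
  proof (rule sum_mono)
    fix i assume "i \<in> {..<n}"
    then have "(A i)\<^sup>2 \<le> (a0 i + T\<^sup>2 * G i)\<^sup>2" using A_le A_nonneg by (intro power_mono) auto
    also have "\<dots> \<le> 2 * (a0 i)\<^sup>2 + 2 * (T\<^sup>2)\<^sup>2 * (G i)\<^sup>2"
      using zero_le_power2[of "a0 i - T\<^sup>2 * G i"] by (simp add: power2_eq_square algebra_simps)
    finally show "(A i)\<^sup>2 \<le> 2 * (a0 i)\<^sup>2 + 2 * (T\<^sup>2)\<^sup>2 * (G i)\<^sup>2" .
  qed
  also have "\<dots> = 2 * (\<Sum>i<n. (a0 i)\<^sup>2) + 2 * (T\<^sup>2)\<^sup>2 * (\<Sum>i<n. (G i)\<^sup>2)"
    by (simp add: sum.distrib sum_distrib_left)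
  also have "\<dots> \<le> 2 * (\<Sum>i<n. (a0 i)\<^sup>2) + 2 * (T\<^sup>2)\<^sup>2 * (Lip\<^sup>2 * (\<Sum>i<n. (A i)\<^sup>2))"
    by (intro add_left_mono mult_left_mono sum_G_squares) auto
  also have "\<dots> = 2 * (\<Sum>i<n. (a0 i)\<^sup>2) + 2 * (Lip * T\<^sup>2)\<^sup>2 * (\<Sum>i<n. (A i)\<^sup>2)"
    by (simp add: power_mult_distrib)
  also have "\<dots> \<le> 2 * (\<Sum>i<n. (a0 i)\<^sup>2) + 2 * (1 / 4)\<^sup>2 * (\<Sum>i<n. (A i)\<^sup>2)"
    by (intro add_left_mono mult_right_mono mult_left_mono power_mono Lip_T sum_nonneg)
       (use Lip_nonneg in auto)
  finally show ?thesis using sum_nonneg[of "{..<n}" "\<lambda>i. (A i)\<^sup>2"]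
    by (simp add: power2_eq_square)
qed

text \<open>The speed at which the force on a particle changes in time.\<close>

definition C :: "nat \<Rightarrow> real" where "C i = coup (B i) (\<Sum>j<n. B j)"

lemma B_nonneg: "i < n \<Longrightarrow> 0 \<le> B i"
  using G_nonneg T_pos by (simp add: B_def)

lemma C_nonneg: "i < n \<Longrightarrow> 0 \<le> C i"
  unfolding C_def by (intro coup_nonneg sum_nonneg B_nonneg) auto

lemma sum_C: "(\<Sum>i<n. C i) = Lip * (\<Sum>i<n. B i)"
  unfolding C_def by (rule sum_coup)

lemma force_increment:
  assumes "i < n" "0 \<le> s" "s \<le> t" "t \<le> T"
  shows "norm (force i (Q t) - force i (Q s)) \<le> C i * (t - s)"
proof -
  have "norm (force i (Q t) - force i (Q s))
      \<le> coup (norm (Q t i - Q s i)) (\<Sum>j<n. norm (Q t j - Q s j))"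
    by (rule force_lipschitz[OF assms(1)])
  also have "\<dots> \<le> coup ((t - s) * B i) (\<Sum>j<n. (t - s) * B j)"
    using assms Q_increment by (intro coup_mono sum_mono) (auto simp: mult.commute)
  also have "\<dots> = C i * (t - s)"
    by (simp add: sum_distrib_left[symmetric] coup_scale C_def)
  finally show ?thesis .
qed

text \<open>Two integrations of the increment of the force, each of which gains one power of the step
  size.\<close>

lemma local_error_Q:
  assumes i: "i < n" and t: "0 \<le> t" "t + h \<le> T" and h: "0 < h"
  shows "norm (Q (t + h) i - Q t i - h *\<^sub>R P t i + (h\<^sup>2 / 2) *\<^sub>R force i (Q t)) \<le> h ^ 3 * C i"
proof -
  let ?f = "\<lambda>s. Q s i - (s - t) *\<^sub>R P t i + ((s - t)\<^sup>2 / 2) *\<^sub>R force i (Q t)"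
  have "norm (?f (t + h) - ?f t) \<le> (h * (C i * h)) * (t + h - t)"
  proof (rule mean_value_bound[where f="?f" and f'="\<lambda>s. P s i - P t i + (s - t) *\<^sub>R force i (Q t)"])
    show "continuous_on {t..t + h} ?f" using t by (intro continuous_intros Q_cont i) auto
    fix s assume s: "t < s" "s < t + h"
    show "(?f has_vector_derivative P s i - P t i + (s - t) *\<^sub>R force i (Q t)) (at s)"
      using Q_deriv'[of s i] s t i by (auto intro!: derivative_eq_intros)
    have "norm ((P s i + (s - t) *\<^sub>R force i (Q t)) - (P t i + (t - t) *\<^sub>R force i (Q t)))
        \<le> (C i * h) * (s - t)"
    proof (rule mean_value_bound[where f="\<lambda>s. P s i + (s - t) *\<^sub>R force i (Q t)"
          and f'="\<lambda>s. - force i (Q s) + force i (Q t)"])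
      show "continuous_on {t..s} (\<lambda>s. P s i + (s - t) *\<^sub>R force i (Q t))"
        using t by (intro continuous_intros P_cont i) auto
      fix u assume u: "t < u" "u < s"
      show "((\<lambda>s. P s i + (s - t) *\<^sub>R force i (Q t)) has_vector_derivative
          - force i (Q u) + force i (Q t)) (at u)"
        using P_deriv'[of u i] u t i by (auto intro!: derivative_eq_intros)
      have "norm (force i (Q u) - force i (Q t)) \<le> C i * (u - t)"
        using force_increment[of i t u] i t u s by auto
      also have "\<dots> \<le> C i * h" using u s C_nonneg[OF i] by (intro mult_left_mono) auto
      finally show "norm (- force i (Q u) + force i (Q t)) \<le> C i * h"
        by (simp add: norm_minus_commute)
    qed (use s in auto)
    also have "\<dots> \<le> (C i * h) * h" using s h C_nonneg[OF i] by (intro mult_left_mono) auto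
    finally show "norm (P s i - P t i + (s - t) *\<^sub>R force i (Q t)) \<le> h * (C i * h)"
      by (simp add: algebra_simps)
  qed (use h in auto)
  then show ?thesis by (simp add: power3_eq_cube algebra_simps)
qed

text \<open>The trapezoidal rule, estimated with the Lipschitz continuity of the force in time only.\<close>

lemma local_error_P:
  assumes i: "i < n" and t: "0 \<le> t" "t + h \<le> T" and h: "0 < h"
  shows "norm (P (t + h) i - P t i + (h / 2) *\<^sub>R (force i (Q t) + force i (Q (t + h)))) \<le> h\<^sup>2 * C i"
proof -
  let ?c = "(1 / 2) *\<^sub>R (force i (Q t) + force i (Q (t + h)))"
  let ?f = "\<lambda>s. P s i + (s - t) *\<^sub>R ?c"
  have "norm (?f (t + h) - ?f t) \<le> (C i * h) * (t + h - t)"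
  proof (rule mean_value_bound[where f="?f" and f'="\<lambda>s. - force i (Q s) + ?c"])
    show "continuous_on {t..t + h} ?f" using t by (intro continuous_intros P_cont i) auto
    fix s assume s: "t < s" "s < t + h"
    show "(?f has_vector_derivative - force i (Q s) + ?c) (at s)"
      using P_deriv'[of s i] s t i by (auto intro!: derivative_eq_intros)
    have "norm (force i (Q s) - force i (Q t)) \<le> C i * (s - t)"
        "norm (force i (Q (t + h)) - force i (Q s)) \<le> C i * (t + h - s)"
      using force_increment[of i t s] force_increment[of i s "t + h"] i t s by auto
    moreover have "- force i (Q s) + ?c = (1/2) *\<^sub>R (force i (Q (t + h)) - force i (Q s))
        - (1/2) *\<^sub>R (force i (Q s) - force i (Q t))"
      by (rule ell2_eqI) (simp add: coord_simps algebra_simps)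
    ultimately have "norm (- force i (Q s) + ?c) \<le> 1/2 * (C i * (t + h - s)) + 1/2 * (C i * (s - t))"
      using norm_triangle_ineq4[of "(1/2) *\<^sub>R (force i (Q (t + h)) - force i (Q s))"
          "(1/2) *\<^sub>R (force i (Q s) - force i (Q t))"] by simp
    also have "\<dots> \<le> C i * h" using C_nonneg[OF i] h by (simp add: algebra_simps)
    finally show "norm (- force i (Q s) + ?c) \<le> C i * h" .
  qed (use h in auto)
  then show ?thesis by (simp add: power2_eq_square algebra_simps)
qed

lemma sum_B_le: "(\<Sum>i<n. B i) \<le> 2 * (1 + T * Lip) * (1 + T) * (\<Sum>i<n. norm (Q 0 i) + norm (P 0 i))"
proof -
  let ?N = "\<Sum>i<n. norm (Q 0 i) + norm (P 0 i)"
  have TL: "T * Lip \<ge> 0" using T_pos Lip_nonneg by simp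
  have a: "(\<Sum>i<n. a0 i) \<le> (1 + T) * ?N"
    unfolding sum_distrib_left a0_def using T_pos by (intro sum_mono) (auto simp: algebra_simps)
  have p: "(\<Sum>i<n. norm (P 0 i)) \<le> (1 + T) * ?N"
    unfolding sum_distrib_left using T_pos by (intro sum_mono) (auto simp: algebra_simps)
  have "(\<Sum>i<n. B i) = (\<Sum>i<n. norm (P 0 i)) + T * Lip * (\<Sum>i<n. A i)"
    by (simp add: B_def sum.distrib sum_distrib_left[symmetric] sum_G)
  also have "\<dots> \<le> (1 + T) * ?N + T * Lip * (2 * ((1 + T) * ?N))"
    using TL a sum_A_le by (intro add_mono p mult_left_mono) auto
  also have "\<dots> \<le> 2 * ((1 + T) * ?N) + T * Lip * (2 * ((1 + T) * ?N))"
    using T_pos by (intro add_right_mono) (auto intro!: mult_nonneg_nonneg sum_nonneg add_nonneg_nonneg)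
  also have "\<dots> = 2 * (1 + T * Lip) * (1 + T) * ?N" by (simp add: algebra_simps)
  finally show ?thesis .
qed

lemma sum_G_le: "(\<Sum>i<n. G i) \<le> 2 * Lip * (1 + T) * (\<Sum>i<n. norm (Q 0 i) + norm (P 0 i))"
proof -
  have a: "(\<Sum>i<n. a0 i) \<le> (1 + T) * (\<Sum>i<n. norm (Q 0 i) + norm (P 0 i))"
    unfolding sum_distrib_left a0_def using T_pos by (intro sum_mono) (auto simp: algebra_simps)
  have "(\<Sum>i<n. G i) \<le> Lip * (2 * ((1 + T) * (\<Sum>i<n. norm (Q 0 i) + norm (P 0 i))))"
    unfolding sum_G using Lip_nonneg sum_A_le a by (intro mult_left_mono) auto
  then show ?thesis by (simp add: algebra_simps)
qed

lemma sum_B_squares_le: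
  "(\<Sum>i<n. (B i)\<^sup>2) \<le> (2 + 12 * (T * Lip)\<^sup>2 * (1 + T\<^sup>2)) * (\<Sum>i<n. (norm (Q 0 i))\<^sup>2 + (norm (P 0 i))\<^sup>2)"
proof -
  let ?N = "\<Sum>i<n. (norm (Q 0 i))\<^sup>2 + (norm (P 0 i))\<^sup>2"
  have sq: "(x + y)\<^sup>2 \<le> 2 * x\<^sup>2 + 2 * y\<^sup>2" for x y :: real
    using zero_le_power2[of "x - y"] by (simp add: power2_eq_square algebra_simps)
  have "(\<Sum>i<n. (a0 i)\<^sup>2) \<le> (\<Sum>i<n. 2 * (1 + T\<^sup>2) * ((norm (Q 0 i))\<^sup>2 + (norm (P 0 i))\<^sup>2))"
  proof (rule sum_mono)
    fix i
    have "(a0 i)\<^sup>2 \<le> 2 * (norm (Q 0 i))\<^sup>2 + 2 * (T\<^sup>2 * (norm (P 0 i))\<^sup>2)"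
      unfolding a0_def by (rule order_trans[OF sq]) (simp add: power_mult_distrib)
    also have "\<dots> \<le> 2 * (1 + T\<^sup>2) * ((norm (Q 0 i))\<^sup>2 + (norm (P 0 i))\<^sup>2)"
      by (simp add: algebra_simps)
    finally show "(a0 i)\<^sup>2 \<le> 2 * (1 + T\<^sup>2) * ((norm (Q 0 i))\<^sup>2 + (norm (P 0 i))\<^sup>2)" .
  qed
  then have a: "(\<Sum>i<n. (a0 i)\<^sup>2) \<le> 2 * (1 + T\<^sup>2) * ?N" by (simp add: sum_distrib_left)
  have "(\<Sum>i<n. (B i)\<^sup>2) \<le> (\<Sum>i<n. 2 * (norm (P 0 i))\<^sup>2 + 2 * (T\<^sup>2 * (G i)\<^sup>2))"
    unfolding B_def by (intro sum_mono order_trans[OF sq]) (simp add: power_mult_distrib)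
  also have "\<dots> = 2 * (\<Sum>i<n. (norm (P 0 i))\<^sup>2) + 2 * T\<^sup>2 * (\<Sum>i<n. (G i)\<^sup>2)"
    by (simp add: sum.distrib sum_distrib_left mult.assoc)
  also have "\<dots> \<le> 2 * ?N + 2 * T\<^sup>2 * (Lip\<^sup>2 * (3 * (2 * (1 + T\<^sup>2) * ?N)))"
    using a sum_A_squares by (intro add_mono mult_left_mono order_trans[OF sum_G_squares] sum_mono) auto
  also have "\<dots> = (2 + 12 * (T * Lip)\<^sup>2 * (1 + T\<^sup>2)) * ?N"
    by (simp add: power_mult_distrib algebra_simps)
  finally show ?thesis .
qed

end

section \<open>Global error of velocity Verlet\<close>

definition stability_const :: "real \<Rightarrow> real \<Rightarrow> real"
  where "stability_const lip T = T * (1 + T * lip) * exp ((1 + T * lip + 2 * lip) * T)"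

definition first_order_const :: "real \<Rightarrow> real \<Rightarrow> real"
  where "first_order_const lip T =
    stability_const lip T * ((1 + T) * (lip * (2 * (1 + T * lip) * (1 + T))))"

definition second_order_const :: "real \<Rightarrow> real \<Rightarrow> real \<Rightarrow> real"
  where "second_order_const lip H T = stability_const lip T *
    (lip * (2 * (1 + T * lip) * (1 + T)) + H * (2 + 12 * (T * lip)\<^sup>2 * (1 + T\<^sup>2)) + lip * (2 * lip * (1 + T)))"

context orbit
begin

definition gap :: "real \<Rightarrow> nat \<Rightarrow> real"
  where "gap h k = (let z = verlet h k (Q 0, P 0) in
    (\<Sum>i<n. norm (Q (real k * h) i - fst z i)) + (\<Sum>i<n. norm (P (real k * h) i - snd z i)))"

text \<open>One Verlet step enlarges the sum of position and velocity errors by a factor \<open>1 + h * a\<close>,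
  where \<open>a\<close> depends on \<open>Lip\<close> and \<open>T\<close> alone, and adds a multiple of the local error. Over at most
  \<open>T / h\<close> steps local errors of size \<open>h * r\<close> add up to a multiple of \<open>r\<close>.\<close>

lemma global_error:
  assumes h: "h > 0" and mh: "real m * h = T" and r: "r \<ge> 0"
    and loc: "\<And>t. 0 \<le> t \<Longrightarrow> t + h \<le> T \<Longrightarrow>
      (\<Sum>i<n. norm (Q (t + h) i - Q t i - h *\<^sub>R P t i + (h\<^sup>2 / 2) *\<^sub>R force i (Q t)))
      + (\<Sum>i<n. norm (P (t + h) i - P t i + (h / 2) *\<^sub>R (force i (Q t) + force i (Q (t + h))))) \<le> h * r"
    and k: "k \<le> m"
  shows "gap h k \<le> stability_const Lip T * r"
proof -
  have m: "m \<ge> 1" using mh T_pos by (cases m) auto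
  have hT: "h \<le> T"
  proof -
    have "1 * h \<le> real m * h" using m h by (intro mult_right_mono) auto
    then show ?thesis using mh by simp
  qed
  define a where "a = 1 + T * Lip + 2 * Lip"
  have a: "a \<ge> 0" using T_pos Lip_nonneg by (simp add: a_def)
  have step: "gap h (Suc k) \<le> (1 + h * a) * gap h k + (1 + T * Lip) * (h * r)" if "k < m" for k
  proof -
    let ?t = "real k * h"
    define X where "X = fst (verlet h k (Q 0, P 0))"
    define Y where "Y = snd (verlet h k (Q 0, P 0))"
    define X' where "X' = fst (verlet h (Suc k) (Q 0, P 0))"
    define Y' where "Y' = snd (verlet h (Suc k) (Q 0, P 0))"
    define lq where "lq i = Q (?t + h) i - Q ?t i - h *\<^sub>R P ?t i + (h\<^sup>2 / 2) *\<^sub>R force i (Q ?t)" for i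
    define lp where "lp i = P (?t + h) i - P ?t i + (h / 2) *\<^sub>R (force i (Q ?t) + force i (Q (?t + h)))" for i
    define E D E' D' where "E = (\<Sum>i<n. norm (Q ?t i - X i))" and "D = (\<Sum>i<n. norm (P ?t i - Y i))"
      and "E' = (\<Sum>i<n. norm (Q (?t + h) i - X' i))" and "D' = (\<Sum>i<n. norm (P (?t + h) i - Y' i))"
    define Lq Lp where "Lq = (\<Sum>i<n. norm (lq i))" and "Lp = (\<Sum>i<n. norm (lp i))"
    have pos: "E \<ge> 0" "D \<ge> 0" "E' \<ge> 0" "Lq \<ge> 0" "Lp \<ge> 0"
      by (auto simp: E_def D_def E'_def Lq_def Lp_def intro: sum_nonneg)
    have "real (Suc k) * h \<le> real m * h" using that h by (intro mult_right_mono) auto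
    then have th: "?t + h \<le> T" "?t \<ge> 0" using mh h by (auto simp: algebra_simps)
    have L: "Lq + Lp \<le> h * r" unfolding Lq_def Lp_def lq_def lp_def by (rule loc) (use th in auto)
    have X': "X' i = X i + h *\<^sub>R Y i - (h\<^sup>2 / 2) *\<^sub>R force i X" if "i < n" for i
      using that by (simp add: X'_def X_def Y_def verlet_Suc fst_vstep)
    have Y': "Y' i = Y i - (h / 2) *\<^sub>R (force i X + force i X')" if "i < n" for i
      using that by (simp add: X'_def Y'_def X_def Y_def verlet_Suc snd_vstep)
    have E': "E' \<le> Lq + E + h * D + h\<^sup>2 / 2 * (Lip * E)"
    proof -
      have "norm (Q (?t + h) i - X' i) \<le> norm (lq i) + norm (Q ?t i - X i) + h * norm (P ?t i - Y i)
          + h\<^sup>2 / 2 * coup (norm (Q ?t i - X i)) E" if i: "i < n" for i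
      proof -
        have "Q (?t + h) i - X' i = (lq i + (Q ?t i - X i) + h *\<^sub>R (P ?t i - Y i))
            - (h\<^sup>2 / 2) *\<^sub>R (force i (Q ?t) - force i X)"
          unfolding X'[OF i] lq_def by (simp add: algebra_simps)
        then have "norm (Q (?t + h) i - X' i) \<le> norm (lq i + (Q ?t i - X i) + h *\<^sub>R (P ?t i - Y i))
            + norm ((h\<^sup>2 / 2) *\<^sub>R (force i (Q ?t) - force i X))" by (metis norm_triangle_ineq4)
        also have "norm (lq i + (Q ?t i - X i) + h *\<^sub>R (P ?t i - Y i))
            \<le> norm (lq i) + norm (Q ?t i - X i) + norm (h *\<^sub>R (P ?t i - Y i))"
          by (meson add_right_mono norm_triangle_ineq order_trans)
        also have "norm ((h\<^sup>2 / 2) *\<^sub>R (force i (Q ?t) - force i X)) \<le> h\<^sup>2 / 2 * coup (norm (Q ?t i - X i)) E"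
          unfolding E_def norm_scaleR using force_lipschitz[OF i] by (simp add: mult_left_mono divide_right_mono)
        finally show ?thesis using h by simp
      qed
      then have "E' \<le> (\<Sum>i<n. norm (lq i) + norm (Q ?t i - X i) + h * norm (P ?t i - Y i)
          + h\<^sup>2 / 2 * coup (norm (Q ?t i - X i)) E)" unfolding E'_def by (intro sum_mono) auto
      also have "\<dots> = Lq + E + h * D + h\<^sup>2 / 2 * (\<Sum>i<n. coup (norm (Q ?t i - X i)) E)"
        by (simp add: sum.distrib sum_distrib_left Lq_def E_def D_def)
      finally show ?thesis unfolding E_def sum_coup .
    qed
    have D': "D' \<le> Lp + D + h / 2 * (Lip * E + Lip * E')"
    proof -
      have "norm (P (?t + h) i - Y' i) \<le> norm (lp i) + norm (P ?t i - Y i)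
          + h / 2 * (coup (norm (Q ?t i - X i)) E + coup (norm (Q (?t + h) i - X' i)) E')" if i: "i < n" for i
      proof -
        have "P (?t + h) i - Y' i = (lp i + (P ?t i - Y i))
            - (h / 2) *\<^sub>R ((force i (Q ?t) - force i X) + (force i (Q (?t + h)) - force i X'))"
          unfolding Y'[OF i] lp_def by (simp add: algebra_simps)
        then have "norm (P (?t + h) i - Y' i) \<le> norm (lp i + (P ?t i - Y i))
            + norm ((h / 2) *\<^sub>R ((force i (Q ?t) - force i X) + (force i (Q (?t + h)) - force i X')))"
          by (metis norm_triangle_ineq4)
        also have "norm (lp i + (P ?t i - Y i)) \<le> norm (lp i) + norm (P ?t i - Y i)"
          by (rule norm_triangle_ineq)
        also have "norm ((h / 2) *\<^sub>R ((force i (Q ?t) - force i X) + (force i (Q (?t + h)) - force i X')))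
            \<le> h / 2 * (coup (norm (Q ?t i - X i)) E + coup (norm (Q (?t + h) i - X' i)) E')"
          unfolding E_def E'_def norm_scaleR using h
          by (auto intro!: mult_left_mono order_trans[OF norm_triangle_ineq] add_mono force_lipschitz[OF i])
        finally show ?thesis by simp
      qed
      then have "D' \<le> (\<Sum>i<n. norm (lp i) + norm (P ?t i - Y i)
          + h / 2 * (coup (norm (Q ?t i - X i)) E + coup (norm (Q (?t + h) i - X' i)) E'))"
        unfolding D'_def by (intro sum_mono) auto
      also have "\<dots> = Lp + D + h / 2 * ((\<Sum>i<n. coup (norm (Q ?t i - X i)) E) + (\<Sum>i<n. coup (norm (Q (?t + h) i - X' i)) E'))"
        by (simp add: sum.distrib sum_distrib_left Lp_def D_def distrib_left)
      finally show ?thesis unfolding E_def E'_def sum_coup .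
    qed
    have gE: "gap h k = E + D" "gap h (Suc k) = E' + D'"
      by (simp_all add: gap_def Let_def E_def D_def E'_def D'_def X_def Y_def X'_def Y'_def algebra_simps)
    have hl: "h * Lip \<ge> 0" "h * Lip \<le> T * Lip" "h\<^sup>2 * Lip \<le> 1 / 4" "h\<^sup>2 * Lip \<le> h * (T * Lip)"
    proof -
      show "h * Lip \<ge> 0" "h * Lip \<le> T * Lip" using h hT Lip_nonneg by (auto intro: mult_right_mono)
      have "h\<^sup>2 * Lip \<le> T\<^sup>2 * Lip" using h hT Lip_nonneg by (intro mult_right_mono power_mono) auto
      then show "h\<^sup>2 * Lip \<le> 1 / 4" using Lip_T by (simp add: mult.commute)
      have "h * (h * Lip) \<le> h * (T * Lip)" using h hT Lip_nonneg by (intro mult_left_mono mult_right_mono) auto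
      then show "h\<^sup>2 * Lip \<le> h * (T * Lip)" by (simp add: power2_eq_square mult.assoc)
    qed
    have b1: "h\<^sup>2 * Lip * E \<le> 1 / 4 * E" "h\<^sup>2 * Lip * E \<le> h * (T * Lip) * E" "h\<^sup>2 * Lip * D \<le> h * (T * Lip) * D"
      using mult_right_mono[OF hl(3) pos(1)] mult_right_mono[OF hl(4) pos(1)] mult_right_mono[OF hl(4) pos(2)] by simp_all
    have b2: "h * Lip * E' \<le> h * Lip * (Lq + E + h * D + h\<^sup>2 / 2 * (Lip * E))"
      using E' hl by (intro mult_left_mono) auto
    \<comment> \<open>The new position error enters the velocity error through the force at the new position; substituting its own bound leaves products that are cubic in the step size.\<close>
    have b3: "h * Lip * (h\<^sup>2 * Lip * E) \<le> h * Lip * (1 / 4 * E)"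
      using b1(1) hl by (intro mult_left_mono) auto
    have b4: "h * Lip * Lq \<le> T * Lip * Lq" "0 \<le> h * Lip * E" "0 \<le> T * Lip * Lq" "0 \<le> T * Lip * Lp"
      "0 \<le> h * (T * Lip) * D" "0 \<le> h * Lip * D" "0 \<le> h * (T * Lip) * E" "0 \<le> h * E"
      using hl pos h T_pos Lip_nonneg by (auto intro: mult_right_mono)
    have D2: "D' \<le> Lp + D + 1/2 * (h * Lip * E) + 1/2 * (h * Lip * Lq + h * Lip * E + h\<^sup>2 * Lip * D + 1/2 * (h * Lip * (1 / 4 * E)))"
    proof -
      have "h * Lip * (Lq + E + h * D + h\<^sup>2 / 2 * (Lip * E)) =
         h * Lip * Lq + h * Lip * E + h\<^sup>2 * Lip * D + 1/2 * (h * Lip * (h\<^sup>2 * Lip * E))"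
        by (simp add: algebra_simps power2_eq_square)
      also have "\<dots> \<le> h * Lip * Lq + h * Lip * E + h\<^sup>2 * Lip * D + 1/2 * (h * Lip * (1 / 4 * E))"
        by (intro add_left_mono mult_left_mono b3) simp
      finally have s1: "h * Lip * E' \<le> h * Lip * Lq + h * Lip * E + h\<^sup>2 * Lip * D + 1/2 * (h * Lip * (1 / 4 * E))"
        using b2 by (rule order_trans[rotated])
      have "D' \<le> Lp + D + (1/2 * (h * Lip * E) + 1/2 * (h * Lip * E'))"
        using D' by (simp add: algebra_simps)
      also have "\<dots> \<le> Lp + D + (1/2 * (h * Lip * E) + 1/2 * (h * Lip * Lq + h * Lip * E + h\<^sup>2 * Lip * D + 1/2 * (h * Lip * (1 / 4 * E))))"
        by (intro add_left_mono mult_left_mono s1) simp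
      finally show ?thesis by (simp only: add.assoc)
    qed
    have E2: "E' \<le> Lq + E + h * D + 1/2 * (h\<^sup>2 * Lip * E)" using E' by simp
    have R: "Lq + Lp + T * Lip * Lq + T * Lip * Lp \<le> (1 + T * Lip) * (h * r)"
    proof -
      have "(1 + T * Lip) * (Lq + Lp) \<le> (1 + T * Lip) * (h * r)"
        using L T_pos Lip_nonneg by (intro mult_left_mono) auto
      then show ?thesis by (simp add: algebra_simps)
    qed
    \<comment> \<open>The estimates are linear in the monomials that occur, so each monomial becomes a variable of its own.\<close>
    have lin: "E' + D' \<le> X + Y"
      if "X = E + D + xE + xD + tE + tD + 2 * lE + 2 * lD"
        "D' \<le> Lp + D + 1/2 * lE + 1/2 * (lq + lE + kD + 1/2 * mE)" "E' \<le> Lq + E + xD + 1/2 * kE"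
        "Lq + Lp + tq + tp \<le> Y" "mE = 1/4 * lE" "kE \<le> tE" "kD \<le> tD" "lq \<le> tq"
        "0 \<le> lE" "0 \<le> tq" "0 \<le> tp" "0 \<le> tD" "0 \<le> lD" "0 \<le> tE" "0 \<le> xE"
      for X Y xE xD tE tD lE lD lq kD mE kE tq tp :: real
    proof -
      have "E' + D' \<le> (Lq + Lp) + E + D + xD + 1/2 * kE + lE + 1/2 * lq + 1/2 * kD + 1/16 * lE"
        using that(2,3,5) by (simp add: field_simps)
      moreover have "1/2 * kE \<le> tE" "1/2 * kD \<le> tD" "1/2 * lq \<le> tq"
        using that(6-8,10,12,14) by linarith+
      moreover have "Lq + Lp + tq \<le> Y" using that(4,11) by linarith
      moreover have "X = E + D + xE + xD + tE + tD + 2 * lE + 2 * lD" by fact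
      ultimately show ?thesis using that(9,13,15) by linarith
    qed
    have "(1 + h * a) * (E + D) = E + D + h * E + h * D + h * (T * Lip) * E + h * (T * Lip) * D
        + 2 * (h * Lip * E) + 2 * (h * Lip * D)"
      by (simp add: a_def algebra_simps)
    then show ?thesis unfolding gE
      by (rule lin[OF _ D2 E2 R _ b1(2,3) b4]) simp
  qed
  have "gap h k \<le> real k * ((1 + T * Lip) * (h * r)) * (1 + h * a) ^ k"
  proof (rule discrete_gronwall[where m=m])
    show "gap h 0 = 0" by (simp add: gap_def)
    show "0 \<le> (1 + T * Lip) * (h * r)" "0 \<le> h * a" using T_pos Lip_nonneg h r a by auto
  qed (use step k in auto)
  also have "\<dots> \<le> real k * ((1 + T * Lip) * (h * r)) * exp (a * T)"
  proof (rule mult_left_mono)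
    have "(1 + h * a) ^ k \<le> exp (h * a) ^ k" using h a by (intro power_mono) auto
    also have "\<dots> = exp (real k * h * a)" by (simp add: exp_of_nat_mult[symmetric] mult.assoc)
    also have "real k * h * a \<le> T * a" using k h a by (intro mult_right_mono) (auto simp: mh[symmetric])
    finally show "(1 + h * a) ^ k \<le> exp (a * T)" by (simp add: mult.commute)
  qed (use T_pos Lip_nonneg h r in auto)
  also have "\<dots> = (real k * h) * ((1 + T * Lip) * r * exp (a * T))" by simp
  also have "\<dots> \<le> T * ((1 + T * Lip) * r * exp (a * T))"
    using k h T_pos Lip_nonneg r by (intro mult_right_mono) (auto simp: mh[symmetric])
  finally show ?thesis by (simp add: stability_const_def a_def mult_ac)
qed

lemma stability_const_nonneg: "0 \<le> stability_const Lip T"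
  using T_pos Lip_nonneg by (simp add: stability_const_def)

lemma first_order_error:
  assumes h: "h > 0" and mh: "real m * h = T" and k: "k \<le> m"
  shows "gap h k \<le> h * first_order_const Lip T * (\<Sum>i<n. norm (Q 0 i) + norm (P 0 i))"
proof -
  let ?N = "\<Sum>i<n. norm (Q 0 i) + norm (P 0 i)"
  define SC where "SC = (\<Sum>i<n. C i)"
  have SC: "SC \<ge> 0" unfolding SC_def by (intro sum_nonneg C_nonneg) auto
  have "gap h k \<le> stability_const Lip T * (h * ((1 + T) * SC))"
  proof (rule global_error[OF h mh _ _ k])
    show "0 \<le> h * ((1 + T) * SC)" using h T_pos SC by simp
    fix t assume t: "0 \<le> t" "t + h \<le> T"
    have "(\<Sum>i<n. norm (Q (t + h) i - Q t i - h *\<^sub>R P t i + (h\<^sup>2 / 2) *\<^sub>R force i (Q t)))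
      + (\<Sum>i<n. norm (P (t + h) i - P t i + (h / 2) *\<^sub>R (force i (Q t) + force i (Q (t + h)))))
      \<le> (\<Sum>i<n. h ^ 3 * C i) + (\<Sum>i<n. h\<^sup>2 * C i)"
      by (intro add_mono sum_mono local_error_Q local_error_P t h) auto
    also have "\<dots> = h * (h * ((1 + h) * SC))"
      by (simp add: sum_distrib_left[symmetric] SC_def power2_eq_square power3_eq_cube algebra_simps)
    also have "\<dots> \<le> h * (h * ((1 + T) * SC))"
      using t h SC by (intro mult_left_mono mult_right_mono) auto
    finally show "(\<Sum>i<n. norm (Q (t + h) i - Q t i - h *\<^sub>R P t i + (h\<^sup>2 / 2) *\<^sub>R force i (Q t)))
      + (\<Sum>i<n. norm (P (t + h) i - P t i + (h / 2) *\<^sub>R (force i (Q t) + force i (Q (t + h)))))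
      \<le> h * (h * ((1 + T) * SC))" .
  qed
  also have "\<dots> \<le> stability_const Lip T * (h * ((1 + T) * (Lip * (2 * (1 + T * Lip) * (1 + T) * ?N))))"
    unfolding SC_def sum_C using h T_pos Lip_nonneg stability_const_nonneg
    by (intro mult_left_mono sum_B_le) auto
  finally show ?thesis by (simp add: first_order_const_def algebra_simps)
qed

end

lemma grad_chain:
  assumes "twice_cont_differentiable f" "(c has_vector_derivative c') (at s)"
  shows "((\<lambda>s. grad f (c s)) has_vector_derivative hess f (c s) c') (at s)"
proof -
  have "((\<lambda>s. grad f (c s)) has_derivative (\<lambda>u. hess f (c s) (u *\<^sub>R c'))) (at s)"
    by (rule has_derivative_compose[OF _ grad_has_derivative[OF assms(1)]])
       (use assms(2) in \<open>simp add: has_vector_derivative_def\<close>)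
  then show ?thesis by (simp add: has_vector_derivative_def blinfun.scaleR_right)
qed

lemma hess_apply_diff:
  assumes "\<And>x y. norm (hess f x - hess f y) \<le> LH * norm (x - y)" "\<And>x. norm (hess f x) \<le> B"
  shows "norm (hess f a u - hess f b w) \<le> LH * norm (a - b) * norm u + B * norm (u - w)"
proof -
  have "hess f a u - hess f b w = (hess f a - hess f b) u + hess f b (u - w)"
    by (simp add: blinfun.diff_left blinfun.diff_right)
  also have "norm \<dots> \<le> norm ((hess f a - hess f b) u) + norm (hess f b (u - w))" by (rule norm_triangle_ineq)
  also have "\<dots> \<le> norm (hess f a - hess f b) * norm u + norm (hess f b) * norm (u - w)"
    by (intro add_mono norm_blinfun)
  also have "\<dots> \<le> LH * norm (a - b) * norm u + B * norm (u - w)"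
    using assms by (intro add_mono mult_right_mono) auto
  finally show ?thesis .
qed

text \<open>With Lipschitz Hessians the force along an orbit is differentiable in time with a Lipschitz
  derivative \<open>dforce\<close>, and the trapezoidal rule gains another order.\<close>

locale orbit3 = orbit +
  fixes LH LtH :: real
  assumes hessV_lip: "\<And>x y. norm (hess V x - hess V y) \<le> LH * norm (x - y)"
    and hessW_lip: "\<And>x y. norm (hess W x - hess W y) \<le> LtH * norm (x - y)"
    and LH_nonneg: "LH \<ge> 0" and LtH_nonneg: "LtH \<ge> 0"
begin

definition dforce :: "nat \<Rightarrow> real \<Rightarrow> ell2" where
  "dforce i s = hess V (Q s i) (P s i) + (eps / real n) *\<^sub>R
    (\<Sum>j\<in>{..<n} - {i}. hess W (Q s i - Q s j) (P s i - P s j) - hess W (Q s j - Q s i) (P s j - P s i))"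

lemma force_deriv:
  assumes "s > 0" "i < n"
  shows "((\<lambda>s. force i (Q s)) has_vector_derivative dforce i s) (at s)"
  unfolding force_def dforce_def using assms
  by (intro has_vector_derivative_add bounded_linear.has_vector_derivative[OF bounded_linear_scaleR_right]
      has_vector_derivative_sum has_vector_derivative_diff grad_chain V_C2 W_C2 Q_deriv') auto

text \<open>The Lipschitz constant in time of \<open>dforce\<close>. The squares of the velocity bounds come from the
  derivative of the Hessian along the orbit, and they are the reason why second moments of the
  initial data appear in the second-order estimate.\<close>

definition M :: "nat \<Rightarrow> real" where
  "M i = LH * (B i)\<^sup>2 + L * G i +
     (eps / real n) * (\<Sum>j<n. 2 * (LtH * (B i + B j)\<^sup>2 + Lt * (G i + G j)))"

lemma sum_M: "(\<Sum>i<n. M i) \<le> (LH + 8 * (eps * LtH)) * (\<Sum>i<n. (B i)\<^sup>2) + Lip * (\<Sum>i<n. G i)"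
proof -
  let ?b = "\<Sum>i<n. (B i)\<^sup>2" and ?g = "\<Sum>i<n. G i"
  have sq: "(x + y)\<^sup>2 \<le> 2 * x\<^sup>2 + 2 * y\<^sup>2" for x y :: real
    using zero_le_power2[of "x - y"] by (simp add: power2_eq_square algebra_simps)
  have "(\<Sum>i<n. \<Sum>j<n. 2 * (LtH * (B i + B j)\<^sup>2 + Lt * (G i + G j)))
     \<le> (\<Sum>i<n. \<Sum>j<n. 4 * LtH * (B i)\<^sup>2 + 4 * LtH * (B j)\<^sup>2 + 2 * Lt * G i + 2 * Lt * G j)"
  proof (intro sum_mono)
    fix i j
    have "LtH * (B i + B j)\<^sup>2 \<le> LtH * (2 * (B i)\<^sup>2 + 2 * (B j)\<^sup>2)"
      using LtH_nonneg by (intro mult_left_mono sq)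
    then show "2 * (LtH * (B i + B j)\<^sup>2 + Lt * (G i + G j))
       \<le> 4 * LtH * (B i)\<^sup>2 + 4 * LtH * (B j)\<^sup>2 + 2 * Lt * G i + 2 * Lt * G j" by (simp add: algebra_simps)
  qed
  also have "\<dots> = real n * (8 * LtH * ?b + 4 * Lt * ?g)"
    by (simp add: sum.distrib sum_distrib_left[symmetric] algebra_simps)
  finally have "(eps / real n) * (\<Sum>i<n. \<Sum>j<n. 2 * (LtH * (B i + B j)\<^sup>2 + Lt * (G i + G j)))
     \<le> (eps / real n) * (real n * (8 * LtH * ?b + 4 * Lt * ?g))"
    using eps_nonneg by (intro mult_left_mono) auto
  also have "\<dots> = 8 * (eps * LtH) * ?b + 4 * (eps * Lt) * ?g" using n_pos by (simp add: algebra_simps)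
  finally have "(\<Sum>i<n. M i) \<le> LH * ?b + L * ?g + (8 * (eps * LtH) * ?b + 4 * (eps * Lt) * ?g)"
    unfolding M_def by (simp only: sum.distrib sum_distrib_left[symmetric])
  then show ?thesis by (simp add: Lip_def algebra_simps)
qed

lemma M_nonneg: "i < n \<Longrightarrow> 0 \<le> M i"
  unfolding M_def using LH_nonneg LtH_nonneg L_nonneg Lt_nonneg eps_nonneg G_nonneg
  by (intro add_nonneg_nonneg mult_nonneg_nonneg sum_nonneg divide_nonneg_nonneg) auto

lemma dforce_increment:
  assumes i: "i < n" and s: "0 \<le> s" "s \<le> t" "t \<le> T"
  shows "norm (dforce i t - dforce i s) \<le> M i * (t - s)"
proof -
  have BG: "norm (Q t j - Q s j) \<le> B j * (t - s)" "norm (P t j - P s j) \<le> G j * (t - s)" "norm (P t j) \<le> B j"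
    if "j < n" for j using Q_increment P_increment P_le_B s that by auto
  have V: "norm (hess V (Q t i) (P t i) - hess V (Q s i) (P s i)) \<le> (LH * (B i)\<^sup>2 + L * G i) * (t - s)"
  proof -
    have "norm (hess V (Q t i) (P t i) - hess V (Q s i) (P s i))
       \<le> LH * norm (Q t i - Q s i) * norm (P t i) + L * norm (P t i - P s i)"
      by (rule hess_apply_diff[OF hessV_lip finite_sup_le[OF hess_V]])
    also have "\<dots> \<le> LH * (B i * (t - s)) * B i + L * (G i * (t - s))"
      using BG[OF i] LH_nonneg L_nonneg B_nonneg[OF i] s by (intro add_mono mult_mono mult_left_mono) auto
    finally show ?thesis by (simp add: power2_eq_square algebra_simps)
  qed
  have W: "norm (hess W (Q t k - Q t l) (P t k - P t l) - hess W (Q s k - Q s l) (P s k - P s l))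
     \<le> (LtH * (B k + B l)\<^sup>2 + Lt * (G k + G l)) * (t - s)" if kl: "k < n" "l < n" for k l
  proof -
    have "norm ((Q t k - Q t l) - (Q s k - Q s l)) \<le> (B k + B l) * (t - s)"
      using norm_triangle_ineq4[of "Q t k - Q s k" "Q t l - Q s l"] BG(1)[OF kl(1)] BG(1)[OF kl(2)]
      by (simp add: algebra_simps)
    moreover have "norm ((P t k - P t l) - (P s k - P s l)) \<le> (G k + G l) * (t - s)"
      using norm_triangle_ineq4[of "P t k - P s k" "P t l - P s l"] BG(2)[OF kl(1)] BG(2)[OF kl(2)]
      by (simp add: algebra_simps)
    moreover have "norm (P t k - P t l) \<le> B k + B l"
      using norm_triangle_ineq4[of "P t k" "P t l"] BG(3)[OF kl(1)] BG(3)[OF kl(2)] by simp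
    ultimately have "LtH * norm ((Q t k - Q t l) - (Q s k - Q s l)) * norm (P t k - P t l)
         + Lt * norm ((P t k - P t l) - (P s k - P s l))
       \<le> LtH * ((B k + B l) * (t - s)) * (B k + B l) + Lt * ((G k + G l) * (t - s))"
      using LtH_nonneg Lt_nonneg B_nonneg kl s by (intro add_mono mult_mono mult_left_mono) auto
    then show ?thesis
      using hess_apply_diff[OF hessW_lip finite_sup_le[OF hess_W], of "Q t k - Q t l" "P t k - P t l" "Q s k - Q s l" "P s k - P s l"]
      by (simp add: power2_eq_square algebra_simps)
  qed
  let ?w = "\<lambda>t j. hess W (Q t i - Q t j) (P t i - P t j) - hess W (Q t j - Q t i) (P t j - P t i)"
  have "norm (?w t j - ?w s j) \<le> 2 * (LtH * (B i + B j)\<^sup>2 + Lt * (G i + G j)) * (t - s)" if "j < n" for j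
    using W[OF i that] W[OF that i]
      norm_triangle_ineq4[of "hess W (Q t i - Q t j) (P t i - P t j) - hess W (Q s i - Q s j) (P s i - P s j)"
         "hess W (Q t j - Q t i) (P t j - P t i) - hess W (Q s j - Q s i) (P s j - P s i)"]
    by (simp add: algebra_simps)
  then have "norm ((\<Sum>j\<in>{..<n} - {i}. ?w t j) - (\<Sum>j\<in>{..<n} - {i}. ?w s j))
     \<le> (\<Sum>j\<in>{..<n} - {i}. 2 * (LtH * (B i + B j)\<^sup>2 + Lt * (G i + G j)) * (t - s))"
    unfolding sum_subtractf[symmetric] by (intro sum_norm_le) auto
  also have "\<dots> \<le> (\<Sum>j<n. 2 * (LtH * (B i + B j)\<^sup>2 + Lt * (G i + G j)) * (t - s))"
    using LtH_nonneg Lt_nonneg G_nonneg i s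
    by (intro sum_mono2 mult_nonneg_nonneg add_nonneg_nonneg) auto
  finally have W2: "norm ((\<Sum>j\<in>{..<n} - {i}. ?w t j) - (\<Sum>j\<in>{..<n} - {i}. ?w s j))
     \<le> (\<Sum>j<n. 2 * (LtH * (B i + B j)\<^sup>2 + Lt * (G i + G j))) * (t - s)" by (simp add: sum_distrib_right)
  have "norm (dforce i t - dforce i s) = norm ((hess V (Q t i) (P t i) - hess V (Q s i) (P s i)) +
     (eps / real n) *\<^sub>R ((\<Sum>j\<in>{..<n} - {i}. ?w t j) - (\<Sum>j\<in>{..<n} - {i}. ?w s j)))"
    unfolding dforce_def by (simp only: scaleR_diff_right add_diff_add)
  also have "\<dots> \<le> norm (hess V (Q t i) (P t i) - hess V (Q s i) (P s i)) +
     eps / real n * norm ((\<Sum>j\<in>{..<n} - {i}. ?w t j) - (\<Sum>j\<in>{..<n} - {i}. ?w s j))"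
    using eps_nonneg by (intro order_trans[OF norm_triangle_ineq]) simp
  also have "\<dots> \<le> (LH * (B i)\<^sup>2 + L * G i) * (t - s) +
     eps / real n * ((\<Sum>j<n. 2 * (LtH * (B i + B j)\<^sup>2 + Lt * (G i + G j))) * (t - s))"
    using eps_nonneg by (intro add_mono V mult_left_mono W2) auto
  also have "\<dots> = M i * (t - s)" by (simp add: M_def distrib_right)
  finally show ?thesis .
qed

text \<open>The error of the trapezoidal rule is an integral of the increments of \<open>dforce\<close>.\<close>

lemma local_error_P2:
  assumes i: "i < n" and t: "0 \<le> t" "t + h \<le> T" and h: "0 < h"
  shows "norm (P (t + h) i - P t i + (h / 2) *\<^sub>R (force i (Q t) + force i (Q (t + h)))) \<le> h ^ 3 * M i"
proof -
  have fcont: "continuous_on {a..b} (\<lambda>s. force i (Q s))" if "0 \<le> a" "b \<le> T" for a b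
  proof (rule continuous_onI)
    fix x and e :: real assume x: "x \<in> {a..b}" and e: "e > 0"
    show "\<exists>d>0. \<forall>x'\<in>{a..b}. dist x' x < d \<longrightarrow> dist (force i (Q x')) (force i (Q x)) \<le> e"
    proof (intro exI[of _ "e / (C i + 1)"] conjI ballI impI)
      fix x' assume x': "x' \<in> {a..b}" "dist x' x < e / (C i + 1)"
      have "norm (force i (Q x') - force i (Q x)) \<le> C i * \<bar>x' - x\<bar>"
        using force_increment[OF i, of x x'] force_increment[OF i, of x' x] x x' that
        by (cases "x \<le> x'") (auto simp: norm_minus_commute)
      also have "\<dots> \<le> C i * (e / (C i + 1))"
        using x' C_nonneg[OF i] by (intro mult_left_mono) (auto simp: dist_real_def)
      also have "\<dots> \<le> e" using C_nonneg[OF i] e by (simp add: field_simps)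
      finally show "dist (force i (Q x')) (force i (Q x)) \<le> e" by (simp add: dist_norm)
    qed (use e C_nonneg[OF i] in auto)
  qed
  let ?f = "\<lambda>s. P s i + ((s - t) / 2) *\<^sub>R (force i (Q t) + force i (Q s))"
  have "norm (?f (t + h) - ?f t) \<le> (h * (M i * h)) * (t + h - t)"
  proof (rule mean_value_bound[where f="?f" and
        f'="\<lambda>s. - force i (Q s) + ((1/2) *\<^sub>R (force i (Q t) + force i (Q s)) + ((s - t) / 2) *\<^sub>R dforce i s)"])
    show "continuous_on {t..t + h} ?f" using t by (intro continuous_intros P_cont i fcont) auto
    fix s assume s: "t < s" "s < t + h"
    show "(?f has_vector_derivative - force i (Q s) + ((1/2) *\<^sub>R (force i (Q t) + force i (Q s)) + ((s - t) / 2) *\<^sub>R dforce i s)) (at s)"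
      using P_deriv'[of s i] force_deriv[of s i] s t i by (auto intro!: derivative_eq_intros)
    have "norm ((force i (Q s) - (s - t) *\<^sub>R dforce i s) - (force i (Q t) - (t - t) *\<^sub>R dforce i s)) \<le> (M i * h) * (s - t)"
    proof (rule mean_value_bound[where f="\<lambda>u. force i (Q u) - (u - t) *\<^sub>R dforce i s" and f'="\<lambda>u. dforce i u - dforce i s"])
      show "continuous_on {t..s} (\<lambda>u. force i (Q u) - (u - t) *\<^sub>R dforce i s)"
        using t s by (intro continuous_intros fcont) auto
      fix u assume u: "t < u" "u < s"
      show "((\<lambda>u. force i (Q u) - (u - t) *\<^sub>R dforce i s) has_vector_derivative dforce i u - dforce i s) (at u)"
        using force_deriv[of u i] u t i by (auto intro!: derivative_eq_intros)
      have "norm (dforce i s - dforce i u) \<le> M i * (s - u)"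
        by (rule dforce_increment) (use i u s t in auto)
      also have "\<dots> \<le> M i * h" using M_nonneg[OF i] u s by (intro mult_left_mono) auto
      finally show "norm (dforce i u - dforce i s) \<le> M i * h" by (simp add: norm_minus_commute)
    qed (use s in auto)
    also have "\<dots> \<le> (M i * h) * h" using s h M_nonneg[OF i] by (intro mult_left_mono) auto
    finally have *: "norm (force i (Q s) - force i (Q t) - (s - t) *\<^sub>R dforce i s) \<le> h * (M i * h)"
      by (simp add: algebra_simps)
    have "- force i (Q s) + ((1/2) *\<^sub>R (force i (Q t) + force i (Q s)) + ((s - t) / 2) *\<^sub>R dforce i s)
      = - ((1/2) *\<^sub>R (force i (Q s) - force i (Q t) - (s - t) *\<^sub>R dforce i s))"
      by (rule ell2_eqI) (simp add: coord_simps field_simps)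
    then have "norm (- force i (Q s) + ((1/2) *\<^sub>R (force i (Q t) + force i (Q s)) + ((s - t) / 2) *\<^sub>R dforce i s))
      = 1/2 * norm (force i (Q s) - force i (Q t) - (s - t) *\<^sub>R dforce i s)" by simp
    also have "\<dots> \<le> h * (M i * h)" using * norm_ge_zero[of "force i (Q s) - force i (Q t) - (s - t) *\<^sub>R dforce i s"] by linarith
    finally show "norm (- force i (Q s) + ((1/2) *\<^sub>R (force i (Q t) + force i (Q s)) + ((s - t) / 2) *\<^sub>R dforce i s)) \<le> h * (M i * h)" .
  qed (use h in auto)
  then show ?thesis by (simp add: power3_eq_cube algebra_simps)
qed

lemma second_order_error:
  assumes h: "h > 0" and mh: "real m * h = T" and k: "k \<le> m"
  shows "gap h k \<le> h\<^sup>2 * second_order_const Lip (LH + 8 * (eps * LtH)) T *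
    ((\<Sum>i<n. norm (Q 0 i) + norm (P 0 i)) + (\<Sum>i<n. (norm (Q 0 i))\<^sup>2 + (norm (P 0 i))\<^sup>2))"
proof -
  let ?N = "\<Sum>i<n. norm (Q 0 i) + norm (P 0 i)" and ?N2 = "\<Sum>i<n. (norm (Q 0 i))\<^sup>2 + (norm (P 0 i))\<^sup>2"
  let ?H = "LH + 8 * (eps * LtH)"
  define R where "R = (\<Sum>i<n. C i) + (\<Sum>i<n. M i)"
  have H: "?H \<ge> 0" using LH_nonneg LtH_nonneg eps_nonneg by simp
  have R0: "R \<ge> 0" unfolding R_def by (intro add_nonneg_nonneg sum_nonneg C_nonneg M_nonneg) auto
  have "gap h k \<le> stability_const Lip T * (h\<^sup>2 * R)"
  proof (rule global_error[OF h mh _ _ k])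
    show "0 \<le> h\<^sup>2 * R" using R0 by simp
    fix t assume t: "0 \<le> t" "t + h \<le> T"
    have "(\<Sum>i<n. norm (Q (t + h) i - Q t i - h *\<^sub>R P t i + (h\<^sup>2 / 2) *\<^sub>R force i (Q t)))
      + (\<Sum>i<n. norm (P (t + h) i - P t i + (h / 2) *\<^sub>R (force i (Q t) + force i (Q (t + h)))))
      \<le> (\<Sum>i<n. h ^ 3 * C i) + (\<Sum>i<n. h ^ 3 * M i)"
      by (intro add_mono sum_mono local_error_Q local_error_P2 t h) auto
    also have "\<dots> = h * (h\<^sup>2 * R)"
      by (simp add: sum_distrib_left[symmetric] R_def power2_eq_square power3_eq_cube algebra_simps)
    finally show "(\<Sum>i<n. norm (Q (t + h) i - Q t i - h *\<^sub>R P t i + (h\<^sup>2 / 2) *\<^sub>R force i (Q t)))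
      + (\<Sum>i<n. norm (P (t + h) i - P t i + (h / 2) *\<^sub>R (force i (Q t) + force i (Q (t + h)))))
      \<le> h * (h\<^sup>2 * R)" .
  qed
  also have "R \<le> (Lip * (2 * (1 + T * Lip) * (1 + T)) + ?H * (2 + 12 * (T * Lip)\<^sup>2 * (1 + T\<^sup>2)) + Lip * (2 * Lip * (1 + T))) * (?N + ?N2)"
  proof -
    have "R \<le> Lip * (2 * (1 + T * Lip) * (1 + T) * ?N) + (?H * ((2 + 12 * (T * Lip)\<^sup>2 * (1 + T\<^sup>2)) * ?N2)
       + Lip * (2 * Lip * (1 + T) * ?N))"
      unfolding R_def sum_C using H Lip_nonneg
      by (intro add_mono order_trans[OF sum_M] mult_left_mono sum_B_le sum_B_squares_le sum_G_le) auto
    moreover have N: "0 \<le> ?N" "0 \<le> ?N2" by (auto intro!: sum_nonneg)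
    moreover define a b c where "a = Lip * (2 * (1 + T * Lip) * (1 + T))" and
      "b = ?H * (2 + 12 * (T * Lip)\<^sup>2 * (1 + T\<^sup>2))" and "c = Lip * (2 * Lip * (1 + T))"
    ultimately have R: "R \<le> a * ?N + (b * ?N2 + c * ?N)" by (simp add: mult.assoc)
    have "a \<ge> 0" "b \<ge> 0" "c \<ge> 0" using H Lip_nonneg T_pos by (auto simp: a_def b_def c_def)
    then have "0 \<le> a * ?N2" "0 \<le> b * ?N" "0 \<le> c * ?N2" using N by simp_all
    with R show ?thesis unfolding a_def[symmetric] b_def[symmetric] c_def[symmetric] by (simp add: algebra_simps)
  qed
  finally show ?thesis using stability_const_nonneg
    by (simp add: second_order_const_def mult_left_mono mult.assoc mult.left_commute)
qed

end

section \<open>Lebesgue and Gaussian measures on configurations\<close>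

abbreviation Rborel :: "nat \<Rightarrow> ell2 measure"
  where "Rborel d \<equiv> restrict_space borel (Rspace d)"

text \<open>The one-particle factors of the two product measures on configurations.\<close>

definition Leb :: "nat \<Rightarrow> ell2 measure"
  where "Leb d = distr (PiM {..<d} (\<lambda>_. lborel)) (Rborel d) (embed d)"

definition Gau :: "nat \<Rightarrow> ell2 measure"
  where "Gau d = distr (PiM {..<d} (\<lambda>_. std_normal_distribution)) (Rborel d) (embed d)"

lemma space_Rborel [simp]: "space (Rborel d) = Rspace d"
  by (simp add: space_restrict_space)

lemma sets_Leb [simp, measurable_cong]: "sets (Leb d) = sets (Rborel d)"
  and sets_Gau [simp, measurable_cong]: "sets (Gau d) = sets (Rborel d)"
  and space_Leb [simp]: "space (Leb d) = Rspace d" and space_Gau [simp]: "space (Gau d) = Rspace d"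
  by (simp_all add: Leb_def Gau_def)

lemma measurable_RborelD: "f \<in> M \<rightarrow>\<^sub>M Rborel d \<Longrightarrow> f \<in> borel_measurable M"
  by (simp add: measurable_restrict_space2_iff)

lemma measurable_RborelI:
  "f \<in> borel_measurable M \<Longrightarrow> (\<And>x. x \<in> space M \<Longrightarrow> f x \<in> Rspace d) \<Longrightarrow> f \<in> M \<rightarrow>\<^sub>M Rborel d"
  by (rule measurable_restrict_space2) auto

lemma measurable_on_Rborel:
  "f \<in> borel_measurable borel \<Longrightarrow> f \<in> borel_measurable (Rborel d)"
  by (rule measurable_restrict_space1)

lemma id_Rborel [measurable]: "(\<lambda>x. x) \<in> borel_measurable (Rborel d)"
  by (rule measurable_restrict_space1) simp

lemma coord_borel [measurable]: "(\<lambda>x. coord x i) \<in> borel_measurable borel"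
  using bounded_linear_coord by (intro borel_measurable_continuous_onI linear_continuous_on)

lemma embed_measurable:
  assumes "\<And>i. i < d \<Longrightarrow> (\<lambda>x. f x i) \<in> borel_measurable M"
  shows "(\<lambda>x. embed d (f x)) \<in> M \<rightarrow>\<^sub>M Rborel d"
proof (rule measurable_RborelI)
  show "(\<lambda>x. embed d (f x)) \<in> borel_measurable M"
    unfolding embed_eq_sum using assms by (intro borel_measurable_sum borel_measurable_scaleR) auto
qed simp

lemma embed_PiM [measurable]:
  "embed d \<in> PiM {..<d} (\<lambda>_. lborel) \<rightarrow>\<^sub>M Rborel d"
  "embed d \<in> PiM {..<d} (\<lambda>_. std_normal_distribution) \<rightarrow>\<^sub>M Rborel d"
proof -
  show "embed d \<in> PiM {..<d} (\<lambda>_. lborel) \<rightarrow>\<^sub>M Rborel d"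
    using embed_measurable[of d "\<lambda>x. x" "PiM {..<d} (\<lambda>_. lborel)"]
      measurable_component_singleton[of _ "{..<d}" "\<lambda>_. lborel :: real measure"] by (simp add: eta_contract_eq)
  show "embed d \<in> PiM {..<d} (\<lambda>_. std_normal_distribution) \<rightarrow>\<^sub>M Rborel d"
    using embed_measurable[of d "\<lambda>x. x" "PiM {..<d} (\<lambda>_. std_normal_distribution)"]
      measurable_component_singleton[of _ "{..<d}" "\<lambda>_. std_normal_distribution"] by (simp add: eta_contract_eq)
qed

text \<open>The coordinate map inverts the embedding, so its image measure is the product measure, whose
  \<open>\<sigma>\<close>-finiteness can be pulled back.\<close>

lemma sigma_finite_Leb: "sigma_finite_measure (Leb d)"
proof -
  let ?P = "PiM {..<d} (\<lambda>_. lborel :: real measure)"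
  let ?r = "\<lambda>x. restrict (coord x) {..<d}"
  interpret product_sigma_finite "\<lambda>_::nat. lborel :: real measure" by standard
  have r: "?r \<in> Leb d \<rightarrow>\<^sub>M ?P"
    by (rule measurable_restrict) (auto intro!: measurable_restrict_space1 simp: Leb_def)
  have "distr (Leb d) ?P ?r = distr ?P ?P (\<lambda>f. ?r (embed d f))"
    unfolding Leb_def using r by (subst distr_distr) (auto simp: comp_def Leb_def)
  also have "\<dots> = distr ?P ?P (\<lambda>f. f)"
    by (rule distr_cong) (auto simp: coord_embed space_PiM restrict_def PiE_def extensional_def fun_eq_iff)
  also have "\<dots> = ?P" by simp
  finally have "distr (Leb d) ?P ?r = ?P" .
  then show ?thesis using r sigma_finite[of "{..<d}"]
    by (intro sigma_finite_measure_distr[of "Leb d" ?P ?r]) auto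
qed

interpretation Leb: sigma_finite_measure "Leb d" for d by (rule sigma_finite_Leb)

lemma prob_space_std_normal: "prob_space std_normal_distribution"
  by (rule prob_space_normal_density) simp

lemma prob_space_Gau: "prob_space (Gau d)"
  unfolding Gau_def by (intro prob_space.prob_space_distr prob_space_PiM prob_space_std_normal embed_PiM)

interpretation Gau: prob_space "Gau d" for d by (rule prob_space_Gau)

lemma lebesgue_config_eq: "lebesgue_config n d = PiM {..<n} (\<lambda>_. Leb d)"
  by (simp add: lebesgue_config_def iid_measure_def Leb_def)

lemma gauss_config_eq: "gauss_config n d = PiM {..<n} (\<lambda>_. Gau d)"
  by (simp add: gauss_config_def iid_measure_def Gau_def)

lemma product_sigma_finite_Leb: "product_sigma_finite (\<lambda>_::nat. Leb d)"
  by standard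

lemma prob_space_gauss_config: "prob_space (gauss_config n d)"
  unfolding gauss_config_eq by (intro prob_space_PiM prob_space_Gau)

lemma sigma_finite_lebesgue_config: "sigma_finite_measure (lebesgue_config n d)"
  unfolding lebesgue_config_eq by (intro product_sigma_finite.sigma_finite product_sigma_finite_Leb) simp

lemma PiM_density:
  assumes I: "finite I" and M: "sigma_finite_measure M" and f: "f \<in> borel_measurable M"
    and D: "sigma_finite_measure (density M f)"
  shows "PiM I (\<lambda>_. density M f) = density (PiM I (\<lambda>_. M)) (\<lambda>x. \<Prod>i\<in>I. f (x i))"
proof -
  interpret M: product_sigma_finite "\<lambda>_. M" using M by (simp add: product_sigma_finite_def)
  interpret D: product_sigma_finite "\<lambda>_. density M f" using D by (simp add: product_sigma_finite_def)
  note f[measurable]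
  show ?thesis
  proof (rule D.PiM_eqI[OF I, symmetric])
    show "sets (density (PiM I (\<lambda>_. M)) (\<lambda>x. \<Prod>i\<in>I. f (x i))) = sets (PiM I (\<lambda>_. density M f))"
      by (simp cong: sets_PiM_cong)
    fix A assume A: "\<And>i. i \<in> I \<Longrightarrow> A i \<in> sets (density M f)"
    then have A'[measurable]: "\<And>i. i \<in> I \<Longrightarrow> A i \<in> sets M" by simp
    have "emeasure (density (PiM I (\<lambda>_. M)) (\<lambda>x. \<Prod>i\<in>I. f (x i))) (Pi\<^sub>E I A)
       = (\<integral>\<^sup>+x. (\<Prod>i\<in>I. f (x i)) * indicator (Pi\<^sub>E I A) x \<partial>PiM I (\<lambda>_. M))"
      using A' I by (intro emeasure_density) (auto intro!: sets_PiM_I_finite)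
    also have "\<dots> = (\<integral>\<^sup>+x. (\<Prod>i\<in>I. f (x i) * indicator (A i) (x i)) \<partial>PiM I (\<lambda>_. M))"
    proof (rule nn_integral_cong)
      fix x assume "x \<in> space (PiM I (\<lambda>_. M))"
      then have x: "x \<in> extensional I" by (auto simp: space_PiM PiE_def)
      have "indicator (Pi\<^sub>E I A) x = (\<Prod>i\<in>I. indicator (A i) (x i) :: ennreal)"
      proof (cases "x \<in> Pi\<^sub>E I A")
        case True then show ?thesis by (auto simp: PiE_iff)
      next
        case False
        then obtain i where "i \<in> I" "x i \<notin> A i" using x by (auto simp: PiE_iff)
        then show ?thesis using False I by (auto simp: prod_zero_iff intro!: bexI[of _ i])
      qed
      then show "(\<Prod>i\<in>I. f (x i)) * indicator (Pi\<^sub>E I A) x = (\<Prod>i\<in>I. f (x i) * indicator (A i) (x i))"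
        by (simp add: prod.distrib)
    qed
    also have "\<dots> = (\<Prod>i\<in>I. \<integral>\<^sup>+x. f x * indicator (A i) x \<partial>M)"
      using A' I by (intro M.product_nn_integral_prod) auto
    also have "\<dots> = (\<Prod>i\<in>I. emeasure (density M f) (A i))"
      using A' by (intro prod.cong) (auto simp: emeasure_density)
    finally show "emeasure (density (PiM I (\<lambda>_. M)) (\<lambda>x. \<Prod>i\<in>I. f (x i))) (Pi\<^sub>E I A)
       = (\<Prod>i\<in>I. emeasure (density M f) (A i))" .
  qed
qed

lemma distr_PiM_maps:
  assumes I: "finite I" and M: "sigma_finite_measure M" and N: "sigma_finite_measure N"
    and t[measurable]: "\<And>i. i \<in> I \<Longrightarrow> t i \<in> M \<rightarrow>\<^sub>M N" and eq: "\<And>i. i \<in> I \<Longrightarrow> distr M N (t i) = N"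
  shows "distr (PiM I (\<lambda>_. M)) (PiM I (\<lambda>_. N)) (\<lambda>x. \<lambda>i\<in>I. t i (x i)) = PiM I (\<lambda>_. N)"
proof -
  interpret M: product_sigma_finite "\<lambda>_. M" using M by (simp add: product_sigma_finite_def)
  interpret N: product_sigma_finite "\<lambda>_. N" using N by (simp add: product_sigma_finite_def)
  have m[measurable]: "(\<lambda>x. \<lambda>i\<in>I. t i (x i)) \<in> PiM I (\<lambda>_. M) \<rightarrow>\<^sub>M PiM I (\<lambda>_. N)"
    by (rule measurable_restrict) auto
  show ?thesis
  proof (rule N.PiM_eqI[OF I])
    fix A assume A[measurable]: "\<And>i. i \<in> I \<Longrightarrow> A i \<in> sets N"
    have "emeasure (distr (PiM I (\<lambda>_. M)) (PiM I (\<lambda>_. N)) (\<lambda>x. \<lambda>i\<in>I. t i (x i))) (Pi\<^sub>E I A)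
        = emeasure (PiM I (\<lambda>_. M)) ((\<lambda>x. \<lambda>i\<in>I. t i (x i)) -` Pi\<^sub>E I A \<inter> space (PiM I (\<lambda>_. M)))"
      using I by (intro emeasure_distr m sets_PiM_I_finite A)
    also have "(\<lambda>x. \<lambda>i\<in>I. t i (x i)) -` Pi\<^sub>E I A \<inter> space (PiM I (\<lambda>_. M)) = (\<Pi>\<^sub>E i\<in>I. t i -` A i \<inter> space M)"
      by (auto simp: space_PiM PiE_iff)
    also have "emeasure (PiM I (\<lambda>_. M)) \<dots> = (\<Prod>i\<in>I. emeasure M (t i -` A i \<inter> space M))"
      by (intro M.emeasure_PiM I measurable_sets[OF t A])
    also have "\<dots> = (\<Prod>i\<in>I. emeasure N (A i))"
      using eq by (intro prod.cong refl) (metis A emeasure_distr t)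
    finally show "emeasure (distr (PiM I (\<lambda>_. M)) (PiM I (\<lambda>_. N)) (\<lambda>x. \<lambda>i\<in>I. t i (x i))) (Pi\<^sub>E I A)
        = (\<Prod>i\<in>I. emeasure N (A i))" .
  qed simp
qed

section \<open>Gaussian densities\<close>

definition gdens :: "nat \<Rightarrow> ell2 \<Rightarrow> real"
  where "gdens d x = (1 / sqrt (2 * pi)) ^ d * exp (- (norm x)\<^sup>2 / 2)"

lemma gdens_pos: "gdens d x > 0" by (simp add: gdens_def)

lemma gdens_borel [measurable]: "gdens d \<in> borel_measurable borel"
  unfolding gdens_def by measurable

lemma Gau_density: "Gau d = density (Leb d) (\<lambda>x. ennreal (gdens d x))"
proof -
  let ?P = "PiM {..<d} (\<lambda>_. lborel :: real measure)"
  have "PiM {..<d} (\<lambda>_. std_normal_distribution)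
     = density ?P (\<lambda>f. \<Prod>i\<in>{..<d}. ennreal (std_normal_density (f i)))"
    by (rule PiM_density)
       (auto intro: lborel.sigma_finite_measure_axioms prob_space_imp_sigma_finite prob_space_std_normal)
  also have "\<dots> = density ?P (\<lambda>f. ennreal (gdens d (embed d f)))"
  proof (intro density_cong AE_I2)
    fix f
    have "(\<Prod>i\<in>{..<d}. std_normal_density (f i)) = gdens d (embed d f)"
      unfolding std_normal_density_def prod.distrib gdens_def
      by (simp add: norm_Rspace[of _ d] coord_embed sum_nonneg exp_sum[symmetric] sum_negf sum_divide_distrib)
    then show "(\<Prod>i\<in>{..<d}. ennreal (std_normal_density (f i))) = ennreal (gdens d (embed d f))"
      by (subst prod_ennreal) auto
  qed (auto intro!: measurable_compose[OF embed_PiM(1)] measurable_compose[OF measurable_component_singleton])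
  finally show ?thesis unfolding Gau_def Leb_def
    by (subst density_distr) auto
qed

lemma gauss_config_density:
  "gauss_config n d = density (lebesgue_config n d) (\<lambda>v. \<Prod>i\<in>{..<n}. ennreal (gdens d (v i)))"
  unfolding gauss_config_eq lebesgue_config_eq Gau_density
  by (rule PiM_density)
     (auto simp: Gau_density[symmetric] intro: sigma_finite_Leb prob_space_imp_sigma_finite prob_space_Gau)

section \<open>Translations and reflections\<close>

lemma PiM_lborel_translate:
  assumes "finite I"
  shows "distr (PiM I (\<lambda>_. lborel :: real measure)) (PiM I (\<lambda>_. lborel)) (\<lambda>x. \<lambda>i\<in>I. c i + x i) = PiM I (\<lambda>_. lborel)"
proof (rule distr_PiM_maps[OF assms])
  show "distr lborel lborel (\<lambda>x. c i + x) = lborel" for i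
    using lborel_distr_plus[of "c i"] by (simp cong: distr_cong)
qed (auto intro: lborel.sigma_finite_measure_axioms)

lemma Leb_translate:
  assumes a: "a \<in> Rspace d" shows "distr (Leb d) (Leb d) (\<lambda>x. x + a) = Leb d"
proof -
  let ?P = "PiM {..<d} (\<lambda>_. lborel :: real measure)"
  have m[measurable]: "(\<lambda>x. x + a) \<in> Rborel d \<rightarrow>\<^sub>M Rborel d"
    using a by (intro measurable_RborelI borel_measurable_add id_Rborel) auto
  have m2[measurable]: "(\<lambda>f. \<lambda>i\<in>{..<d}. coord a i + f i) \<in> ?P \<rightarrow>\<^sub>M ?P" by (rule measurable_restrict) simp
  have "distr (Leb d) (Leb d) (\<lambda>x. x + a) = distr (Leb d) (Rborel d) (\<lambda>x. x + a)"
    by (rule distr_cong) auto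
  also have "\<dots> = distr ?P (Rborel d) (\<lambda>f. embed d f + a)"
    unfolding Leb_def by (subst distr_distr) (auto simp: comp_def)
  also have "\<dots> = distr ?P (Rborel d) (\<lambda>f. embed d (\<lambda>i\<in>{..<d}. coord a i + f i))"
    using a by (intro distr_cong) (auto intro!: ell2_eqI simp: coord_embed coord_simps Rspace_def)
  also have "\<dots> = distr (distr ?P ?P (\<lambda>f. \<lambda>i\<in>{..<d}. coord a i + f i)) (Rborel d) (embed d)"
    by (subst distr_distr) (auto simp: comp_def)
  also have "\<dots> = Leb d" by (simp add: PiM_lborel_translate Leb_def)
  finally show ?thesis .
qed

lemma nn_integral_Leb_translate:
  assumes a: "a \<in> Rspace d" and g: "g \<in> borel_measurable (Rborel d)"
  shows "(\<integral>\<^sup>+x. g (x + a) \<partial>Leb d) = (\<integral>\<^sup>+x. g x \<partial>Leb d)"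
proof -
  have "(\<lambda>x. x + a) \<in> Leb d \<rightarrow>\<^sub>M Leb d"
    using a by (subst measurable_cong_sets[OF sets_Leb sets_Leb])
      (intro measurable_RborelI borel_measurable_add id_Rborel, auto)
  then have "(\<integral>\<^sup>+x. g x \<partial>distr (Leb d) (Leb d) (\<lambda>x. x + a)) = (\<integral>\<^sup>+x. g (x + a) \<partial>Leb d)"
    using g by (intro nn_integral_distr) (auto cong: measurable_cong_sets)
  then show ?thesis using Leb_translate[OF a] by simp
qed

text \<open>The Householder reflection at the hyperplane orthogonal to the unit vector \<open>e\<close>.\<close>

definition reflect :: "ell2 \<Rightarrow> ell2 \<Rightarrow> ell2"
  where "reflect e x = x - (2 * inner x e) *\<^sub>R e"

text \<open>Some entry \<open>c k\<close> of the unit vector is nonzero, so the coordinate \<open>k\<close> can be replaced by the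
  inner product \<open>s\<close> with \<open>c\<close>, which changes Lebesgue measure by a constant factor. In the new
  coordinates the reflection replaces \<open>s\<close> by \<open>- s\<close> and translates the others by a vector that
  depends on \<open>s\<close> only, and both maps preserve Lebesgue measure.\<close>

lemma PiM_reflect:
  fixes c :: "nat \<Rightarrow> real"
  assumes c: "(\<Sum>i<d. (c i)\<^sup>2) = 1" and G: "G \<in> borel_measurable (PiM {..<d} (\<lambda>_. lborel))"
  shows "(\<integral>\<^sup>+y. G (\<lambda>i\<in>{..<d}. y i - 2 * (\<Sum>j<d. c j * y j) * c i) \<partial>PiM {..<d} (\<lambda>_. lborel))
       = (\<integral>\<^sup>+y. G y \<partial>PiM {..<d} (\<lambda>_. lborel))"
proof -
  interpret product_sigma_finite "\<lambda>_::nat. lborel :: real measure" by standard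
  \<comment> \<open>A coordinate along which the reflecting hyperplane is a graph.\<close>
  obtain k where k: "k < d" "c k \<noteq> 0"
  proof (rule ccontr)
    assume "\<not> thesis" then have "\<And>i. i < d \<Longrightarrow> c i = 0" using that by blast
    then have "(\<Sum>i<d. (c i)\<^sup>2) = 0" by simp
    then show False using c by simp
  qed
  define I where "I = {..<d} - {k}"
  have I: "insert k I = {..<d}" "k \<notin> I" "finite I" using k by (auto simp: I_def)
  let ?P = "PiM I (\<lambda>_. lborel :: real measure)"
  note G' = G[folded I(1)]
  define \<sigma> where "\<sigma> x = (\<Sum>i\<in>I. c i * x i)" for x :: "nat \<Rightarrow> real"
  define pt where "pt x s = x(k := - (\<sigma> x / c k) + 1 / c k * s)" for x :: "nat \<Rightarrow> real" and s
  define R where "R y = (\<lambda>i\<in>{..<d}. y i - 2 * (\<Sum>j<d. c j * y j) * c i)" for y :: "nat \<Rightarrow> real"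
  have sum_split: "(\<Sum>j<d. f j) = f k + (\<Sum>j\<in>I. f j)" for f :: "nat \<Rightarrow> real"
    using I by (metis sum.insert)
  have Rm: "R \<in> PiM (insert k I) (\<lambda>_. lborel) \<rightarrow>\<^sub>M PiM (insert k I) (\<lambda>_. lborel)"
    unfolding R_def I(1) by (rule measurable_restrict) measurable
  have \<sigma>m[measurable]: "\<sigma> \<in> borel_measurable ?P" unfolding \<sigma>_def by measurable
  have ptm: "(\<lambda>(x, s). pt x s) \<in> ?P \<Otimes>\<^sub>M lborel \<rightarrow>\<^sub>M PiM (insert k I) (\<lambda>_. lborel)"
    unfolding pt_def case_prod_beta by (rule measurable_fun_upd[where J=I]) (use I in auto)
  \<comment> \<open>Integration over the last coordinate in terms of the inner product with the unit vector.\<close>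
  have disint: "(\<integral>\<^sup>+y. F y \<partial>PiM (insert k I) (\<lambda>_. lborel)) = (\<integral>\<^sup>+x. (\<integral>\<^sup>+s. F (pt x s) \<partial>lborel) \<partial>?P) * ennreal \<bar>1 / c k\<bar>"
    if F: "F \<in> borel_measurable (PiM (insert k I) (\<lambda>_. lborel))" for F
  proof -
    have Fm: "(\<lambda>(x, s). F (pt x s)) \<in> borel_measurable (?P \<Otimes>\<^sub>M lborel)"
      using measurable_compose[OF ptm F] by (simp add: case_prod_beta)
    have "(\<integral>\<^sup>+y. F y \<partial>PiM (insert k I) (\<lambda>_. lborel)) = (\<integral>\<^sup>+x. (\<integral>\<^sup>+y. F (x(k := y)) \<partial>lborel) \<partial>?P)"
      using I by (intro product_nn_integral_insert F) auto
    also have "\<dots> = (\<integral>\<^sup>+x. (\<integral>\<^sup>+s. F (pt x s) \<partial>lborel) * ennreal \<bar>1 / c k\<bar> \<partial>?P)"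
    proof (rule nn_integral_cong)
      fix x assume x: "x \<in> space ?P"
      have "(\<lambda>y. F (x(k := y))) \<in> borel_measurable borel"
        using measurable_compose[OF measurable_fun_upd[where J=I and I="insert k I" and i=k and f="\<lambda>_. x" and h="\<lambda>y. y" and N="lborel" and M="\<lambda>_. lborel"] F] I x
        by simp
      from nn_integral_real_affine[OF this, of "1 / c k" "- (\<sigma> x / c k)"] k
      show "(\<integral>\<^sup>+y. F (x(k := y)) \<partial>lborel) = (\<integral>\<^sup>+s. F (pt x s) \<partial>lborel) * ennreal \<bar>1 / c k\<bar>"
        by (simp add: pt_def mult.commute)
    qed
    also have "\<dots> = (\<integral>\<^sup>+x. (\<integral>\<^sup>+s. F (pt x s) \<partial>lborel) \<partial>?P) * ennreal \<bar>1 / c k\<bar>"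
      using Fm by (intro nn_integral_multc lborel.borel_measurable_nn_integral)
    finally show ?thesis .
  qed
  have refl: "R (pt x s) = pt (\<lambda>i\<in>I. - (2 * s * c i) + x i) (- s)" if x: "x \<in> space ?P" for x s
  proof -
    have s: "(\<Sum>j<d. c j * pt x s j) = s"
    proof -
      have "(\<Sum>j\<in>I. c j * pt x s j) = \<sigma> x" unfolding \<sigma>_def pt_def using I by (intro sum.cong) auto
      moreover have "c k * pt x s k = s - \<sigma> x" using k by (simp add: pt_def field_simps)
      ultimately show ?thesis by (simp add: sum_split)
    qed
    have "R (pt x s) i = pt (\<lambda>i\<in>I. - (2 * s * c i) + x i) (- s) i" for i
    proof (cases "i = k")
      case True
      have "(\<Sum>j\<in>I. c j * (- (2 * s * c j) + x j)) = \<sigma> x - 2 * s * (\<Sum>j\<in>I. (c j)\<^sup>2)"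
        by (simp add: \<sigma>_def algebra_simps sum.distrib sum_subtractf sum_distrib_left power2_eq_square)
      also have "(\<Sum>j\<in>I. (c j)\<^sup>2) = 1 - (c k)\<^sup>2" using c sum_split[of "\<lambda>i. (c i)\<^sup>2"] by simp
      finally have *: "\<sigma> (\<lambda>i\<in>I. - (2 * s * c i) + x i) = \<sigma> x - 2 * s * (1 - (c k)\<^sup>2)"
        by (simp add: \<sigma>_def)
      have "R (pt x s) k = pt x s k - 2 * s * c k" using k by (simp add: R_def s)
      also have "\<dots> = pt (\<lambda>i\<in>I. - (2 * s * c i) + x i) (- s) k"
        unfolding pt_def fun_upd_same * using k(2) by (simp add: field_simps power2_eq_square)
      finally show ?thesis using True by simp
    next
      case False
      show ?thesis
      proof (cases "i \<in> I")
        case True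
        then have "i < d" using I by auto
        then have "R (pt x s) i = pt x s i - 2 * s * c i" by (simp add: R_def s)
        then show ?thesis using True False by (simp add: pt_def)
      next
        case False': False
        then have "\<not> i < d" using I False by auto
        then show ?thesis using False False' by (simp add: R_def pt_def)
      qed
    qed
    then show ?thesis by (rule ext)
  qed
  have mH: "(\<lambda>(x, s). G (pt x (- s))) \<in> borel_measurable (?P \<Otimes>\<^sub>M lborel)"
  proof -
    have "(\<lambda>(x, s). (x, - s)) \<in> ?P \<Otimes>\<^sub>M lborel \<rightarrow>\<^sub>M ?P \<Otimes>\<^sub>M (lborel :: real measure)" by measurable
    from measurable_compose[OF measurable_compose[OF this ptm] G'] show ?thesis by (simp add: case_prod_beta)
  qed
  have mT: "(\<lambda>(x, s). G (R (pt x s))) \<in> borel_measurable (?P \<Otimes>\<^sub>M lborel)"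
    using measurable_compose[OF measurable_compose[OF ptm Rm] G'] by (simp add: case_prod_beta)
  interpret PS: pair_sigma_finite ?P "lborel :: real measure"
    using sigma_finite[OF I(3)] by (simp add: pair_sigma_finite_def lborel.sigma_finite_measure_axioms)
  have "(\<integral>\<^sup>+x. (\<integral>\<^sup>+s. G (R (pt x s)) \<partial>lborel) \<partial>?P) = (\<integral>\<^sup>+s. (\<integral>\<^sup>+x. G (R (pt x s)) \<partial>?P) \<partial>lborel)"
    by (rule PS.Fubini'[OF mT, symmetric])
  also have "\<dots> = (\<integral>\<^sup>+s. (\<integral>\<^sup>+x. G (pt (\<lambda>i\<in>I. - (2 * s * c i) + x i) (- s)) \<partial>?P) \<partial>lborel)"
    by (intro nn_integral_cong) (simp add: refl)
  also have "\<dots> = (\<integral>\<^sup>+s. (\<integral>\<^sup>+x. G (pt x (- s)) \<partial>?P) \<partial>lborel)"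
  proof (rule nn_integral_cong)
    fix s :: real
    let ?t = "\<lambda>x. \<lambda>i\<in>I. - (2 * s * c i) + x i"
    have "(\<lambda>x. G (pt x (- s))) \<in> borel_measurable ?P"
      using measurable_Pair1[OF mH, of s] by simp
    then have "(\<integral>\<^sup>+x. G (pt x (- s)) \<partial>distr ?P ?P ?t) = (\<integral>\<^sup>+x. G (pt (?t x) (- s)) \<partial>?P)"
      by (intro nn_integral_distr measurable_restrict) auto
    then show "(\<integral>\<^sup>+x. G (pt (?t x) (- s)) \<partial>?P) = (\<integral>\<^sup>+x. G (pt x (- s)) \<partial>?P)"
      using PiM_lborel_translate[OF I(3), of "\<lambda>i. - (2 * s * c i)"] by simp
  qed
  also have "\<dots> = (\<integral>\<^sup>+x. (\<integral>\<^sup>+s. G (pt x (- s)) \<partial>lborel) \<partial>?P)"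
    by (rule PS.Fubini'[OF mH])
  also have "\<dots> = (\<integral>\<^sup>+x. (\<integral>\<^sup>+s. G (pt x s) \<partial>lborel) \<partial>?P)"
  proof (rule nn_integral_cong)
    fix x assume x: "x \<in> space ?P"
    have "(\<lambda>(x, s). G (pt x s)) \<in> borel_measurable (?P \<Otimes>\<^sub>M lborel)"
      using measurable_compose[OF ptm G'] by (simp add: case_prod_beta)
    from measurable_Pair2[OF this x] have "(\<lambda>s. G (pt x s)) \<in> borel_measurable borel" by simp
    from nn_integral_real_affine[OF this, of "-1" 0]
    show "(\<integral>\<^sup>+s. G (pt x (- s)) \<partial>lborel) = (\<integral>\<^sup>+s. G (pt x s) \<partial>lborel)" by simp
  qed
  finally have "(\<integral>\<^sup>+y. G (R y) \<partial>PiM (insert k I) (\<lambda>_. lborel)) = (\<integral>\<^sup>+y. G y \<partial>PiM (insert k I) (\<lambda>_. lborel))"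
    using disint[OF measurable_compose[OF Rm G']] disint[OF G'] by simp
  then show ?thesis unfolding I(1) R_def .
qed

lemma inner_reflect: "norm e = 1 \<Longrightarrow> inner (reflect e x) (reflect e y) = inner x y"
  by (simp add: reflect_def inner_diff_left inner_diff_right inner_commute norm_eq_1 algebra_simps)

lemma norm_reflect: "norm e = 1 \<Longrightarrow> norm (reflect e x) = norm x"
  by (simp add: norm_eq_sqrt_inner inner_reflect norm_eq_1)

lemma reflect_reflect: "norm e = 1 \<Longrightarrow> reflect e (reflect e x) = x"
  by (simp add: reflect_def inner_diff_left norm_eq_1 algebra_simps scaleR_add_left[symmetric])

lemma reflect_add: "reflect e (x + y) = reflect e x + reflect e y"
  by (simp add: reflect_def inner_add_left algebra_simps)

lemma reflect_measurable: "e \<in> Rspace d \<Longrightarrow> reflect e \<in> Rborel d \<rightarrow>\<^sub>M Rborel d"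
  unfolding reflect_def
  by (intro measurable_RborelI borel_measurable_diff borel_measurable_scaleR borel_measurable_times
      borel_measurable_inner id_Rborel) auto

lemma nn_integral_Leb_reflect:
  assumes e: "e \<in> Rspace d" "norm e = 1" and g: "g \<in> borel_measurable (Rborel d)"
  shows "(\<integral>\<^sup>+x. g (reflect e x) \<partial>Leb d) = (\<integral>\<^sup>+x. g x \<partial>Leb d)"
proof -
  let ?P = "PiM {..<d} (\<lambda>_. lborel :: real measure)"
  have "(\<Sum>i<d. (coord e i)\<^sup>2) = 1" using e norm_Rspace[OF e(1)] by simp
  moreover have "(\<lambda>y. g (embed d y)) \<in> borel_measurable ?P" by (rule measurable_compose[OF embed_PiM(1) g])
  ultimately have "(\<integral>\<^sup>+y. g (embed d (\<lambda>i\<in>{..<d}. y i - 2 * (\<Sum>j<d. coord e j * y j) * coord e i)) \<partial>?P)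
      = (\<integral>\<^sup>+y. g (embed d y) \<partial>?P)"
    by (rule PiM_reflect)
  moreover have "embed d (\<lambda>i\<in>{..<d}. y i - 2 * (\<Sum>j<d. coord e j * y j) * coord e i) = reflect e (embed d y)" for y
  proof -
    have "inner (embed d y) e = (\<Sum>j<d. coord e j * y j)"
      by (simp add: inner_Rspace[of _ d] coord_embed mult.commute)
    then show ?thesis using e
      by (intro ell2_eqI) (auto simp: reflect_def coord_simps coord_embed Rspace_def)
  qed
  ultimately show ?thesis unfolding Leb_def
    by (simp add: nn_integral_distr g measurable_compose[OF reflect_measurable[OF e(1)] g])
qed

section \<open>Symmetry and moments of the Gaussian measure\<close>

lemma nn_integral_Gau: "g \<in> borel_measurable (Rborel d) \<Longrightarrow>
    (\<integral>\<^sup>+x. g x \<partial>Gau d) = (\<integral>\<^sup>+x. ennreal (gdens d x) * g x \<partial>Leb d)"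
  unfolding Gau_density
  by (rule nn_integral_density)
     (use measurable_on_Rborel[OF gdens_borel, of d d] in \<open>simp_all cong: measurable_cong_sets\<close>)

lemma nn_integral_Gau_reflect:
  assumes e: "e \<in> Rspace d" "norm e = 1" and g: "g \<in> borel_measurable (Rborel d)"
  shows "(\<integral>\<^sup>+x. g (reflect e x) \<partial>Gau d) = (\<integral>\<^sup>+x. g x \<partial>Gau d)"
proof -
  have "gdens d (reflect e x) = gdens d x" for x using e by (simp add: gdens_def norm_reflect)
  then have "(\<integral>\<^sup>+x. g (reflect e x) \<partial>Gau d) = (\<integral>\<^sup>+x. ennreal (gdens d (reflect e x)) * g (reflect e x) \<partial>Leb d)"
    using g e by (simp add: nn_integral_Gau measurable_compose[OF reflect_measurable])
  also have "\<dots> = (\<integral>\<^sup>+x. ennreal (gdens d x) * g x \<partial>Leb d)"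
    using g by (intro nn_integral_Leb_reflect[OF e]) measurable
  finally show ?thesis using g by (simp add: nn_integral_Gau)
qed

lemma nn_integral_PiM_component:
  assumes "prob_space M" "i \<in> I" "g \<in> borel_measurable M"
  shows "(\<integral>\<^sup>+x. g (x i) \<partial>PiM I (\<lambda>_. M)) = (\<integral>\<^sup>+x. g x \<partial>M)"
proof -
  have "(\<integral>\<^sup>+x. g x \<partial>M) = (\<integral>\<^sup>+x. g x \<partial>distr (PiM I (\<lambda>_. M)) M (\<lambda>\<omega>. \<omega> i))"
    using distr_PiM_component[of I "\<lambda>_. M" i] assms by simp
  also have "\<dots> = (\<integral>\<^sup>+x. g (x i) \<partial>PiM I (\<lambda>_. M))"
    using assms by (intro nn_integral_distr) auto
  finally show ?thesis by simp
qed

text \<open>Every one-dimensional marginal of the standard normal law is standard normal: a reflection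
  carries the given direction to a coordinate axis.\<close>

lemma distr_Gau_inner:
  assumes e: "e \<in> Rspace d" "norm e = 1"
  shows "distr (Gau d) borel (\<lambda>x. inner x e) = std_normal_distribution"
proof -
  have "d > 0"
  proof (rule ccontr)
    assume "\<not> d > 0" then have "e = 0" using e by (intro ell2_eqI) (auto simp: Rspace_def coord_zero)
    then show False using e by simp
  qed
  let ?b = "basis_vec 0"
  have b: "?b \<in> Rspace d" "norm ?b = 1"
    using \<open>d > 0\<close> by (auto intro: basis_vec_in_Rspace simp: norm_eq_sqrt_inner inner_basis_vec coord_basis_vec)
  have axis: "(\<integral>\<^sup>+x. g (inner x ?b) \<partial>Gau d) = (\<integral>\<^sup>+u. g u \<partial>std_normal_distribution)"
    if g: "g \<in> borel_measurable borel" for g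
  proof -
    have "(\<integral>\<^sup>+x. g (inner x ?b) \<partial>Gau d) = (\<integral>\<^sup>+f. g (f 0) \<partial>PiM {..<d} (\<lambda>_. std_normal_distribution))"
      unfolding Gau_def using \<open>d > 0\<close> g
      by (subst nn_integral_distr) (auto intro!: measurable_on_Rborel measurable_compose[OF _ g] nn_integral_cong simp: inner_basis_vec coord_embed)
    also have "\<dots> = (\<integral>\<^sup>+u. g u \<partial>std_normal_distribution)"
      using \<open>d > 0\<close> g by (intro nn_integral_PiM_component prob_space_std_normal) auto
    finally show ?thesis .
  qed
  have gen: "(\<integral>\<^sup>+x. g (inner x e) \<partial>Gau d) = (\<integral>\<^sup>+u. g u \<partial>std_normal_distribution)"
    if g: "g \<in> borel_measurable borel" for g
  proof (cases "e = ?b")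
    case True then show ?thesis using axis[OF g] by simp
  next
    case False
    define w where "w = sgn (e - ?b)"
    have w: "w \<in> Rspace d" "norm w = 1" using False e b by (auto simp: w_def sgn_div_norm norm_sgn)
    have "reflect w e = ?b"
    proof -
      have "(norm (e - ?b))\<^sup>2 = 2 * inner e (e - ?b)"
        using e b by (simp add: power2_norm_eq_inner inner_diff_left inner_diff_right inner_commute norm_eq_1)
      moreover have "inner e w = inner e (e - ?b) / norm (e - ?b)"
        by (simp add: w_def sgn_div_norm divide_inverse mult.commute)
      ultimately have "norm (e - ?b) * norm (e - ?b) = (2 * inner e w) * norm (e - ?b)"
        using False by (simp add: field_simps power2_eq_square)
      then have "norm (e - ?b) = 2 * inner e w" using False by simp
      then have "2 * inner e w * inverse (norm (e - ?b)) = 1"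
        using False by (metis norm_eq_zero right_inverse right_minus_eq)
      moreover have "(2 * inner e w) *\<^sub>R w = (2 * inner e w * inverse (norm (e - ?b))) *\<^sub>R (e - ?b)"
        by (simp only: w_def sgn_div_norm scaleR_scaleR)
      ultimately have "(2 * inner e w) *\<^sub>R w = e - ?b" by simp
      then show ?thesis by (simp add: reflect_def)
    qed
    then have "inner (reflect w x) e = inner x ?b" for x
      using inner_reflect[OF w(2), of "reflect w x" e] by (simp add: reflect_reflect w)
    moreover have "(\<integral>\<^sup>+x. g (inner x e) \<partial>Gau d) = (\<integral>\<^sup>+x. g (inner (reflect w x) e) \<partial>Gau d)"
      by (rule nn_integral_Gau_reflect[OF w, symmetric]) (intro measurable_on_Rborel measurable_compose[OF _ g], simp)
    ultimately show ?thesis using axis[OF g] by simp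
  qed
  show ?thesis
  proof (rule measure_eqI)
    fix A assume "A \<in> sets (distr (Gau d) borel (\<lambda>x. inner x e))"
    then have A[measurable]: "A \<in> sets borel" by simp
    have "emeasure (distr (Gau d) borel (\<lambda>x. inner x e)) A = (\<integral>\<^sup>+u. indicator A u \<partial>distr (Gau d) borel (\<lambda>x. inner x e))"
      by simp
    also have "\<dots> = (\<integral>\<^sup>+x. indicator A (inner x e) \<partial>Gau d)" by (rule nn_integral_distr) auto
    also have "\<dots> = emeasure std_normal_distribution A" by (simp add: gen)
    finally show "emeasure (distr (Gau d) borel (\<lambda>x. inner x e)) A = emeasure std_normal_distribution A" .
  qed simp
qed

lemma Gau_quadratic:
  assumes e: "e \<in> Rspace d" "norm e = 1"
  shows "integrable (Gau d) (\<lambda>x. (inner x e + c)\<^sup>2)" "(\<integral>x. (inner x e + c)\<^sup>2 \<partial>Gau d) = 1 + c\<^sup>2"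
proof -
  let ?N = "std_normal_distribution"
  interpret N: prob_space ?N by (rule prob_space_std_normal)
  have i: "integrable ?N (\<lambda>u. u ^ 2)" "integrable ?N (\<lambda>u. u)"
    using integrable_std_normal_distribution_moment[of 2] integrable_std_normal_distribution_moment[of 1] by simp_all
  have eq: "(\<lambda>u. (u + c)\<^sup>2) = (\<lambda>u. u ^ 2 + 2 * c * u + c\<^sup>2)" by (auto simp: power2_eq_square algebra_simps)
  have "integrable ?N (\<lambda>u. (u + c)\<^sup>2)" unfolding eq using i by simp
  then show "integrable (Gau d) (\<lambda>x. (inner x e + c)\<^sup>2)"
    using integrable_distr_eq[of "\<lambda>x. inner x e" "Gau d" borel "\<lambda>u. (u + c)\<^sup>2"] distr_Gau_inner[OF e] by simp
  have "(\<integral>x. (inner x e + c)\<^sup>2 \<partial>Gau d) = (\<integral>u. (u + c)\<^sup>2 \<partial>?N)"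
    using integral_distr[of "\<lambda>x. inner x e" "Gau d" borel "\<lambda>u. (u + c)\<^sup>2"] distr_Gau_inner[OF e] by simp
  also have "\<dots> = (\<integral>u. u ^ 2 \<partial>?N) + 2 * c * (\<integral>u. u \<partial>?N) + c\<^sup>2"
    unfolding eq using i N.prob_space by simp
  also have "(\<integral>u. u ^ 2 \<partial>?N) = 1" using std_normal_distribution_even_moments[of 1] by simp
  also have "(\<integral>u. u \<partial>?N) = 0" using integral_std_normal_distribution_moment_odd[of 1] by simp
  finally show "(\<integral>x. (inner x e + c)\<^sup>2 \<partial>Gau d) = 1 + c\<^sup>2" by simp
qed

lemma nn_integral_Gau_quadratic:
  assumes e: "e \<in> Rspace d" "norm e = 1"
  shows "(\<integral>\<^sup>+x. ennreal ((inner x e + c)\<^sup>2) \<partial>Gau d) = ennreal (1 + c\<^sup>2)"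
  using Gau_quadratic[OF e] by (simp add: nn_integral_eq_integral)

lemma Gau_norm_sq: "(\<integral>\<^sup>+x. ennreal ((norm x)\<^sup>2) \<partial>Gau d) = ennreal (real d)"
proof -
  have b: "basis_vec i \<in> Rspace d" "norm (basis_vec i) = 1" if "i < d" for i
    using that by (auto intro: basis_vec_in_Rspace simp: norm_eq_sqrt_inner inner_basis_vec coord_basis_vec)
  have "(\<integral>\<^sup>+x. ennreal ((norm x)\<^sup>2) \<partial>Gau d) = (\<integral>\<^sup>+x. (\<Sum>i<d. ennreal ((inner x (basis_vec i) + 0)\<^sup>2)) \<partial>Gau d)"
    by (intro nn_integral_cong) (auto simp: norm_Rspace inner_basis_vec sum_nonneg)
  also have "\<dots> = (\<Sum>i<d. \<integral>\<^sup>+x. ennreal ((inner x (basis_vec i) + 0)\<^sup>2) \<partial>Gau d)"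
    by (intro nn_integral_sum) measurable
  also have "\<dots> = (\<Sum>i<d. ennreal 1)" using b nn_integral_Gau_quadratic[of _ d 0] by (intro sum.cong) auto
  finally show ?thesis by (simp add: ennreal_of_nat_eq_real_of_nat)
qed

text \<open>Optimising \<open>norm x \<le> (norm x)\<^sup>2 / (2 * s) + s / 2\<close> over \<open>s\<close> gives the Cauchy-Schwarz bound by
  the second moment, with extended nonnegative integrals throughout.\<close>

lemma Gau_norm: assumes "d \<ge> 1" shows "(\<integral>\<^sup>+x. ennreal (norm x) \<partial>Gau d) \<le> ennreal (sqrt (real d))"
proof -
  let ?s = "sqrt (real d)"
  have s: "?s > 0" using assms by simp
  have "norm x \<le> 1 / (2 * ?s) * (norm x)\<^sup>2 + ?s / 2" for x :: ell2
  proof -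
    have "0 \<le> (norm x - ?s)\<^sup>2" by simp
    then have "2 * ?s * norm x \<le> (norm x)\<^sup>2 + ?s\<^sup>2" by (simp add: power2_diff algebra_simps)
    then show ?thesis using s by (simp add: field_simps power2_eq_square)
  qed
  then have "(\<integral>\<^sup>+x. ennreal (norm x) \<partial>Gau d) \<le> (\<integral>\<^sup>+x. ennreal (1 / (2 * ?s)) * ennreal ((norm x)\<^sup>2) + ennreal (?s / 2) \<partial>Gau d)"
    using s by (intro nn_integral_mono) (simp add: ennreal_mult[symmetric] ennreal_plus[symmetric] del: ennreal_plus)
  also have "\<dots> = ennreal (1 / (2 * ?s)) * ennreal (real d) + ennreal (?s / 2)"
    by (subst nn_integral_add) (auto simp: nn_integral_cmult Gau_norm_sq Gau.emeasure_space_1[unfolded space_Gau])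
  also have "\<dots> = ennreal (1 / (2 * ?s) * real d + ?s / 2)"
    using s by (simp add: ennreal_mult[symmetric] ennreal_plus[symmetric] del: ennreal_plus)
  also have "1 / (2 * ?s) * real d + ?s / 2 = ?s"
    using s by (simp add: field_simps real_sqrt_mult_self)
  finally show ?thesis .
qed

lemma gauss_config_sum:
  assumes g[measurable]: "g \<in> borel_measurable (Gau d)"
  shows "(\<integral>\<^sup>+v. (\<Sum>i<n. g (v i)) \<partial>gauss_config n d) = of_nat n * (\<integral>\<^sup>+x. g x \<partial>Gau d)"
proof -
  have "(\<integral>\<^sup>+v. (\<Sum>i<n. g (v i)) \<partial>gauss_config n d) = (\<Sum>i<n. \<integral>\<^sup>+v. g (v i) \<partial>gauss_config n d)"
    unfolding gauss_config_eq by (rule nn_integral_sum) (auto intro: measurable_compose[OF _ g])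
  also have "\<dots> = (\<Sum>i<n. \<integral>\<^sup>+x. g x \<partial>Gau d)"
    unfolding gauss_config_eq by (intro sum.cong nn_integral_PiM_component prob_space_Gau g) auto
  finally show ?thesis by simp
qed

section \<open>The coupling of one velocity pair\<close>

text \<open>The ratio of the standard normal densities at \<open>x + a\<close> and \<open>x\<close>.\<close>

definition accept_prob :: "ell2 \<Rightarrow> ell2 \<Rightarrow> real"
  where "accept_prob a x = exp (- (inner x a + (norm a)\<^sup>2 / 2))"

text \<open>The second component of the noise is uniform on the unit interval and decides about the shift
  by \<open>a\<close>. The case \<open>a = 0\<close> is excluded because the reflection then has no direction.\<close>

definition rejected :: "ell2 \<Rightarrow> ell2 \<times> real \<Rightarrow> bool"
  where "rejected a w \<longleftrightarrow> a \<noteq> 0 \<and> accept_prob a (fst w) < snd w"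

definition partner :: "ell2 \<Rightarrow> ell2 \<times> real \<Rightarrow> ell2"
  where "partner a w = (if rejected a w then reflect (sgn a) (fst w) else fst w + a)"

definition Unif :: "real measure" where "Unif = uniform_measure lborel {0..1}"

definition GU :: "nat \<Rightarrow> (ell2 \<times> real) measure" where "GU d = Gau d \<Otimes>\<^sub>M Unif"

lemma prob_space_Unif: "prob_space Unif"
  unfolding Unif_def by (rule prob_space_uniform_measure) auto

interpretation Unif: prob_space Unif by (rule prob_space_Unif)

lemma sets_Unif [simp, measurable_cong]: "sets Unif = sets borel" by (simp add: Unif_def)

lemma prob_space_GU: "prob_space (GU d)"
  unfolding GU_def by (intro prob_space_pair prob_space_Gau prob_space_Unif)

lemma sets_GU [measurable_cong]: "sets (GU d) = sets (Rborel d \<Otimes>\<^sub>M borel)"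
  unfolding GU_def by (intro sets_pair_measure_cong) auto

lemma space_GU: "space (GU d) = Rspace d \<times> UNIV"
  by (simp add: GU_def space_pair_measure Unif_def)

lemma nn_integral_Unif_threshold:
  assumes "t \<ge> 0"
  shows "(\<integral>\<^sup>+u. (if t < u then b else a) \<partial>Unif) = ennreal (min 1 t) * a + ennreal (1 - min 1 t) * b"
proof -
  have m: "emeasure Unif {t<..} = ennreal (1 - min 1 t)"
  proof -
    have "{0..1} \<inter> {t<..} = (if t < 1 then {t<..1} else {})" using assms by auto
    then show ?thesis unfolding Unif_def by (auto simp: emeasure_uniform_measure divide_ennreal_def)
  qed
  have m': "emeasure Unif {..t} = ennreal (min 1 t)"
  proof -
    have "{0..1} \<inter> {..t} = {0..min 1 t}" by auto
    then show ?thesis unfolding Unif_def using assms by (auto simp: emeasure_uniform_measure divide_ennreal_def)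
  qed
  have "(\<integral>\<^sup>+u. (if t < u then b else a) \<partial>Unif) = (\<integral>\<^sup>+u. a * indicator {..t} u + b * indicator {t<..} u \<partial>Unif)"
    by (intro nn_integral_cong) (auto simp: indicator_def)
  also have "\<dots> = a * emeasure Unif {..t} + b * emeasure Unif {t<..}"
    by (subst nn_integral_add) (auto simp: nn_integral_cmult_indicator)
  finally show ?thesis by (simp add: m m' mult.commute)
qed

lemma nn_integral_GU:
  "f \<in> borel_measurable (GU d) \<Longrightarrow> (\<integral>\<^sup>+w. f w \<partial>GU d) = (\<integral>\<^sup>+x. \<integral>\<^sup>+u. f (x, u) \<partial>Unif \<partial>Gau d)"
  unfolding GU_def by (rule Unif.nn_integral_fst[symmetric])

lemma fst_GU_borel [measurable]: "fst \<in> borel_measurable (GU d)"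
  unfolding GU_def by (rule measurable_compose[OF measurable_fst]) (simp add: id_Rborel cong: measurable_cong_sets)

lemma fst_GU [measurable]: "fst \<in> GU d \<rightarrow>\<^sub>M Rborel d"
  unfolding GU_def using measurable_fst[of "Gau d" Unif] by (simp cong: measurable_cong_sets)

lemma snd_GU [measurable]: "snd \<in> borel_measurable (GU d)"
  unfolding GU_def using measurable_snd[of "Gau d" Unif] by (simp cong: measurable_cong_sets)

lemma partner_measurable_joint:
  assumes [measurable]: "f \<in> borel_measurable M" "g \<in> borel_measurable M" "u \<in> borel_measurable M"
  shows "(\<lambda>z. partner (f z) (g z, u z)) \<in> borel_measurable M"
    and "Measurable.pred M (\<lambda>z. rejected (f z) (g z, u z))"
proof -
  have m: "(\<lambda>z. norm (f z)) \<in> borel_measurable M" "(\<lambda>z. inner (g z) (f z)) \<in> borel_measurable M"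
    by (auto intro!: borel_measurable_norm borel_measurable_inner assms)
  have "(\<lambda>z. exp (- (inner (g z) (f z) + (norm (f z))\<^sup>2 / 2))) \<in> borel_measurable M" using m by measurable
  then show p: "Measurable.pred M (\<lambda>z. rejected (f z) (g z, u z))"
    unfolding rejected_def accept_prob_def fst_conv snd_conv zero_less_norm_iff[symmetric]
    using m assms(3) by measurable
  have "(\<lambda>z. reflect (sgn (f z)) (g z)) \<in> borel_measurable M"
    unfolding reflect_def sgn_div_norm
    by (intro borel_measurable_diff borel_measurable_scaleR borel_measurable_times borel_measurable_inner
        borel_measurable_inverse borel_measurable_const m assms borel_measurable_divide)
  then show "(\<lambda>z. partner (f z) (g z, u z)) \<in> borel_measurable M"
    unfolding partner_def fst_conv
    by (intro measurable_If borel_measurable_add assms p[unfolded pred_def])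
qed

lemma rejected_pred [measurable]: "Measurable.pred (GU d) (rejected a)"
  using partner_measurable_joint(2)[of "\<lambda>_. a" "GU d" fst snd] by simp

lemma partner_in_Rspace: "a \<in> Rspace d \<Longrightarrow> fst w \<in> Rspace d \<Longrightarrow> partner a w \<in> Rspace d"
  by (simp add: partner_def reflect_def sgn_div_norm)

lemma partner_measurable: "a \<in> Rspace d \<Longrightarrow> partner a \<in> GU d \<rightarrow>\<^sub>M Rborel d"
  using partner_measurable_joint(1)[of "\<lambda>_. a" "GU d" fst snd] partner_in_Rspace
  by (intro measurable_RborelI) (auto simp: space_GU)

text \<open>Accepted shifts carry the common part of the two normal densities, and the reflection
  exchanges their excess parts, so the partner is again standard normal.\<close>

lemma distr_partner:
  assumes a: "a \<in> Rspace d" shows "distr (GU d) (Gau d) (partner a) = Gau d"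
proof (rule measure_eqI)
  fix A assume "A \<in> sets (distr (GU d) (Gau d) (partner a))"
  then have A[measurable]: "A \<in> sets (Rborel d)" by simp
  let ?g = "indicator A :: ell2 \<Rightarrow> ennreal"
  have g: "?g \<in> borel_measurable (Rborel d)" by simp
  have pm: "partner a \<in> GU d \<rightarrow>\<^sub>M Gau d" using partner_measurable[OF a] by (simp cong: measurable_cong_sets)
  have gp: "(\<lambda>w. ?g (partner a w)) \<in> borel_measurable (GU d)"
    by (rule measurable_compose[OF partner_measurable[OF a] g])
  have "emeasure (distr (GU d) (Gau d) (partner a)) A = (\<integral>\<^sup>+w. ?g (partner a w) \<partial>GU d)"
    by (subst nn_integral_distr[OF pm, symmetric]) (auto cong: measurable_cong_sets)
  also have "\<dots> = (\<integral>\<^sup>+x. \<integral>\<^sup>+u. ?g (partner a (x, u)) \<partial>Unif \<partial>Gau d)" by (rule nn_integral_GU[OF gp])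
  also have "\<dots> = (\<integral>\<^sup>+x. ?g x \<partial>Gau d)"
  proof (cases "a = 0")
    case True
    then show ?thesis by (simp add: partner_def rejected_def Unif.emeasure_space_1)
  next
    case False
    let ?e = "sgn a"
    have e: "?e \<in> Rspace d" "norm ?e = 1" using a False by (auto simp: sgn_div_norm norm_sgn)
    let ?k = "\<lambda>x. min (gdens d x) (gdens d (x + a))"
    have k: "gdens d x * min 1 (accept_prob a x) = ?k x" for x
    proof -
      have "gdens d (x + a) = gdens d x * accept_prob a x"
        unfolding gdens_def accept_prob_def mult.assoc exp_add[symmetric]
        by (simp add: power2_norm_eq_inner inner_add_left inner_add_right inner_commute field_simps)
      then show ?thesis using gdens_pos[of d x] by (simp add: min_mult_distrib_left)
    qed
    have km: "?k \<in> borel_measurable borel" "(\<lambda>x. ?k (x - a)) \<in> borel_measurable borel"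
        "(\<lambda>x. ?k (reflect ?e x)) \<in> borel_measurable borel"
      unfolding reflect_def by measurable
    note km' = km[THEN measurable_on_Rborel]
    have k1: "0 \<le> ?k x" "?k x \<le> gdens d x" for x using gdens_pos[of d] by (auto simp: less_imp_le)
    have "(\<integral>\<^sup>+u. ?g (partner a (x, u)) \<partial>Unif)
        = ennreal (min 1 (accept_prob a x)) * ?g (x + a) + ennreal (1 - min 1 (accept_prob a x)) * ?g (reflect ?e x)" for x
      unfolding partner_def rejected_def fst_conv snd_conv if_distrib[of ?g]
      using nn_integral_Unif_threshold[of "accept_prob a x" "?g (reflect ?e x)" "?g (x + a)"] False
      by (simp add: accept_prob_def)
    then have "(\<integral>\<^sup>+x. \<integral>\<^sup>+u. ?g (partner a (x, u)) \<partial>Unif \<partial>Gau d)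
        = (\<integral>\<^sup>+x. ennreal (min 1 (accept_prob a x)) * ?g (x + a) + ennreal (1 - min 1 (accept_prob a x)) * ?g (reflect ?e x) \<partial>Gau d)"
      by simp
    also have "\<dots> = (\<integral>\<^sup>+x. ennreal (gdens d x) * (ennreal (min 1 (accept_prob a x)) * ?g (x + a) + ennreal (1 - min 1 (accept_prob a x)) * ?g (reflect ?e x)) \<partial>Leb d)"
    proof (rule nn_integral_Gau)
      have "(\<lambda>x. ?g (x + a)) \<in> borel_measurable (Rborel d)" "(\<lambda>x. ?g (reflect ?e x)) \<in> borel_measurable (Rborel d)"
        using measurable_compose[OF _ g] a reflect_measurable[OF e(1)]
        by (auto intro!: measurable_compose[OF _ g] measurable_RborelI borel_measurable_add id_Rborel)
      moreover have "accept_prob a \<in> borel_measurable (Rborel d)"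
        unfolding accept_prob_def by (intro measurable_on_Rborel) measurable
      ultimately show "(\<lambda>x. ennreal (min 1 (accept_prob a x)) * ?g (x + a) + ennreal (1 - min 1 (accept_prob a x)) * ?g (reflect ?e x)) \<in> borel_measurable (Rborel d)"
        by measurable
    qed
    also have "\<dots> = (\<integral>\<^sup>+x. ennreal (?k x) * ?g (x + a) + ennreal (gdens d x - ?k x) * ?g (reflect ?e x) \<partial>Leb d)"
    proof (rule nn_integral_cong)
      fix x
      have "gdens d x * (1 - min 1 (accept_prob a x)) = gdens d x - ?k x"
        unfolding k[symmetric] by (simp add: algebra_simps)
      then show "ennreal (gdens d x) * (ennreal (min 1 (accept_prob a x)) * ?g (x + a) + ennreal (1 - min 1 (accept_prob a x)) * ?g (reflect ?e x))
          = ennreal (?k x) * ?g (x + a) + ennreal (gdens d x - ?k x) * ?g (reflect ?e x)"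
        using k[of x] gdens_pos[of d x]
        by (simp add: distrib_left mult.assoc[symmetric] ennreal_mult'[symmetric] less_imp_le)
    qed
    also have "\<dots> = (\<integral>\<^sup>+x. ennreal (?k x) * ?g (x + a) \<partial>Leb d) + (\<integral>\<^sup>+x. ennreal (gdens d x - ?k x) * ?g (reflect ?e x) \<partial>Leb d)"
    proof (rule nn_integral_add)
      have "(\<lambda>x. ?g (x + a)) \<in> borel_measurable (Rborel d)" "(\<lambda>x. ?g (reflect ?e x)) \<in> borel_measurable (Rborel d)"
        using a reflect_measurable[OF e(1)]
        by (auto intro!: measurable_compose[OF _ g] measurable_RborelI borel_measurable_add id_Rborel)
      then show "(\<lambda>x. ennreal (?k x) * ?g (x + a)) \<in> borel_measurable (Leb d)"
        "(\<lambda>x. ennreal (gdens d x - ?k x) * ?g (reflect ?e x)) \<in> borel_measurable (Leb d)"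
        by measurable
    qed
    also have "(\<integral>\<^sup>+x. ennreal (?k x) * ?g (x + a) \<partial>Leb d) = (\<integral>\<^sup>+x. ennreal (?k (x - a)) * ?g x \<partial>Leb d)"
      using nn_integral_Leb_translate[OF a, of "\<lambda>x. ennreal (?k (x - a)) * ?g x"] km' by simp
    also have "(\<integral>\<^sup>+x. ennreal (gdens d x - ?k x) * ?g (reflect ?e x) \<partial>Leb d)
        = (\<integral>\<^sup>+x. ennreal (gdens d (reflect ?e x) - ?k (reflect ?e x)) * ?g x \<partial>Leb d)"
      using nn_integral_Leb_reflect[OF e, of "\<lambda>x. ennreal (gdens d (reflect ?e x) - ?k (reflect ?e x)) * ?g x"] km'
        measurable_compose[OF reflect_measurable[OF e(1)] measurable_on_Rborel[OF gdens_borel]] e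
      by (simp add: reflect_reflect)
    also have "(\<integral>\<^sup>+x. ennreal (?k (x - a)) * ?g x \<partial>Leb d)
        + (\<integral>\<^sup>+x. ennreal (gdens d (reflect ?e x) - ?k (reflect ?e x)) * ?g x \<partial>Leb d)
       = (\<integral>\<^sup>+x. ennreal (?k (x - a)) * ?g x + ennreal (gdens d (reflect ?e x) - ?k (reflect ?e x)) * ?g x \<partial>Leb d)"
    proof (rule nn_integral_add[symmetric])
      have G: "(\<lambda>x. gdens d (reflect ?e x)) \<in> borel_measurable (Rborel d)"
        by (rule measurable_compose[OF reflect_measurable[OF e(1)] measurable_on_Rborel[OF gdens_borel]])
      have aux: "(\<lambda>x. ennreal (k x) * ?g x) \<in> borel_measurable (Rborel d)"
        if "k \<in> borel_measurable (Rborel d)" for k using that by measurable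
      show "(\<lambda>x. ennreal (?k (x - a)) * ?g x) \<in> borel_measurable (Leb d)"
        "(\<lambda>x. ennreal (gdens d (reflect ?e x) - ?k (reflect ?e x)) * ?g x) \<in> borel_measurable (Leb d)"
        unfolding measurable_cong_sets[OF sets_Leb refl]
        by (rule aux[OF km'(2)], rule aux[OF borel_measurable_diff[OF G km'(3)]])
    qed
    also have "\<dots> = (\<integral>\<^sup>+x. ennreal (gdens d x) * ?g x \<partial>Leb d)"
    proof (rule nn_integral_cong)
      fix x
      have "reflect ?e a = - a" using False
        by (simp add: reflect_def sgn_div_norm dot_square_norm power2_eq_square field_simps)
           (simp add: scaleR_2[symmetric] del: scaleR_2)
      then have "norm (reflect ?e x + a) = norm (x - a)"
        using norm_reflect[OF e(2), of "reflect ?e x + a"] e(2) by (simp add: reflect_add reflect_reflect)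
      then have "gdens d (reflect ?e x + a) = gdens d (x - a)" "gdens d (reflect ?e x) = gdens d x"
        using e by (simp_all add: gdens_def norm_reflect)
      then have "?k (x - a) + (gdens d (reflect ?e x) - ?k (reflect ?e x)) = gdens d x" by (simp add: min.commute)
      then show "ennreal (?k (x - a)) * ?g x + ennreal (gdens d (reflect ?e x) - ?k (reflect ?e x)) * ?g x = ennreal (gdens d x) * ?g x"
        using k1[of "x - a"] k1[of "reflect ?e x"]
        by (simp add: distrib_right[symmetric] ennreal_plus[symmetric] del: ennreal_plus)
    qed
    also have "\<dots> = (\<integral>\<^sup>+x. ?g x \<partial>Gau d)" by (rule nn_integral_Gau[OF g, symmetric])
    finally show ?thesis .
  qed
  finally show "emeasure (distr (GU d) (Gau d) (partner a)) A = emeasure (Gau d) A" by simp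
qed simp

section \<open>Comparing measures by test functions\<close>

lemma tendsto_fun_componentwise:
  fixes f :: "nat \<Rightarrow> 'a \<Rightarrow> 'b::topological_space"
  assumes "\<And>i. (\<lambda>m. f m i) \<longlonglongrightarrow> l i"
  shows "f \<longlonglongrightarrow> l"
proof -
  have "limitin (product_topology (\<lambda>_. euclidean) UNIV) f l sequentially"
    unfolding limitin_componentwise using assms by auto
  then show ?thesis by (simp add: euclidean_product_topology)
qed

text \<open>Comparing a test function with its complement to one upgrades inequalities to equalities.\<close>

lemma prob_eqI_test_functions:
  fixes M N :: "'a::metric_space measure"
  assumes M: "prob_space M" "sets M = sets borel" and N: "prob_space N" "sets N = sets borel"
    and le: "\<And>\<psi> :: 'a \<Rightarrow> real. continuous_on UNIV \<psi> \<Longrightarrow> (\<And>x. 0 \<le> \<psi> x \<and> \<psi> x \<le> 1) \<Longrightarrow>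
      (\<integral>\<^sup>+x. ennreal (\<psi> x) \<partial>M) \<le> (\<integral>\<^sup>+x. ennreal (\<psi> x) \<partial>N)"
  shows "M = N"
proof -
  interpret M: prob_space M by fact
  interpret N: prob_space N by fact
  have int: "integrable M \<psi>" "integrable N \<psi>" if "continuous_on UNIV \<psi>" "\<And>x. 0 \<le> \<psi> x \<and> \<psi> x \<le> 1" for \<psi> :: "'a \<Rightarrow> real"
    using that M(2) N(2) borel_measurable_continuous_onI[OF that(1)]
    by (auto intro!: M.integrable_const_bound[of _ 1] N.integrable_const_bound[of _ 1] cong: measurable_cong_sets)
  have le': "(\<integral>x. \<psi> x \<partial>M) \<le> (\<integral>x. \<psi> x \<partial>N)" if \<psi>: "continuous_on UNIV \<psi>" "\<And>x. 0 \<le> \<psi> x \<and> \<psi> x \<le> 1" for \<psi> :: "'a \<Rightarrow> real"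
    using le[OF \<psi>] int[OF \<psi>] \<psi>(2) by (simp add: nn_integral_eq_integral integral_nonneg)
  have eq: "(\<integral>x. \<psi> x \<partial>M) = (\<integral>x. \<psi> x \<partial>N)" if \<psi>: "continuous_on UNIV \<psi>" "\<And>x. 0 \<le> \<psi> x \<and> \<psi> x \<le> 1" for \<psi> :: "'a \<Rightarrow> real"
  proof (rule antisym[OF le'[OF \<psi>]])
    have "(\<integral>x. 1 - \<psi> x \<partial>M) \<le> (\<integral>x. 1 - \<psi> x \<partial>N)"
      using \<psi> by (intro le') (auto intro!: continuous_intros)
    then show "(\<integral>x. \<psi> x \<partial>N) \<le> (\<integral>x. \<psi> x \<partial>M)"
      using int[OF \<psi>] M.prob_space N.prob_space by simp
  qed
  have closed_eq: "emeasure M F = emeasure N F" if F: "closed F" for F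
  proof (cases "F = {}")
    case False
    define \<psi> where "\<psi> k x = max 0 (1 - real k * infdist x F)" for k x
    have \<psi>: "continuous_on UNIV (\<psi> k)" "0 \<le> \<psi> k x \<and> \<psi> k x \<le> 1" for k x
      unfolding \<psi>_def by (auto intro!: continuous_intros infdist_nonneg mult_nonneg_nonneg)
    have lim: "(\<lambda>k. \<psi> k x) \<longlonglongrightarrow> indicator F x" for x
    proof (cases "x \<in> F")
      case True then show ?thesis by (simp add: \<psi>_def)
    next
      case False': False
      then have d: "infdist x F > 0"
        using F False in_closed_iff_infdist_zero[of F x] infdist_nonneg[of x F] by force
      obtain k0 :: nat where k0: "1 / infdist x F < real k0" using reals_Archimedean2 by blast
      have "\<psi> k x = 0" if "k \<ge> k0" for k
      proof -
        have "1 / infdist x F < real k" using k0 that by (meson less_le_trans of_nat_mono)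
        then have "1 < real k * infdist x F" using d by (simp add: field_simps)
        then show ?thesis by (simp add: \<psi>_def)
      qed
      then show ?thesis using False'
        by (intro tendsto_eventually) (auto simp: eventually_sequentially)
    qed
    have Fm: "F \<in> sets borel" using F by simp
    have lims: "(\<lambda>k. \<integral>x. \<psi> k x \<partial>K) \<longlonglongrightarrow> measure K F" if K: "prob_space K" "sets K = sets borel" for K
    proof -
      interpret K: prob_space K by fact
      have "(\<lambda>k. \<integral>x. \<psi> k x \<partial>K) \<longlonglongrightarrow> (\<integral>x. indicator F x \<partial>K)"
      proof (rule integral_dominated_convergence[where w="\<lambda>_. 1"])
        show "\<psi> k \<in> borel_measurable K" for k
          using borel_measurable_continuous_onI[OF \<psi>(1)] K(2) by (simp cong: measurable_cong_sets)
        show "(indicator F :: 'a \<Rightarrow> real) \<in> borel_measurable K" using Fm K(2) by simp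
        show "AE x in K. (\<lambda>k. \<psi> k x) \<longlonglongrightarrow> indicator F x" using lim by simp
        show "AE x in K. norm (\<psi> k x) \<le> 1" for k using \<psi>(2) by simp
      qed simp
      then show ?thesis using Fm K(2) by (simp add: sets_eq_imp_space_eq[OF K(2)])
    qed
    have "measure M F = measure N F"
      using LIMSEQ_unique[OF lims[OF M]] lims[OF N] eq[OF \<psi>] by simp
    then show ?thesis by (simp add: M.emeasure_eq_measure N.emeasure_eq_measure)
  qed simp
  show ?thesis
  proof (rule measure_eqI_generator_eq[where E="Collect closed" and \<Omega>=UNIV and A="\<lambda>_. UNIV"])
    show "Int_stable (Collect closed :: 'a set set)" by (auto simp: Int_stable_def)
    show "sets M = sigma_sets UNIV (Collect closed)" "sets N = sigma_sets UNIV (Collect closed)"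
      using M(2) N(2) by (auto simp: borel_eq_closed)
  qed (use closed_eq in auto)
qed

section \<open>Measurability of configuration maps\<close>

lemma configsD: "x \<in> configs n d \<Longrightarrow> i < n \<Longrightarrow> x i \<in> Rspace d"
  by (auto simp: configs_def PiE_iff)

lemma restrict_configs: "(\<And>i. i < n \<Longrightarrow> f i \<in> Rspace d) \<Longrightarrow> restrict f {..<n} \<in> configs n d"
  by (auto simp: configs_def)

lemma space_lebesgue_config [simp]: "space (lebesgue_config n d) = configs n d"
  by (simp add: lebesgue_config_eq space_PiM configs_def)

lemma sets_lebesgue_config: "sets (lebesgue_config n d) = sets (PiM {..<n} (\<lambda>_. Rborel d))"
  unfolding lebesgue_config_eq by (intro sets_PiM_cong) auto

lemma sets_gauss_config: "sets (gauss_config n d) = sets (lebesgue_config n d)"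
  unfolding lebesgue_config_eq gauss_config_eq by (intro sets_PiM_cong) auto

lemma space_gauss_config [simp]: "space (gauss_config n d) = configs n d"
  using sets_eq_imp_space_eq[OF sets_gauss_config] by simp

lemma config_component_measurable:
  "i < n \<Longrightarrow> (\<lambda>x. x i) \<in> lebesgue_config n d \<rightarrow>\<^sub>M Rborel d"
  unfolding measurable_cong_sets[OF sets_lebesgue_config refl] by (rule measurable_component_singleton) simp

lemma config_component_borel:
  "i < n \<Longrightarrow> (\<lambda>x. x i) \<in> borel_measurable (lebesgue_config n d)"
  by (rule measurable_RborelD[OF config_component_measurable])

lemma config_measurableI:
  assumes "\<And>i. i < n \<Longrightarrow> (\<lambda>z. f z i) \<in> borel_measurable M" "\<And>z. z \<in> space M \<Longrightarrow> f z \<in> configs n d"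
  shows "f \<in> M \<rightarrow>\<^sub>M lebesgue_config n d"
  unfolding measurable_cong_sets[OF refl sets_lebesgue_config]
proof (rule measurable_PiM_single'[where f="\<lambda>i z. f z i" and I="{..<n}"])
  show "(\<lambda>z. f z i) \<in> M \<rightarrow>\<^sub>M Rborel d" if "i \<in> {..<n}" for i
    using that assms(1) configsD[OF assms(2)] by (intro measurable_RborelI) auto
  show "f \<in> space M \<rightarrow> (\<Pi>\<^sub>E i\<in>{..<n}. space (Rborel d))"
    using assms(2) by (auto simp: configs_def)
qed

lemma config_componentD:
  assumes "f \<in> M \<rightarrow>\<^sub>M lebesgue_config n d" "i < n"
  shows "(\<lambda>z. f z i) \<in> borel_measurable M"
  by (rule measurable_compose[OF assms(1) config_component_borel[OF assms(2)]])

lemma lebesgue_config_translate: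
  assumes a: "\<And>i. i < n \<Longrightarrow> a i \<in> Rspace d" and g: "g \<in> borel_measurable (lebesgue_config n d)"
  shows "(\<integral>\<^sup>+x. g (\<lambda>i\<in>{..<n}. x i + a i) \<partial>lebesgue_config n d) = (\<integral>\<^sup>+x. g x \<partial>lebesgue_config n d)"
proof -
  have t: "(\<lambda>x. x + a i) \<in> Leb d \<rightarrow>\<^sub>M Leb d" if "i < n" for i
    unfolding measurable_cong_sets[OF sets_Leb sets_Leb] using a[OF that]
    by (intro measurable_RborelI borel_measurable_add id_Rborel) auto
  have D: "distr (lebesgue_config n d) (lebesgue_config n d) (\<lambda>x. \<lambda>i\<in>{..<n}. x i + a i) = lebesgue_config n d"
    unfolding lebesgue_config_eq
    by (rule distr_PiM_maps) (use t a in \<open>auto intro: sigma_finite_Leb Leb_translate\<close>)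
  have "(\<lambda>x. \<lambda>i\<in>{..<n}. x i + a i) \<in> lebesgue_config n d \<rightarrow>\<^sub>M lebesgue_config n d"
    unfolding lebesgue_config_eq
  proof (rule measurable_restrict)
    fix i assume i: "i \<in> {..<n}"
    then have "(\<lambda>x. x i) \<in> PiM {..<n} (\<lambda>_. Leb d) \<rightarrow>\<^sub>M Leb d" by simp
    from measurable_compose[OF this t] show "(\<lambda>x. x i + a i) \<in> PiM {..<n} (\<lambda>_. Leb d) \<rightarrow>\<^sub>M Leb d" using i by simp
  qed
  then have "(\<integral>\<^sup>+x. g x \<partial>distr (lebesgue_config n d) (lebesgue_config n d) (\<lambda>x. \<lambda>i\<in>{..<n}. x i + a i))
     = (\<integral>\<^sup>+x. g (\<lambda>i\<in>{..<n}. x i + a i) \<partial>lebesgue_config n d)"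
    by (rule nn_integral_distr) (use g in simp)
  then show ?thesis unfolding D by simp
qed

context mean_field
begin

abbreviation LC :: "config measure" where "LC \<equiv> lebesgue_config n d"
abbreviation PS :: "phase measure" where "PS \<equiv> LC \<Otimes>\<^sub>M LC"

lemma pair_sigma_finite_LC: "pair_sigma_finite LC LC"
  by (simp add: pair_sigma_finite_def sigma_finite_lebesgue_config)

lemma grad_borel: "twice_cont_differentiable f \<Longrightarrow> grad f \<in> borel_measurable borel"
  by (intro borel_measurable_continuous_onI)
     (auto simp: twice_cont_differentiable_def continuous_on_eq_continuous_within intro: differentiable_imp_continuous_within)

lemma fun_borel: "twice_cont_differentiable f \<Longrightarrow> f \<in> borel_measurable borel"
  by (intro borel_measurable_continuous_onI)
     (auto simp: twice_cont_differentiable_def continuous_on_eq_continuous_within intro: differentiable_imp_continuous_within)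

lemma force_measurable:
  assumes f: "\<And>j. j < n \<Longrightarrow> (\<lambda>z. f z j) \<in> borel_measurable M" and i: "i < n"
  shows "(\<lambda>z. force i (f z)) \<in> borel_measurable M"
  unfolding force_def using f i
  by (intro borel_measurable_add borel_measurable_scaleR borel_measurable_const borel_measurable_sum
      borel_measurable_diff measurable_compose[OF _ grad_borel[OF V_C2]] measurable_compose[OF _ grad_borel[OF W_C2]]) auto

lemma potential_measurable: "U \<in> borel_measurable LC"
  unfolding potential_def
  by (intro borel_measurable_add borel_measurable_times borel_measurable_const borel_measurable_sum
      measurable_compose[OF _ fun_borel[OF V_C2]] measurable_compose[OF _ fun_borel[OF W_C2]]
      borel_measurable_diff config_component_borel) auto

lemma kick_measurable: "kick h \<in> PS \<rightarrow>\<^sub>M PS"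
  unfolding kick_def
proof (intro measurable_Pair measurable_fst config_measurableI)
  fix i assume i: "i < n"
  have "(\<lambda>z. snd z i - h *\<^sub>R force i (fst z)) \<in> borel_measurable PS"
    by (intro borel_measurable_diff borel_measurable_scaleR borel_measurable_const force_measurable
        config_componentD[OF measurable_fst] config_componentD[OF measurable_snd] i)
  then show "(\<lambda>z. (\<lambda>i\<in>{..<n}. snd z i - h *\<^sub>R force i (fst z)) i) \<in> borel_measurable PS" using i by simp
next
  fix z assume "z \<in> space PS"
  then have "snd z \<in> configs n d" by (auto simp: space_pair_measure)
  then show "(\<lambda>i\<in>{..<n}. snd z i - h *\<^sub>R force i (fst z)) \<in> configs n d"
    by (intro restrict_configs Rspace_closed force_Rspace configsD)
qed

lemma drift_measurable: "drift h \<in> PS \<rightarrow>\<^sub>M PS"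
  unfolding drift_def
proof (intro measurable_Pair measurable_snd config_measurableI)
  fix i assume i: "i < n"
  have "(\<lambda>z. fst z i + h *\<^sub>R snd z i) \<in> borel_measurable PS"
    by (intro borel_measurable_add borel_measurable_scaleR borel_measurable_const
        config_componentD[OF measurable_fst] config_componentD[OF measurable_snd] i)
  then show "(\<lambda>z. (\<lambda>i\<in>{..<n}. fst z i + h *\<^sub>R snd z i) i) \<in> borel_measurable PS" using i by simp
next
  fix z assume "z \<in> space PS"
  then have "fst z \<in> configs n d" "snd z \<in> configs n d" by (auto simp: space_pair_measure)
  then show "(\<lambda>i\<in>{..<n}. fst z i + h *\<^sub>R snd z i) \<in> configs n d"
    by (intro restrict_configs Rspace_closed configsD)
qed

lemma vstep_measurable: "vstep h \<in> PS \<rightarrow>\<^sub>M PS"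
  unfolding vstep_def
  by (rule measurable_compose[OF measurable_compose[OF kick_measurable drift_measurable] kick_measurable])

lemma verlet_measurable: "verlet h k \<in> PS \<rightarrow>\<^sub>M PS"
proof (induction k)
  case (Suc k)
  have "(\<lambda>z. vstep h (verlet h k z)) \<in> PS \<rightarrow>\<^sub>M PS" by (rule measurable_compose[OF Suc vstep_measurable])
  moreover have "verlet h (Suc k) = (\<lambda>z. vstep h (verlet h k z))" by (rule ext) (rule verlet_Suc)
  ultimately show ?case by simp
qed (simp add: verlet_def id_def[symmetric])

text \<open>Kicks and drifts are shears, so that by Fubini they preserve phase space volume.\<close>

lemma kick_preserves:
  assumes F: "F \<in> borel_measurable PS"
  shows "(\<integral>\<^sup>+z. F (kick h z) \<partial>PS) = (\<integral>\<^sup>+z. F z \<partial>PS)"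
proof -
  interpret pair_sigma_finite LC LC by (rule pair_sigma_finite_LC)
  have "(\<integral>\<^sup>+z. F (kick h z) \<partial>PS) = (\<integral>\<^sup>+x. \<integral>\<^sup>+v. F (kick h (x, v)) \<partial>LC \<partial>LC)"
    by (rule sigma_finite_measure.nn_integral_fst[OF sigma_finite_lebesgue_config, symmetric]) (rule measurable_compose[OF kick_measurable F])
  also have "\<dots> = (\<integral>\<^sup>+x. \<integral>\<^sup>+v. F (x, v) \<partial>LC \<partial>LC)"
  proof (rule nn_integral_cong)
    fix x assume x: "x \<in> space LC"
    have "(\<integral>\<^sup>+v. F (x, (\<lambda>i\<in>{..<n}. v i + - (h *\<^sub>R force i x))) \<partial>LC) = (\<integral>\<^sup>+v. F (x, v) \<partial>LC)"
      by (rule lebesgue_config_translate[where g="\<lambda>v. F (x, v)"])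
         (use F x in \<open>auto intro: measurable_Pair2\<close>)
    then show "(\<integral>\<^sup>+v. F (kick h (x, v)) \<partial>LC) = (\<integral>\<^sup>+v. F (x, v) \<partial>LC)" by (simp add: kick_def)
  qed
  also have "\<dots> = (\<integral>\<^sup>+z. F z \<partial>PS)" by (rule sigma_finite_measure.nn_integral_fst[OF sigma_finite_lebesgue_config F])
  finally show ?thesis .
qed

lemma drift_preserves:
  assumes F: "F \<in> borel_measurable PS"
  shows "(\<integral>\<^sup>+z. F (drift h z) \<partial>PS) = (\<integral>\<^sup>+z. F z \<partial>PS)"
proof -
  interpret pair_sigma_finite LC LC by (rule pair_sigma_finite_LC)
  have "(\<integral>\<^sup>+z. F (drift h z) \<partial>PS) = (\<integral>\<^sup>+v. \<integral>\<^sup>+x. F (drift h (x, v)) \<partial>LC \<partial>LC)"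
    by (rule nn_integral_snd[symmetric]) (rule measurable_compose[OF drift_measurable F])
  also have "\<dots> = (\<integral>\<^sup>+v. \<integral>\<^sup>+x. F (x, v) \<partial>LC \<partial>LC)"
  proof (rule nn_integral_cong)
    fix v assume v: "v \<in> space LC"
    have "(\<integral>\<^sup>+x. F ((\<lambda>i\<in>{..<n}. x i + h *\<^sub>R v i), v) \<partial>LC) = (\<integral>\<^sup>+x. F (x, v) \<partial>LC)"
      by (rule lebesgue_config_translate[where g="\<lambda>x. F (x, v)"])
         (use F v configsD[of v n d] in \<open>auto intro: measurable_Pair1\<close>)
    then show "(\<integral>\<^sup>+x. F (drift h (x, v)) \<partial>LC) = (\<integral>\<^sup>+x. F (x, v) \<partial>LC)" by (simp add: drift_def)
  qed
  also have "\<dots> = (\<integral>\<^sup>+z. F z \<partial>PS)"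
    by (rule nn_integral_snd[OF F])
  finally show ?thesis .
qed

lemma verlet_preserves:
  assumes F: "F \<in> borel_measurable PS"
  shows "(\<integral>\<^sup>+z. F (verlet h k z) \<partial>PS) = (\<integral>\<^sup>+z. F z \<partial>PS)"
  using F
proof (induction k arbitrary: F)
  case (Suc k)
  note mk = measurable_compose[OF kick_measurable[of "h / 2"]] and md = measurable_compose[OF drift_measurable[of h]]
  have "(\<integral>\<^sup>+z. F (verlet h (Suc k) z) \<partial>PS) = (\<integral>\<^sup>+z. F (vstep h z) \<partial>PS)"
    unfolding verlet_Suc by (rule Suc.IH) (rule measurable_compose[OF vstep_measurable Suc.prems])
  also have "\<dots> = (\<integral>\<^sup>+z. F z \<partial>PS)"
    unfolding vstep_def
    using kick_preserves[OF md[OF mk[OF Suc.prems]]] drift_preserves[OF mk[OF Suc.prems]] kick_preserves[OF Suc.prems] by simp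
  finally show ?case .
qed simp

section \<open>The exact flow\<close>

definition energy :: "phase \<Rightarrow> real"
  where "energy z = U (fst z) + (\<Sum>i<n. (norm (snd z i))\<^sup>2 / 2)"

lemma hamiltonian_orbit:
  assumes hf: "hamiltonian_flow n d U q p" and x: "x \<in> configs n d" and v: "v \<in> configs n d"
    and T: "T > 0" "Lip * T\<^sup>2 \<le> 1 / 4"
  shows "orbit n d V W eps L Lt T (\<lambda>t. q t x v) (\<lambda>t. p t x v)"
proof (unfold_locales)
  show "0 < T" "Lip * T\<^sup>2 \<le> 1 / 4" by fact+
  fix t :: real and i assume ti: "t \<ge> 0" "i < n"
  have "((\<lambda>s. q s x v i) has_vector_derivative p t x v i) (at t within {0..}) \<and>
      ((\<lambda>s. p s x v i) has_vector_derivative - partial_grad U i (q t x v)) (at t within {0..})"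
    using hf x v ti unfolding hamiltonian_flow_def by blast
  then show "((\<lambda>s. q s x v i) has_vector_derivative p t x v i) (at t within {0..})"
     "((\<lambda>s. p s x v i) has_vector_derivative - force i (q t x v)) (at t within {0..})"
    using partial_grad_eq_force[OF ti(2)] by auto
qed

lemma hamiltonian_flow_configs:
  assumes "hamiltonian_flow n d U q p" "x \<in> configs n d" "v \<in> configs n d"
  shows "q 0 x v = x" "p 0 x v = v" "t \<ge> 0 \<Longrightarrow> q t x v \<in> configs n d" "t \<ge> 0 \<Longrightarrow> p t x v \<in> configs n d"
  using assms unfolding hamiltonian_flow_def by blast+

lemma potential_tendsto:
  assumes "\<And>i. i < n \<Longrightarrow> (\<lambda>m. f m i) \<longlonglongrightarrow> x i"
  shows "(\<lambda>m. U (f m)) \<longlonglongrightarrow> U x"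
proof -
  have c: "isCont V y" "isCont W y" for y
    using V_C2 W_C2 by (auto simp: twice_cont_differentiable_def intro: differentiable_imp_continuous_within)
  show ?thesis unfolding potential_def
    by (intro tendsto_intros isCont_tendsto_compose[OF c(1)] isCont_tendsto_compose[OF c(2)] assms) auto
qed

end

context orbit
begin

lemma energy_conserved: assumes t: "t \<ge> 0" shows "energy (Q t, P t) = energy (Q 0, P 0)"
proof -
  have K: "((\<lambda>s. (norm (P s i))\<^sup>2 / 2) has_derivative (\<lambda>h. inner (P s i) (h *\<^sub>R - force i (Q s)))) (at s within {0..})"
    if "s \<ge> 0" "i < n" for s i
    using P_deriv[OF that, unfolded has_vector_derivative_def]
    unfolding power2_norm_eq_inner
    by (auto intro!: derivative_eq_intros simp: inner_commute)
  have E: "((\<lambda>s. energy (Q s, P s)) has_vector_derivative 0) (at s within {0..})" if s: "s \<ge> 0" for s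
  proof -
    have "((\<lambda>s. energy (Q s, P s)) has_derivative
       (\<lambda>h. (\<Sum>k<n. inner (h *\<^sub>R P s k) (force k (Q s))) + (\<Sum>i<n. inner (P s i) (h *\<^sub>R - force i (Q s))))) (at s within {0..})"
      unfolding energy_def fst_conv snd_conv
      using Q_deriv[OF s, unfolded has_vector_derivative_def] K[OF s]
      by (intro has_derivative_add potential_chain has_derivative_sum) auto
    then show ?thesis by (simp add: has_vector_derivative_def sum_negf)
  qed
  have "energy (Q t, P t) = energy (Q 0, P 0) + (t - 0) *\<^sub>R 0"
  proof (rule constant_derivative_increment[where f="\<lambda>s. energy (Q s, P s)"])
    show "continuous_on {0..t} (\<lambda>s. energy (Q s, P s))"
      using continuous_on_vector_derivative[of "{0..}" "\<lambda>s. energy (Q s, P s)" "\<lambda>_. 0"] E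
      by (auto intro: continuous_on_subset)
    fix s assume s: "0 < s" "s < t"
    show "((\<lambda>s. energy (Q s, P s)) has_vector_derivative 0) (at s)"
      by (rule has_vector_derivative_halfline[OF E]) (use s in auto)
  qed (use t in auto)
  then show ?thesis by simp
qed

text \<open>The global error bound, read for a single initial condition as the number of steps tends to
  infinity.\<close>

lemma verlet_converges:
  assumes i: "i < n"
  shows "(\<lambda>m. fst (verlet (T / real (Suc m)) (Suc m) (Q 0, P 0)) i) \<longlonglongrightarrow> Q T i"
    "(\<lambda>m. snd (verlet (T / real (Suc m)) (Suc m) (Q 0, P 0)) i) \<longlonglongrightarrow> P T i"
proof -
  let ?h = "\<lambda>m. T / real (Suc m)" and ?N = "\<Sum>i<n. norm (Q 0 i) + norm (P 0 i)"
  let ?z = "\<lambda>m. verlet (?h m) (Suc m) (Q 0, P 0)"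
  have g: "gap (?h m) (Suc m) \<le> ?h m * first_order_const Lip T * ?N" for m
    by (rule first_order_error[of _ "Suc m"]) (use T_pos in auto)
  have lim: "(\<lambda>m. ?h m * first_order_const Lip T * ?N) \<longlonglongrightarrow> 0"
    by (intro tendsto_mult_left_zero tendsto_divide_0[OF tendsto_const]
        filterlim_compose[OF filterlim_Suc filterlim_ident] filterlim_at_top_imp_at_infinity
        filterlim_compose[OF filterlim_real_sequentially filterlim_Suc])
  have r: "real (Suc m) * ?h m = T" for m by simp
  have b: "norm (Q T i - fst (?z m) i) \<le> gap (?h m) (Suc m)" "norm (P T i - snd (?z m) i) \<le> gap (?h m) (Suc m)" for m
  proof -
    have "norm (Q T i - fst (?z m) i) \<le> (\<Sum>i<n. norm (Q T i - fst (?z m) i))"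
      "norm (P T i - snd (?z m) i) \<le> (\<Sum>i<n. norm (P T i - snd (?z m) i))"
      using i by (auto intro!: member_le_sum)
    moreover have "0 \<le> (\<Sum>i<n. norm (Q T i - fst (?z m) i))" "0 \<le> (\<Sum>i<n. norm (P T i - snd (?z m) i))"
      by (auto intro: sum_nonneg)
    ultimately show "norm (Q T i - fst (?z m) i) \<le> gap (?h m) (Suc m)" "norm (P T i - snd (?z m) i) \<le> gap (?h m) (Suc m)"
      unfolding gap_def Let_def r by linarith+
  qed
  show "(\<lambda>m. fst (?z m) i) \<longlonglongrightarrow> Q T i"
    by (rule LIM_zero_cancel, rule Lim_null_comparison[OF _ lim])
       (use order_trans[OF b(1) g] in \<open>simp add: norm_minus_commute\<close>)
  show "(\<lambda>m. snd (?z m) i) \<longlonglongrightarrow> P T i"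
    by (rule LIM_zero_cancel, rule Lim_null_comparison[OF _ lim])
       (use order_trans[OF b(2) g] in \<open>simp add: norm_minus_commute\<close>)
qed

end

section \<open>The Gibbs measure and the exact flow\<close>

lemma configs_arb: "x \<in> configs n d \<Longrightarrow> \<not> i < n \<Longrightarrow> x i = undefined"
  unfolding configs_def by (erule PiE_arb) simp

lemma config_measurable_borel:
  assumes "f \<in> M \<rightarrow>\<^sub>M lebesgue_config n d"
  shows "f \<in> borel_measurable M"
proof (rule measurable_coordinatewise_then_product)
  fix i
  show "(\<lambda>z. f z i) \<in> borel_measurable M"
  proof (cases "i < n")
    case False
    have "f z i = undefined" if "z \<in> space M" for z
      using measurable_space[OF assms that] False by (simp add: configs_arb)
    then show ?thesis by (simp cong: measurable_cong)
  qed (rule config_componentD[OF assms])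
qed

text \<open>Configurations form a retract of the space of all sequences of points by a Borel map, so a
  measure on configurations is determined by its image on the larger metric space, on which
  continuous test functions are available.\<close>

lemma config_measure_eqI:
  assumes M: "sets M = sets (lebesgue_config n d)" and N: "sets N = sets (lebesgue_config n d)"
    and eq: "distr M borel (\<lambda>x. x) = distr N borel (\<lambda>x. x)"
  shows "M = N"
proof -
  define \<kappa> :: "config \<Rightarrow> config" where "\<kappa> x = (\<lambda>i\<in>{..<n}. embed d (coord (x i)))" for x
  have \<kappa>: "\<kappa> \<in> borel \<rightarrow>\<^sub>M lebesgue_config n d"
  proof (rule config_measurableI)
    fix i assume "i < n"
    have "(\<lambda>x :: config. embed d (coord (x i))) \<in> borel_measurable borel"
      by (rule measurable_RborelD[OF embed_measurable]) measurable
    then show "(\<lambda>x. \<kappa> x i) \<in> borel_measurable borel" using \<open>i < n\<close> by (simp add: \<kappa>_def)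
  qed (simp add: \<kappa>_def restrict_configs)
  have id: "distr (distr K borel (\<lambda>x. x)) (lebesgue_config n d) \<kappa> = K"
    if K: "sets K = sets (lebesgue_config n d)" for K
  proof -
    have i: "(\<lambda>x. x) \<in> borel_measurable K"
      by (rule config_measurable_borel[of _ _ n d]) (simp add: measurable_cong_sets[OF K refl])
    have "distr (distr K borel (\<lambda>x. x)) (lebesgue_config n d) \<kappa> = distr K (lebesgue_config n d) (\<lambda>x. \<kappa> x)"
      using \<kappa> i by (simp add: distr_distr comp_def)
    also have "\<dots> = distr K K (\<lambda>x. x)"
    proof (rule distr_cong)
      fix x assume "x \<in> space K"
      then have x: "x \<in> configs n d" using sets_eq_imp_space_eq[OF K] by simp
      have "\<kappa> x i = x i" for i
      proof (cases "i < n")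
        case True
        then show ?thesis by (simp add: \<kappa>_def embed_coord[OF configsD[OF x]])
      next
        case False
        then show ?thesis by (simp add: \<kappa>_def configs_arb[OF x])
      qed
      then show "\<kappa> x = x" by (rule ext)
    qed (use K in auto)
    finally show ?thesis by simp
  qed
  show ?thesis by (rule trans[OF sym[OF id[OF M, unfolded eq]] id[OF N]])
qed

context mean_field
begin

abbreviation gibbsU :: "config measure" where "gibbsU \<equiv> gibbs n d U"

definition Z :: real where "Z = (\<integral>x. exp (- U x) \<partial>LC)"

text \<open>The phase space density of position and velocity, which is a function of the energy
  (\<open>joint_density_energy\<close>).\<close>

definition joint_density :: "phase \<Rightarrow> real"
  where "joint_density z = exp (- U (fst z)) / Z * (\<Prod>i<n. gdens d (snd z i))"

lemma gibbs_density: "gibbsU = density LC (\<lambda>x. ennreal (exp (- U x) / Z))"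
  by (simp add: gibbs_def Let_def Z_def)

lemma sets_gibbs: "sets gibbsU = sets LC" by (simp add: gibbs_density)

lemma space_gibbs [simp]: "space gibbsU = configs n d" by (simp add: gibbs_density)

lemma exp_potential_measurable: "(\<lambda>x. exp (- U x)) \<in> borel_measurable LC"
  using potential_measurable by measurable

lemma Z_pos: assumes int: "integrable LC (\<lambda>x. exp (- U x))" shows "Z > 0"
proof -
  have "Z \<noteq> 0"
  proof
    assume "Z = 0"
    then have "AE x in LC. exp (- U x) = 0"
      using int unfolding Z_def by (subst (asm) integral_nonneg_eq_0_iff_AE) auto
    then have ae: "AE x in LC. False" by simp
    have "AE x in gauss_config n d. False"
      unfolding gauss_config_density using ae by (subst AE_density) (auto intro!: borel_measurable_prod_ennreal measurable_compose[OF config_component_borel])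
    then show False using prob_space.AE_False[OF prob_space_gauss_config] by blast
  qed
  moreover have "Z \<ge> 0" unfolding Z_def by simp
  ultimately show ?thesis by simp
qed

lemma prob_space_gibbs: assumes int: "integrable LC (\<lambda>x. exp (- U x))" shows "prob_space gibbsU"
proof
  have "emeasure gibbsU (space gibbsU) = (\<integral>\<^sup>+x. ennreal (exp (- U x) / Z) \<partial>LC)"
    unfolding gibbs_density using exp_potential_measurable
    by (subst emeasure_density) (auto intro!: nn_integral_cong simp: indicator_def simp flip: space_lebesgue_config)
  also have "\<dots> = ennreal (\<integral>x. exp (- U x) / Z \<partial>LC)"
    using int Z_pos[OF int] by (intro nn_integral_eq_integral) auto
  also have "(\<integral>x. exp (- U x) / Z \<partial>LC) = 1" using Z_pos[OF int] by (simp add: Z_def)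
  finally show "emeasure gibbsU (space gibbsU) = 1" by simp
qed

lemma joint_density_energy:
  "joint_density z = (((1 / sqrt (2 * pi)) ^ d) ^ n / Z) * exp (- energy z)"
proof -
  have "(\<Prod>i<n. gdens d (snd z i)) = ((1 / sqrt (2 * pi)) ^ d) ^ n * exp (- (\<Sum>i<n. (norm (snd z i))\<^sup>2 / 2))"
    by (simp add: gdens_def prod.distrib exp_sum sum_negf[symmetric])
  moreover have "exp (- energy z) = exp (- U (fst z)) * exp (- (\<Sum>i<n. (norm (snd z i))\<^sup>2 / 2))"
    by (simp add: energy_def exp_add[symmetric])
  ultimately show ?thesis by (simp add: joint_density_def)
qed

lemma joint_density_measurable: "joint_density \<in> borel_measurable PS"
  unfolding joint_density_def
  by (intro borel_measurable_times borel_measurable_divide borel_measurable_const borel_measurable_prod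
      measurable_compose[OF measurable_fst exp_potential_measurable] measurable_compose[OF _ gdens_borel]
      config_componentD[OF measurable_snd]) auto

lemma joint_measure:
  assumes int: "integrable LC (\<lambda>x. exp (- U x))"
  shows "gibbsU \<Otimes>\<^sub>M gauss_config n d = density PS (\<lambda>z. ennreal (joint_density z))"
proof -
  have m: "(\<lambda>v. \<Prod>i<n. ennreal (gdens d (v i))) \<in> borel_measurable LC"
    by (intro borel_measurable_prod_ennreal measurable_compose[OF config_component_borel]) auto
  have "gibbsU \<Otimes>\<^sub>M gauss_config n d = density PS (\<lambda>(x, v). ennreal (exp (- U x) / Z) * (\<Prod>i<n. ennreal (gdens d (v i))))"
    unfolding gibbs_density gauss_config_density
  proof (rule pair_measure_density)
    show "sigma_finite_measure (density LC (\<lambda>v. \<Prod>i<n. ennreal (gdens d (v i))))"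
      unfolding gauss_config_density[symmetric] by (rule prob_space_imp_sigma_finite[OF prob_space_gauss_config])
  qed (use m exp_potential_measurable in \<open>auto intro: sigma_finite_lebesgue_config\<close>)
  also have "(\<lambda>(x, v). ennreal (exp (- U x) / Z) * (\<Prod>i<n. ennreal (gdens d (v i)))) = (\<lambda>z. ennreal (joint_density z))"
  proof (rule ext)
    fix z :: phase
    have "(\<Prod>i<n. ennreal (gdens d (snd z i))) = ennreal (\<Prod>i<n. gdens d (snd z i))"
      using gdens_pos by (intro prod_ennreal) (auto simp: less_imp_le)
    moreover have "0 \<le> exp (- U (fst z)) / Z" using Z_pos[OF int] by simp
    ultimately show "(case z of (x, v) \<Rightarrow> ennreal (exp (- U x) / Z) * (\<Prod>i<n. ennreal (gdens d (v i)))) = ennreal (joint_density z)"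
      unfolding joint_density_def by (simp add: case_prod_beta ennreal_mult' del: times_divide_eq_left)
  qed
  finally show ?thesis .
qed

text \<open>The flow is given by a differential equation for each initial condition separately; it is
  measurable as the pointwise limit of the Verlet maps.\<close>

lemma flow_measurable:
  assumes hf: "hamiltonian_flow n d U q p" and T: "T > 0" "Lip * T\<^sup>2 \<le> 1 / 4"
  shows "(\<lambda>z. q T (fst z) (snd z)) \<in> PS \<rightarrow>\<^sub>M LC"
proof (rule config_measurableI)
  show "q T (fst z) (snd z) \<in> configs n d" if "z \<in> space PS" for z
    using that T hamiltonian_flow_configs(3)[OF hf] by (auto simp: space_pair_measure)
  fix i assume i: "i < n"
  show "(\<lambda>z. q T (fst z) (snd z) i) \<in> borel_measurable PS"
  proof (rule borel_measurable_LIMSEQ_metric)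
    show "(\<lambda>z. fst (verlet (T / real (Suc m)) (Suc m) z) i) \<in> borel_measurable PS" for m
      by (rule config_componentD[OF measurable_compose[OF verlet_measurable measurable_fst] i])
    fix z assume "z \<in> space PS"
    then have z: "fst z \<in> configs n d" "snd z \<in> configs n d" by (auto simp: space_pair_measure)
    interpret orbit n d V W eps L Lt T "\<lambda>t. q t (fst z) (snd z)" "\<lambda>t. p t (fst z) (snd z)"
      by (rule hamiltonian_orbit[OF hf z T])
    show "(\<lambda>m. fst (verlet (T / real (Suc m)) (Suc m) z) i) \<longlonglongrightarrow> q T (fst z) (snd z) i"
      using verlet_converges(1)[OF i] by (simp add: hamiltonian_flow_configs(1,2)[OF hf z] del: of_nat_Suc)
  qed
qed

text \<open>Volume preservation passes from the Verlet maps to their limit as an inequality, by Fatou's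
  lemma, and the exact flow conserves the energy, hence the phase space density.\<close>

lemma flow_test_function:
  fixes \<psi> :: "config \<Rightarrow> real"
  assumes hf: "hamiltonian_flow n d U q p" and T: "T > 0" "Lip * T\<^sup>2 \<le> 1 / 4"
    and \<psi>: "continuous_on UNIV \<psi>" "\<And>x. 0 \<le> \<psi> x \<and> \<psi> x \<le> 1"
  shows "(\<integral>\<^sup>+z. ennreal (\<psi> (q T (fst z) (snd z)) * joint_density z) \<partial>PS)
    \<le> (\<integral>\<^sup>+z. ennreal (\<psi> (fst z) * joint_density z) \<partial>PS)"
proof -
  define F where "F z = ennreal (\<psi> (fst z) * joint_density z)" for z
  have F: "F \<in> borel_measurable PS"
    unfolding F_def
    by (intro measurable_compose[OF _ measurable_ennreal] borel_measurable_times joint_density_measurable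
        measurable_compose[OF config_measurable_borel[OF measurable_fst] borel_measurable_continuous_onI[OF \<psi>(1)]])
  have lim: "(\<lambda>m. F (verlet (T / real (Suc m)) (Suc m) z)) \<longlonglongrightarrow> ennreal (\<psi> (q T (fst z) (snd z)) * joint_density z)"
    if "z \<in> space PS" for z
  proof -
    have z: "fst z \<in> configs n d" "snd z \<in> configs n d" using that by (auto simp: space_pair_measure)
    interpret orbit n d V W eps L Lt T "\<lambda>t. q t (fst z) (snd z)" "\<lambda>t. p t (fst z) (snd z)"
      by (rule hamiltonian_orbit[OF hf z T])
    let ?q = "q T (fst z) (snd z)" and ?p = "p T (fst z) (snd z)"
    let ?z = "\<lambda>m. verlet (T / real (Suc m)) (Suc m) z"
    have z0: "(q 0 (fst z) (snd z), p 0 (fst z) (snd z)) = z" by (simp add: hamiltonian_flow_configs(1,2)[OF hf z])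
    have c: "(\<lambda>m. fst (?z m) i) \<longlonglongrightarrow> ?q i" "(\<lambda>m. snd (?z m) i) \<longlonglongrightarrow> ?p i" if "i < n" for i
      using verlet_converges[OF that] unfolding z0 by auto
    have conf: "fst (?z m) \<in> configs n d" for m using verlet_configs z by blast
    have qc: "?q \<in> configs n d" using hamiltonian_flow_configs(3)[OF hf z] T by simp
    have "(\<lambda>m. fst (?z m)) \<longlonglongrightarrow> ?q"
    proof (rule tendsto_fun_componentwise)
      fix i show "(\<lambda>m. fst (?z m) i) \<longlonglongrightarrow> ?q i"
      proof (cases "i < n")
        case False
        then have "fst (?z m) i = ?q i" for m
          using conf[of m] qc by (simp add: configs_arb)
        then show ?thesis by simp
      qed (rule c)
    qed
    then have a: "(\<lambda>m. \<psi> (fst (?z m))) \<longlonglongrightarrow> \<psi> ?q"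
      using \<psi>(1) by (intro continuous_on_tendsto_compose[OF \<psi>(1)]) auto
    have "(\<lambda>m. energy (?z m)) \<longlonglongrightarrow> energy (?q, ?p)"
      unfolding energy_def fst_conv snd_conv using c
      by (intro tendsto_intros potential_tendsto) auto
    also have "energy (?q, ?p) = energy z" using energy_conserved[of T] T unfolding z0 by simp
    finally have "(\<lambda>m. joint_density (?z m)) \<longlonglongrightarrow> joint_density z"
      unfolding joint_density_energy by (intro tendsto_intros)
    with a show ?thesis unfolding F_def by (intro tendsto_ennrealI tendsto_mult)
  qed
  have "(\<integral>\<^sup>+z. ennreal (\<psi> (q T (fst z) (snd z)) * joint_density z) \<partial>PS)
     = (\<integral>\<^sup>+z. liminf (\<lambda>m. F (verlet (T / real (Suc m)) (Suc m) z)) \<partial>PS)"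
    by (intro nn_integral_cong lim_imp_Liminf[symmetric] lim) auto
  also have "\<dots> \<le> liminf (\<lambda>m. \<integral>\<^sup>+z. F (verlet (T / real (Suc m)) (Suc m) z) \<partial>PS)"
    by (intro nn_integral_liminf measurable_compose[OF verlet_measurable F])
  also have "\<dots> = (\<integral>\<^sup>+z. F z \<partial>PS)" by (simp only: verlet_preserves[OF F]) (simp add: Liminf_const)
  finally show ?thesis by (simp add: F_def)
qed

lemma flow_invariant:
  assumes hf: "hamiltonian_flow n d U q p" and T: "T > 0" "Lip * T\<^sup>2 \<le> 1 / 4"
    and int: "integrable LC (\<lambda>x. exp (- U x))"
  shows "distr (gibbsU \<Otimes>\<^sub>M gauss_config n d) LC (\<lambda>z. q T (fst z) (snd z)) = gibbsU"
proof -
  let ?J = "gibbsU \<Otimes>\<^sub>M gauss_config n d" and ?q = "\<lambda>z. q T (fst z) (snd z)"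
  interpret G: prob_space gibbsU by (rule prob_space_gibbs[OF int])
  interpret N: prob_space "gauss_config n d" by (rule prob_space_gauss_config)
  interpret GN: pair_prob_space gibbsU "gauss_config n d" ..
  have sJ: "sets ?J = sets PS" using sets_gibbs sets_gauss_config by (intro sets_pair_measure_cong)
  have qm: "?q \<in> ?J \<rightarrow>\<^sub>M LC" using flow_measurable[OF hf T] by (simp add: measurable_cong_sets[OF sJ refl])
  have qb: "?q \<in> borel_measurable ?J" by (rule config_measurable_borel[OF qm])
  have gid: "(\<lambda>x. x) \<in> gibbsU \<rightarrow>\<^sub>M LC" by (simp add: measurable_cong_sets[OF sets_gibbs refl])
  have gb: "(\<lambda>x. x) \<in> borel_measurable gibbsU" by (rule config_measurable_borel[OF gid])
  show ?thesis
  proof (rule config_measure_eqI)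
    show "sets (distr ?J LC ?q) = sets LC" "sets gibbsU = sets LC" by (auto simp: sets_gibbs)
    have "distr (distr ?J LC ?q) borel (\<lambda>x. x) = distr ?J borel ?q"
      using qm config_measurable_borel[of "\<lambda>x. x" LC n d] by (simp add: distr_distr comp_def)
    also have "\<dots> = distr gibbsU borel (\<lambda>x. x)"
    proof (rule prob_eqI_test_functions)
      show "prob_space (distr ?J borel ?q)" by (rule GN.P.prob_space_distr[OF qb])
      show "prob_space (distr gibbsU borel (\<lambda>x. x))" by (rule G.prob_space_distr[OF gb])
      fix \<psi> :: "config \<Rightarrow> real" assume \<psi>: "continuous_on UNIV \<psi>" "\<And>x. 0 \<le> \<psi> x \<and> \<psi> x \<le> 1"
      have \<psi>m: "\<psi> \<in> borel_measurable borel" by (rule borel_measurable_continuous_onI[OF \<psi>(1)])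
      have \<psi>g: "\<psi> \<in> borel_measurable gibbsU" using measurable_compose[OF gb \<psi>m] by simp
      have jd: "joint_density z \<ge> 0" for z
        unfolding joint_density_def using Z_pos[OF int] gdens_pos
        by (intro mult_nonneg_nonneg divide_nonneg_nonneg prod_nonneg) (auto simp: less_imp_le)
      have pull: "(\<integral>\<^sup>+z. ennreal (f z) \<partial>?J) = (\<integral>\<^sup>+z. ennreal (f z * joint_density z) \<partial>PS)"
        if f: "f \<in> borel_measurable PS" "\<And>z. f z \<ge> 0" for f
        unfolding joint_measure[OF int] using f jd joint_density_measurable
        by (subst nn_integral_density) (auto intro!: nn_integral_cong simp: ennreal_mult'[symmetric] mult.commute)
      have "(\<integral>\<^sup>+x. ennreal (\<psi> x) \<partial>distr ?J borel ?q) = (\<integral>\<^sup>+z. ennreal (\<psi> (?q z)) \<partial>?J)"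
        using qb \<psi>m by (intro nn_integral_distr) auto
      also have "\<dots> = (\<integral>\<^sup>+z. ennreal (\<psi> (?q z) * joint_density z) \<partial>PS)"
        using \<psi>(2) measurable_compose[OF config_measurable_borel[OF flow_measurable[OF hf T]] \<psi>m] by (intro pull) auto
      also have "\<dots> \<le> (\<integral>\<^sup>+z. ennreal (\<psi> (fst z) * joint_density z) \<partial>PS)"
        by (rule flow_test_function[OF hf T \<psi>])
      also have "\<dots> = (\<integral>\<^sup>+z. ennreal (\<psi> (fst z)) \<partial>?J)"
        using \<psi>(2) measurable_compose[OF config_measurable_borel[OF measurable_fst] \<psi>m] by (intro pull[symmetric]) auto
      also have "\<dots> = (\<integral>\<^sup>+x. \<integral>\<^sup>+v. ennreal (\<psi> x) \<partial>gauss_config n d \<partial>gibbsU)"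
        by (rule N.nn_integral_fst[of "\<lambda>z. ennreal (\<psi> (fst z))" gibbsU, unfolded fst_conv, symmetric])
          (rule measurable_compose[OF measurable_compose[OF measurable_fst \<psi>g] measurable_ennreal])
      also have "\<dots> = (\<integral>\<^sup>+x. ennreal (\<psi> x) \<partial>gibbsU)" using N.emeasure_space_1 by simp
      also have "\<dots> = (\<integral>\<^sup>+x. ennreal (\<psi> x) \<partial>distr gibbsU borel (\<lambda>x. x))"
        using gb \<psi>m by (intro nn_integral_distr[symmetric]) auto
      finally show "(\<integral>\<^sup>+x. ennreal (\<psi> x) \<partial>distr ?J borel ?q) \<le> (\<integral>\<^sup>+x. ennreal (\<psi> x) \<partial>distr gibbsU borel (\<lambda>x. x))" .
    qed auto
    finally show "distr (distr ?J LC ?q) borel (\<lambda>x. x) = distr gibbsU borel (\<lambda>x. x)" .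
  qed
qed

end

section \<open>Duhamel formula for velocity Verlet\<close>

text \<open>The weights of the discrete Duhamel formula \<open>verlet_summation\<close>. They add up to half the square
  of the elapsed time, exactly as the kernel of the continuous formula does, so no error in the step
  size enters the estimates that use them.\<close>

definition verlet_weight :: "real \<Rightarrow> nat \<Rightarrow> nat \<Rightarrow> real"
  where "verlet_weight h m j = h\<^sup>2 * real (m - j) * (if j = 0 then 1 / 2 else 1)"

lemma verlet_weight_nonneg: "0 \<le> verlet_weight h m j"
  by (simp add: verlet_weight_def)

lemma sum_verlet_weight: "(\<Sum>j<m. verlet_weight h m j) = (real m * h)\<^sup>2 / 2"
proof -
  define b :: "nat \<Rightarrow> real" where "b j = (if j = 0 then 1 / 2 else 1)" for j
  have b: "(\<Sum>j<Suc m. b j) = real m + 1 / 2" for m by (induction m) (auto simp: b_def)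
  have "(\<Sum>j<m. real (m - j) * b j) = (real m)\<^sup>2 / 2"
  proof (induction m)
    case (Suc m)
    have "(\<Sum>j<Suc m. real (Suc m - j) * b j) = (\<Sum>j<Suc m. real (m - j) * b j + b j)"
      by (intro sum.cong) (auto simp: of_nat_diff algebra_simps)
    also have "\<dots> = (\<Sum>j<m. real (m - j) * b j) + (real m + 1 / 2)"
      by (simp only: sum.distrib b) simp
    finally show ?case using Suc by (simp add: power2_eq_square algebra_simps)
  qed simp
  then show ?thesis unfolding verlet_weight_def b_def
    by (simp add: mult.assoc sum_distrib_left[symmetric] power_mult_distrib)
qed

lemma verlet_summation:
  fixes z w g :: "nat \<Rightarrow> 'a::real_vector"
  assumes z: "\<And>k. k < m \<Longrightarrow> z (Suc k) = z k + h *\<^sub>R w k - (h\<^sup>2 / 2) *\<^sub>R g k"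
    and w: "\<And>k. k < m \<Longrightarrow> w (Suc k) = w k - (h / 2) *\<^sub>R (g k + g (Suc k))"
  shows "k \<le> m \<Longrightarrow> z k = z 0 + (real k * h) *\<^sub>R w 0 - (\<Sum>j<k. verlet_weight h k j *\<^sub>R g j)"
proof -
  define b :: "nat \<Rightarrow> real" where "b j = (if j = 0 then 1 / 2 else 1)" for j
  have W: "w k - (h / 2) *\<^sub>R g k = w 0 - h *\<^sub>R (\<Sum>j<Suc k. b j *\<^sub>R g j)" if "k \<le> m" for k
    using that
  proof (induction k)
    case (Suc k)
    have "w (Suc k) - (h / 2) *\<^sub>R g (Suc k) = (w k - (h / 2) *\<^sub>R g k) - h *\<^sub>R g (Suc k)"
    proof -
      have "h *\<^sub>R g (Suc k) = (h / 2) *\<^sub>R g (Suc k) + (h / 2) *\<^sub>R g (Suc k)"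
        by (simp add: scaleR_add_left[symmetric])
      then show ?thesis using w[of k] Suc.prems by (simp add: algebra_simps)
    qed
    then show ?case using Suc by (simp add: b_def algebra_simps)
  qed (simp add: b_def)
  show "k \<le> m \<Longrightarrow> z k = z 0 + (real k * h) *\<^sub>R w 0 - (\<Sum>j<k. verlet_weight h k j *\<^sub>R g j)"
  proof (induction k)
    case (Suc k)
    have vw: "verlet_weight h (Suc k) j = verlet_weight h k j + h\<^sup>2 * b j" if "j < Suc k" for j
      using that by (simp add: verlet_weight_def b_def Suc_diff_le algebra_simps)
    have "(\<Sum>j<Suc k. verlet_weight h (Suc k) j *\<^sub>R g j) = (\<Sum>j<Suc k. verlet_weight h k j *\<^sub>R g j + h\<^sup>2 *\<^sub>R (b j *\<^sub>R g j))"
      by (intro sum.cong) (auto simp: vw scaleR_add_left)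
    also have "\<dots> = (\<Sum>j<k. verlet_weight h k j *\<^sub>R g j) + h\<^sup>2 *\<^sub>R (\<Sum>j<Suc k. b j *\<^sub>R g j)"
      by (simp only: sum.distrib scaleR_sum_right[symmetric]) (simp add: verlet_weight_def)
    finally have S: "(\<Sum>j<Suc k. verlet_weight h (Suc k) j *\<^sub>R g j)
       = (\<Sum>j<k. verlet_weight h k j *\<^sub>R g j) + h\<^sup>2 *\<^sub>R (\<Sum>j<Suc k. b j *\<^sub>R g j)" .
    have "z (Suc k) = z k + h *\<^sub>R (w k - (h / 2) *\<^sub>R g k)"
      using z[of k] Suc.prems by (simp add: algebra_simps power2_eq_square)
    also have "\<dots> = z 0 + (real k * h) *\<^sub>R w 0 - (\<Sum>j<k. verlet_weight h k j *\<^sub>R g j)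
        + h *\<^sub>R (w 0 - h *\<^sub>R (\<Sum>j<Suc k. b j *\<^sub>R g j))"
      using Suc W[of k] by simp
    also have "\<dots> = z 0 + (real (Suc k) * h) *\<^sub>R w 0 - (\<Sum>j<Suc k. verlet_weight h (Suc k) j *\<^sub>R g j)"
      unfolding S by (simp add: algebra_simps power2_eq_square)
    finally show ?case .
  qed simp
qed

lemma verlet_deviation:
  fixes z w g :: "nat \<Rightarrow> 'a::real_normed_vector"
  assumes z: "\<And>k. k < m \<Longrightarrow> z (Suc k) = z k + h *\<^sub>R w k - (h\<^sup>2 / 2) *\<^sub>R g k"
    and w: "\<And>k. k < m \<Longrightarrow> w (Suc k) = w k - (h / 2) *\<^sub>R (g k + g (Suc k))"
    and g: "\<And>k. k < m \<Longrightarrow> norm (g k) \<le> B" and k: "k \<le> m"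
  shows "norm (z k - (z 0 + (real k * h) *\<^sub>R w 0)) \<le> (real k * h)\<^sup>2 / 2 * B"
proof -
  have "norm (z k - (z 0 + (real k * h) *\<^sub>R w 0)) = norm (\<Sum>j<k. verlet_weight h k j *\<^sub>R g j)"
  proof -
    have "z k = z 0 + (real k * h) *\<^sub>R w 0 - (\<Sum>j<k. verlet_weight h k j *\<^sub>R g j)"
      by (rule verlet_summation[where m=m]) (use z w k in auto)
    then show ?thesis by simp
  qed
  also have "\<dots> \<le> (\<Sum>j<k. verlet_weight h k j * B)"
    using g k by (intro sum_norm_le) (auto simp: verlet_weight_nonneg intro!: mult_left_mono)
  also have "\<dots> = (real k * h)\<^sup>2 / 2 * B" by (simp add: sum_distrib_right[symmetric] sum_verlet_weight)
  finally show ?thesis .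
qed

lemma norm_segment_le:
  fixes z w :: "'a::real_normed_vector"
  assumes "0 \<le> t" "t \<le> T" "T > 0"
  shows "norm (z + t *\<^sub>R w) \<le> max (norm z) (norm (z + T *\<^sub>R w))"
proof -
  have "z + t *\<^sub>R w = (1 - t / T) *\<^sub>R z + (t / T) *\<^sub>R (z + T *\<^sub>R w)"
    using assms by (simp add: algebra_simps)
  then have "norm (z + t *\<^sub>R w) \<le> (1 - t / T) * norm z + (t / T) * norm (z + T *\<^sub>R w)"
    using norm_triangle_ineq[of "(1 - t / T) *\<^sub>R z" "(t / T) *\<^sub>R (z + T *\<^sub>R w)"] assms by simp
  also have "\<dots> \<le> (1 - t / T) * max (norm z) (norm (z + T *\<^sub>R w)) + (t / T) * max (norm z) (norm (z + T *\<^sub>R w))"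
    using assms by (intro add_mono mult_left_mono) auto
  finally show ?thesis by (simp add: algebra_simps)
qed

section \<open>The step and interaction conditions\<close>

locale hmc = mean_field +
  fixes K R T h1 :: real
  assumes d_pos: "d \<ge> 1" and K_pos: "K > 0" and R_nonneg: "R \<ge> 0"
    and convex_far: "\<And>x y. x \<in> Rspace d \<Longrightarrow> y \<in> Rspace d \<Longrightarrow> norm (x - y) \<ge> R \<Longrightarrow>
      inner (x - y) (grad V x - grad V y) \<ge> K * (norm (x - y))\<^sup>2"
    and T_pos: "T > 0" and h1_nonneg: "h1 \<ge> 0"
    and step_cond: "step_condition L K R T h1"
    and inter_cond: "interaction_condition L Lt K R T eps"
begin

definition Rt :: real where "Rt = R_tilde L K R"
definition ell :: real where "ell = eps * Lt"

text \<open>Tested at two points at distance \<open>R + 1\<close>.\<close>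

lemma K_le_L: "K \<le> L"
proof -
  define x where "x = (R + 1) *\<^sub>R basis_vec 0"
  have x: "x \<in> Rspace d" unfolding x_def using d_pos by (intro Rspace_closed basis_vec_in_Rspace) auto
  have nx: "norm x = R + 1"
    using R_nonneg by (simp add: x_def norm_eq_sqrt_inner inner_basis_vec coord_simps coord_basis_vec)
  have "K * (norm x)\<^sup>2 \<le> inner x (grad V x - grad V 0)"
    using convex_far[OF x, of 0] nx by simp
  also have "\<dots> \<le> norm x * norm (grad V x - grad V 0)" by (rule norm_cauchy_schwarz)
  also have "\<dots> \<le> norm x * (L * norm x)" using gradV_lipschitz[of x 0] by (intro mult_left_mono) auto
  finally have "K * (norm x)\<^sup>2 \<le> L * (norm x)\<^sup>2" by (simp add: power2_eq_square mult_ac)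
  moreover have "norm x > 0" using nx R_nonneg by simp
  ultimately show ?thesis by simp
qed

lemma L_pos: "L > 0" using K_pos K_le_L by simp

lemma ell_nonneg: "0 \<le> ell" unfolding ell_def by (rule epsLt_nonneg)

lemma Rt_nonneg: "0 \<le> Rt"
  unfolding Rt_def R_tilde_def using R_nonneg K_pos L_pos by simp

lemma step_bounds: "L * T\<^sup>2 \<le> 3 / 20" "L\<^sup>2 * T\<^sup>2 \<le> 9 / 50 * K" "L * T * Rt \<le> 3 / 80"
proof -
  have T2: "L * T\<^sup>2 \<le> L * (T + h1)\<^sup>2"
    using T_pos h1_nonneg L_pos by (intro mult_left_mono power_mono) auto
  have a: "L * (T + h1)\<^sup>2 \<le> 3 / 5 * (1 / 4)" and b: "L * (T + h1)\<^sup>2 \<le> 3 / 5 * (3 * K / (10 * L))"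
    using step_cond unfolding step_condition_def by (auto split: if_splits)
  show "L * T\<^sup>2 \<le> 3 / 20" using a T2 by simp
  have "L * T\<^sup>2 \<le> 9 * K / (50 * L)" using b T2 by simp
  then show "L\<^sup>2 * T\<^sup>2 \<le> 9 / 50 * K" using L_pos by (simp add: field_simps power2_eq_square)
  show "L * T * Rt \<le> 3 / 80"
  proof (cases "Rt = 0")
    case False
    then have R: "Rt > 0" using Rt_nonneg by simp
    have "L * (T + h1)\<^sup>2 \<le> 3 / 5 * (3 / (256 * 5 * L * Rt\<^sup>2))"
      using step_cond False unfolding step_condition_def Rt_def by (auto split: if_splits)
    then have "L * T\<^sup>2 \<le> 9 / (6400 * L * Rt\<^sup>2)" using T2 by simp
    then have "(L * T * Rt)\<^sup>2 \<le> (3 / 80)\<^sup>2"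
      using R L_pos by (simp add: field_simps power2_eq_square)
    then show ?thesis by (rule power2_le_imp_le) simp
  qed simp
qed

lemma K_T: "K * T\<^sup>2 \<le> 3 / 20"
  using mult_right_mono[OF K_le_L, of "T\<^sup>2"] step_bounds(1) by simp

text \<open>The square in the interaction condition is a multiple of \<open>K * (K * T\<^sup>2) * (1 + Rt / T)\<^sup>2\<close>, in
  which \<open>K * T\<^sup>2\<close> is bounded and the last factor is absorbed by the exponential.\<close>

lemma ell_small: "ell \<le> K / 10000 * exp (- (5 * Rt / (4 * T)))"
proof -
  define a where "a = Rt / T"
  have a: "a \<ge> 0" using Rt_nonneg T_pos by (simp add: a_def)
  have "ell < 1 / 2 * (K * (Rt + T) / (36 * 149))\<^sup>2 * exp (- (5 * a))"
    using inter_cond by (simp add: interaction_condition_def ell_def Rt_def a_def)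
  also have "(K * (Rt + T) / (36 * 149))\<^sup>2 = (K * (K * T\<^sup>2)) * (1 + a)\<^sup>2 / (36 * 149)\<^sup>2"
    using T_pos by (simp add: a_def field_simps power2_eq_square)
  also have "1 / 2 * ((K * (K * T\<^sup>2)) * (1 + a)\<^sup>2 / (36 * 149)\<^sup>2) * exp (- (5 * a))
     \<le> 1 / 2 * ((K * (3 / 20)) * (exp a)\<^sup>2 / (36 * 149)\<^sup>2) * exp (- (5 * a))"
    using K_T K_pos a exp_ge_add_one_self[of a] T_pos
    by (intro mult_right_mono mult_left_mono divide_right_mono mult_mono power_mono) auto
  also have "\<dots> = K * (3 / 40 / (36 * 149)\<^sup>2) * ((exp a)\<^sup>2 * exp (- (5 * a)))" by simp
  also have "(exp a)\<^sup>2 * exp (- (5 * a)) = exp (- (3 * a))"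
    by (simp add: exp_double[symmetric] exp_add[symmetric])
  also have "K * (3 / 40 / (36 * 149)\<^sup>2) * exp (- (3 * a)) \<le> K * (1 / 10000) * exp (- (5 / 4 * a))"
    using K_pos a by (intro mult_mono mult_left_mono) auto
  finally show ?thesis by (simp add: a_def)
qed

lemma ell_le_K: "ell \<le> K / 10000"
proof -
  have "exp (- (5 * Rt / (4 * T))) \<le> 1" using Rt_nonneg T_pos by simp
  then have "K / 10000 * exp (- (5 * Rt / (4 * T))) \<le> K / 10000 * 1"
    using K_pos by (intro mult_left_mono) auto
  then show ?thesis using ell_small by simp
qed

lemma Lip_T: "Lip * T\<^sup>2 \<le> 1 / 4"
proof -
  have "Lip \<le> 5 / 3 * L" using ell_le_K K_le_L K_pos unfolding Lip_def ell_def by linarith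
  then have "Lip * T\<^sup>2 \<le> 5 / 3 * L * T\<^sup>2" by (rule mult_right_mono) simp
  then show ?thesis using step_bounds(1) by simp
qed

text \<open>A bound for the relative size of the displacement that the force on a particle causes during
  one transition.\<close>

definition lam :: real where "lam = (L + 2 * ell) * T\<^sup>2 / 2"

lemma lam_bounds: "0 \<le> lam" "lam \<le> 1 / 13" "L * lam \<le> (901 / 10000) * K" "lam \<le> (5001 / 10000) * (L * T\<^sup>2)"
proof -
  show "0 \<le> lam" using L_pos ell_nonneg by (simp add: lam_def)
  have e: "L + 2 * ell \<le> (5001 / 5000) * L" using ell_le_K K_le_L by simp
  then have "(L + 2 * ell) * T\<^sup>2 \<le> (5001 / 5000) * L * T\<^sup>2" by (intro mult_right_mono) auto
  then show l: "lam \<le> (5001 / 10000) * (L * T\<^sup>2)" unfolding lam_def by linarith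
  then show "lam \<le> 1 / 13" using step_bounds(1) by simp
  have "L * lam \<le> L * ((5001 / 10000) * (L * T\<^sup>2))" using l L_pos by (intro mult_left_mono) auto
  also have "\<dots> = (5001 / 10000) * (L\<^sup>2 * T\<^sup>2)" by (simp add: power2_eq_square)
  also have "\<dots> \<le> (5001 / 10000) * (9 / 50 * K)" using step_bounds(2) by (intro mult_left_mono) auto
  finally show "L * lam \<le> (901 / 10000) * K" using K_pos by simp
qed

text \<open>At distance less than \<open>R\<close> the lower bound fails by at most \<open>(L + K) * R\<^sup>2\<close>, and \<open>Rt\<close> is chosen
  such that this equals \<open>K / 64 * Rt\<^sup>2\<close>.\<close>

lemma convex_defect:
  assumes "x \<in> Rspace d" "y \<in> Rspace d" "Rt \<le> r"
  shows "inner (x - y) (grad V x - grad V y) \<ge> K * (norm (x - y))\<^sup>2 - K / 64 * r\<^sup>2"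
proof (cases "norm (x - y) \<ge> R")
  case True
  have "0 \<le> K / 64 * r\<^sup>2" using K_pos by simp
  then show ?thesis using convex_far[OF assms(1,2) True] by linarith
next
  case False
  have "- (norm (x - y) * norm (grad V x - grad V y)) \<le> inner (x - y) (grad V x - grad V y)"
    using Cauchy_Schwarz_ineq2[of "x - y" "grad V x - grad V y"] by linarith
  moreover have "norm (x - y) * norm (grad V x - grad V y) \<le> L * (norm (x - y))\<^sup>2"
    using mult_left_mono[OF gradV_lipschitz[of x y], of "norm (x - y)"] by (simp add: power2_eq_square mult_ac)
  moreover have "(L + K) * (norm (x - y))\<^sup>2 \<le> K / 64 * r\<^sup>2"
  proof -
    have "(L + K) * (norm (x - y))\<^sup>2 \<le> (L + K) * R\<^sup>2"
      using False L_pos K_pos by (intro mult_left_mono power_mono) auto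
    also have "\<dots> = K / 64 * Rt\<^sup>2"
      using L_pos K_pos by (simp add: Rt_def R_tilde_def power_mult_distrib)
    also have "\<dots> \<le> K / 64 * r\<^sup>2"
      using assms(3) Rt_nonneg K_pos by (intro mult_left_mono power_mono) auto
    finally show ?thesis .
  qed
  ultimately show ?thesis by (simp add: algebra_simps)
qed

end

section \<open>Two parallel Verlet trajectories\<close>

text \<open>Two Verlet trajectories with the same step size that run up to time \<open>T\<close>. For the difference of
  the two positions of one particle, \<open>maxq\<close> is its largest norm along the way and \<open>free\<close> is the
  value that this norm would have at most in free flight. The contribution \<open>iota\<close> of the other
  particles is the same for all particles.\<close>

locale trajectory_pair = hmc +
  fixes h :: real and m :: nat and zx zy :: phase
  assumes h_pos: "h > 0" and mh: "real m * h = T"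
    and zx: "fst zx \<in> configs n d" "snd zx \<in> configs n d"
    and zy: "fst zy \<in> configs n d" "snd zy \<in> configs n d"
begin

definition dq :: "nat \<Rightarrow> nat \<Rightarrow> ell2"
  where "dq k i = fst (verlet h k zx) i - fst (verlet h k zy) i"
definition dp :: "nat \<Rightarrow> nat \<Rightarrow> ell2"
  where "dp k i = snd (verlet h k zx) i - snd (verlet h k zy) i"
definition df :: "nat \<Rightarrow> nat \<Rightarrow> ell2"
  where "df k i = force i (fst (verlet h k zx)) - force i (fst (verlet h k zy))"
definition dg :: "nat \<Rightarrow> nat \<Rightarrow> ell2"
  where "dg k i = grad V (fst (verlet h k zx) i) - grad V (fst (verlet h k zy) i)"
definition maxq :: "nat \<Rightarrow> real"
  where "maxq i = Max ((\<lambda>k. norm (dq k i)) ` {..m})"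
definition iota :: real
  where "iota = ell * T\<^sup>2 / real n * (\<Sum>j<n. maxq j)"
definition free :: "nat \<Rightarrow> real"
  where "free i = max (norm (dq 0 i)) (norm (dq 0 i + T *\<^sub>R dp 0 i))"

lemma dq_Suc: "i < n \<Longrightarrow> dq (Suc k) i = dq k i + h *\<^sub>R dp k i - (h\<^sup>2 / 2) *\<^sub>R df k i"
  by (simp add: dq_def dp_def df_def verlet_Suc fst_vstep algebra_simps)

lemma dp_Suc: "i < n \<Longrightarrow> dp (Suc k) i = dp k i - (h / 2) *\<^sub>R (df k i + df (Suc k) i)"
  by (simp add: dp_def df_def verlet_Suc snd_vstep algebra_simps)

lemma dq_le_maxq: "k \<le> m \<Longrightarrow> norm (dq k i) \<le> maxq i"
  unfolding maxq_def by (intro Max_ge) auto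

lemma maxq_attained: "\<exists>k\<le>m. maxq i = norm (dq k i)"
proof -
  have "maxq i \<in> (\<lambda>k. norm (dq k i)) ` {..m}" unfolding maxq_def by (intro Max_in) auto
  then show ?thesis by auto
qed

lemma maxq_nonneg: "0 \<le> maxq i" using maxq_attained[of i] by auto

lemma iota_nonneg: "0 \<le> iota"
  unfolding iota_def using ell_nonneg maxq_nonneg by (simp add: sum_nonneg)

lemma df_bound: assumes "i < n" "k \<le> m" shows "norm (df k i) \<le> coup (maxq i) (\<Sum>j<n. maxq j)"
proof -
  have "norm (df k i) \<le> coup (norm (dq k i)) (\<Sum>j<n. norm (dq k j))"
    unfolding df_def dq_def by (rule force_lipschitz[OF assms(1)])
  also have "\<dots> \<le> coup (maxq i) (\<Sum>j<n. maxq j)"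
    using assms by (intro coup_mono sum_mono dq_le_maxq)
  finally show ?thesis .
qed

lemma coup_maxq: "T\<^sup>2 / 2 * coup (maxq i) (\<Sum>j<n. maxq j) = lam * maxq i + iota"
  by (simp add: coup_def lam_def iota_def ell_def algebra_simps)

lemma time_le: "k \<le> m \<Longrightarrow> real k * h \<le> T" unfolding mh[symmetric] using h_pos by (intro mult_right_mono) auto

text \<open>The discrete Duhamel formula with the bound \<open>coup\<close> for the difference of the forces.\<close>

lemma deviation:
  assumes i: "i < n" and k: "k \<le> m"
  shows "norm (dq k i - (dq 0 i + (real k * h) *\<^sub>R dp 0 i)) \<le> lam * maxq i + iota"
proof -
  have "norm (dq k i - (dq 0 i + (real k * h) *\<^sub>R dp 0 i)) \<le> (real k * h)\<^sup>2 / 2 * coup (maxq i) (\<Sum>j<n. maxq j)"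
    by (rule verlet_deviation[where m=m and z="\<lambda>k. dq k i" and w="\<lambda>k. dp k i" and g="\<lambda>k. df k i"])
       (use i k dq_Suc dp_Suc df_bound in auto)
  also have "\<dots> \<le> T\<^sup>2 / 2 * coup (maxq i) (\<Sum>j<n. maxq j)"
    using time_le[OF k] h_pos maxq_nonneg
    by (intro mult_right_mono divide_right_mono power_mono coup_nonneg sum_nonneg) auto
  finally show ?thesis by (simp only: coup_maxq)
qed

text \<open>As \<open>lam \<le> 1 / 13\<close>, the term \<open>lam * maxq i\<close> of \<open>deviation\<close> can be absorbed, which leaves the
  factor \<open>13 / 12\<close>.\<close>

lemma maxq_le: assumes i: "i < n" shows "maxq i \<le> 13 / 12 * (free i + iota)"
proof -
  obtain k where k: "k \<le> m" "maxq i = norm (dq k i)" using maxq_attained by blast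
  have "norm (dq k i) \<le> norm (dq k i - (dq 0 i + (real k * h) *\<^sub>R dp 0 i)) + norm (dq 0 i + (real k * h) *\<^sub>R dp 0 i)"
    using norm_triangle_sub[of "dq k i" "dq 0 i + (real k * h) *\<^sub>R dp 0 i"] by simp
  also have "\<dots> \<le> (lam * maxq i + iota) + free i"
    unfolding free_def using time_le[OF k(1)] h_pos T_pos
    by (intro add_mono deviation[OF i k(1)] norm_segment_le) auto
  also have "lam * maxq i \<le> 1 / 13 * maxq i"
    by (rule mult_right_mono[OF lam_bounds(2) maxq_nonneg])
  finally show ?thesis using k(2) by simp
qed

lemma sum_maxq_le: "(\<Sum>j<n. maxq j) \<le> (6 / 5) * (\<Sum>j<n. free j)"
proof -
  let ?A = "\<Sum>j<n. maxq j" and ?F = "\<Sum>j<n. free j"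
  have A: "0 \<le> ?A" by (intro sum_nonneg maxq_nonneg)
  have "?A \<le> (\<Sum>j<n. 13 / 12 * (free j + iota))" by (intro sum_mono maxq_le) auto
  also have "\<dots> = 13 / 12 * (?F + real n * iota)" by (simp only: sum_distrib_left[symmetric] sum.distrib) simp
  also have "real n * iota = ell * T\<^sup>2 * ?A" using n_pos by (simp add: iota_def)
  also have "ell * T\<^sup>2 \<le> 1 / 100"
  proof -
    have "ell * T\<^sup>2 \<le> K / 10000 * T\<^sup>2" using ell_le_K by (intro mult_right_mono) auto
    then show ?thesis using K_T by simp
  qed
  finally have "?A \<le> 13 / 12 * (?F + 1 / 100 * ?A)" using A by (simp add: mult_right_mono)
  then show ?thesis using A by simp
qed

lemma sum_iota: "real n * iota \<le> (6 / 5) * (ell * T\<^sup>2) * (\<Sum>j<n. free j)"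
proof -
  have "real n * iota = ell * T\<^sup>2 * (\<Sum>j<n. maxq j)" using n_pos by (simp add: iota_def)
  also have "\<dots> \<le> ell * T\<^sup>2 * ((6 / 5) * (\<Sum>j<n. free j))"
    using ell_nonneg by (intro mult_left_mono sum_maxq_le) auto
  finally show ?thesis by simp
qed

lemma final_distance:
  assumes i: "i < n"
  shows "norm (dq m i) \<le> norm (dq 0 i + T *\<^sub>R dp 0 i) + 13 / 12 * lam * free i + 13 / 12 * iota"
proof -
  have "norm (dq m i) \<le> norm (dq 0 i + T *\<^sub>R dp 0 i) + (lam * maxq i + iota)"
    using norm_triangle_sub[of "dq m i" "dq 0 i + T *\<^sub>R dp 0 i"] deviation[OF i order_refl] by (simp add: mh)
  also have "lam * maxq i \<le> lam * (13 / 12 * (free i + iota))"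
    by (rule mult_left_mono[OF maxq_le[OF i] lam_bounds(1)])
  also have "\<dots> \<le> 13 / 12 * lam * free i + 1 / 12 * iota"
    using mult_right_mono[OF lam_bounds(2) iota_nonneg] by (simp add: algebra_simps)
  finally show ?thesis by simp
qed

end

text \<open>The variables \<open>x\<close>, \<open>y\<close> and \<open>i\<close> stand for \<open>K * T\<^sup>2\<close>, \<open>L * T\<^sup>2\<close> and \<open>iota\<close>. The difference of
  the two sides is a quadratic form in \<open>r\<close> and \<open>i\<close> all of whose coefficients are nonnegative in the
  given range. The coefficient \<open>1351 / 10000\<close> collects the two second-order remainders of
  \<open>far_contraction\<close>.\<close>

lemma far_polynomial:
  fixes r i x y :: real
  assumes r: "0 \<le> r" and i: "0 \<le> i" and x: "0 \<le> x" "x \<le> 3 / 20" and y: "0 \<le> y" "y \<le> 3 / 20"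
  shows "r\<^sup>2 - 63 / 64 * x * r\<^sup>2 + 2 * x * r * ((r + i) / 12 + i) + x * (1351 / 10000) * (169 / 144) * (r + i)\<^sup>2
     + 13 / 12 * y * i * (r + i) \<le> ((1 - 3 / 10 * x) * r + 2 * i)\<^sup>2"
proof -
  define k :: real where "k = (1351 / 10000) * (169 / 144)"
  have k: "0 \<le> k" "k \<le> (4 / 25)" by (auto simp: k_def)
  have kx: "0 \<le> k * x" "k * x \<le> (4 / 25) * (3 / 20)"
    using k x mult_mono[of k "(4 / 25)" x "(3 / 20)"] by auto
  have "((1 - 3 / 10 * x) * r + 2 * i)\<^sup>2 - (r\<^sup>2 - 63 / 64 * x * r\<^sup>2 + 2 * x * r * ((r + i) / 12 + i)
      + x * k * (r + i)\<^sup>2 + 13 / 12 * y * i * (r + i))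
    = r\<^sup>2 * (x * (63 / 64 - 3 / 5 - 1 / 6 - k) + 9 / 100 * x\<^sup>2)
      + r * i * (4 * (1 - 3 / 10 * x) - x * (1 / 6 + 2) - 2 * (k * x) - 13 / 12 * y)
      + i\<^sup>2 * (4 - k * x - 13 / 12 * y)"
    by (simp add: power2_eq_square field_simps)
  also have "\<dots> \<ge> 0"
    using assms k kx by (intro add_nonneg_nonneg mult_nonneg_nonneg) auto
  finally show ?thesis by (simp add: k_def mult.assoc)
qed

context trajectory_pair
begin

text \<open>At large distance the trajectories start with equal velocities. The convexity of \<open>V\<close> is used
  along the whole trajectory, and \<open>convex_defect\<close> covers the times at which the particles are closer
  than \<open>R\<close>.\<close>

lemma far_contraction:
  assumes i: "i < n" and p0: "dp 0 i = 0" and far: "Rt \<le> norm (dq 0 i)"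
  shows "norm (dq m i) \<le> (1 - K * T\<^sup>2 / 4) * norm (dq 0 i) + (31 / 10) * iota"
proof -
  define z where "z = dq 0 i"
  define r where "r = norm z"
  define A where "A = maxq i"
  define D where "D = lam * A + iota"
  define c where "c = verlet_weight h m"
  have r: "0 \<le> r" and A: "0 \<le> A" and D: "0 \<le> D" and io: "0 \<le> iota"
    using maxq_nonneg iota_nonneg lam_bounds(1) by (auto simp: r_def A_def D_def)
  have c: "0 \<le> c j" for j by (simp add: c_def verlet_weight_nonneg)
  have sc: "(\<Sum>j<m. c j) = T\<^sup>2 / 2" by (simp add: c_def sum_verlet_weight mh)
  have free: "free i = r" using p0 by (simp add: free_def r_def z_def)
  have Aq: "A \<le> 13 / 12 * (r + iota)" using maxq_le[OF i] by (simp add: free A_def)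
  have Dq: "D \<le> (r + iota) / 12 + iota"
  proof -
    have "lam * A \<le> 1 / 13 * (13 / 12 * (r + iota))" using lam_bounds(1,2) Aq A by (intro mult_mono) auto
    then show ?thesis by (simp add: D_def)
  qed
  have dev: "norm (dq j i - z) \<le> D" if "j \<le> m" for j
    using deviation[OF i that] p0 by (simp add: z_def A_def D_def)
  have dg: "norm (dg j i) \<le> L * A" if "j < m" for j
  proof -
    have "norm (dg j i) \<le> L * norm (dq j i)" unfolding dg_def dq_def by (rule gradV_lipschitz)
    also have "\<dots> \<le> L * A" unfolding A_def using that L_pos by (intro mult_left_mono dq_le_maxq) auto
    finally show ?thesis .
  qed
  have conf: "fst (verlet h j zx) i \<in> Rspace d" "fst (verlet h j zy) i \<in> Rspace d" for j
    using verlet_configs[OF zx, of h j] verlet_configs[OF zy, of h j] configsD i by blast+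
  \<comment> \<open>A lower bound, uniform in time, for the pull towards the partner in the initial direction.\<close>
  define Low where "Low = K * (r\<^sup>2 - 2 * r * D) - K / 64 * r\<^sup>2 - D * (L * A)"
  have low: "Low \<le> inner z (dg j i)" if j: "j < m" for j
  proof -
    have sq: "r\<^sup>2 - 2 * r * D \<le> (norm (dq j i))\<^sup>2"
    proof -
      define \<delta> where "\<delta> = dq j i - z"
      have "(norm (dq j i))\<^sup>2 = (norm (z + \<delta>))\<^sup>2" by (simp add: \<delta>_def)
      also have "\<dots> = r\<^sup>2 + 2 * inner z \<delta> + (norm \<delta>)\<^sup>2"
        by (simp add: r_def power2_norm_eq_inner inner_add_left inner_add_right inner_commute)
      moreover have "- (r * D) \<le> inner z \<delta>"
      proof -
        have "\<bar>inner z \<delta>\<bar> \<le> r * norm \<delta>" unfolding r_def by (rule Cauchy_Schwarz_ineq2)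
        also have "\<dots> \<le> r * D" using dev[of j] j r by (intro mult_left_mono) (auto simp: \<delta>_def)
        finally show ?thesis by linarith
      qed
      ultimately show ?thesis using zero_le_power2[of "norm \<delta>"] by linarith
    qed
    have "\<bar>inner (dq j i - z) (dg j i)\<bar> \<le> norm (dq j i - z) * norm (dg j i)" by (rule Cauchy_Schwarz_ineq2)
    also have "\<dots> \<le> D * (L * A)" using dev[of j] dg[OF j] j D by (intro mult_mono) auto
    finally have "inner (dq j i) (dg j i) - D * (L * A) \<le> inner z (dg j i)"
      by (simp add: inner_diff_left)
    moreover have "K * (norm (dq j i))\<^sup>2 - K / 64 * r\<^sup>2 \<le> inner (dq j i) (dg j i)"
      unfolding dq_def dg_def by (rule convex_defect[OF conf]) (use far in \<open>simp add: r_def z_def\<close>)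
    moreover have "K * (r\<^sup>2 - 2 * r * D) \<le> K * (norm (dq j i))\<^sup>2" using sq K_pos by (intro mult_left_mono) auto
    ultimately show ?thesis unfolding Low_def by linarith
  qed
  define g where "g = (\<Sum>j<m. c j *\<^sub>R dg j i)"
  have gz: "T\<^sup>2 / 2 * Low \<le> inner z g"
  proof -
    have "T\<^sup>2 / 2 * Low = (\<Sum>j<m. c j * Low)" by (simp only: sum_distrib_right[symmetric] sc)
    also have "\<dots> \<le> (\<Sum>j<m. c j * inner z (dg j i))" using low c by (intro sum_mono mult_left_mono) auto
    finally show ?thesis by (simp add: g_def inner_sum_right)
  qed
  have gn: "norm g \<le> T\<^sup>2 / 2 * (L * A)"
  proof -
    have "norm g \<le> (\<Sum>j<m. c j * (L * A))"
      unfolding g_def using dg c by (intro sum_norm_le) (auto intro!: mult_left_mono)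
    then show ?thesis by (simp only: sum_distrib_right[symmetric] sc)
  qed
  define x where "x = K * T\<^sup>2"
  define y where "y = L * T\<^sup>2"
  have x: "0 \<le> x" "x \<le> 3 / 20" and y: "0 \<le> y" "y \<le> 3 / 20"
    using K_T step_bounds(1) K_pos L_pos by (auto simp: x_def y_def)
  have A2: "A\<^sup>2 \<le> 169 / 144 * (r + iota)\<^sup>2"
    using power_mono[OF Aq A, of 2] unfolding power_mult_distrib by (simp add: power_divide)
  have "(norm (z - g))\<^sup>2 = r\<^sup>2 - 2 * inner z g + (norm g)\<^sup>2"
    by (simp add: r_def power2_norm_eq_inner inner_diff_left inner_diff_right inner_commute)
  also have "\<dots> \<le> r\<^sup>2 - T\<^sup>2 * Low + (T\<^sup>2 / 2 * (L * A))\<^sup>2"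
    using gz power_mono[OF gn norm_ge_zero, of 2] by simp
  also have "\<dots> = r\<^sup>2 - 63 / 64 * x * r\<^sup>2 + 2 * x * r * D + T\<^sup>2 * (D * (L * A)) + (T\<^sup>2 / 2 * (L * A))\<^sup>2"
    by (simp add: Low_def x_def algebra_simps)
  also have "\<dots> \<le> r\<^sup>2 - 63 / 64 * x * r\<^sup>2 + 2 * x * r * ((r + iota) / 12 + iota)
      + (x * (901 / 10000) * (169 / 144) * (r + iota)\<^sup>2 + 13 / 12 * y * iota * (r + iota))
      + x * (450 / 10000) * (169 / 144) * (r + iota)\<^sup>2"
  proof (intro add_mono order_refl)
    show "2 * x * r * D \<le> 2 * x * r * ((r + iota) / 12 + iota)" using Dq x r by (intro mult_left_mono) auto
    have "T\<^sup>2 * (D * (L * A)) = T\<^sup>2 * ((L * lam) * A\<^sup>2) + y * iota * A"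
      by (simp add: D_def y_def power2_eq_square algebra_simps)
    also have "T\<^sup>2 * ((L * lam) * A\<^sup>2) \<le> T\<^sup>2 * (((901 / 10000) * K) * (169 / 144 * (r + iota)\<^sup>2))"
      using K_pos by (intro mult_left_mono mult_mono[OF lam_bounds(3) A2]) auto
    also have "\<dots> = x * (901 / 10000) * (169 / 144) * (r + iota)\<^sup>2" by (simp add: x_def)
    also have "y * iota * A \<le> 13 / 12 * y * iota * (r + iota)"
    proof -
      have "y * iota * A \<le> y * iota * (13 / 12 * (r + iota))" using Aq y io by (intro mult_left_mono) auto
      also have "\<dots> = 13 / 12 * y * iota * (r + iota)" by (simp only: mult_ac)
      finally show ?thesis .
    qed
    finally show "T\<^sup>2 * (D * (L * A)) \<le> x * (901 / 10000) * (169 / 144) * (r + iota)\<^sup>2 + 13 / 12 * y * iota * (r + iota)"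
      by simp
    have "(T\<^sup>2 / 2 * (L * A))\<^sup>2 = T\<^sup>2 * ((L\<^sup>2 * T\<^sup>2) * A\<^sup>2) / 4" by (simp add: power2_eq_square)
    also have "\<dots> \<le> T\<^sup>2 * ((9 / 50 * K) * (169 / 144 * (r + iota)\<^sup>2)) / 4"
      using K_pos by (intro divide_right_mono mult_left_mono mult_mono[OF step_bounds(2) A2]) auto
    also have "\<dots> = x * (450 / 10000) * (169 / 144) * (r + iota)\<^sup>2" by (simp add: x_def)
    finally show "(T\<^sup>2 / 2 * (L * A))\<^sup>2 \<le> x * (450 / 10000) * (169 / 144) * (r + iota)\<^sup>2" .
  qed
  also have "\<dots> = r\<^sup>2 - 63 / 64 * x * r\<^sup>2 + 2 * x * r * ((r + iota) / 12 + iota)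
      + x * (1351 / 10000) * (169 / 144) * (r + iota)\<^sup>2 + 13 / 12 * y * iota * (r + iota)" by simp
  also have "\<dots> \<le> ((1 - 3 / 10 * x) * r + 2 * iota)\<^sup>2" by (rule far_polynomial[OF r io x y])
  finally have v: "norm (z - g) \<le> (1 - 3 / 10 * x) * r + 2 * iota"
    by (rule power2_le_imp_le) (use x r io in auto)
  \<comment> \<open>What remains of the force after the confining part is the interaction, which is small.\<close>
  define e where "e = (\<Sum>j<m. c j *\<^sub>R (df j i - dg j i))"
  have en: "norm e \<le> ell * T\<^sup>2 * A + iota"
  proof -
    have "norm (df j i - dg j i) \<le> 2 * ell * A + 2 * ell / real n * (\<Sum>j<n. maxq j)" if j: "j < m" for j
    proof -
      have "norm (df j i - dg j i) \<le> 2 * ell * norm (dq j i) + 2 * ell / real n * (\<Sum>k<n. norm (dq j k))"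
        unfolding df_def dg_def dq_def ell_def by (rule interaction_lipschitz[OF i])
      also have "\<dots> \<le> 2 * ell * A + 2 * ell / real n * (\<Sum>j<n. maxq j)"
        using j ell_nonneg unfolding A_def by (intro add_mono mult_left_mono sum_mono dq_le_maxq) auto
      finally show ?thesis .
    qed
    then have "norm e \<le> (\<Sum>j<m. c j * (2 * ell * A + 2 * ell / real n * (\<Sum>j<n. maxq j)))"
      unfolding e_def using c by (intro sum_norm_le) (auto intro!: mult_left_mono)
    also have "\<dots> = ell * T\<^sup>2 * A + iota"
      unfolding sum_distrib_right[symmetric] sc iota_def by (simp add: algebra_simps)
    finally show ?thesis .
  qed
  have "dq m i = z + (real m * h) *\<^sub>R dp 0 i - (\<Sum>j<m. c j *\<^sub>R df j i)"
    unfolding c_def z_def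
    by (rule verlet_summation[where m=m and z="\<lambda>k. dq k i" and w="\<lambda>k. dp k i"]) (use i dq_Suc dp_Suc in auto)
  also have "\<dots> = (z - g) - e"
    by (simp add: p0 g_def e_def scaleR_diff_right sum_subtractf)
  finally have "norm (dq m i) \<le> norm (z - g) + norm e" by (metis norm_triangle_ineq4)
  also have "\<dots> \<le> ((1 - 3 / 10 * x) * r + 2 * iota) + (ell * T\<^sup>2 * A + iota)" by (intro add_mono v en)
  also have "ell * T\<^sup>2 * A \<le> (x / 10000) * (13 / 12 * (r + iota))"
    using mult_right_mono[OF ell_le_K, of "T\<^sup>2"] ell_nonneg Aq A K_pos unfolding x_def by (intro mult_mono) auto
  also have "\<dots> \<le> x / 100 * r + 1 / 100 * iota"
    using mult_right_mono[OF x(2) io] mult_nonneg_nonneg[OF x(1) r] io by (simp add: algebra_simps)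
  finally show ?thesis using mult_nonneg_nonneg[OF x(1) r] io
    unfolding r_def[symmetric] z_def[symmetric] x_def[symmetric] by (simp add: algebra_simps)
qed

end

section \<open>Moments of the coupling\<close>

text \<open>Given the velocity, a shift is accepted with probability \<open>min 1 (exp (- \<tau>))\<close>, where
  \<open>\<tau> = inner x a + (norm a)\<^sup>2 / 2\<close>, so it is rejected with probability at most \<open>max 0 \<tau>\<close>.\<close>

lemma rejected_integral_le:
  assumes a: "a \<in> Rspace d" and g: "g \<in> borel_measurable (Rborel d)"
  shows "(\<integral>\<^sup>+w. (if rejected a w then g (fst w) else 0) \<partial>GU d)
    \<le> (\<integral>\<^sup>+x. ennreal (norm a * max 0 (inner x (sgn a) + norm a / 2)) * g x \<partial>Gau d)"
proof (cases "a = 0")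
  case False
  have m: "(\<lambda>w. if rejected a w then g (fst w) else 0) \<in> borel_measurable (GU d)"
    using measurable_compose[OF fst_GU g] by measurable
  have "(\<integral>\<^sup>+w. (if rejected a w then g (fst w) else 0) \<partial>GU d)
     = (\<integral>\<^sup>+x. \<integral>\<^sup>+u. (if accept_prob a x < u then g x else 0) \<partial>Unif \<partial>Gau d)"
    unfolding nn_integral_GU[OF m] unfolding rejected_def fst_conv snd_conv using False by simp
  also have "\<dots> = (\<integral>\<^sup>+x. ennreal (1 - min 1 (accept_prob a x)) * g x \<partial>Gau d)"
    using nn_integral_Unif_threshold[of "accept_prob a _" "g _" 0] by (intro nn_integral_cong) (simp add: accept_prob_def)
  also have "\<dots> \<le> (\<integral>\<^sup>+x. ennreal (norm a * max 0 (inner x (sgn a) + norm a / 2)) * g x \<partial>Gau d)"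
  proof (intro nn_integral_mono mult_right_mono ennreal_leI)
    fix x
    have "norm a * (inner x (sgn a) + norm a / 2) = inner x a + (norm a)\<^sup>2 / 2"
      using False by (simp add: sgn_div_norm field_simps power2_eq_square)
    moreover have "1 - accept_prob a x \<le> inner x a + (norm a)\<^sup>2 / 2"
      using exp_ge_add_one_self[of "- (inner x a + (norm a)\<^sup>2 / 2)"] unfolding accept_prob_def by linarith
    ultimately have r: "1 - accept_prob a x \<le> norm a * max 0 (inner x (sgn a) + norm a / 2)"
      using mult_left_mono[of "inner x (sgn a) + norm a / 2" "max 0 (inner x (sgn a) + norm a / 2)" "norm a"] by simp
    show "1 - min 1 (accept_prob a x) \<le> norm a * max 0 (inner x (sgn a) + norm a / 2)"
    proof (cases "1 \<le> accept_prob a x")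
      case True
      then have "1 - min 1 (accept_prob a x) = 0" by simp
      also have "\<dots> \<le> norm a * max 0 (inner x (sgn a) + norm a / 2)" by (intro mult_nonneg_nonneg) auto
      finally show ?thesis .
    next
      case False
      then have "1 - min 1 (accept_prob a x) = 1 - accept_prob a x" by simp
      then show ?thesis using r by (simp only:)
    qed
  qed simp
  finally show ?thesis .
qed (simp add: rejected_def)

lemma sgn_direction: "a \<in> Rspace d \<Longrightarrow> a \<noteq> 0 \<Longrightarrow> sgn a \<in> Rspace d \<and> norm (sgn a) = 1"
  by (simp add: sgn_div_norm norm_sgn)

text \<open>The majorant \<open>(y + 1)\<^sup>2 / 4\<close> of \<open>max 0 y\<close> replaces the tail of the normal law by its second
  moment. The resulting factor \<open>(1 + (1 + s / 2)\<^sup>2) / 4\<close> with \<open>s = norm a\<close> is below \<open>57 / 100\<close> for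
  \<open>s \<le> 1 / 4\<close>. It has to be well below one, since the rejection costs compete with the gain of an
  accepted shift.\<close>

lemma reject_probability:
  assumes a: "a \<in> Rspace d" and s: "norm a \<le> 1 / 4"
  shows "(\<integral>\<^sup>+w. (if rejected a w then 1 else 0) \<partial>GU d) \<le> ennreal ((57 / 100) * norm a)"
proof (cases "a = 0")
  case False
  let ?s = "norm a"
  note e = sgn_direction[OF a False]
  have "(\<integral>\<^sup>+w. (if rejected a w then 1 else 0) \<partial>GU d)
     \<le> (\<integral>\<^sup>+x. ennreal (?s * max 0 (inner x (sgn a) + ?s / 2)) * 1 \<partial>Gau d)"
    using rejected_integral_le[OF a, of "\<lambda>_. 1"] by simp
  also have "\<dots> \<le> (\<integral>\<^sup>+x. ennreal (?s / 4) * ennreal ((inner x (sgn a) + (1 + ?s / 2))\<^sup>2) \<partial>Gau d)"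
  proof (rule nn_integral_mono)
    fix x
    have "max 0 y \<le> (y + 1)\<^sup>2 / 4" for y :: real
      using zero_le_power2[of "y - 1"] zero_le_power2[of "y + 1"] by (auto simp: max_def power2_eq_square algebra_simps)
    from this[of "inner x (sgn a) + ?s / 2"]
    have "?s * max 0 (inner x (sgn a) + ?s / 2) \<le> ?s * ((inner x (sgn a) + (1 + ?s / 2))\<^sup>2 / 4)"
      by (intro mult_left_mono) (auto simp: add_ac)
    then show "ennreal (?s * max 0 (inner x (sgn a) + ?s / 2)) * 1 \<le> ennreal (?s / 4) * ennreal ((inner x (sgn a) + (1 + ?s / 2))\<^sup>2)"
      by (simp add: ennreal_mult[symmetric] ennreal_leI)
  qed
  also have "\<dots> = ennreal (?s / 4) * ennreal (1 + (1 + ?s / 2)\<^sup>2)"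
    by (subst nn_integral_cmult) (use nn_integral_Gau_quadratic[of "sgn a" d "1 + ?s / 2"] e in \<open>auto intro!: measurable_compose[OF _ measurable_ennreal]\<close>)
  also have "\<dots> = ennreal (?s / 4 * (1 + (1 + ?s / 2)\<^sup>2))" by (subst ennreal_mult[symmetric]) auto
  also have "\<dots> \<le> ennreal ((57 / 100) * ?s)"
  proof (rule ennreal_leI)
    have "(1 + ?s / 2)\<^sup>2 \<le> (1 + 1 / 8)\<^sup>2" using s by (intro power_mono) auto
    then have "1 + (1 + ?s / 2)\<^sup>2 \<le> (57 / 25)" by (simp add: power2_eq_square)
    then have "?s / 4 * (1 + (1 + ?s / 2)\<^sup>2) \<le> ?s / 4 * (57 / 25)" by (intro mult_left_mono) auto
    then show "?s / 4 * (1 + (1 + ?s / 2)\<^sup>2) \<le> (57 / 100) * ?s" by simp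
  qed
  finally show ?thesis .
qed (simp add: rejected_def)

text \<open>A rejected velocity is reflected, so the two velocities then differ by twice its component
  along the shift.\<close>

lemma reject_component:
  assumes a: "a \<in> Rspace d" and s: "norm a \<le> 1 / 4"
  shows "(\<integral>\<^sup>+w. (if rejected a w then ennreal \<bar>inner (fst w) (sgn a)\<bar> else 0) \<partial>GU d) \<le> ennreal ((51 / 50) * norm a)"
proof (cases "a = 0")
  case False
  let ?s = "norm a" and ?e = "sgn a"
  note e = sgn_direction[OF a False]
  have "(\<integral>\<^sup>+w. (if rejected a w then ennreal \<bar>inner (fst w) ?e\<bar> else 0) \<partial>GU d)
     \<le> (\<integral>\<^sup>+x. ennreal (?s * max 0 (inner x ?e + ?s / 2)) * ennreal \<bar>inner x ?e\<bar> \<partial>Gau d)"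
    by (rule rejected_integral_le[OF a]) (intro measurable_on_Rborel, measurable)
  also have "\<dots> \<le> (\<integral>\<^sup>+x. ennreal (?s / 2) * ennreal ((inner x ?e + ?s / 2)\<^sup>2) + ennreal (?s / 2) * ennreal ((inner x ?e + 0)\<^sup>2) \<partial>Gau d)"
  proof (rule nn_integral_mono)
    fix x
    have "max 0 y * \<bar>u\<bar> \<le> (y\<^sup>2 + u\<^sup>2) / 2" for y u :: real
      using zero_le_power2[of "y - \<bar>u\<bar>"] by (auto simp: max_def power2_diff)
    from mult_left_mono[OF this[of "inner x ?e + ?s / 2" "inner x ?e"], of ?s]
    have "?s * max 0 (inner x ?e + ?s / 2) * \<bar>inner x ?e\<bar> \<le> ?s / 2 * (inner x ?e + ?s / 2)\<^sup>2 + ?s / 2 * (inner x ?e + 0)\<^sup>2"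
      by (simp add: algebra_simps add_divide_distrib)
    then show "ennreal (?s * max 0 (inner x ?e + ?s / 2)) * ennreal \<bar>inner x ?e\<bar>
       \<le> ennreal (?s / 2) * ennreal ((inner x ?e + ?s / 2)\<^sup>2) + ennreal (?s / 2) * ennreal ((inner x ?e + 0)\<^sup>2)"
      by (simp add: ennreal_mult[symmetric] ennreal_plus[symmetric] ennreal_leI del: ennreal_plus)
  qed
  also have "\<dots> = ennreal (?s / 2) * ennreal (1 + (?s / 2)\<^sup>2) + ennreal (?s / 2) * ennreal (1 + 0\<^sup>2)"
  proof -
    have m: "(\<lambda>x. ennreal ((inner x ?e + c)\<^sup>2)) \<in> borel_measurable (Gau d)" for c by measurable
    show ?thesis
      using e m by (simp add: nn_integral_add nn_integral_cmult nn_integral_Gau_quadratic del: add_0_right)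
  qed
  also have "\<dots> = ennreal (?s / 2 * (1 + (?s / 2)\<^sup>2) + ?s / 2)"
    by (simp add: ennreal_mult[symmetric] ennreal_plus[symmetric] del: ennreal_plus)
  also have "\<dots> \<le> ennreal ((51 / 50) * ?s)"
  proof (rule ennreal_leI)
    have "(?s / 2)\<^sup>2 \<le> (1 / 8)\<^sup>2" using s by (intro power_mono) auto
    then have "?s / 2 * (1 + (?s / 2)\<^sup>2) \<le> ?s / 2 * (51 / 50)" by (intro mult_left_mono) (auto simp: power2_eq_square)
    then show "?s / 2 * (1 + (?s / 2)\<^sup>2) + ?s / 2 \<le> (51 / 50) * ?s" using norm_ge_zero[of a] by linarith
  qed
  finally show ?thesis .
qed (simp add: rejected_def)

lemma partner_difference:
  "fst w - partner a w = (if rejected a w then (2 * inner (fst w) (sgn a)) *\<^sub>R sgn a else - a)"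
  by (simp add: partner_def reflect_def)

lemma partner_distance_measurable [measurable]:
  "(\<lambda>w. norm (fst w - partner a w)) \<in> borel_measurable (GU d)"
proof -
  have [measurable]: "(\<lambda>w. partner a w) \<in> borel_measurable (GU d)"
    using partner_measurable_joint(1)[of "\<lambda>_. a" "GU d" fst snd] by simp
  show ?thesis by measurable
qed

lemma partner_distance:
  assumes a: "a \<in> Rspace d" and s: "norm a \<le> 1 / 4"
  shows "(\<integral>\<^sup>+w. ennreal (norm (fst w - partner a w)) \<partial>GU d) \<le> ennreal (4 * norm a)"
proof -
  interpret GU: prob_space "GU d" by (rule prob_space_GU)
  have "(\<integral>\<^sup>+w. ennreal (norm (fst w - partner a w)) \<partial>GU d)
     \<le> (\<integral>\<^sup>+w. ennreal (norm a) + 2 * (if rejected a w then ennreal \<bar>inner (fst w) (sgn a)\<bar> else 0) \<partial>GU d)"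
  proof (rule nn_integral_mono)
    fix w :: "ell2 \<times> real"
    have "norm (sgn a) \<le> 1" by (simp add: norm_sgn)
    then have "norm ((2 * inner (fst w) (sgn a)) *\<^sub>R sgn a) \<le> norm a + 2 * \<bar>inner (fst w) (sgn a)\<bar>"
    proof -
      have "norm ((2 * inner (fst w) (sgn a)) *\<^sub>R sgn a) = 2 * \<bar>inner (fst w) (sgn a)\<bar> * norm (sgn a)"
        by (simp add: abs_mult)
      also have "\<dots> \<le> 2 * \<bar>inner (fst w) (sgn a)\<bar> * 1" using \<open>norm (sgn a) \<le> 1\<close> by (intro mult_left_mono) auto
      finally show ?thesis using norm_ge_zero[of a] by linarith
    qed
    moreover have "2 * ennreal \<bar>inner (fst w) (sgn a)\<bar> = ennreal (2 * \<bar>inner (fst w) (sgn a)\<bar>)"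
      by (simp add: ennreal_mult')
    ultimately show "ennreal (norm (fst w - partner a w)) \<le> ennreal (norm a) + 2 * (if rejected a w then ennreal \<bar>inner (fst w) (sgn a)\<bar> else 0)"
      by (auto simp: partner_difference ennreal_plus[symmetric] ennreal_leI simp del: ennreal_plus)
  qed
  also have "\<dots> = ennreal (norm a) + 2 * (\<integral>\<^sup>+w. (if rejected a w then ennreal \<bar>inner (fst w) (sgn a)\<bar> else 0) \<partial>GU d)"
    using GU.emeasure_space_1 by (subst nn_integral_add) (auto simp: nn_integral_cmult)
  also have "\<dots> \<le> ennreal (norm a) + 2 * ennreal ((51 / 50) * norm a)"
    by (intro add_left_mono mult_left_mono reject_component[OF a s]) auto
  also have "\<dots> = ennreal (norm a + 2 * ((51 / 50) * norm a))"
  proof -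
    have "ennreal (2 * ((51 / 50) * norm a)) = 2 * ennreal ((51 / 50) * norm a)"
      by (subst ennreal_mult) auto
    then show ?thesis by (subst ennreal_plus, simp, simp, simp only:)
  qed
  also have "\<dots> \<le> ennreal (4 * norm a)" by (intro ennreal_leI) simp
  finally show ?thesis .
qed

section \<open>The concave distance\<close>

context hmc
begin

text \<open>The distance function \<open>fc\<close> is concave with slope \<open>exp (- r / T) + mu\<close> at \<open>r\<close>, and \<open>mu\<close> is the
  reciprocal of the prefactor in the theorem. At distance \<open>r < Rt\<close> the velocity of one particle is
  shifted by \<open>gam * r\<close> towards the other, which would reduce the distance in free flight to
  \<open>(1 - gam * T) * r\<close>. The first entry of the minimum prevents the particles from overshooting and
  the second keeps the shift below \<open>1 / 4\<close>, so that it is rarely rejected. The constant \<open>cc\<close> is the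
  rate.\<close>

definition mu :: real where "mu = exp (- (5 / 4 * (Rt / T + 2)))"
definition fc :: "real \<Rightarrow> real" where "fc r = T * (1 - exp (- r / T)) + mu * r"
definition cc :: real where "cc = rate L K R T"
definition gam :: real where "gam = min (1 / T) (1 / (4 * Rt))"
definition shift :: "ell2 \<Rightarrow> ell2" where "shift z = (if norm z < Rt then gam *\<^sub>R z else 0)"

lemma mu_pos: "mu > 0" by (simp add: mu_def)

lemma prefactor_mu: "prefactor L K R T = 1 / mu"
  by (simp add: prefactor_def mu_def Rt_def[symmetric] exp_minus inverse_eq_divide)

lemma cc_eq: "cc = K * T\<^sup>2 / 156 * exp (- (5 * Rt / (4 * T)))"
  by (simp add: cc_def rate_def Rt_def)

lemma cc_pos: "cc > 0" using K_pos T_pos by (simp add: cc_eq)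

text \<open>Numerical bounds for the constant factor that relates \<open>mu\<close> to the exponential in the rate.\<close>

lemma exp_half5: "exp (5 / 2 :: real) \<le> (25 / 2)" "(1133 / 100) \<le> exp (5 / 2 :: real)"
proof -
  have "(exp (5 / 2 :: real))\<^sup>2 = exp 1 ^ 5"
    by (simp add: exp_double[symmetric] exp_of_nat_mult[symmetric])
  also have "\<dots> \<le> (68 / 25) ^ 5" using e_less_272 by (intro power_mono) auto
  also have "\<dots> \<le> (25 / 2)\<^sup>2" by (simp add: power_divide)
  finally show "exp (5 / 2 :: real) \<le> (25 / 2)" by (rule power2_le_imp_le) simp
  have "((13 / 8) :: real) ^ 5 \<le> exp (1 / 2) ^ 5"
    using exp_lower_Taylor_quadratic[of "1 / 2 :: real"] by (intro power_mono) (auto simp: power2_eq_square)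
  also have "\<dots> = exp (5 / 2 :: real)" by (simp add: exp_of_nat_mult[symmetric])
  finally have "((13 / 8) :: real) ^ 5 \<le> exp (5 / 2)" .
  moreover have "(1133 / 100) \<le> ((13 / 8) :: real) ^ 5" by (simp add: power_divide)
  ultimately show "(1133 / 100) \<le> exp (5 / 2 :: real)" by linarith
qed

lemma mu_split: "mu = exp (- (5 * Rt / (4 * T))) * exp (- (5 / 2))"
  by (simp add: mu_def exp_add[symmetric] algebra_simps)

lemma exp_decay_le_1: "exp (- (5 * Rt / (4 * T))) \<le> 1"
  using Rt_nonneg T_pos by simp

lemma mu_bounds: "(2 / 25) * exp (- (5 * Rt / (4 * T))) \<le> mu" "mu \<le> (883 / 10000) * exp (- (5 * Rt / (4 * T)))" "mu \<le> (883 / 10000)"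
proof -
  have "(2 / 25) \<le> exp (- (5 / 2) :: real)" "exp (- (5 / 2) :: real) \<le> (883 / 10000)"
    using exp_half5 by (auto simp: exp_minus field_simps)
  then show "(2 / 25) * exp (- (5 * Rt / (4 * T))) \<le> mu" "mu \<le> (883 / 10000) * exp (- (5 * Rt / (4 * T)))"
    unfolding mu_split by (auto simp: mult.commute)
  then show "mu \<le> (883 / 10000)" using exp_decay_le_1 by linarith
qed

lemma fc_tangent: "fc s \<le> fc r + (exp (- r / T) + mu) * (s - r)"
proof -
  have "exp (- s / T) = exp (- r / T) * exp (- ((s - r) / T))"
    using T_pos by (simp add: exp_add[symmetric] field_simps)
  also have "\<dots> \<ge> exp (- r / T) * (1 + - ((s - r) / T))"
    by (intro mult_left_mono exp_ge_add_one_self) auto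
  finally have "T * (exp (- r / T) * (1 - (s - r) / T)) \<le> T * exp (- s / T)" using T_pos by (intro mult_left_mono) auto
  moreover have "T * (exp (- r / T) * (1 - (s - r) / T)) = T * exp (- r / T) - exp (- r / T) * (s - r)"
    using T_pos by (simp add: field_simps)
  ultimately show ?thesis by (simp add: fc_def algebra_simps)
qed

text \<open>The bounded part of \<open>fc\<close> rises by at most \<open>T * exp (- r / T)\<close> from \<open>r\<close> to infinity, which
  bounds the damage of a rejected shift irrespective of the distance that is reached.\<close>

lemma fc_jump: "fc s \<le> fc r + T * exp (- r / T) + mu * (s - r)"
proof -
  have "0 \<le> T * exp (- s / T)" using T_pos by simp
  then show ?thesis by (simp add: fc_def algebra_simps)
qed

lemma fc_lower: "r \<ge> 0 \<Longrightarrow> mu * r \<le> fc r"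
  using T_pos by (simp add: fc_def)

lemma fc_nonneg: "r \<ge> 0 \<Longrightarrow> 0 \<le> fc r"
  by (rule order_trans[OF mult_nonneg_nonneg fc_lower]) (use mu_pos in auto)

lemma fc_mono: "r \<le> s \<Longrightarrow> fc r \<le> fc s"
  unfolding fc_def using T_pos mu_pos by (intro add_mono mult_left_mono) (auto simp: divide_right_mono)

lemma fc_0: "fc 0 = 0" by (simp add: fc_def)

lemma fc_upper: "r \<ge> 0 \<Longrightarrow> fc r \<le> (1 + mu) * r"
  using fc_tangent[of r 0] by (simp add: fc_0)

lemma fc_lipschitz: "0 \<le> r \<Longrightarrow> 0 \<le> \<delta> \<Longrightarrow> s \<le> r + \<delta> \<Longrightarrow> fc s \<le> fc r + (1 + mu) * \<delta>"
proof -
  assume a: "0 \<le> r" "0 \<le> \<delta>" "s \<le> r + \<delta>"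
  have "fc s \<le> fc (r + \<delta>)" by (rule fc_mono) fact
  also have "\<dots> \<le> fc r + (exp (- r / T) + mu) * \<delta>" using fc_tangent[of "r + \<delta>" r] by simp
  also have "\<dots> \<le> fc r + (1 + mu) * \<delta>" using a T_pos by (intro add_left_mono mult_right_mono add_mono) auto
  finally show ?thesis .
qed

lemma fc_measurable [measurable]: "fc \<in> borel_measurable borel"
  unfolding fc_def by measurable

text \<open>The choice of \<open>gam\<close> together with the step condition makes the displacement by the force, of
  relative size \<open>L * T\<^sup>2\<close>, small compared with the gain \<open>gam * T\<close> of the shift.\<close>

lemma near_facts:
  assumes "0 \<le> r" "r < Rt"
  shows "gam > 0" "gam * T \<le> 1" "L * T\<^sup>2 \<le> 3 / 20 * (gam * T)" "gam * r \<le> 1 / 4"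
    "exp (- (5 * Rt / (4 * T))) \<le> exp (- r / T)"
proof -
  have R: "Rt > 0" using assms by simp
  show "gam > 0" using R T_pos by (simp add: gam_def)
  have "gam \<le> 1 / T" by (simp add: gam_def)
  then show "gam * T \<le> 1" using T_pos by (simp add: field_simps)
  show "L * T\<^sup>2 \<le> 3 / 20 * (gam * T)"
  proof (cases "1 / T \<le> 1 / (4 * Rt)")
    case True
    then show ?thesis using step_bounds(1) T_pos by (simp add: gam_def min_absorb1)
  next
    case False
    then have "gam = 1 / (4 * Rt)" by (simp add: gam_def)
    moreover have "L * T\<^sup>2 \<le> 3 / 80 * T / Rt"
      using step_bounds(3) R T_pos mult_right_mono[OF step_bounds(3), of T] by (simp add: field_simps power2_eq_square)
    ultimately show ?thesis using R by simp
  qed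
  have "gam * r \<le> 1 / (4 * Rt) * Rt" using assms R by (intro mult_mono) (auto simp: gam_def)
  then show "gam * r \<le> 1 / 4" using R by simp
  have "r / T \<le> Rt / T" using assms T_pos by (simp add: divide_right_mono)
  also have "Rt / T \<le> 5 * Rt / (4 * T)" using R T_pos by (simp add: field_simps)
  finally show "exp (- (5 * Rt / (4 * T))) \<le> exp (- r / T)" by simp
qed

lemma shift_Rspace: "z \<in> Rspace d \<Longrightarrow> shift z \<in> Rspace d"
  by (simp add: shift_def)

lemma norm_shift: "norm (shift z) \<le> 1 / 4" "norm (shift z) \<le> norm z / T"
proof -
  have "norm (shift z) = (if norm z < Rt then gam * norm z else 0)"
    using near_facts(1)[of "norm z"] by (auto simp: shift_def)
  moreover have "gam * norm z \<le> norm z / T" if "norm z < Rt"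
    using mult_right_mono[OF near_facts(2)[OF _ that], of "norm z / T"] T_pos by simp
  ultimately show "norm (shift z) \<le> 1 / 4" "norm (shift z) \<le> norm z / T"
    using near_facts(4)[of "norm z"] T_pos by auto
qed

text \<open>The three parts of \<open>particle_cost\<close> bound the new value of \<open>fc\<close> for one particle: \<open>base_cost\<close>
  is the value for common velocities at large distance and for an accepted shift at small distance,
  \<open>reject_cost\<close> and the term next to it are added upon rejection, and the last line is the share of
  the particle in the interaction of all particles. The factors \<open>91 / 100\<close> and \<open>9 / 100\<close> account for
  the force, which destroys at most \<open>9 / 100\<close> of the gain of the shift.\<close>

definition base_cost :: "ell2 \<Rightarrow> real"
  where "base_cost z = (let r = norm z in
    if Rt \<le> r then fc r - mu * (K * T\<^sup>2 / 4) * r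
    else fc r - (91 / 100) * (exp (- r / T) + mu) * (gam * T * r))"

definition reject_cost :: "ell2 \<Rightarrow> real"
  where "reject_cost z = (let r = norm z in
    if Rt \<le> r then 0
    else (91 / 100) * (exp (- r / T) + mu) * (gam * T * r) + T * exp (- r / T) + (9 / 100) * mu * (gam * T * r))"

definition particle_cost :: "ell2 \<Rightarrow> ell2 \<times> real \<Rightarrow> real"
  where "particle_cost z w = base_cost z
    + (if rejected (shift z) w then reject_cost z + (11 / 5) * mu * T * \<bar>inner (fst w) (sgn (shift z))\<bar> else 0)
    + (41 / 10) * (ell * T\<^sup>2) * (norm z + T * norm (fst w - partner (shift z) w))"

end

context trajectory_pair
begin

text \<open>The tangent of the concave function at the old distance turns the shorter distance into a
  gain.\<close>

lemma near_accept:
  assumes i: "i < n" and near: "norm (dq 0 i) < Rt" and p0: "dp 0 i = - (gam *\<^sub>R dq 0 i)"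
  shows "fc (norm (dq m i)) \<le> fc (norm (dq 0 i)) - (91 / 100) * (exp (- norm (dq 0 i) / T) + mu) * (gam * T * norm (dq 0 i)) + (17 / 5) * iota"
proof -
  let ?r = "norm (dq 0 i)"
  note nf = near_facts[OF norm_ge_zero near]
  have c: "dq 0 i + T *\<^sub>R dp 0 i = (1 - gam * T) *\<^sub>R dq 0 i" by (simp add: p0 algebra_simps)
  then have e: "norm (dq 0 i + T *\<^sub>R dp 0 i) = (1 - gam * T) * ?r" using nf by simp
  have free: "free i = ?r"
    unfolding free_def e using nf T_pos by (intro max_absorb1) (simp add: mult_left_le_one_le)
  have "13 / 12 * lam \<le> (9 / 100) * (gam * T)" using lam_bounds(4) nf(1-3) T_pos mult_pos_pos[OF nf(1) T_pos] by linarith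
  then have "13 / 12 * lam * ?r \<le> (9 / 100) * (gam * T) * ?r" by (intro mult_right_mono) auto
  then have "norm (dq m i) - ?r \<le> - (91 / 100) * (gam * T * ?r) + 13 / 12 * iota"
    using final_distance[OF i] unfolding e free by (simp add: algebra_simps)
  then have "(exp (- ?r / T) + mu) * (norm (dq m i) - ?r) \<le> (exp (- ?r / T) + mu) * (- (91 / 100) * (gam * T * ?r) + 13 / 12 * iota)"
    using mu_pos by (intro mult_left_mono) (auto simp: add_pos_pos less_imp_le)
  moreover have "(exp (- ?r / T) + mu) * (13 / 12 * iota) \<le> 3 * (13 / 12 * iota)"
  proof (rule mult_right_mono)
    have "exp (- ?r / T) \<le> 1" using T_pos by simp
    then show "exp (- ?r / T) + mu \<le> 3" using mu_bounds(3) by linarith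
  qed (use iota_nonneg in simp)
  ultimately show ?thesis using fc_tangent[of "norm (dq m i)" ?r] iota_nonneg by (simp add: field_simps)
qed

text \<open>The gain is lost and the distance may grow by \<open>2 * T * \<bar>u\<bar>\<close>, but the concave part of \<open>fc\<close> can
  only jump by \<open>T * exp (- r / T)\<close>; the growth itself is paid for with the small slope \<open>mu\<close>.\<close>

lemma near_reject:
  assumes i: "i < n" and near: "norm (dq 0 i) < Rt" and p0: "dp 0 i = (2 * u) *\<^sub>R e" and e: "norm e \<le> 1"
  shows "fc (norm (dq m i)) \<le> fc (norm (dq 0 i)) + T * exp (- norm (dq 0 i) / T)
    + (9 / 100) * mu * (gam * T * norm (dq 0 i)) + (11 / 5) * mu * T * \<bar>u\<bar> + (17 / 5) * iota"
proof -
  let ?r = "norm (dq 0 i)"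
  note nf = near_facts[OF norm_ge_zero near]
  have b: "norm (dq 0 i + T *\<^sub>R dp 0 i) \<le> ?r + 2 * T * \<bar>u\<bar>"
  proof -
    have "norm (T *\<^sub>R dp 0 i) = 2 * T * \<bar>u\<bar> * norm e" using T_pos by (simp add: p0 abs_mult)
    also have "\<dots> \<le> 2 * T * \<bar>u\<bar> * 1" using e T_pos by (intro mult_left_mono) auto
    finally show ?thesis using norm_triangle_ineq[of "dq 0 i" "T *\<^sub>R dp 0 i"] by simp
  qed
  have Tu: "0 \<le> T * \<bar>u\<bar>" using T_pos by simp
  have free: "free i \<le> ?r + 2 * T * \<bar>u\<bar>" unfolding free_def using b Tu by simp
  have l: "13 / 12 * lam \<le> (9 / 100) * (gam * T)" "13 / 12 * lam \<le> 1 / 12"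
    using lam_bounds(2,4) nf(1-3) mult_pos_pos[OF nf(1) T_pos] by (linarith, linarith)
  have "13 / 12 * lam * free i \<le> 13 / 12 * lam * (?r + 2 * T * \<bar>u\<bar>)"
    using free lam_bounds(1) by (intro mult_left_mono) auto
  also have "\<dots> = 13 / 12 * lam * ?r + 13 / 12 * lam * (2 * (T * \<bar>u\<bar>))" by (simp add: algebra_simps)
  also have "\<dots> \<le> (9 / 100) * (gam * T) * ?r + 1 / 12 * (2 * (T * \<bar>u\<bar>))"
    using l Tu by (intro add_mono mult_right_mono) auto
  finally have "norm (dq m i) - ?r \<le> (9 / 100) * (gam * T * ?r) + (11 / 5) * (T * \<bar>u\<bar>) + 13 / 12 * iota"
    using final_distance[OF i] b Tu by linarith
  then have "mu * (norm (dq m i) - ?r) \<le> mu * ((9 / 100) * (gam * T * ?r) + (11 / 5) * (T * \<bar>u\<bar>) + 13 / 12 * iota)"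
    using mu_pos by (intro mult_left_mono) auto
  moreover have "mu * (13 / 12 * iota) \<le> 3 * (13 / 12 * iota)"
    using mu_bounds(3) iota_nonneg by (intro mult_right_mono) auto
  ultimately show ?thesis using fc_jump[of "norm (dq m i)" ?r] iota_nonneg by (simp add: algebra_simps)
qed

text \<open>Here only the slope \<open>mu\<close> is used for the gain, because \<open>exp (- r / T)\<close> may be arbitrarily
  small.\<close>

lemma far_cost:
  assumes i: "i < n" and far: "Rt \<le> norm (dq 0 i)" and p0: "dp 0 i = 0"
  shows "fc (norm (dq m i)) \<le> fc (norm (dq 0 i)) - mu * (K * T\<^sup>2 / 4) * norm (dq 0 i) + (17 / 5) * iota"
proof -
  let ?r = "norm (dq 0 i)" and ?E = "exp (- norm (dq 0 i) / T)"
  have E: "0 \<le> ?E" "?E \<le> 1" using T_pos by auto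
  define q where "q = K * T\<^sup>2 / 4 * ?r"
  have "norm (dq m i) - ?r \<le> - q + (31 / 10) * iota"
    using far_contraction[OF i p0 far] by (simp add: q_def algebra_simps)
  then have "(?E + mu) * (norm (dq m i) - ?r) \<le> (?E + mu) * (- q + (31 / 10) * iota)"
    using mu_pos E by (intro mult_left_mono) auto
  also have "\<dots> = - (?E * q) - mu * q + (?E + mu) * ((31 / 10) * iota)" by (simp add: algebra_simps)
  also have "(?E + mu) * ((31 / 10) * iota) \<le> (109 / 100) * ((31 / 10) * iota)"
  proof (rule mult_right_mono)
    show "?E + mu \<le> 109 / 100" using mu_bounds(3) E by linarith
  qed (use iota_nonneg in simp)
  finally have "(?E + mu) * (norm (dq m i) - ?r) \<le> - (?E * q) - mu * q + (109 / 100) * ((31 / 10) * iota)" by simp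
  moreover have "0 \<le> ?E * q" using E K_pos by (simp add: q_def)
  moreover have "mu * q = mu * (K * T\<^sup>2 / 4) * ?r" by (simp add: q_def)
  ultimately show ?thesis using fc_tangent[of "norm (dq m i)" ?r] iota_nonneg by linarith
qed

end

section \<open>Contraction in one transition\<close>

context hmc
begin

lemma K_decay: "K * T\<^sup>2 * exp (- (5 * Rt / (4 * T))) = 156 * cc"
  by (simp add: cc_eq)

text \<open>The interaction is small even in comparison with the rate, so it can be paid for by a fraction
  of the contraction.\<close>

lemma ell_cc: "41 / 10 * (ell * T\<^sup>2) \<le> 7 / 100 * cc"
proof -
  have "ell * T\<^sup>2 \<le> (K / 10000 * exp (- (5 * Rt / (4 * T)))) * T\<^sup>2"
    by (rule mult_right_mono[OF ell_small]) simp
  also have "\<dots> = 156 / 10000 * cc" using K_decay by (simp add: mult_ac)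
  finally show ?thesis using cc_pos by simp
qed

lemma base_cost_nonneg: "0 \<le> base_cost z"
proof (cases "Rt \<le> norm z")
  case True
  have "K * T\<^sup>2 / 4 \<le> 1" using K_T by simp
  then have "mu * (K * T\<^sup>2 / 4) * norm z \<le> mu * 1 * norm z"
    using mu_pos by (intro mult_right_mono mult_left_mono) auto
  then show ?thesis using True fc_lower[of "norm z"] by (simp add: base_cost_def Let_def)
next
  case False
  let ?r = "norm z"
  have near: "?r < Rt" using False by simp
  note nf = near_facts[OF norm_ge_zero near]
  have "0 \<le> fc ((1 - gam * T) * ?r)" using nf by (intro fc_nonneg) auto
  also have "\<dots> \<le> fc ?r + (exp (- ?r / T) + mu) * ((1 - gam * T) * ?r - ?r)" by (rule fc_tangent)
  also have "\<dots> = fc ?r - (exp (- ?r / T) + mu) * (gam * T * ?r)" by (simp add: algebra_simps)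
  also have "\<dots> \<le> fc ?r - 91 / 100 * ((exp (- ?r / T) + mu) * (gam * T * ?r))"
  proof -
    have "0 \<le> (exp (- ?r / T) + mu) * (gam * T * ?r)" using nf(1) T_pos mu_pos
      by (intro mult_nonneg_nonneg add_nonneg_nonneg) auto
    then show ?thesis by linarith
  qed
  finally show ?thesis by (simp only: base_cost_def Let_def False if_False mult.assoc)
qed

lemma reject_cost_nonneg: "0 \<le> reject_cost z"
proof (cases "Rt \<le> norm z")
  case False
  then have "gam > 0" using near_facts(1)[of "norm z"] by simp
  then show ?thesis using False T_pos mu_pos
    unfolding reject_cost_def Let_def
    by (auto intro!: add_nonneg_nonneg mult_nonneg_nonneg)
qed (simp add: reject_cost_def Let_def)

text \<open>At large distance the gain \<open>mu * (K * T\<^sup>2 / 4) * r\<close> is at least \<open>3.12 * cc * r\<close>, which exceeds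
  \<open>2 * cc * fc r \<le> 2.18 * cc * r\<close> and leaves room for the interaction. At small distance let \<open>E\<close> be
  the slope \<open>exp (- r / T)\<close> and \<open>G\<close> the shortening \<open>gam * T * r\<close>. An accepted shift gains
  \<open>0.91 * E * G\<close>, a rejection loses this gain and the jump \<open>T * E\<close> with probability at most
  \<open>0.57 * gam * r\<close>, that is at most \<open>0.7 * E * G\<close> in total. The remaining \<open>0.21 * E * G\<close> pays for
  the terms with \<open>mu\<close>, since \<open>mu\<close> is below \<open>0.09 * E\<close>, and for the interaction and the rate, which
  are smaller still.\<close>

lemma cost_inequality:
  "base_cost z + 41 / 10 * (ell * T\<^sup>2) * norm z + reject_cost z * (57 / 100 * norm (shift z))
    + 22 / 10 * mu * T * (102 / 100 * norm (shift z)) + 41 / 10 * (ell * T\<^sup>2) * T * (4 * norm (shift z))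
   \<le> (1 - 2 * cc) * fc (norm z)"
proof -
  define r where "r = norm z"
  define c3 where "c3 = 41 / 10 * (ell * T\<^sup>2)"
  have r: "0 \<le> r" by (simp add: r_def)
  have c3: "0 \<le> c3" "c3 * r \<le> 7 / 100 * (cc * r)"
    using ell_nonneg mult_right_mono[OF ell_cc r] by (auto simp: c3_def)
  have f2: "cc * fc r \<le> 109 / 100 * (cc * r)"
  proof -
    have "fc r \<le> (1 + mu) * r" by (rule fc_upper[OF r])
    also have "\<dots> \<le> 109 / 100 * r" using mu_bounds(3) r by (intro mult_right_mono) auto
    finally have "cc * fc r \<le> cc * (109 / 100 * r)" using cc_pos by (intro mult_left_mono) auto
    then show ?thesis by simp
  qed
  have ccr: "0 \<le> cc * r" using cc_pos r by simp
  show ?thesis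
  proof (cases "Rt \<le> r")
    case True
    have s: "shift z = 0" using True by (simp add: shift_def r_def)
    have "312 / 100 * cc \<le> mu * (K * T\<^sup>2 / 4)"
    proof -
      have "(8 / 100 * exp (- (5 * Rt / (4 * T)))) * (K * T\<^sup>2 / 4) \<le> mu * (K * T\<^sup>2 / 4)"
        using mu_bounds(1) K_pos by (intro mult_right_mono) auto
      moreover have "(8 / 100 * exp (- (5 * Rt / (4 * T)))) * (K * T\<^sup>2 / 4) = 2 / 100 * (156 * cc)"
        unfolding K_decay[symmetric] by simp
      ultimately show ?thesis by simp
    qed
    from mult_right_mono[OF this r] have "312 / 100 * (cc * r) \<le> mu * (K * T\<^sup>2 / 4) * r" by simp
    moreover have "base_cost z = fc r - mu * (K * T\<^sup>2 / 4) * r"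
      using True by (simp add: base_cost_def r_def Let_def)
    moreover have "(1 - 2 * cc) * fc r = fc r - 2 * (cc * fc r)" by (simp add: algebra_simps)
    ultimately have "base_cost z + c3 * r \<le> (1 - 2 * cc) * fc r" using c3 f2 ccr by linarith
    then show ?thesis by (simp add: s r_def c3_def)
  next
    case False
    then have near: "r < Rt" by simp
    note nf = near_facts[OF r near]
    define E where "E = exp (- r / T)"
    define G where "G = gam * T * r"
    define s where "s = gam * r"
    have s: "norm (shift z) = s" using near nf(1) by (simp add: shift_def s_def r_def)
    have s0: "0 \<le> s" "s \<le> 1 / 4" using nf r by (auto simp: s_def)
    have E: "0 \<le> E" by (simp add: E_def)
    have G: "0 \<le> G" "G \<le> r" "T * s = G"
      using nf r T_pos mult_right_mono[OF nf(2) r] by (auto simp: G_def s_def)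
    have b: "base_cost z = fc r - 91 / 100 * (E * G) - 91 / 100 * (mu * G)"
      using False by (simp add: base_cost_def r_def[symmetric] Let_def E_def G_def algebra_simps)
    define X where "X = 91 / 100 * (E * G) + 91 / 100 * (mu * G) + 9 / 100 * (mu * G)"
    have EG: "0 \<le> E * G" "0 \<le> mu * G" using E G mu_pos by auto
    have X: "0 \<le> X" using EG unfolding X_def by linarith
    have rc: "reject_cost z * (57 / 100 * s) = X * (57 / 100 * s) + 57 / 100 * (E * G)"
    proof -
      have "reject_cost z = X + T * E"
        using False by (simp add: reject_cost_def r_def[symmetric] Let_def E_def G_def X_def field_simps)
      then show ?thesis using G(3) by (simp add: algebra_simps)
    qed
    have "X * (57 / 100 * s) \<le> X * (57 / 400)" using s0 X by (intro mult_left_mono) auto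
    then have rc2: "reject_cost z * (57 / 100 * s) \<le> X * (57 / 400) + 57 / 100 * (E * G)" unfolding rc by simp
    have m: "22 / 10 * mu * T * (102 / 100 * s) = 2244 / 1000 * (mu * G)"
      unfolding G(3)[symmetric] by simp
    have c: "c3 * T * (4 * s) \<le> 28 / 100 * (cc * r)"
    proof -
      have "c3 * T * (4 * s) = 4 * (c3 * G)" unfolding G(3)[symmetric] by simp
      also have "\<dots> \<le> 4 * (c3 * r)" using c3 G by (simp add: mult_left_mono)
      finally show ?thesis using c3(2) by linarith
    qed
    have "mu \<le> 883 / 10000 * E" using mu_bounds(2) nf(5) unfolding E_def by linarith
    from mult_right_mono[OF this G(1)] have muE: "mu * G \<le> 883 / 10000 * (E * G)" by simp
    have ccE: "cc * r \<le> 1 / 1000 * (E * G)"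
    proof -
      have "K * T\<^sup>2 \<le> 3 / 20 * (gam * T)"
        using mult_right_mono[OF K_le_L, of "T\<^sup>2"] nf(3) by simp
      then have "156 * cc \<le> (3 / 20 * (gam * T)) * E"
        unfolding K_decay[symmetric] E_def
        by (rule mult_mono[OF _ nf(5)]) (use nf(1) T_pos in auto)
      from mult_right_mono[OF this r] have "156 * (cc * r) \<le> 3 / 20 * (E * G)" by (simp add: G_def mult_ac)
      then show ?thesis using EG by linarith
    qed
    have eq: "(1 - 2 * cc) * fc r = fc r - 2 * (cc * fc r)" by (simp add: algebra_simps)
    have "base_cost z + c3 * r + reject_cost z * (57 / 100 * s) + 22 / 10 * mu * T * (102 / 100 * s) + c3 * T * (4 * s)
       \<le> (1 - 2 * cc) * fc r"
    proof -
      have s1: "reject_cost z * (57 / 100 * s) \<le> 7 / 10 * (E * G) + 15 / 100 * (mu * G)"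
      proof -
        have "X = 91 / 100 * (E * G) + mu * G" by (simp add: X_def)
        then show ?thesis using rc2 EG by linarith
      qed
      have s2: "(149 / 100) * (mu * G) \<le> 14 / 100 * (E * G)" using muE EG by linarith
      have s3: "35 / 100 * (cc * r) + 2 * (cc * fc r) \<le> 3 / 1000 * (E * G)" using f2 ccE ccr by linarith
      have "fc r - 91 / 100 * (E * G) - 91 / 100 * (mu * G) + c3 * r + reject_cost z * (57 / 100 * s)
          + 2244 / 1000 * (mu * G) + c3 * T * (4 * s)
        \<le> fc r - 21 / 100 * (E * G) + (149 / 100) * (mu * G) + 35 / 100 * (cc * r)"
        using s1 c c3(2) EG by linarith
      also have "\<dots> \<le> fc r - 2 * (cc * fc r)" using s2 s3 EG by linarith
      finally show ?thesis unfolding b m eq .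
    qed
    then show ?thesis by (simp add: s r_def c3_def)
  qed
qed

lemma particle_cost_nonneg: "0 \<le> particle_cost z w"
  unfolding particle_cost_def
  using base_cost_nonneg reject_cost_nonneg mu_pos T_pos ell_nonneg
  by (intro add_nonneg_nonneg mult_nonneg_nonneg) auto

lemma particle_cost_measurable: "particle_cost z \<in> borel_measurable (GU d)"
  unfolding particle_cost_def by measurable

lemma rate_small: "2 * cc \<le> 1"
proof -
  have "cc = K * T\<^sup>2 / 156 * exp (- (5 * Rt / (4 * T)))" by (rule cc_eq)
  also have "\<dots> \<le> (3 / 20) / 156 * 1"
    using K_T K_pos exp_decay_le_1 by (intro mult_mono divide_right_mono) auto
  finally show ?thesis by simp
qed

lemma particle_cost_expectation:
  assumes z: "z \<in> Rspace d"
  shows "(\<integral>\<^sup>+w. ennreal (particle_cost z w) \<partial>GU d) \<le> ennreal ((1 - 2 * cc) * fc (norm z))"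
proof -
  interpret GU: prob_space "GU d" by (rule prob_space_GU)
  define a where "a = shift z"
  define s where "s = norm a"
  define c3 where "c3 = 41 / 10 * (ell * T\<^sup>2)"
  define c2 where "c2 = 22 / 10 * mu * T"
  have a: "a \<in> Rspace d" "norm a \<le> 1 / 4" using shift_Rspace[OF z] norm_shift(1) by (auto simp: a_def)
  have c: "0 \<le> c2" "0 \<le> c3" using mu_pos T_pos ell_nonneg by (auto simp: c2_def c3_def)
  have s: "0 \<le> s" by (simp add: s_def)
  let ?A = "base_cost z + c3 * norm z"
  have A: "0 \<le> ?A" using base_cost_nonneg c by (intro add_nonneg_nonneg mult_nonneg_nonneg) auto
  let ?I = "\<lambda>w. if rejected a w then 1 else 0 :: ennreal"
  let ?J = "\<lambda>w. if rejected a w then ennreal \<bar>inner (fst w) (sgn a)\<bar> else 0"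
  let ?N = "\<lambda>w. ennreal (norm (fst w - partner a w))"
  have m: "?I \<in> borel_measurable (GU d)" "?J \<in> borel_measurable (GU d)" "?N \<in> borel_measurable (GU d)"
    by measurable
  have "(\<integral>\<^sup>+w. ennreal (particle_cost z w) \<partial>GU d)
     \<le> (\<integral>\<^sup>+w. ((ennreal ?A + ennreal (reject_cost z) * ?I w) + ennreal c2 * ?J w) + ennreal (c3 * T) * ?N w \<partial>GU d)"
  proof (rule nn_integral_mono)
    fix w
    have e: "particle_cost z w = ((?A + (if rejected a w then reject_cost z else 0))
        + (if rejected a w then c2 * \<bar>inner (fst w) (sgn a)\<bar> else 0)) + c3 * T * norm (fst w - partner a w)"
      by (simp add: particle_cost_def a_def c2_def c3_def algebra_simps)
    show "ennreal (particle_cost z w) \<le> ((ennreal ?A + ennreal (reject_cost z) * ?I w) + ennreal c2 * ?J w) + ennreal (c3 * T) * ?N w"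
      unfolding e using A c T_pos reject_cost_nonneg
      by (cases "rejected a w") (simp_all add: ennreal_plus[symmetric] ennreal_mult[symmetric] del: ennreal_plus)
  qed
  also have "\<dots> = ((ennreal ?A + ennreal (reject_cost z) * (\<integral>\<^sup>+w. ?I w \<partial>GU d)) + ennreal c2 * (\<integral>\<^sup>+w. ?J w \<partial>GU d))
      + ennreal (c3 * T) * (\<integral>\<^sup>+w. ?N w \<partial>GU d)"
    using m GU.emeasure_space_1 by (simp add: nn_integral_add nn_integral_cmult)
  also have "\<dots> \<le> ((ennreal ?A + ennreal (reject_cost z) * ennreal (57 / 100 * s)) + ennreal c2 * ennreal (102 / 100 * s))
      + ennreal (c3 * T) * ennreal (4 * s)"
    using reject_probability[OF a] reject_component[OF a] partner_distance[OF a]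
    unfolding s_def by (intro add_mono mult_left_mono) auto
  also have "\<dots> = ennreal (?A + reject_cost z * (57 / 100 * s) + c2 * (102 / 100 * s) + c3 * T * (4 * s))"
    using A c s T_pos reject_cost_nonneg
    by (simp add: ennreal_plus[symmetric] ennreal_mult[symmetric] del: ennreal_plus)
  also have "\<dots> \<le> ennreal ((1 - 2 * cc) * fc (norm z))"
    using cost_inequality[of z] by (intro ennreal_leI) (simp add: a_def s_def c2_def c3_def)
  finally show ?thesis .
qed

definition velocity :: "(nat \<Rightarrow> ell2 \<times> real) \<Rightarrow> config"
  where "velocity \<omega> = (\<lambda>i\<in>{..<n}. fst (\<omega> i))"

definition partner_velocity :: "config \<Rightarrow> config \<Rightarrow> (nat \<Rightarrow> ell2 \<times> real) \<Rightarrow> config"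
  where "partner_velocity x y \<omega> = (\<lambda>i\<in>{..<n}. partner (shift (x i - y i)) (\<omega> i))"

definition noise :: "(nat \<Rightarrow> ell2 \<times> real) measure"
  where "noise = PiM {..<n} (\<lambda>_. GU d)"

definition rho :: "config \<Rightarrow> config \<Rightarrow> real"
  where "rho x y = (\<Sum>i<n. fc (norm (x i - y i)))"

lemma rho_nonneg: "0 \<le> rho x y"
  unfolding rho_def by (intro sum_nonneg fc_nonneg) auto

lemma space_noise: "\<omega> \<in> space noise \<Longrightarrow> i < n \<Longrightarrow> fst (\<omega> i) \<in> Rspace d"
  by (auto simp: noise_def space_PiM space_GU PiE_iff mem_Times_iff)

lemma velocity_configs: "\<omega> \<in> space noise \<Longrightarrow> velocity \<omega> \<in> configs n d"
  unfolding velocity_def by (intro restrict_configs space_noise)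

lemma partner_velocity_configs:
  "\<omega> \<in> space noise \<Longrightarrow> x \<in> configs n d \<Longrightarrow> y \<in> configs n d \<Longrightarrow> partner_velocity x y \<omega> \<in> configs n d"
  unfolding partner_velocity_def
  by (intro restrict_configs partner_in_Rspace shift_Rspace Rspace_closed configsD space_noise)

text \<open>The interaction term \<open>iota\<close> is common to all particles; summed over them it is bounded by the
  free flight distances and then redistributed, and \<open>34 / 10 * 6 / 5 \<le> 41 / 10\<close>.\<close>

lemma coupled_step_cost:
  assumes h: "h > 0" and mh: "real m * h = T" and x: "x \<in> configs n d" and y: "y \<in> configs n d"
    and \<omega>: "\<omega> \<in> space noise"
  shows "rho (fst (verlet h m (x, velocity \<omega>))) (fst (verlet h m (y, partner_velocity x y \<omega>)))
     \<le> (\<Sum>i<n. particle_cost (x i - y i) (\<omega> i))"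
proof -
  interpret trajectory_pair n d V W eps L Lt K R T h1 h m "(x, velocity \<omega>)" "(y, partner_velocity x y \<omega>)"
    by unfold_locales (use h mh x y \<omega> velocity_configs partner_velocity_configs in auto)
  have q0: "dq 0 i = x i - y i" for i by (simp add: dq_def)
  have p0: "dp 0 i = fst (\<omega> i) - partner (shift (x i - y i)) (\<omega> i)" if "i < n" for i
    unfolding dp_def using that by (simp add: velocity_def partner_velocity_def)
  have one: "fc (norm (dq m i)) \<le> base_cost (x i - y i) + (if rejected (shift (x i - y i)) (\<omega> i)
       then reject_cost (x i - y i) + 11 / 5 * mu * T * \<bar>inner (fst (\<omega> i)) (sgn (shift (x i - y i)))\<bar> else 0) + 34 / 10 * iota"
    if i: "i < n" for i
  proof (cases "Rt \<le> norm (x i - y i)")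
    case True
    then have s: "shift (x i - y i) = 0" by (simp add: shift_def)
    then have "dp 0 i = 0" using p0[OF i] by (simp add: partner_def rejected_def)
    then show ?thesis using far_cost[OF i] True s by (simp add: q0 base_cost_def rejected_def Let_def)
  next
    case False
    then have near: "norm (dq 0 i) < Rt" by (simp add: q0)
    have s: "shift (x i - y i) = gam *\<^sub>R dq 0 i" using False by (simp add: shift_def q0)
    show ?thesis
    proof (cases "rejected (shift (x i - y i)) (\<omega> i)")
      case True
      have "dp 0 i = (2 * inner (fst (\<omega> i)) (sgn (shift (x i - y i)))) *\<^sub>R sgn (shift (x i - y i))"
        using p0[OF i] True by (simp add: partner_difference)
      moreover have "norm (sgn (shift (x i - y i))) \<le> 1" by (simp add: norm_sgn)
      ultimately show ?thesis
        using near_reject[OF i near, of "inner (fst (\<omega> i)) (sgn (shift (x i - y i)))" "sgn (shift (x i - y i))"] True False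
        by (simp add: q0 base_cost_def reject_cost_def Let_def)
    next
      case acc: False
      have "dp 0 i = - (gam *\<^sub>R dq 0 i)" using p0[OF i] acc by (simp add: partner_difference s)
      from near_accept[OF i near this] acc False show ?thesis
        by (simp add: q0 base_cost_def Let_def)
    qed
  qed
  have fr: "free i \<le> norm (x i - y i) + T * norm (fst (\<omega> i) - partner (shift (x i - y i)) (\<omega> i))" if i: "i < n" for i
    unfolding free_def q0 p0[OF i] using T_pos norm_triangle_ineq[of "x i - y i" "T *\<^sub>R (fst (\<omega> i) - partner (shift (x i - y i)) (\<omega> i))"]
    by simp
  have "rho (fst (verlet h m (x, velocity \<omega>))) (fst (verlet h m (y, partner_velocity x y \<omega>))) = (\<Sum>i<n. fc (norm (dq m i)))"
    by (simp add: rho_def dq_def)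
  also have "\<dots> \<le> (\<Sum>i<n. base_cost (x i - y i) + (if rejected (shift (x i - y i)) (\<omega> i)
       then reject_cost (x i - y i) + 11 / 5 * mu * T * \<bar>inner (fst (\<omega> i)) (sgn (shift (x i - y i)))\<bar> else 0) + 34 / 10 * iota)"
    by (intro sum_mono one) auto
  also have "\<dots> = (\<Sum>i<n. base_cost (x i - y i) + (if rejected (shift (x i - y i)) (\<omega> i)
       then reject_cost (x i - y i) + 11 / 5 * mu * T * \<bar>inner (fst (\<omega> i)) (sgn (shift (x i - y i)))\<bar> else 0)) + 34 / 10 * (real n * iota)"
    by (simp add: sum.distrib)
  also have "34 / 10 * (real n * iota) \<le> (\<Sum>i<n. 41 / 10 * (ell * T\<^sup>2) * (norm (x i - y i) + T * norm (fst (\<omega> i) - partner (shift (x i - y i)) (\<omega> i))))"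
  proof -
    have f0: "0 \<le> (ell * T\<^sup>2) * (\<Sum>j<n. free j)"
      using ell_nonneg by (intro mult_nonneg_nonneg sum_nonneg) (auto simp: free_def le_max_iff_disj)
    have "34 / 10 * (real n * iota) \<le> 34 / 10 * (6 / 5 * (ell * T\<^sup>2) * (\<Sum>j<n. free j))"
      using sum_iota by simp
    also have "\<dots> \<le> 41 / 10 * (ell * T\<^sup>2) * (\<Sum>j<n. free j)" using f0 by simp
    also have "\<dots> \<le> 41 / 10 * (ell * T\<^sup>2) * (\<Sum>i<n. norm (x i - y i) + T * norm (fst (\<omega> i) - partner (shift (x i - y i)) (\<omega> i)))"
      using ell_nonneg by (intro mult_left_mono sum_mono fr) auto
    finally show ?thesis by (simp add: sum_distrib_left)
  qed
  finally show ?thesis by (simp add: particle_cost_def sum.distrib)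
qed

lemma one_step_contraction:
  assumes h: "h > 0" and mh: "real m * h = T" and x: "x \<in> configs n d" and y: "y \<in> configs n d"
  shows "(\<integral>\<^sup>+\<omega>. ennreal (rho (fst (verlet h m (x, velocity \<omega>))) (fst (verlet h m (y, partner_velocity x y \<omega>)))) \<partial>noise)
     \<le> ennreal (1 - 2 * cc) * ennreal (rho x y)"
proof -
  have "(\<integral>\<^sup>+\<omega>. ennreal (rho (fst (verlet h m (x, velocity \<omega>))) (fst (verlet h m (y, partner_velocity x y \<omega>)))) \<partial>noise)
     \<le> (\<integral>\<^sup>+\<omega>. (\<Sum>i<n. ennreal (particle_cost (x i - y i) (\<omega> i))) \<partial>noise)"
    using coupled_step_cost[OF assms] particle_cost_nonneg
    by (intro nn_integral_mono) (simp add: sum_ennreal ennreal_leI)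
  also have "\<dots> = (\<Sum>i<n. \<integral>\<^sup>+\<omega>. ennreal (particle_cost (x i - y i) (\<omega> i)) \<partial>noise)"
    unfolding noise_def
  proof (rule nn_integral_sum)
    fix i assume "i \<in> {..<n}"
    then have "(\<lambda>\<omega>. \<omega> i) \<in> PiM {..<n} (\<lambda>_. GU d) \<rightarrow>\<^sub>M GU d" by simp
    from measurable_compose[OF measurable_compose[OF this particle_cost_measurable] measurable_ennreal]
    show "(\<lambda>\<omega>. ennreal (particle_cost (x i - y i) (\<omega> i))) \<in> borel_measurable (PiM {..<n} (\<lambda>_. GU d))" .
  qed
  also have "\<dots> = (\<Sum>i<n. \<integral>\<^sup>+w. ennreal (particle_cost (x i - y i) w) \<partial>GU d)"
    unfolding noise_def
    by (intro sum.cong refl nn_integral_PiM_component prob_space_GU measurable_compose[OF particle_cost_measurable measurable_ennreal]) auto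
  also have "\<dots> \<le> (\<Sum>i<n. ennreal ((1 - 2 * cc) * fc (norm (x i - y i))))"
    by (intro sum_mono particle_cost_expectation Rspace_closed configsD[OF x] configsD[OF y]) auto
  also have "\<dots> = ennreal ((1 - 2 * cc) * rho x y)"
    using rate_small fc_nonneg by (subst sum_ennreal) (auto simp: rho_def sum_distrib_left)
  also have "\<dots> = ennreal (1 - 2 * cc) * ennreal (rho x y)"
    using rate_small rho_nonneg by (intro ennreal_mult) auto
  finally show ?thesis .
qed

end

section \<open>First moment of an invariant measure\<close>

text \<open>The drift condition alone does not allow to integrate \<open>g\<close>, whose integral might be infinite.
  Its truncations can be integrated: by invariance and Jensen's inequality for the minimum, the
  integral of \<open>min A g\<close> is at most that of \<open>min A (q ^ k * g + b * S k)\<close> for every \<open>k\<close>, where \<open>S k\<close>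
  is a partial geometric sum. As \<open>k\<close> tends to infinity the first term vanishes, which leaves a bound
  that does not depend on \<open>A\<close>.\<close>

lemma invariant_moment_finite:
  fixes g :: "'a \<Rightarrow> ennreal" and q :: real
  assumes \<nu>: "prob_space \<nu>" and \<gamma>: "prob_space \<gamma>"
    and \<phi>: "\<phi> \<in> \<nu> \<Otimes>\<^sub>M \<gamma> \<rightarrow>\<^sub>M \<nu>" and g: "g \<in> borel_measurable \<nu>" "\<And>x. g x < \<infinity>"
    and inv: "\<And>f :: 'a \<Rightarrow> ennreal. f \<in> borel_measurable \<nu> \<Longrightarrow> (\<integral>\<^sup>+x. \<integral>\<^sup>+v. f (\<phi> (x, v)) \<partial>\<gamma> \<partial>\<nu>) = (\<integral>\<^sup>+x. f x \<partial>\<nu>)"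
    and q: "0 \<le> q" "q < 1" and b: "b < \<infinity>"
    and drift: "\<And>x. x \<in> space \<nu> \<Longrightarrow> (\<integral>\<^sup>+v. g (\<phi> (x, v)) \<partial>\<gamma>) \<le> ennreal q * g x + b"
  shows "(\<integral>\<^sup>+x. g x \<partial>\<nu>) < \<infinity>"
proof -
  interpret \<nu>: prob_space \<nu> by fact
  interpret \<gamma>: prob_space \<gamma> by fact
  note g(1)[measurable]
  define S where "S k = (\<Sum>j<k. ennreal q ^ j)" for k
  define B where "B = b * ennreal (1 / (1 - q))"
  have SB: "b * S k \<le> B" for k
  proof -
    have "S k = ennreal (\<Sum>j<k. q ^ j)" unfolding S_def using q by (subst sum_ennreal[symmetric]) (auto simp: ennreal_power)
    also have "(\<Sum>j<k. q ^ j) \<le> 1 / (1 - q)"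
    proof -
      have "(\<Sum>j<k. q ^ j) = (1 - q ^ k) / (1 - q)" using q by (simp add: sum_gp_strict)
      also have "\<dots> \<le> 1 / (1 - q)" using q by (intro divide_right_mono) auto
      finally show ?thesis .
    qed
    finally show ?thesis unfolding B_def by (intro mult_left_mono) (auto intro: ennreal_leI)
  qed
  have Bfin: "B < \<infinity>" using b by (simp add: B_def ennreal_mult_less_top)
  define \<psi> where "\<psi> A k x = min A (ennreal q ^ k * g x + b * S k)" for A k x
  have \<psi>m[measurable]: "\<psi> A k \<in> borel_measurable \<nu>" for A k unfolding \<psi>_def by measurable
  have step: "(\<integral>\<^sup>+x. \<psi> A k x \<partial>\<nu>) \<le> (\<integral>\<^sup>+x. \<psi> A (Suc k) x \<partial>\<nu>)" for A k
  proof -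
    have "(\<integral>\<^sup>+x. \<psi> A k x \<partial>\<nu>) = (\<integral>\<^sup>+x. \<integral>\<^sup>+v. \<psi> A k (\<phi> (x, v)) \<partial>\<gamma> \<partial>\<nu>)" by (rule inv[symmetric]) simp
    also have "\<dots> \<le> (\<integral>\<^sup>+x. \<psi> A (Suc k) x \<partial>\<nu>)"
    proof (rule nn_integral_mono)
      fix x assume x: "x \<in> space \<nu>"
      have gm: "(\<lambda>v. g (\<phi> (x, v))) \<in> borel_measurable \<gamma>"
        using measurable_Pair2[OF measurable_compose[OF \<phi> g(1)] x] by simp
      have "(\<integral>\<^sup>+v. \<psi> A k (\<phi> (x, v)) \<partial>\<gamma>) \<le> (\<integral>\<^sup>+v. A \<partial>\<gamma>)" by (intro nn_integral_mono) (simp add: \<psi>_def)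
      then have 1: "(\<integral>\<^sup>+v. \<psi> A k (\<phi> (x, v)) \<partial>\<gamma>) \<le> A" by (simp add: \<gamma>.emeasure_space_1)
      have "(\<integral>\<^sup>+v. \<psi> A k (\<phi> (x, v)) \<partial>\<gamma>) \<le> (\<integral>\<^sup>+v. ennreal q ^ k * g (\<phi> (x, v)) + b * S k \<partial>\<gamma>)"
        by (intro nn_integral_mono) (simp add: \<psi>_def)
      also have "\<dots> = ennreal q ^ k * (\<integral>\<^sup>+v. g (\<phi> (x, v)) \<partial>\<gamma>) + b * S k"
        using gm by (simp add: nn_integral_add nn_integral_cmult \<gamma>.emeasure_space_1)
      also have "\<dots> \<le> ennreal q ^ k * (ennreal q * g x + b) + b * S k"
        by (intro add_right_mono mult_left_mono drift x) simp
      also have "\<dots> = ennreal q ^ Suc k * g x + b * S (Suc k)"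
        by (simp add: S_def distrib_left mult_ac add_ac)
      finally show "(\<integral>\<^sup>+v. \<psi> A k (\<phi> (x, v)) \<partial>\<gamma>) \<le> \<psi> A (Suc k) x" using 1 by (simp add: \<psi>_def)
    qed
    finally show ?thesis .
  qed
  have trunc: "(\<integral>\<^sup>+x. min A (g x) \<partial>\<nu>) \<le> B" if A: "A < \<infinity>" for A
  proof -
    have up: "(\<integral>\<^sup>+x. min A (g x) \<partial>\<nu>) \<le> (\<integral>\<^sup>+x. \<psi> A k x \<partial>\<nu>)" for k
    proof (induction k)
      case (Suc k) then show ?case using step[of A k] by (rule order_trans)
    qed (simp add: \<psi>_def S_def)
    have "(\<integral>\<^sup>+x. \<psi> A k x \<partial>\<nu>) \<le> (\<integral>\<^sup>+x. min A (ennreal q ^ k * g x) \<partial>\<nu>) + B" for k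
    proof -
      have "(\<integral>\<^sup>+x. \<psi> A k x \<partial>\<nu>) \<le> (\<integral>\<^sup>+x. min A (ennreal q ^ k * g x) + B \<partial>\<nu>)"
      proof (rule nn_integral_mono)
        fix x
        have "min A (u + w) \<le> min A u + w" for u w :: ennreal by (simp add: min_def add_increasing2)
        then show "\<psi> A k x \<le> min A (ennreal q ^ k * g x) + B"
          unfolding \<psi>_def using SB[of k] by (meson add_left_mono order_trans)
      qed
      also have "\<dots> = (\<integral>\<^sup>+x. min A (ennreal q ^ k * g x) \<partial>\<nu>) + B"
        by (subst nn_integral_add) (auto simp: \<nu>.emeasure_space_1)
      finally show ?thesis .
    qed
    then have le: "(\<integral>\<^sup>+x. min A (g x) \<partial>\<nu>) \<le> (\<integral>\<^sup>+x. min A (ennreal q ^ k * g x) \<partial>\<nu>) + B" for k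
      using up[of k] order_trans by blast
    have "(\<lambda>k. \<integral>\<^sup>+x. min A (ennreal q ^ k * g x) \<partial>\<nu>) \<longlonglongrightarrow> (\<integral>\<^sup>+x. 0 \<partial>\<nu>)"
    proof (rule nn_integral_dominated_convergence[where w="\<lambda>_. A"])
      show "AE x in \<nu>. (\<lambda>k. min A (ennreal q ^ k * g x)) \<longlonglongrightarrow> 0"
      proof (rule AE_I2)
        fix x
        obtain r where r: "g x = ennreal r" "0 \<le> r" using g(2)[of x] by (cases "g x") auto
        have "(\<lambda>k. ennreal (q ^ k * r)) \<longlonglongrightarrow> ennreal (0 * r)"
          using q by (intro tendsto_ennrealI tendsto_mult tendsto_const LIMSEQ_power_zero) auto
        then have "(\<lambda>k. ennreal q ^ k * g x) \<longlonglongrightarrow> 0"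
          using q r by (simp add: ennreal_power ennreal_mult)
        then have "(\<lambda>k. min A (ennreal q ^ k * g x)) \<longlonglongrightarrow> min A 0" by (intro tendsto_min tendsto_const)
        then show "(\<lambda>k. min A (ennreal q ^ k * g x)) \<longlonglongrightarrow> 0" by simp
      qed
      show "(\<integral>\<^sup>+x. A \<partial>\<nu>) < \<infinity>" using A by (simp add: \<nu>.emeasure_space_1)
    qed auto
    then have "(\<lambda>k. (\<integral>\<^sup>+x. min A (ennreal q ^ k * g x) \<partial>\<nu>) + B) \<longlonglongrightarrow> 0 + B"
      by (intro tendsto_add tendsto_const) simp
    then show ?thesis using le by (intro LIMSEQ_le_const[of _ "B"]) auto
  qed
  have "(\<integral>\<^sup>+x. g x \<partial>\<nu>) = (\<integral>\<^sup>+x. liminf (\<lambda>j. min (of_nat j) (g x)) \<partial>\<nu>)"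
  proof (rule nn_integral_cong)
    fix x
    obtain r where r: "g x = ennreal r" "0 \<le> r" using g(2)[of x] by (cases "g x") auto
    obtain N :: nat where N: "r \<le> real N" using real_arch_simple by blast
    have "min (of_nat j) (g x) = g x" if "j \<ge> N" for j
      using that N r by (simp add: min_absorb2 ennreal_of_nat_eq_real_of_nat ennreal_leI)
    then have "(\<lambda>j. min (of_nat j) (g x)) \<longlonglongrightarrow> g x"
      by (intro tendsto_eventually) (auto simp: eventually_sequentially)
    then show "g x = liminf (\<lambda>j. min (of_nat j) (g x))" by (intro lim_imp_Liminf[symmetric]) auto
  qed
  also have "\<dots> \<le> liminf (\<lambda>j. \<integral>\<^sup>+x. min (of_nat j) (g x) \<partial>\<nu>)" by (intro nn_integral_liminf) measurable
  also have "\<dots> \<le> liminf (\<lambda>j::nat. B)"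
    by (intro Liminf_mono always_eventually allI trunc) (simp add: ennreal_of_nat_eq_real_of_nat)
  also have "\<dots> = B" by (simp add: Liminf_const)
  finally show ?thesis using Bfin by simp
qed

context hmc
begin

lemma prob_space_noise: "prob_space noise"
  unfolding noise_def by (intro prob_space_PiM prob_space_GU)

lemma noise_component: "i < n \<Longrightarrow> (\<lambda>\<omega>. \<omega> i) \<in> noise \<rightarrow>\<^sub>M GU d"
  unfolding noise_def by (rule measurable_component_singleton) simp

lemma velocity_measurable: "velocity \<in> noise \<rightarrow>\<^sub>M LC"
proof (rule config_measurableI)
  fix i assume i: "i < n"
  show "(\<lambda>\<omega>. velocity \<omega> i) \<in> borel_measurable noise"
    using measurable_compose[OF noise_component[OF i] fst_GU_borel] i by (simp add: velocity_def)
qed (rule velocity_configs)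

lemma shift_measurable [measurable]: "shift \<in> borel_measurable borel"
  unfolding shift_def by measurable

lemma partner_velocity_measurable:
  assumes f: "f \<in> M \<rightarrow>\<^sub>M LC" and g: "g \<in> M \<rightarrow>\<^sub>M LC" and w: "w \<in> M \<rightarrow>\<^sub>M noise"
  shows "(\<lambda>z. partner_velocity (f z) (g z) (w z)) \<in> M \<rightarrow>\<^sub>M LC"
proof (rule config_measurableI)
  fix i assume i: "i < n"
  note c = measurable_compose[OF w noise_component[OF i]]
  have "(\<lambda>z. partner (shift (f z i - g z i)) (fst (w z i), snd (w z i))) \<in> borel_measurable M"
  proof (rule partner_measurable_joint(1))
    show "(\<lambda>z. shift (f z i - g z i)) \<in> borel_measurable M"
      by (rule measurable_compose[OF borel_measurable_diff[OF config_componentD[OF f i] config_componentD[OF g i]] shift_measurable])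
  qed (rule measurable_compose[OF c fst_GU_borel], rule measurable_compose[OF c snd_GU])
  then show "(\<lambda>z. partner_velocity (f z) (g z) (w z) i) \<in> borel_measurable M" using i by (simp add: partner_velocity_def)
next
  fix z assume "z \<in> space M"
  then show "partner_velocity (f z) (g z) (w z) \<in> configs n d"
    using measurable_space[OF f] measurable_space[OF g] measurable_space[OF w] by (intro partner_velocity_configs) auto
qed

lemma noise_map:
  assumes t: "\<And>i. i < n \<Longrightarrow> t i \<in> GU d \<rightarrow>\<^sub>M Gau d" "\<And>i. i < n \<Longrightarrow> distr (GU d) (Gau d) (t i) = Gau d"
    and g: "g \<in> borel_measurable LC"
  shows "(\<integral>\<^sup>+\<omega>. g (\<lambda>i\<in>{..<n}. t i (\<omega> i)) \<partial>noise) = (\<integral>\<^sup>+v. g v \<partial>gauss_config n d)"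
proof -
  have D: "distr noise (gauss_config n d) (\<lambda>\<omega>. \<lambda>i\<in>{..<n}. t i (\<omega> i)) = gauss_config n d"
    unfolding noise_def gauss_config_eq
    by (rule distr_PiM_maps) (use t in \<open>auto intro: prob_space_imp_sigma_finite prob_space_GU prob_space_Gau\<close>)
  have "(\<lambda>\<omega>. \<lambda>i\<in>{..<n}. t i (\<omega> i)) \<in> noise \<rightarrow>\<^sub>M gauss_config n d"
    unfolding noise_def gauss_config_eq
  proof (rule measurable_restrict)
    fix i assume i: "i \<in> {..<n}"
    then have "(\<lambda>x. x i) \<in> PiM {..<n} (\<lambda>_. GU d) \<rightarrow>\<^sub>M GU d" by simp
    from measurable_compose[OF this t(1)] i show "(\<lambda>x. t i (x i)) \<in> PiM {..<n} (\<lambda>_. GU d) \<rightarrow>\<^sub>M Gau d" by simp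
  qed
  from nn_integral_distr[OF this, of g] g show ?thesis
    by (simp add: D measurable_cong_sets[OF sets_gauss_config refl])
qed

text \<open>The velocity is the partner for the shift zero.\<close>

lemma velocity_law:
  assumes g: "g \<in> borel_measurable LC"
  shows "(\<integral>\<^sup>+\<omega>. g (velocity \<omega>) \<partial>noise) = (\<integral>\<^sup>+v. g v \<partial>gauss_config n d)"
  unfolding velocity_def
proof (rule noise_map[OF _ _ g])
  have "fst = partner 0" by (simp add: fun_eq_iff partner_def rejected_def)
  then show "distr (GU d) (Gau d) fst = Gau d" using distr_partner[of 0 d] by simp
  show "fst \<in> GU d \<rightarrow>\<^sub>M Gau d" using fst_GU by (simp cong: measurable_cong_sets)
qed

lemma partner_velocity_law:
  assumes "x \<in> configs n d" "y \<in> configs n d" and g: "g \<in> borel_measurable LC"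
  shows "(\<integral>\<^sup>+\<omega>. g (partner_velocity x y \<omega>) \<partial>noise) = (\<integral>\<^sup>+v. g v \<partial>gauss_config n d)"
  unfolding partner_velocity_def
proof (rule noise_map[OF _ _ g])
  fix i assume "i < n"
  then have s: "shift (x i - y i) \<in> Rspace d" using assms by (intro shift_Rspace Rspace_closed configsD)
  show "partner (shift (x i - y i)) \<in> GU d \<rightarrow>\<^sub>M Gau d" using partner_measurable[OF s] by (simp cong: measurable_cong_sets)
  show "distr (GU d) (Gau d) (partner (shift (x i - y i))) = Gau d" by (rule distr_partner[OF s])
qed

lemma rho_measurable:
  assumes "f \<in> M \<rightarrow>\<^sub>M LC" "g \<in> M \<rightarrow>\<^sub>M LC"
  shows "(\<lambda>z. rho (f z) (g z)) \<in> borel_measurable M"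
  unfolding rho_def
  by (intro borel_measurable_sum measurable_compose[OF _ fc_measurable] measurable_compose[OF _ borel_measurable_norm] borel_measurable_diff
      config_componentD[OF assms(1)] config_componentD[OF assms(2)]) auto

lemma dist_measurable:
  assumes "f \<in> M \<rightarrow>\<^sub>M LC" "g \<in> M \<rightarrow>\<^sub>M LC"
  shows "(\<lambda>z. \<Sum>i<n. norm (f z i - g z i)) \<in> borel_measurable M"
  by (intro borel_measurable_sum measurable_compose[OF _ borel_measurable_norm] borel_measurable_diff
      config_componentD[OF assms(1)] config_componentD[OF assms(2)]) auto

lemma one_plus_mu: "1 + mu \<le> 2" using mu_bounds(3) by simp

lemma rho_triangle: "rho a c \<le> rho a b + 2 * (\<Sum>i<n. norm (b i - c i))"
proof -
  have "fc (norm (a i - c i)) \<le> fc (norm (a i - b i)) + 2 * norm (b i - c i)" for i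
  proof -
    have "fc (norm (a i - c i)) \<le> fc (norm (a i - b i)) + (1 + mu) * norm (b i - c i)"
      using norm_triangle_ineq[of "a i - b i" "b i - c i"] by (intro fc_lipschitz) auto
    also have "(1 + mu) * norm (b i - c i) \<le> 2 * norm (b i - c i)" by (intro mult_right_mono one_plus_mu) auto
    finally show ?thesis by simp
  qed
  then have "rho a c \<le> (\<Sum>i<n. fc (norm (a i - b i)) + 2 * norm (b i - c i))" unfolding rho_def by (intro sum_mono)
  then show ?thesis by (simp add: rho_def sum.distrib sum_distrib_left)
qed

lemma rho_commute: "rho a b = rho b a"
  by (simp add: rho_def norm_minus_commute)

lemma rho_lower: "mu * (\<Sum>i<n. norm (a i - b i)) \<le> rho a b"
  unfolding rho_def sum_distrib_left by (intro sum_mono fc_lower) auto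

definition origin :: config where "origin = (\<lambda>i\<in>{..<n}. 0)"

lemma origin_configs: "origin \<in> configs n d" unfolding origin_def by (intro restrict_configs) simp

lemma origin_nth: "i < n \<Longrightarrow> origin i = 0" by (simp add: origin_def)

lemma verlet_origin: "i < n \<Longrightarrow> fst (verlet h k (origin, origin)) i = 0 \<and> snd (verlet h k (origin, origin)) i = 0"
proof (induction k arbitrary: i)
  case (Suc k)
  let ?z = "verlet h k (origin, origin)"
  have f: "force i (fst ?z) = 0" if "i < n" for i by (rule force_zero) (use Suc.IH that in auto)
  have q: "fst (vstep h ?z) i = 0" if "i < n" for i using fst_vstep[OF that, of h ?z] Suc.IH[OF that] f[OF that] by simp
  have f': "force i (fst (vstep h ?z)) = 0" by (rule force_zero) (use q Suc.prems in auto)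
  have "snd (vstep h ?z) i = 0" using snd_vstep[OF Suc.prems, of h ?z] Suc.IH[OF Suc.prems] f[OF Suc.prems] f' by simp
  then show ?case using q[OF Suc.prems] by (simp add: verlet_Suc)
qed (simp add: origin_nth)

lemma verlet_from_origin:
  assumes h: "h > 0" and mh: "real m * h = T" and v: "v \<in> configs n d"
  shows "(\<Sum>i<n. norm (fst (verlet h m (origin, v)) i)) \<le> 2 * T * (\<Sum>i<n. norm (v i))"
proof -
  interpret trajectory_pair n d V W eps L Lt K R T h1 h m "(origin, v)" "(origin, origin)"
    by unfold_locales (use h mh v origin_configs in auto)
  have free: "free i = T * norm (v i)" if "i < n" for i
    unfolding free_def dq_def dp_def using T_pos that by (simp add: origin_nth)
  have "(\<Sum>i<n. norm (fst (verlet h m (origin, v)) i)) = (\<Sum>i<n. norm (dq m i))"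
    unfolding dq_def using verlet_origin by (intro sum.cong) auto
  also have "\<dots> \<le> (\<Sum>i<n. maxq i)" by (intro sum_mono dq_le_maxq) simp
  also have "\<dots> \<le> 6 / 5 * (\<Sum>i<n. free i)" using sum_maxq_le by simp
  also have "(\<Sum>i<n. free i) = T * (\<Sum>i<n. norm (v i))" using free by (simp add: sum_distrib_left)
  also have "6 / 5 * (T * (\<Sum>i<n. norm (v i))) \<le> 2 * T * (\<Sum>i<n. norm (v i))"
    using T_pos by (simp add: sum_nonneg mult_right_mono)
  finally show ?thesis .
qed

lemma gauss_norm_sum: "(\<integral>\<^sup>+v. ennreal (\<Sum>i<n. norm (v i)) \<partial>gauss_config n d) \<le> ennreal (sqrt (real d) * real n)"
proof -
  have "(\<integral>\<^sup>+v. ennreal (\<Sum>i<n. norm (v i)) \<partial>gauss_config n d) = of_nat n * (\<integral>\<^sup>+x. ennreal (norm x) \<partial>Gau d)"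
    using gauss_config_sum[of "\<lambda>x. ennreal (norm x)" d n] by (simp add: sum_ennreal)
  also have "\<dots> \<le> of_nat n * ennreal (sqrt (real d))" using Gau_norm[OF d_pos] by (rule mult_left_mono) simp
  also have "\<dots> = ennreal (sqrt (real d) * real n)"
    by (simp add: ennreal_of_nat_eq_real_of_nat ennreal_mult[symmetric] mult.commute)
  finally show ?thesis .
qed

lemma gauss_norm_sq_sum: "(\<integral>\<^sup>+v. ennreal (\<Sum>i<n. (norm (v i))\<^sup>2) \<partial>gauss_config n d) = ennreal (real d * real n)"
proof -
  have "(\<integral>\<^sup>+v. ennreal (\<Sum>i<n. (norm (v i))\<^sup>2) \<partial>gauss_config n d) = of_nat n * (\<integral>\<^sup>+x. ennreal ((norm x)\<^sup>2) \<partial>Gau d)"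
    using gauss_config_sum[of "\<lambda>x. ennreal ((norm x)\<^sup>2)" d n] by (simp add: sum_ennreal)
  also have "\<dots> = ennreal (real d * real n)"
    unfolding Gau_norm_sq by (simp add: ennreal_of_nat_eq_real_of_nat ennreal_mult[symmetric] mult.commute)
  finally show ?thesis .
qed

end

locale hmc_run = hmc +
  fixes q p qt pt :: flow and h :: real and m :: nat and muh :: "config measure"
  assumes hf: "hamiltonian_flow n d U q p"
    and h_pos: "h > 0" and mh: "real m * h = T" and vf: "verlet_flow n d U h qt pt"
    and int: "integrable LC (\<lambda>x. exp (- U x))"
    and inv: "invariant_prob LC (hmc_kernel n d T qt) muh"
begin

abbreviation qv :: "config \<Rightarrow> config \<Rightarrow> config" where "qv x v \<equiv> fst (verlet h m (x, v))"

lemma qt_eq: "x \<in> configs n d \<Longrightarrow> v \<in> configs n d \<Longrightarrow> qt T x v = qv x v"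
  using verlet_flow_grid[OF vf h_pos, of x v m] by (simp add: mh)

lemma prob_space_muh: "prob_space muh" and sets_muh: "sets muh = sets LC"
  using inv by (auto simp: invariant_prob_def)

lemma space_muh [simp]: "space muh = configs n d"
  using sets_eq_imp_space_eq[OF sets_muh] by simp

lemma qv_measurable: "f \<in> M \<rightarrow>\<^sub>M LC \<Longrightarrow> g \<in> M \<rightarrow>\<^sub>M LC \<Longrightarrow> (\<lambda>z. qv (f z) (g z)) \<in> M \<rightarrow>\<^sub>M LC"
  by (rule measurable_compose[OF measurable_compose[OF measurable_Pair verlet_measurable] measurable_fst])

lemma q_measurable: "f \<in> M \<rightarrow>\<^sub>M LC \<Longrightarrow> g \<in> M \<rightarrow>\<^sub>M LC \<Longrightarrow> (\<lambda>z. q T (f z) (g z)) \<in> M \<rightarrow>\<^sub>M LC"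
  using measurable_compose[OF measurable_Pair flow_measurable[OF hf T_pos Lip_T], of f M g] by simp

lemma id_muh: "(\<lambda>x. x) \<in> muh \<rightarrow>\<^sub>M LC" and id_gauss: "(\<lambda>x. x) \<in> gauss_config n d \<rightarrow>\<^sub>M LC"
  and id_gibbs: "(\<lambda>x. x) \<in> gibbsU \<rightarrow>\<^sub>M LC" and id_LC: "(\<lambda>x. x) \<in> LC \<rightarrow>\<^sub>M LC"
  by (simp_all add: measurable_cong_sets[OF sets_muh refl] measurable_cong_sets[OF sets_gauss_config refl]
      measurable_cong_sets[OF sets_gibbs refl])

lemma muh_invariant:
  fixes g :: "config \<Rightarrow> ennreal"
  assumes g: "g \<in> borel_measurable LC"
  shows "(\<integral>\<^sup>+x. \<integral>\<^sup>+v. g (qv x v) \<partial>gauss_config n d \<partial>muh) = (\<integral>\<^sup>+x. g x \<partial>muh)"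
proof -
  interpret N: prob_space "gauss_config n d" by (rule prob_space_gauss_config)
  let ?J = "muh \<Otimes>\<^sub>M gauss_config n d"
  have qm: "(\<lambda>z. qv (fst z) (snd z)) \<in> ?J \<rightarrow>\<^sub>M LC"
    by (rule qv_measurable[OF measurable_compose[OF measurable_fst id_muh] measurable_compose[OF measurable_snd id_gauss]])
  have "distr ?J LC (\<lambda>z. qv (fst z) (snd z)) = muh"
  proof (rule measure_eqI)
    fix A assume "A \<in> sets (distr ?J LC (\<lambda>z. qv (fst z) (snd z)))"
    then have A: "A \<in> sets LC" by simp
    have "emeasure (distr ?J LC (\<lambda>z. qv (fst z) (snd z))) A = (\<integral>\<^sup>+z. indicator A (qv (fst z) (snd z)) \<partial>?J)"
      using A by (subst nn_integral_distr[OF qm, symmetric]) auto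
    also have "\<dots> = (\<integral>\<^sup>+x. \<integral>\<^sup>+v. indicator A (qv x v) \<partial>gauss_config n d \<partial>muh)"
      by (rule N.nn_integral_fst[of "\<lambda>z. indicator A (qv (fst z) (snd z))", unfolded fst_conv snd_conv, symmetric])
         (rule measurable_compose[OF qm borel_measurable_indicator[OF A]])
    also have "\<dots> = (\<integral>\<^sup>+x. emeasure (hmc_kernel n d T qt x) A \<partial>muh)"
    proof (rule nn_integral_cong)
      fix x assume "x \<in> space muh"
      then have x: "x \<in> configs n d" by simp
      have "hmc_kernel n d T qt x = distr (gauss_config n d) LC (qv x)"
        unfolding hmc_kernel_def by (intro distr_cong) (use x qt_eq in auto)
      moreover have qm': "qv x \<in> gauss_config n d \<rightarrow>\<^sub>M LC"
        by (rule qv_measurable[OF measurable_const id_gauss]) (use x in simp)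
      ultimately show "(\<integral>\<^sup>+v. indicator A (qv x v) \<partial>gauss_config n d) = emeasure (hmc_kernel n d T qt x) A"
        using A nn_integral_distr[OF qm', of "indicator A"] by simp
    qed
    also have "\<dots> = emeasure muh A" using inv A by (simp add: invariant_prob_def)
    finally show "emeasure (distr ?J LC (\<lambda>z. qv (fst z) (snd z))) A = emeasure muh A" .
  qed (simp add: sets_muh)
  then have "(\<integral>\<^sup>+x. g x \<partial>muh) = (\<integral>\<^sup>+z. g (qv (fst z) (snd z)) \<partial>?J)"
    using nn_integral_distr[OF qm, of g] g by (simp add: measurable_cong_sets[OF sets_muh refl])
  also have "\<dots> = (\<integral>\<^sup>+x. \<integral>\<^sup>+v. g (qv x v) \<partial>gauss_config n d \<partial>muh)"
    by (rule N.nn_integral_fst[of "\<lambda>z. g (qv (fst z) (snd z))", unfolded fst_conv snd_conv, symmetric])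
       (rule measurable_compose[OF qm g])
  finally show ?thesis by simp
qed

text \<open>The contraction is applied to \<open>y\<close> and the origin. The origin itself is moved by the Gaussian
  velocity only, since the force vanishes there.\<close>

lemma origin_drift:
  assumes y: "y \<in> configs n d"
  shows "(\<integral>\<^sup>+v. ennreal (rho (qv y v) origin) \<partial>gauss_config n d)
    \<le> ennreal (1 - 2 * cc) * ennreal (rho y origin) + ennreal (4 * T * (sqrt (real d) * real n))"
proof -
  have o: "(\<lambda>_. origin) \<in> M \<rightarrow>\<^sub>M LC" for M :: "'z measure" by (rule measurable_const) (simp add: origin_configs)
  have yc: "(\<lambda>_. y) \<in> M \<rightarrow>\<^sub>M LC" for M :: "'z measure" by (rule measurable_const) (simp add: y)
  have pv: "partner_velocity y origin \<in> noise \<rightarrow>\<^sub>M LC"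
    by (rule partner_velocity_measurable[OF yc o]) simp
  have m1: "(\<lambda>v. ennreal (rho (qv y v) origin)) \<in> borel_measurable LC"
    by (intro measurable_compose[OF _ measurable_ennreal] rho_measurable qv_measurable yc o id_LC)
  have m2: "(\<lambda>v. ennreal (2 * (\<Sum>i<n. norm (qv origin v i - origin i)))) \<in> borel_measurable LC"
    by (intro measurable_compose[OF _ measurable_ennreal] borel_measurable_times borel_measurable_const
        dist_measurable qv_measurable o id_LC)
  have "(\<integral>\<^sup>+v. ennreal (rho (qv y v) origin) \<partial>gauss_config n d) = (\<integral>\<^sup>+\<omega>. ennreal (rho (qv y (velocity \<omega>)) origin) \<partial>noise)"
    by (rule velocity_law[OF m1, symmetric])
  also have "\<dots> \<le> (\<integral>\<^sup>+\<omega>. ennreal (rho (qv y (velocity \<omega>)) (qv origin (partner_velocity y origin \<omega>)))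
      + ennreal (2 * (\<Sum>i<n. norm (qv origin (partner_velocity y origin \<omega>) i - origin i))) \<partial>noise)"
    by (intro nn_integral_mono)
       (simp add: ennreal_plus[symmetric] ennreal_leI rho_triangle rho_nonneg sum_nonneg del: ennreal_plus)
  also have "\<dots> = (\<integral>\<^sup>+\<omega>. ennreal (rho (qv y (velocity \<omega>)) (qv origin (partner_velocity y origin \<omega>))) \<partial>noise)
      + (\<integral>\<^sup>+\<omega>. ennreal (2 * (\<Sum>i<n. norm (qv origin (partner_velocity y origin \<omega>) i - origin i))) \<partial>noise)"
    by (intro nn_integral_add measurable_compose[OF _ measurable_ennreal] rho_measurable qv_measurable yc o
        velocity_measurable pv measurable_compose[OF pv m2])
  also have "(\<integral>\<^sup>+\<omega>. ennreal (2 * (\<Sum>i<n. norm (qv origin (partner_velocity y origin \<omega>) i - origin i))) \<partial>noise)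
     = (\<integral>\<^sup>+v. ennreal (2 * (\<Sum>i<n. norm (qv origin v i - origin i))) \<partial>gauss_config n d)"
    by (rule partner_velocity_law[OF y origin_configs m2])
  also have "\<dots> \<le> (\<integral>\<^sup>+v. ennreal (4 * T) * ennreal (\<Sum>i<n. norm (v i)) \<partial>gauss_config n d)"
  proof (rule nn_integral_mono)
    fix v assume "v \<in> space (gauss_config n d)"
    then have "2 * (\<Sum>i<n. norm (qv origin v i - origin i)) \<le> 4 * T * (\<Sum>i<n. norm (v i))"
      using verlet_from_origin[OF h_pos mh, of v] by (simp add: origin_nth)
    then show "ennreal (2 * (\<Sum>i<n. norm (qv origin v i - origin i))) \<le> ennreal (4 * T) * ennreal (\<Sum>i<n. norm (v i))"
      using T_pos by (simp add: ennreal_mult[symmetric] sum_nonneg ennreal_leI)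
  qed
  also have "\<dots> = ennreal (4 * T) * (\<integral>\<^sup>+v. ennreal (\<Sum>i<n. norm (v i)) \<partial>gauss_config n d)"
    by (intro nn_integral_cmult measurable_compose[OF _ measurable_ennreal] borel_measurable_sum measurable_compose[OF _ borel_measurable_norm] config_componentD[OF id_gauss]) auto
  also have "\<dots> \<le> ennreal (4 * T) * ennreal (sqrt (real d) * real n)" by (intro mult_left_mono gauss_norm_sum) simp
  also have "\<dots> = ennreal (4 * T * (sqrt (real d) * real n))" using T_pos by (subst ennreal_mult) auto
  finally have le: "(\<integral>\<^sup>+v. ennreal (rho (qv y v) origin) \<partial>gauss_config n d)
    \<le> (\<integral>\<^sup>+\<omega>. ennreal (rho (qv y (velocity \<omega>)) (qv origin (partner_velocity y origin \<omega>))) \<partial>noise)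
      + ennreal (4 * T * (sqrt (real d) * real n))" by simp
  show ?thesis
    by (rule order_trans[OF le add_right_mono[OF one_step_contraction[OF h_pos mh y origin_configs]]])
qed

lemma muh_moment: "(\<integral>\<^sup>+x. ennreal (rho x origin) \<partial>muh) < \<infinity>"
proof (rule invariant_moment_finite[where \<gamma>="gauss_config n d" and \<phi>="\<lambda>z. qv (fst z) (snd z)" and q="1 - 2 * cc"
      and b="ennreal (4 * T * (sqrt (real d) * real n))"])
  show "(\<lambda>z. qv (fst z) (snd z)) \<in> muh \<Otimes>\<^sub>M gauss_config n d \<rightarrow>\<^sub>M muh"
    unfolding measurable_cong_sets[OF refl sets_muh]
    by (rule qv_measurable[OF measurable_compose[OF measurable_fst id_muh] measurable_compose[OF measurable_snd id_gauss]])
  show "(\<lambda>x. ennreal (rho x origin)) \<in> borel_measurable muh"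
    by (intro measurable_compose[OF _ measurable_ennreal] rho_measurable id_muh measurable_const) (simp add: origin_configs)
  show "(\<integral>\<^sup>+x. \<integral>\<^sup>+v. f (qv (fst (x, v)) (snd (x, v))) \<partial>gauss_config n d \<partial>muh) = (\<integral>\<^sup>+x. f x \<partial>muh)"
    if "f \<in> borel_measurable muh" for f :: "config \<Rightarrow> ennreal"
    using muh_invariant[of f] that by (simp add: measurable_cong_sets[OF sets_muh refl])
  show "(\<integral>\<^sup>+v. ennreal (rho (qv (fst (x, v)) (snd (x, v))) origin) \<partial>gauss_config n d)
    \<le> ennreal (1 - 2 * cc) * ennreal (rho x origin) + ennreal (4 * T * (sqrt (real d) * real n))"
    if "x \<in> space muh" for x using origin_drift[of x] that by simp
qed (use rate_small cc_pos prob_space_muh prob_space_gauss_config in auto)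

section \<open>Transport of couplings\<close>

definition cost :: "(config \<times> config) measure \<Rightarrow> ennreal"
  where "cost \<omega> = (\<integral>\<^sup>+z. ennreal (rho (fst z) (snd z)) \<partial>\<omega>)"

definition flow_error :: "config \<Rightarrow> ennreal"
  where "flow_error x = (\<integral>\<^sup>+v. ennreal (\<Sum>i<n. norm (q T x v i - qv x v i)) \<partial>gauss_config n d)"

lemma prob_space_gibbsU: "prob_space gibbsU" by (rule prob_space_gibbs[OF int])

lemma flow_error_measurable: "flow_error \<in> borel_measurable LC"
proof -
  interpret N: prob_space "gauss_config n d" by (rule prob_space_gauss_config)
  have "(\<lambda>z. ennreal (\<Sum>i<n. norm (q T (fst z) (snd z) i - qv (fst z) (snd z) i))) \<in> borel_measurable (LC \<Otimes>\<^sub>M gauss_config n d)"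
    by (intro measurable_compose[OF _ measurable_ennreal] dist_measurable q_measurable qv_measurable
        measurable_fst measurable_compose[OF measurable_snd id_gauss])
  from N.borel_measurable_nn_integral_fst[OF this] show ?thesis by (simp add: flow_error_def[abs_def])
qed

lemma coupling_facts:
  assumes \<omega>: "\<omega> \<in> couplings gibbsU muh"
  shows "sets \<omega> = sets PS" "space \<omega> = configs n d \<times> configs n d" "prob_space \<omega>"
    "fst \<in> \<omega> \<rightarrow>\<^sub>M LC" "snd \<in> \<omega> \<rightarrow>\<^sub>M LC"
    "distr \<omega> LC fst = gibbsU" "distr \<omega> LC snd = muh"
proof -
  show s: "sets \<omega> = sets PS"
    using \<omega> sets_pair_measure_cong[OF sets_gibbs sets_muh] by (simp add: couplings_def)
  then show "space \<omega> = configs n d \<times> configs n d"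
    using sets_eq_imp_space_eq[OF s] by (simp add: space_pair_measure)
  show f: "fst \<in> \<omega> \<rightarrow>\<^sub>M LC" "snd \<in> \<omega> \<rightarrow>\<^sub>M LC" by (simp_all add: measurable_cong_sets[OF s refl])
  have "distr \<omega> LC fst = distr \<omega> gibbsU fst" "distr \<omega> LC snd = distr \<omega> muh snd"
    by (auto intro!: distr_cong simp: sets_gibbs sets_muh)
  then show d: "distr \<omega> LC fst = gibbsU" "distr \<omega> LC snd = muh" using \<omega> by (auto simp: couplings_def)
  show "prob_space \<omega>" by (rule prob_space_distrD[OF f(1)]) (simp add: d prob_space_gibbsU)
qed

text \<open>Any coupling is pushed forward by one transition on each side, the exact one on the left and
  the discretised one on the right, with coupled velocities. Both marginals are invariant, so the
  result is a coupling of the same measures. Its cost is compared with that of two coupled Verlet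
  transitions, and the difference is the strong error averaged over the Gibbs measure.\<close>

lemma push_coupling:
  assumes \<omega>: "\<omega> \<in> couplings gibbsU muh"
  shows "\<exists>\<omega>'\<in>couplings gibbsU muh.
    cost \<omega>' \<le> ennreal (1 - 2 * cc) * cost \<omega> + 2 * (\<integral>\<^sup>+x. flow_error x \<partial>gibbsU)"
proof -
  note cf = coupling_facts[OF \<omega>]
  have conf: "fst z \<in> configs n d" "snd z \<in> configs n d" if "z \<in> space \<omega>" for z
    using that unfolding cf(2) mem_Times_iff by blast+
  interpret NZ: prob_space noise by (rule prob_space_noise)
  interpret N: prob_space "gauss_config n d" by (rule prob_space_gauss_config)
  let ?O = "\<omega> \<Otimes>\<^sub>M noise"
  define X where "X z = q T (fst (fst z)) (velocity (snd z))" for z :: "(config \<times> config) \<times> (nat \<Rightarrow> ell2 \<times> real)"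
  define X0 where "X0 z = qv (fst (fst z)) (velocity (snd z))" for z :: "(config \<times> config) \<times> (nat \<Rightarrow> ell2 \<times> real)"
  define Y where "Y z = qv (snd (fst z)) (partner_velocity (fst (fst z)) (snd (fst z)) (snd z))"
    for z :: "(config \<times> config) \<times> (nat \<Rightarrow> ell2 \<times> real)"
  have a: "(\<lambda>z. fst (fst z)) \<in> ?O \<rightarrow>\<^sub>M LC" by (rule measurable_compose[OF measurable_fst cf(4)])
  have b: "(\<lambda>z. snd (fst z)) \<in> ?O \<rightarrow>\<^sub>M LC" by (rule measurable_compose[OF measurable_fst cf(5)])
  have v: "(\<lambda>z. velocity (snd z)) \<in> ?O \<rightarrow>\<^sub>M LC" by (rule measurable_compose[OF measurable_snd velocity_measurable])
  have X: "X \<in> ?O \<rightarrow>\<^sub>M LC" unfolding X_def by (rule q_measurable[OF a v])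
  have X0: "X0 \<in> ?O \<rightarrow>\<^sub>M LC" unfolding X0_def by (rule qv_measurable[OF a v])
  have Y: "Y \<in> ?O \<rightarrow>\<^sub>M LC" unfolding Y_def
    by (rule qv_measurable[OF b partner_velocity_measurable[OF a b measurable_snd]])
  have XY: "(\<lambda>z. (X z, Y z)) \<in> ?O \<rightarrow>\<^sub>M PS" by (rule measurable_Pair[OF X Y])
  define \<omega>' where "\<omega>' = distr ?O (gibbsU \<Otimes>\<^sub>M muh) (\<lambda>z. (X z, Y z))"
  have sP: "sets (gibbsU \<Otimes>\<^sub>M muh) = sets PS" by (rule sets_pair_measure_cong[OF sets_gibbs sets_muh])
  have XY': "(\<lambda>z. (X z, Y z)) \<in> ?O \<rightarrow>\<^sub>M gibbsU \<Otimes>\<^sub>M muh" using XY by (simp add: measurable_cong_sets[OF refl sP])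
  have nnO: "(\<integral>\<^sup>+z. f z \<partial>?O) = (\<integral>\<^sup>+z. \<integral>\<^sup>+w. f (z, w) \<partial>noise \<partial>\<omega>)" if "f \<in> borel_measurable ?O" for f
    by (rule NZ.nn_integral_fst[OF that, symmetric])
  have margX: "distr ?O LC X = gibbsU"
  proof (rule measure_eqI)
    fix A assume "A \<in> sets (distr ?O LC X)"
    then have A: "A \<in> sets LC" by simp
    let ?J = "gibbsU \<Otimes>\<^sub>M gauss_config n d"
    have qJ: "(\<lambda>z. q T (fst z) (snd z)) \<in> ?J \<rightarrow>\<^sub>M LC"
      by (rule q_measurable[OF measurable_compose[OF measurable_fst id_gibbs] measurable_compose[OF measurable_snd id_gauss]])
    have qL: "(\<lambda>z. indicator A (q T (fst z) (snd z)) :: ennreal) \<in> borel_measurable (LC \<Otimes>\<^sub>M gauss_config n d)"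
      by (rule measurable_compose[OF q_measurable[OF measurable_fst measurable_compose[OF measurable_snd id_gauss]] borel_measurable_indicator[OF A]])
    have "emeasure (distr ?O LC X) A = (\<integral>\<^sup>+z. indicator A (X z) \<partial>?O)"
      using A by (subst nn_integral_distr[OF X, symmetric]) auto
    also have "\<dots> = (\<integral>\<^sup>+z. \<integral>\<^sup>+w. indicator A (X (z, w)) \<partial>noise \<partial>\<omega>)"
      by (rule nnO, rule measurable_compose[OF X borel_measurable_indicator[OF A]])
    also have "\<dots> = (\<integral>\<^sup>+z. \<integral>\<^sup>+w. indicator A (q T (fst z) (velocity w)) \<partial>noise \<partial>\<omega>)"
      unfolding X_def fst_conv snd_conv by (rule refl)
    also have "\<dots> = (\<integral>\<^sup>+z. \<integral>\<^sup>+u. indicator A (q T (fst z) u) \<partial>gauss_config n d \<partial>\<omega>)"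
    proof (rule nn_integral_cong)
      fix z assume "z \<in> space \<omega>"
      then have z: "fst z \<in> configs n d" by (rule conf)
      show "(\<integral>\<^sup>+w. indicator A (q T (fst z) (velocity w)) \<partial>noise) = (\<integral>\<^sup>+u. indicator A (q T (fst z) u) \<partial>gauss_config n d)"
        by (rule velocity_law, rule measurable_compose[OF q_measurable[OF measurable_const id_LC] borel_measurable_indicator[OF A]])
           (simp add: z)
    qed
    also have "\<dots> = (\<integral>\<^sup>+x. \<integral>\<^sup>+u. indicator A (q T x u) \<partial>gauss_config n d \<partial>distr \<omega> LC fst)"
      using N.borel_measurable_nn_integral_fst[OF qL] by (subst nn_integral_distr[OF cf(4)]) auto
    also have "\<dots> = (\<integral>\<^sup>+x. \<integral>\<^sup>+u. indicator A (q T x u) \<partial>gauss_config n d \<partial>gibbsU)" by (simp only: cf(6))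
    also have "\<dots> = (\<integral>\<^sup>+z. indicator A (q T (fst z) (snd z)) \<partial>?J)"
      by (rule N.nn_integral_fst[of "\<lambda>z. indicator A (q T (fst z) (snd z))", unfolded fst_conv snd_conv])
         (rule measurable_compose[OF qJ borel_measurable_indicator[OF A]])
    also have "\<dots> = emeasure (distr ?J LC (\<lambda>z. q T (fst z) (snd z))) A"
      using A by (subst nn_integral_distr[OF qJ, symmetric]) auto
    also have "\<dots> = emeasure gibbsU A" by (simp only: flow_invariant[OF hf T_pos Lip_T int])
    finally show "emeasure (distr ?O LC X) A = emeasure gibbsU A" .
  qed (simp add: sets_gibbs)
  have margY: "distr ?O LC Y = muh"
  proof (rule measure_eqI)
    fix A assume "A \<in> sets (distr ?O LC Y)"
    then have A: "A \<in> sets LC" by simp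
    have qL: "(\<lambda>z. indicator A (qv (fst z) (snd z)) :: ennreal) \<in> borel_measurable (LC \<Otimes>\<^sub>M gauss_config n d)"
      by (rule measurable_compose[OF qv_measurable[OF measurable_fst measurable_compose[OF measurable_snd id_gauss]] borel_measurable_indicator[OF A]])
    have "emeasure (distr ?O LC Y) A = (\<integral>\<^sup>+z. indicator A (Y z) \<partial>?O)"
      using A by (subst nn_integral_distr[OF Y, symmetric]) auto
    also have "\<dots> = (\<integral>\<^sup>+z. \<integral>\<^sup>+w. indicator A (Y (z, w)) \<partial>noise \<partial>\<omega>)"
      by (rule nnO, rule measurable_compose[OF Y borel_measurable_indicator[OF A]])
    also have "\<dots> = (\<integral>\<^sup>+z. \<integral>\<^sup>+w. indicator A (qv (snd z) (partner_velocity (fst z) (snd z) w)) \<partial>noise \<partial>\<omega>)"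
      unfolding Y_def fst_conv snd_conv by (rule refl)
    also have "\<dots> = (\<integral>\<^sup>+z. \<integral>\<^sup>+u. indicator A (qv (snd z) u) \<partial>gauss_config n d \<partial>\<omega>)"
    proof (rule nn_integral_cong)
      fix z assume "z \<in> space \<omega>"
      then have z: "fst z \<in> configs n d" "snd z \<in> configs n d" by (rule conf)+
      show "(\<integral>\<^sup>+w. indicator A (qv (snd z) (partner_velocity (fst z) (snd z) w)) \<partial>noise) = (\<integral>\<^sup>+u. indicator A (qv (snd z) u) \<partial>gauss_config n d)"
        by (rule partner_velocity_law[OF z], rule measurable_compose[OF qv_measurable[OF measurable_const id_LC] borel_measurable_indicator[OF A]])
           (simp add: z)
    qed
    also have "\<dots> = (\<integral>\<^sup>+x. \<integral>\<^sup>+u. indicator A (qv x u) \<partial>gauss_config n d \<partial>distr \<omega> LC snd)"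
      using N.borel_measurable_nn_integral_fst[OF qL] by (subst nn_integral_distr[OF cf(5)]) auto
    also have "\<dots> = (\<integral>\<^sup>+x. \<integral>\<^sup>+u. indicator A (qv x u) \<partial>gauss_config n d \<partial>muh)" by (simp only: cf(7))
    also have "\<dots> = (\<integral>\<^sup>+x. indicator A x \<partial>muh)" by (rule muh_invariant) (rule borel_measurable_indicator[OF A])
    also have "\<dots> = emeasure muh A" using A by (simp add: sets_muh)
    finally show "emeasure (distr ?O LC Y) A = emeasure muh A" .
  qed (simp add: sets_muh)
  have "\<omega>' \<in> couplings gibbsU muh"
  proof -
    have "distr \<omega>' gibbsU fst = distr ?O gibbsU X" "distr \<omega>' muh snd = distr ?O muh Y"
      unfolding \<omega>'_def using XY' by (simp_all add: distr_distr comp_def)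
    moreover have "distr ?O gibbsU X = distr ?O LC X" "distr ?O muh Y = distr ?O LC Y"
      by (auto intro!: distr_cong simp: sets_gibbs sets_muh)
    ultimately show ?thesis using margX margY by (simp add: couplings_def \<omega>'_def)
  qed
  moreover have "cost \<omega>' \<le> ennreal (1 - 2 * cc) * cost \<omega> + 2 * (\<integral>\<^sup>+x. flow_error x \<partial>gibbsU)"
  proof -
    have rm: "(\<lambda>z. ennreal (rho (fst z) (snd z))) \<in> borel_measurable PS"
      by (intro measurable_compose[OF _ measurable_ennreal] rho_measurable measurable_fst measurable_snd)
    have m1: "(\<lambda>z. ennreal (rho (X0 z) (Y z))) \<in> borel_measurable ?O"
      by (intro measurable_compose[OF _ measurable_ennreal] rho_measurable X0 Y)
    have m2: "(\<lambda>z. ennreal (\<Sum>i<n. norm (X z i - X0 z i))) \<in> borel_measurable ?O"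
      by (intro measurable_compose[OF _ measurable_ennreal] dist_measurable X X0)
    have "cost \<omega>' = (\<integral>\<^sup>+z. ennreal (rho (X z) (Y z)) \<partial>?O)"
      unfolding cost_def \<omega>'_def using rm by (subst nn_integral_distr[OF XY']) (auto simp: measurable_cong_sets[OF sP refl])
    also have "\<dots> \<le> (\<integral>\<^sup>+z. ennreal (rho (X0 z) (Y z)) + 2 * ennreal (\<Sum>i<n. norm (X z i - X0 z i)) \<partial>?O)"
    proof (rule nn_integral_mono)
      fix z
      have "rho (X z) (Y z) \<le> rho (X0 z) (Y z) + 2 * (\<Sum>i<n. norm (X z i - X0 z i))"
        using rho_triangle[of "Y z" "X z" "X0 z"] by (simp add: rho_commute norm_minus_commute)
      then have "ennreal (rho (X z) (Y z)) \<le> ennreal (rho (X0 z) (Y z) + 2 * (\<Sum>i<n. norm (X z i - X0 z i)))"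
        by (rule ennreal_leI)
      also have "\<dots> = ennreal (rho (X0 z) (Y z)) + ennreal (2 * (\<Sum>i<n. norm (X z i - X0 z i)))"
        by (intro ennreal_plus rho_nonneg mult_nonneg_nonneg sum_nonneg) auto
      also have "ennreal (2 * (\<Sum>i<n. norm (X z i - X0 z i))) = 2 * ennreal (\<Sum>i<n. norm (X z i - X0 z i))"
        by (subst ennreal_mult) (auto intro: sum_nonneg)
      finally show "ennreal (rho (X z) (Y z)) \<le> ennreal (rho (X0 z) (Y z)) + 2 * ennreal (\<Sum>i<n. norm (X z i - X0 z i))" .
    qed
    also have "\<dots> = (\<integral>\<^sup>+z. ennreal (rho (X0 z) (Y z)) \<partial>?O) + 2 * (\<integral>\<^sup>+z. ennreal (\<Sum>i<n. norm (X z i - X0 z i)) \<partial>?O)"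
      using m1 m2 by (subst nn_integral_add) (auto simp: nn_integral_cmult)
    also have "(\<integral>\<^sup>+z. ennreal (rho (X0 z) (Y z)) \<partial>?O) \<le> ennreal (1 - 2 * cc) * cost \<omega>"
    proof -
      have "(\<integral>\<^sup>+z. ennreal (rho (X0 z) (Y z)) \<partial>?O) = (\<integral>\<^sup>+z. \<integral>\<^sup>+w. ennreal (rho (X0 (z, w)) (Y (z, w))) \<partial>noise \<partial>\<omega>)"
        by (rule nnO[OF m1])
      also have "\<dots> \<le> (\<integral>\<^sup>+z. ennreal (1 - 2 * cc) * ennreal (rho (fst z) (snd z)) \<partial>\<omega>)"
        unfolding X0_def Y_def fst_conv snd_conv
        by (intro nn_integral_mono one_step_contraction h_pos mh conf)
      also have "\<dots> = ennreal (1 - 2 * cc) * cost \<omega>"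
        unfolding cost_def using rm by (intro nn_integral_cmult) (simp add: measurable_cong_sets[OF cf(1) refl])
      finally show ?thesis .
    qed
    also have "(\<integral>\<^sup>+z. ennreal (\<Sum>i<n. norm (X z i - X0 z i)) \<partial>?O) = (\<integral>\<^sup>+x. flow_error x \<partial>gibbsU)"
    proof -
      have "(\<integral>\<^sup>+z. ennreal (\<Sum>i<n. norm (X z i - X0 z i)) \<partial>?O)
        = (\<integral>\<^sup>+z. \<integral>\<^sup>+w. ennreal (\<Sum>i<n. norm (X (z, w) i - X0 (z, w) i)) \<partial>noise \<partial>\<omega>)" by (rule nnO[OF m2])
      also have "\<dots> = (\<integral>\<^sup>+z. flow_error (fst z) \<partial>\<omega>)"
      proof (rule nn_integral_cong)
        fix z assume "z \<in> space \<omega>"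
        then have z: "(\<lambda>_. fst z) \<in> LC \<rightarrow>\<^sub>M LC" by (intro measurable_const) (simp add: conf)
        show "(\<integral>\<^sup>+w. ennreal (\<Sum>i<n. norm (X (z, w) i - X0 (z, w) i)) \<partial>noise) = flow_error (fst z)"
          unfolding X_def X0_def fst_conv snd_conv flow_error_def
          by (rule velocity_law)
             (intro measurable_compose[OF _ measurable_ennreal] dist_measurable q_measurable qv_measurable z id_LC)
      qed
      also have "\<dots> = (\<integral>\<^sup>+x. flow_error x \<partial>distr \<omega> LC fst)"
        using flow_error_measurable by (subst nn_integral_distr[OF cf(4)]) auto
      finally show ?thesis by (simp only: cf(6))
    qed
    finally show ?thesis by (simp add: add_mono)
  qed
  ultimately show ?thesis by blast
qed

text \<open>The product of the two measures is a coupling, and its cost is bounded by their first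
  moments.\<close>

lemma finite_cost:
  assumes fin: "(\<integral>\<^sup>+x. ennreal (\<Sum>i<n. norm (x i)) \<partial>gibbsU) < \<infinity>"
  shows "\<exists>\<omega>\<in>couplings gibbsU muh. cost \<omega> < \<infinity>"
proof -
  interpret G: prob_space gibbsU by (rule prob_space_gibbsU)
  interpret M: prob_space muh by (rule prob_space_muh)
  interpret P: pair_prob_space gibbsU muh ..
  let ?\<omega> = "gibbsU \<Otimes>\<^sub>M muh"
  have c: "?\<omega> \<in> couplings gibbsU muh"
  proof -
    have "distr ?\<omega> gibbsU fst = gibbsU" by (rule M.distr_pair_fst)
    moreover have "distr ?\<omega> muh snd = muh"
    proof (rule measure_eqI)
      fix A assume "A \<in> sets (distr ?\<omega> muh snd)"
      then have A: "A \<in> sets muh" by simp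
      have "emeasure (distr ?\<omega> muh snd) A = emeasure ?\<omega> (space gibbsU \<times> A)"
        using A sets.sets_into_space[OF A]
        by (subst emeasure_distr) (auto intro!: arg_cong2[where f=emeasure] simp: space_pair_measure)
      also have "\<dots> = emeasure muh A" using A by (simp add: M.emeasure_pair_measure_Times G.emeasure_space_1 del: space_gibbs)
      finally show "emeasure (distr ?\<omega> muh snd) A = emeasure muh A" .
    qed simp
    ultimately show ?thesis by (simp add: couplings_def)
  qed
  have o: "(\<lambda>_. origin) \<in> N \<rightarrow>\<^sub>M LC" for N :: "'z measure" by (rule measurable_const) (simp add: origin_configs)
  have m1: "(\<lambda>x. ennreal (\<Sum>i<n. norm (x i))) \<in> borel_measurable gibbsU"
    by (intro measurable_compose[OF _ measurable_ennreal] borel_measurable_sum measurable_compose[OF _ borel_measurable_norm] config_componentD[OF id_gibbs]) auto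
  have m2: "(\<lambda>x. ennreal (rho x origin)) \<in> borel_measurable muh"
    by (intro measurable_compose[OF _ measurable_ennreal] rho_measurable id_muh o)
  have "cost ?\<omega> \<le> (\<integral>\<^sup>+z. 2 * ennreal (\<Sum>i<n. norm (fst z i)) + ennreal (rho (snd z) origin) \<partial>?\<omega>)"
    unfolding cost_def
  proof (rule nn_integral_mono)
    fix z
    have "rho (fst z) (snd z) \<le> rho (snd z) origin + 2 * (\<Sum>i<n. norm (fst z i))"
      using rho_triangle[of "snd z" "fst z" origin] by (simp add: rho_commute origin_nth)
    then have "ennreal (rho (fst z) (snd z)) \<le> ennreal (2 * (\<Sum>i<n. norm (fst z i)) + rho (snd z) origin)"
      by (intro ennreal_leI) simp
    also have "\<dots> = ennreal (2 * (\<Sum>i<n. norm (fst z i))) + ennreal (rho (snd z) origin)"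
      by (intro ennreal_plus rho_nonneg mult_nonneg_nonneg sum_nonneg) auto
    also have "ennreal (2 * (\<Sum>i<n. norm (fst z i))) = 2 * ennreal (\<Sum>i<n. norm (fst z i))"
      by (subst ennreal_mult) (auto intro: sum_nonneg)
    finally show "ennreal (rho (fst z) (snd z)) \<le> 2 * ennreal (\<Sum>i<n. norm (fst z i)) + ennreal (rho (snd z) origin)" .
  qed
  also have "\<dots> = 2 * (\<integral>\<^sup>+x. ennreal (\<Sum>i<n. norm (x i)) \<partial>gibbsU) + (\<integral>\<^sup>+x. ennreal (rho x origin) \<partial>muh)"
  proof -
    have n1: "(\<lambda>z. 2 * ennreal (\<Sum>i<n. norm (fst z i))) \<in> borel_measurable ?\<omega>"
      by (intro borel_measurable_times_ennreal borel_measurable_const measurable_compose[OF measurable_fst m1])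
    have n2: "(\<lambda>z. ennreal (rho (snd z) origin)) \<in> borel_measurable ?\<omega>"
      by (rule measurable_compose[OF measurable_snd m2])
    have "(\<integral>\<^sup>+z. 2 * ennreal (\<Sum>i<n. norm (fst z i)) \<partial>?\<omega>) = (\<integral>\<^sup>+x. \<integral>\<^sup>+y. 2 * ennreal (\<Sum>i<n. norm (x i)) \<partial>muh \<partial>gibbsU)"
      by (rule M.nn_integral_fst[OF n1, unfolded fst_conv, symmetric])
    also have "\<dots> = 2 * (\<integral>\<^sup>+x. ennreal (\<Sum>i<n. norm (x i)) \<partial>gibbsU)"
      using m1 M.emeasure_space_1 by (simp add: nn_integral_cmult)
    finally have 1: "(\<integral>\<^sup>+z. 2 * ennreal (\<Sum>i<n. norm (fst z i)) \<partial>?\<omega>) = 2 * (\<integral>\<^sup>+x. ennreal (\<Sum>i<n. norm (x i)) \<partial>gibbsU)" .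
    have "(\<integral>\<^sup>+z. ennreal (rho (snd z) origin) \<partial>?\<omega>) = (\<integral>\<^sup>+x. \<integral>\<^sup>+y. ennreal (rho y origin) \<partial>muh \<partial>gibbsU)"
      by (rule M.nn_integral_fst[OF n2, unfolded snd_conv, symmetric])
    also have "\<dots> = (\<integral>\<^sup>+y. ennreal (rho y origin) \<partial>muh)" using G.emeasure_space_1 by simp
    finally have 2: "(\<integral>\<^sup>+z. ennreal (rho (snd z) origin) \<partial>?\<omega>) = (\<integral>\<^sup>+y. ennreal (rho y origin) \<partial>muh)" .
    show ?thesis by (subst nn_integral_add[OF n1 n2]) (simp only: 1 2)
  qed
  also have "\<dots> < \<infinity>" using fin muh_moment by (simp add: ennreal_mult_less_top)
  finally show ?thesis using c by blast
qed

lemma contraction_fixed_point: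
  fixes a B :: ennreal and c :: real
  assumes c: "0 < c" "2 * c \<le> 1" and a: "a < \<infinity>" and le: "a \<le> ennreal (1 - 2 * c) * a + 2 * B"
  shows "a \<le> ennreal (inverse c) * B"
proof (cases "B = \<infinity>")
  case False
  obtain r where r: "a = ennreal r" "0 \<le> r" using a by (cases a) auto
  obtain b where b: "B = ennreal b" "0 \<le> b" using False by (cases B) auto
  have "ennreal (1 - 2 * c) * a + 2 * B = ennreal ((1 - 2 * c) * r + 2 * b)"
  proof -
    have "ennreal (1 - 2 * c) * a = ennreal ((1 - 2 * c) * r)" using c r by (simp add: ennreal_mult)
    moreover have "2 * B = ennreal (2 * b)" unfolding b(1) by (subst ennreal_mult) (use b in auto)
    ultimately show ?thesis using c r b by (simp add: ennreal_plus)
  qed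
  with le have "ennreal r \<le> ennreal ((1 - 2 * c) * r + 2 * b)" using r by simp
  moreover have "0 \<le> (1 - 2 * c) * r + 2 * b" using c r b by (intro add_nonneg_nonneg mult_nonneg_nonneg) auto
  ultimately have "r \<le> (1 - 2 * c) * r + 2 * b" by (simp add: ennreal_le_iff)
  then have "c * r \<le> b" by (simp add: algebra_simps)
  then have "r \<le> inverse c * b" using c by (simp add: field_simps)
  then show ?thesis using r b c by (simp add: ennreal_mult[symmetric] ennreal_leI)
qed (use c in \<open>simp add: ennreal_mult_top\<close>)

text \<open>The infimum of the costs inherits the inequality of \<open>push_coupling\<close>, and \<open>mu\<close> times the sum of
  the distances is at most \<open>rho\<close>.\<close>

lemma wasserstein_le:
  assumes fin: "(\<integral>\<^sup>+x. ennreal (\<Sum>i<n. norm (x i)) \<partial>gibbsU) < \<infinity>"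
  shows "wasserstein_l1 n gibbsU muh
    \<le> ennreal (inverse (rate L K R T) * prefactor L K R T) * (\<integral>\<^sup>+x. flow_error x \<partial>gibbsU)"
proof -
  define B where "B = (\<integral>\<^sup>+x. flow_error x \<partial>gibbsU)"
  define a where "a = (INF \<omega>\<in>couplings gibbsU muh. cost \<omega>)"
  obtain \<omega>0 where \<omega>0: "\<omega>0 \<in> couplings gibbsU muh" "cost \<omega>0 < \<infinity>" using finite_cost[OF fin] by blast
  have afin: "a < \<infinity>" unfolding a_def using \<omega>0 INF_lower[of \<omega>0 "couplings gibbsU muh" cost] by (metis order_le_less_trans)
  have le: "a \<le> ennreal (1 - 2 * cc) * cost \<omega> + 2 * B" if "\<omega> \<in> couplings gibbsU muh" for \<omega>
    using push_coupling[OF that] unfolding a_def B_def by (meson INF_lower order_trans)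
  have "a \<le> ennreal (1 - 2 * cc) * a + 2 * B"
  proof (rule ennreal_le_epsilon)
    fix e :: real assume e: "0 < e"
    have "a < a + ennreal e" using afin e by (cases a) (auto simp: ennreal_plus[symmetric] ennreal_less_iff simp del: ennreal_plus)
    then obtain \<omega> where \<omega>: "\<omega> \<in> couplings gibbsU muh" "cost \<omega> < a + ennreal e"
      unfolding a_def INF_less_iff by blast
    have "a \<le> ennreal (1 - 2 * cc) * cost \<omega> + 2 * B" by (rule le[OF \<omega>(1)])
    also have "\<dots> \<le> ennreal (1 - 2 * cc) * (a + ennreal e) + 2 * B"
      using \<omega>(2) by (intro add_right_mono mult_left_mono) auto
    also have "\<dots> \<le> (ennreal (1 - 2 * cc) * a + 2 * B) + ennreal e"
    proof -
      have "ennreal (1 - 2 * cc) * ennreal e \<le> 1 * ennreal e"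
        using cc_pos by (intro mult_right_mono) (auto simp: ennreal_le_1)
      then show ?thesis by (simp add: distrib_left add_ac add_left_mono)
    qed
    finally show "a \<le> (ennreal (1 - 2 * cc) * a + 2 * B) + ennreal e" .
  qed
  then have aB: "a \<le> ennreal (inverse cc) * B"
    by (rule contraction_fixed_point[OF cc_pos rate_small afin])
  have "wasserstein_l1 n gibbsU muh \<le> ennreal (1 / mu) * cost \<omega>" if \<omega>: "\<omega> \<in> couplings gibbsU muh" for \<omega>
  proof -
    note cf = coupling_facts[OF \<omega>]
    have "wasserstein_l1 n gibbsU muh \<le> (\<integral>\<^sup>+z. ennreal (\<Sum>i<n. norm (fst z i - snd z i)) \<partial>\<omega>)"
      unfolding wasserstein_l1_def by (rule INF_lower[OF \<omega>])
    also have "\<dots> \<le> (\<integral>\<^sup>+z. ennreal (1 / mu) * ennreal (rho (fst z) (snd z)) \<partial>\<omega>)"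
    proof (rule nn_integral_mono)
      fix z
      have "(\<Sum>i<n. norm (fst z i - snd z i)) \<le> 1 / mu * rho (fst z) (snd z)"
        using rho_lower[of "fst z" "snd z"] mu_pos by (simp add: field_simps)
      then show "ennreal (\<Sum>i<n. norm (fst z i - snd z i)) \<le> ennreal (1 / mu) * ennreal (rho (fst z) (snd z))"
        using mu_pos rho_nonneg by (simp add: ennreal_mult[symmetric] ennreal_leI del: times_divide_eq_left)
    qed
    also have "\<dots> = ennreal (1 / mu) * cost \<omega>" unfolding cost_def
      by (intro nn_integral_cmult measurable_compose[OF _ measurable_ennreal] rho_measurable cf(4,5))
    finally show ?thesis .
  qed
  then have W: "ennreal mu * wasserstein_l1 n gibbsU muh \<le> cost \<omega>" if "\<omega> \<in> couplings gibbsU muh" for \<omega>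
  proof -
    have "ennreal mu * wasserstein_l1 n gibbsU muh \<le> ennreal mu * (ennreal (1 / mu) * cost \<omega>)"
      using \<open>\<And>\<omega>. \<omega> \<in> couplings gibbsU muh \<Longrightarrow> wasserstein_l1 n gibbsU muh \<le> ennreal (1 / mu) * cost \<omega>\<close>[OF that]
      by (rule mult_left_mono) simp
    also have "\<dots> = cost \<omega>"
      using mu_pos by (simp add: mult.assoc[symmetric] ennreal_mult[symmetric])
    finally show ?thesis .
  qed
  have "ennreal mu * wasserstein_l1 n gibbsU muh \<le> a" unfolding a_def by (rule INF_greatest) (rule W)
  then have "ennreal mu * wasserstein_l1 n gibbsU muh \<le> ennreal (inverse cc) * B" using aB by (rule order_trans)
  then have "ennreal (1 / mu) * (ennreal mu * wasserstein_l1 n gibbsU muh) \<le> ennreal (1 / mu) * (ennreal (inverse cc) * B)"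
    by (rule mult_left_mono) simp
  moreover have "ennreal (1 / mu) * (ennreal mu * wasserstein_l1 n gibbsU muh) = wasserstein_l1 n gibbsU muh"
    using mu_pos by (simp add: mult.assoc[symmetric] ennreal_mult[symmetric])
  moreover have "ennreal (1 / mu) * (ennreal (inverse cc) * B) = ennreal (inverse (rate L K R T) * prefactor L K R T) * B"
  proof -
    have "ennreal (inverse cc * (1 / mu)) = ennreal (1 / mu) * ennreal (inverse cc)"
      using mu_pos cc_pos by (subst mult.commute, intro ennreal_mult) auto
    then show ?thesis unfolding prefactor_mu cc_def[symmetric] by (simp only: mult.assoc)
  qed
  ultimately show ?thesis by (simp add: B_def)
qed

end

context hmc
begin

section \<open>The error bounds\<close>

lemma grid_index:
  assumes h: "h > 0" and N: "T / h \<in> \<nat>"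
  obtains m where "real m * h = T" "\<And>k. real k * h \<le> T \<Longrightarrow> k \<le> m"
proof -
  obtain m where "T / h = real m" using N by (auto elim: Nats_cases)
  then have mh: "real m * h = T" using h by (simp add: field_simps)
  moreover have "k \<le> m" if "real k * h \<le> T" for k
    using that h unfolding mh[symmetric] by simp
  ultimately show ?thesis by (rule that)
qed

lemma flow_gap:
  assumes hf: "hamiltonian_flow n d U q p" and vf: "verlet_flow n d U h qt pt" and h: "h > 0"
    and x: "x \<in> configs n d" and v: "v \<in> configs n d"
  shows "(\<Sum>i<n. norm (q (real k * h) x v i - qt (real k * h) x v i))
     \<le> orbit.gap n V W eps (\<lambda>t. q t x v) (\<lambda>t. p t x v) h k"
proof -
  interpret orbit n d V W eps L Lt T "\<lambda>t. q t x v" "\<lambda>t. p t x v"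
    by (rule hamiltonian_orbit[OF hf x v T_pos Lip_T])
  show ?thesis
    unfolding gap_def Let_def hamiltonian_flow_configs(1,2)[OF hf x v]
    using verlet_flow_grid[OF vf h x v, of k] by (simp add: sum_nonneg)
qed

lemma first_order_path:
  assumes hf: "hamiltonian_flow n d U q p" and vf: "verlet_flow n d U h qt pt" and h: "h > 0"
    and mh: "real m * h = T" and k: "k \<le> m" and x: "x \<in> configs n d" and v: "v \<in> configs n d"
  shows "(\<Sum>i<n. norm (q (real k * h) x v i - qt (real k * h) x v i))
     \<le> h * first_order_const Lip T * ((\<Sum>i<n. norm (x i)) + (\<Sum>i<n. norm (v i)))"
proof -
  interpret orbit n d V W eps L Lt T "\<lambda>t. q t x v" "\<lambda>t. p t x v"
    by (rule hamiltonian_orbit[OF hf x v T_pos Lip_T])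
  show ?thesis
    using order_trans[OF flow_gap[OF hf vf h x v] first_order_error[OF h mh k]]
    by (simp add: hamiltonian_flow_configs(1,2)[OF hf x v] sum.distrib)
qed

lemma second_order_path:
  assumes hf: "hamiltonian_flow n d U q p" and vf: "verlet_flow n d U h qt pt" and h: "h > 0"
    and mh: "real m * h = T" and k: "k \<le> m" and x: "x \<in> configs n d" and v: "v \<in> configs n d"
    and C3: "thrice_differentiable V" "thrice_differentiable W"
    and LH: "finite_sup (third_deriv V) LH" "finite_sup (third_deriv W) LtH"
  shows "(\<Sum>i<n. norm (q (real k * h) x v i - qt (real k * h) x v i))
     \<le> h\<^sup>2 * second_order_const Lip (LH + 8 * (eps * LtH)) T *
       ((\<Sum>i<n. norm (x i)) + (\<Sum>i<n. norm (v i)) + ((\<Sum>i<n. (norm (x i))\<^sup>2) + (\<Sum>i<n. (norm (v i))\<^sup>2)))"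
proof -
  interpret orbit n d V W eps L Lt T "\<lambda>t. q t x v" "\<lambda>t. p t x v"
    by (rule hamiltonian_orbit[OF hf x v T_pos Lip_T])
  interpret orbit3 n d V W eps L Lt T "\<lambda>t. q t x v" "\<lambda>t. p t x v" LH LtH
    by unfold_locales (use hess_lipschitz[OF C3(1) LH(1)] hess_lipschitz[OF C3(2) LH(2)] finite_sup_nonneg[OF LH(1)] finite_sup_nonneg[OF LH(2)] in auto)
  show ?thesis
    using order_trans[OF flow_gap[OF hf vf h x v] second_order_error[OF h mh k]]
    by (simp add: hamiltonian_flow_configs(1,2)[OF hf x v] sum.distrib)
qed

lemma norm_sum_measurable:
  "(\<lambda>v. ennreal (\<Sum>i<n. norm (v i))) \<in> borel_measurable LC"
  "(\<lambda>v. ennreal (\<Sum>i<n. (norm (v i))\<^sup>2)) \<in> borel_measurable LC"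
  by (auto intro!: measurable_compose[OF _ measurable_ennreal] borel_measurable_sum borel_measurable_power
      measurable_compose[OF _ borel_measurable_norm] config_component_borel)

lemma first_order_expectation:
  assumes hf: "hamiltonian_flow n d U q p" and vf: "verlet_flow n d U h qt pt" and h: "h > 0"
    and mh: "real m * h = T" and k: "k \<le> m" and x: "x \<in> configs n d"
    and C: "0 \<le> C" "first_order_const Lip T \<le> C"
  shows "(\<integral>\<^sup>+v. ennreal (\<Sum>i<n. norm (q (real k * h) x v i - qt (real k * h) x v i)) \<partial>gauss_config n d)
    \<le> ennreal (h * C * (sqrt (real d) * real n + (\<Sum>i<n. norm (x i))))"
proof -
  interpret N: prob_space "gauss_config n d" by (rule prob_space_gauss_config)
  let ?X = "\<Sum>i<n. norm (x i)"
  have X: "0 \<le> ?X" by (intro sum_nonneg) auto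
  have m: "(\<lambda>v. ennreal (\<Sum>i<n. norm (v i))) \<in> borel_measurable (gauss_config n d)"
    using norm_sum_measurable(1) by (simp add: measurable_cong_sets[OF sets_gauss_config refl])
  have "(\<integral>\<^sup>+v. ennreal (\<Sum>i<n. norm (q (real k * h) x v i - qt (real k * h) x v i)) \<partial>gauss_config n d)
    \<le> (\<integral>\<^sup>+v. ennreal (h * C) * (ennreal ?X + ennreal (\<Sum>i<n. norm (v i))) \<partial>gauss_config n d)"
  proof (rule nn_integral_mono)
    fix v assume "v \<in> space (gauss_config n d)"
    then have v: "v \<in> configs n d" by simp
    let ?V = "\<Sum>i<n. norm (v i)"
    have V: "0 \<le> ?V" by (intro sum_nonneg) auto
    have "(\<Sum>i<n. norm (q (real k * h) x v i - qt (real k * h) x v i)) \<le> h * first_order_const Lip T * (?X + ?V)"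
      by (rule first_order_path[OF hf vf h mh k x v])
    also have "\<dots> \<le> h * C * (?X + ?V)" using h C X V by (intro mult_right_mono mult_left_mono) auto
    finally show "ennreal (\<Sum>i<n. norm (q (real k * h) x v i - qt (real k * h) x v i))
       \<le> ennreal (h * C) * (ennreal ?X + ennreal ?V)"
      using h C X V by (simp add: ennreal_plus[symmetric] ennreal_mult[symmetric] ennreal_leI del: ennreal_plus)
  qed
  also have "\<dots> = ennreal (h * C) * (ennreal ?X + (\<integral>\<^sup>+v. ennreal (\<Sum>i<n. norm (v i)) \<partial>gauss_config n d))"
    using m N.emeasure_space_1 by (simp add: nn_integral_cmult nn_integral_add)
  also have "\<dots> \<le> ennreal (h * C) * (ennreal ?X + ennreal (sqrt (real d) * real n))"
    by (intro mult_left_mono add_left_mono gauss_norm_sum) simp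
  also have "\<dots> = ennreal (h * C * (sqrt (real d) * real n + ?X))"
    using h C X by (simp add: ennreal_plus[symmetric] ennreal_mult[symmetric] add.commute del: ennreal_plus)
  finally show ?thesis .
qed

lemma second_order_expectation:
  assumes hf: "hamiltonian_flow n d U q p" and vf: "verlet_flow n d U h qt pt" and h: "h > 0"
    and mh: "real m * h = T" and k: "k \<le> m" and x: "x \<in> configs n d"
    and C3: "thrice_differentiable V" "thrice_differentiable W"
    and LH: "finite_sup (third_deriv V) LH" "finite_sup (third_deriv W) LtH"
    and C: "0 \<le> C" "2 * second_order_const Lip (LH + 8 * (eps * LtH)) T \<le> C"
  shows "(\<integral>\<^sup>+v. ennreal (\<Sum>i<n. norm (q (real k * h) x v i - qt (real k * h) x v i)) \<partial>gauss_config n d)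
    \<le> ennreal (h\<^sup>2 * C * (real d * real n + (\<Sum>i<n. norm (x i)) + (\<Sum>i<n. (norm (x i))\<^sup>2)))"
proof -
  interpret N: prob_space "gauss_config n d" by (rule prob_space_gauss_config)
  let ?X = "(\<Sum>i<n. norm (x i)) + (\<Sum>i<n. (norm (x i))\<^sup>2)"
  have X: "0 \<le> ?X" by (intro add_nonneg_nonneg sum_nonneg) auto
  have m: "(\<lambda>v. ennreal (\<Sum>i<n. norm (v i))) \<in> borel_measurable (gauss_config n d)"
     "(\<lambda>v. ennreal (\<Sum>i<n. (norm (v i))\<^sup>2)) \<in> borel_measurable (gauss_config n d)"
    using norm_sum_measurable by (simp_all add: measurable_cong_sets[OF sets_gauss_config refl])
  let ?c = "h\<^sup>2 * (C / 2)"
  have c: "0 \<le> ?c" using C by simp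
  have "(\<integral>\<^sup>+v. ennreal (\<Sum>i<n. norm (q (real k * h) x v i - qt (real k * h) x v i)) \<partial>gauss_config n d)
    \<le> (\<integral>\<^sup>+v. ennreal ?c * ((ennreal ?X + ennreal (\<Sum>i<n. norm (v i))) + ennreal (\<Sum>i<n. (norm (v i))\<^sup>2)) \<partial>gauss_config n d)"
  proof (rule nn_integral_mono)
    fix v assume "v \<in> space (gauss_config n d)"
    then have v: "v \<in> configs n d" by simp
    let ?V = "\<Sum>i<n. norm (v i)" and ?V2 = "\<Sum>i<n. (norm (v i))\<^sup>2"
    have V: "0 \<le> ?V" "0 \<le> ?V2" by (auto intro!: sum_nonneg)
    have "(\<Sum>i<n. norm (q (real k * h) x v i - qt (real k * h) x v i))
       \<le> h\<^sup>2 * second_order_const Lip (LH + 8 * (eps * LtH)) T * (?X + ?V + ?V2)"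
      using second_order_path[OF hf vf h mh k x v C3 LH] by (simp add: add_ac)
    also have "\<dots> \<le> ?c * (?X + ?V + ?V2)" using C X V by (intro mult_right_mono mult_left_mono) auto
    finally show "ennreal (\<Sum>i<n. norm (q (real k * h) x v i - qt (real k * h) x v i))
       \<le> ennreal ?c * ((ennreal ?X + ennreal ?V) + ennreal ?V2)"
      using c X V by (simp add: ennreal_plus[symmetric] ennreal_mult[symmetric] ennreal_leI del: ennreal_plus)
  qed
  also have "\<dots> = ennreal ?c * ((ennreal ?X + (\<integral>\<^sup>+v. ennreal (\<Sum>i<n. norm (v i)) \<partial>gauss_config n d))
      + (\<integral>\<^sup>+v. ennreal (\<Sum>i<n. (norm (v i))\<^sup>2) \<partial>gauss_config n d))"
    using m N.emeasure_space_1 by (simp add: nn_integral_cmult nn_integral_add)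
  also have "\<dots> \<le> ennreal ?c * ((ennreal ?X + ennreal (sqrt (real d) * real n)) + ennreal (real d * real n))"
    unfolding gauss_norm_sq_sum by (intro mult_left_mono add_left_mono add_right_mono gauss_norm_sum) simp
  also have "\<dots> = ennreal (?c * (?X + sqrt (real d) * real n + real d * real n))"
    using c X by (simp add: ennreal_plus[symmetric] ennreal_mult[symmetric] del: ennreal_plus)
  also have "\<dots> \<le> ennreal (h\<^sup>2 * C * (real d * real n + (\<Sum>i<n. norm (x i)) + (\<Sum>i<n. (norm (x i))\<^sup>2)))"
  proof (rule ennreal_leI)
    have "1 \<le> sqrt (real d)" using d_pos by simp
    then have "sqrt (real d) * 1 \<le> sqrt (real d) * sqrt (real d)" by (intro mult_left_mono) auto
    then have "sqrt (real d) * real n \<le> real d * real n" by (intro mult_right_mono) auto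
    then have "?X + sqrt (real d) * real n + real d * real n \<le> 2 * (real d * real n + ?X)"
      using X unfolding distrib_left by linarith
    then have "?c * (?X + sqrt (real d) * real n + real d * real n) \<le> ?c * (2 * (real d * real n + ?X))"
      using c by (rule mult_left_mono)
    moreover have "?c * (2 * y) = h\<^sup>2 * C * y" for y by simp
    ultimately show "?c * (?X + sqrt (real d) * real n + real d * real n)
       \<le> h\<^sup>2 * C * (real d * real n + (\<Sum>i<n. norm (x i)) + (\<Sum>i<n. (norm (x i))\<^sup>2))"
      by (simp only: add.assoc)
  qed
  finally show ?thesis .
qed

end

context hmc_run
begin

text \<open>The term \<open>D\<close> is zero for the first-order estimate and the sum of the squared norms for the
  second-order one.\<close>

lemma wasserstein_error_bound:
  assumes err: "\<And>x. x \<in> configs n d \<Longrightarrow> flow_error x \<le> ennreal c0 * (ennreal c1 + ennreal (\<Sum>i<n. norm (x i)) + D x)"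
    and c0: "c0 > 0" and D: "D \<in> borel_measurable LC"
  shows "wasserstein_l1 n gibbsU muh \<le> ennreal (inverse (rate L K R T) * prefactor L K R T * c0) *
    (ennreal c1 + (\<integral>\<^sup>+x. ennreal (\<Sum>i<n. norm (x i)) \<partial>gibbsU) + (\<integral>\<^sup>+x. D x \<partial>gibbsU))"
proof -
  interpret G: prob_space gibbsU by (rule prob_space_gibbsU)
  let ?N = "\<integral>\<^sup>+x. ennreal (\<Sum>i<n. norm (x i)) \<partial>gibbsU"
  have r: "0 < inverse (rate L K R T) * prefactor L K R T"
    using cc_pos mu_pos by (simp add: cc_def prefactor_mu)
  show ?thesis
  proof (cases "?N < \<infinity>")
    case False
    then have "?N = \<infinity>" by (metis infinity_ennreal_def less_top)
    moreover have "ennreal c * (a + \<infinity> + b) = \<infinity>" if "c > 0" for c a b using that by (simp add: ennreal_mult_top)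
    ultimately show ?thesis using mult_pos_pos[OF r c0] by (metis infinity_ennreal_def top_greatest)
  next
    case True
    have m: "(\<lambda>x. ennreal (\<Sum>i<n. norm (x i))) \<in> borel_measurable gibbsU" "D \<in> borel_measurable gibbsU"
      using norm_sum_measurable(1) D by (simp_all add: measurable_cong_sets[OF sets_gibbs refl])
    have "(\<integral>\<^sup>+x. flow_error x \<partial>gibbsU) \<le> (\<integral>\<^sup>+x. ennreal c0 * (ennreal c1 + ennreal (\<Sum>i<n. norm (x i)) + D x) \<partial>gibbsU)"
      by (intro nn_integral_mono err) simp
    also have "\<dots> = ennreal c0 * (ennreal c1 + ?N + (\<integral>\<^sup>+x. D x \<partial>gibbsU))"
      using m G.emeasure_space_1 by (simp add: nn_integral_cmult nn_integral_add)
    finally have "ennreal (inverse (rate L K R T) * prefactor L K R T) * (\<integral>\<^sup>+x. flow_error x \<partial>gibbsU)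
       \<le> ennreal (inverse (rate L K R T) * prefactor L K R T) * (ennreal c0 * (ennreal c1 + ?N + (\<integral>\<^sup>+x. D x \<partial>gibbsU)))"
      by (rule mult_left_mono) simp
    also have "\<dots> = ennreal (inverse (rate L K R T) * prefactor L K R T * c0) * (ennreal c1 + ?N + (\<integral>\<^sup>+x. D x \<partial>gibbsU))"
      using r c0 by (subst ennreal_mult[of "inverse (rate L K R T) * prefactor L K R T" c0]) (auto simp: mult.assoc)
    finally show ?thesis using wasserstein_le[OF True] by (rule order_trans[rotated])
  qed
qed

end

context hmc
begin

lemma first_order_accuracy:
  assumes hf: "hamiltonian_flow n d U q p" and vf: "verlet_flow n d U h qt pt"
    and h: "h > 0" "T / h \<in> \<nat>"
    and C: "0 < C" "first_order_const Lip T \<le> C"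
  shows "x \<in> configs n d \<Longrightarrow> real k * h \<le> T \<Longrightarrow>
      (\<integral>\<^sup>+v. ennreal (\<Sum>i<n. norm (q (real k * h) x v i - qt (real k * h) x v i)) \<partial>gauss_config n d)
        \<le> ennreal (h * C * (sqrt (real d) * real n + (\<Sum>i<n. norm (x i))))"
    and "integrable LC (\<lambda>x. exp (- U x)) \<Longrightarrow> invariant_prob LC (hmc_kernel n d T qt) muh \<Longrightarrow>
      wasserstein_l1 n gibbsU muh \<le> ennreal (h * inverse (rate L K R T) * prefactor L K R T * C) *
        (ennreal (sqrt (real d) * real n) + (\<integral>\<^sup>+x. ennreal (\<Sum>i<n. norm (x i)) \<partial>gibbsU))"
proof -
  obtain m where m: "real m * h = T" "\<And>k. real k * h \<le> T \<Longrightarrow> k \<le> m" using grid_index[OF h] by blast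
  note E = first_order_expectation[OF hf vf h(1) m(1) _ _ less_imp_le[OF C(1)] C(2)]
  show "x \<in> configs n d \<Longrightarrow> real k * h \<le> T \<Longrightarrow>
      (\<integral>\<^sup>+v. ennreal (\<Sum>i<n. norm (q (real k * h) x v i - qt (real k * h) x v i)) \<partial>gauss_config n d)
        \<le> ennreal (h * C * (sqrt (real d) * real n + (\<Sum>i<n. norm (x i))))"
    using E m(2) by blast
  assume int: "integrable LC (\<lambda>x. exp (- U x))" and inv: "invariant_prob LC (hmc_kernel n d T qt) muh"
  interpret hmc_run n d V W eps L Lt K R T h1 q p qt pt h m muh
    by unfold_locales (fact hf h(1) m(1) vf int inv)+
  have "wasserstein_l1 n gibbsU muh \<le> ennreal (inverse (rate L K R T) * prefactor L K R T * (h * C)) *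
     (ennreal (sqrt (real d) * real n) + (\<integral>\<^sup>+x. ennreal (\<Sum>i<n. norm (x i)) \<partial>gibbsU) + (\<integral>\<^sup>+x. 0 \<partial>gibbsU))"
  proof (rule wasserstein_error_bound)
    fix x assume x: "x \<in> configs n d"
    have "flow_error x = (\<integral>\<^sup>+v. ennreal (\<Sum>i<n. norm (q (real m * h) x v i - qt (real m * h) x v i)) \<partial>gauss_config n d)"
      unfolding flow_error_def m(1) using qt_eq[OF x] by (intro nn_integral_cong) simp
    also have "\<dots> \<le> ennreal (h * C * (sqrt (real d) * real n + (\<Sum>i<n. norm (x i))))" by (rule E[OF order_refl x])
    also have "\<dots> = ennreal (h * C) * (ennreal (sqrt (real d) * real n) + ennreal (\<Sum>i<n. norm (x i)) + 0)"
      using h C by (simp add: ennreal_plus[symmetric] ennreal_mult[symmetric] sum_nonneg del: ennreal_plus)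
    finally show "flow_error x \<le> ennreal (h * C) * (ennreal (sqrt (real d) * real n) + ennreal (\<Sum>i<n. norm (x i)) + 0)" .
  next
    show "h * C > 0" using h C by simp
  qed (simp)
  then show "wasserstein_l1 n gibbsU muh \<le> ennreal (h * inverse (rate L K R T) * prefactor L K R T * C) *
     (ennreal (sqrt (real d) * real n) + (\<integral>\<^sup>+x. ennreal (\<Sum>i<n. norm (x i)) \<partial>gibbsU))"
    by (simp add: mult_ac)
qed

lemma second_order_accuracy:
  assumes hf: "hamiltonian_flow n d U q p" and vf: "verlet_flow n d U h qt pt"
    and h: "h > 0" "T / h \<in> \<nat>"
    and C3: "thrice_differentiable V" "thrice_differentiable W"
    and LH: "finite_sup (third_deriv V) LH" "finite_sup (third_deriv W) LtH"
    and C: "0 < C" "2 * second_order_const Lip (LH + 8 * (eps * LtH)) T \<le> C"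
  shows "x \<in> configs n d \<Longrightarrow> real k * h \<le> T \<Longrightarrow>
      (\<integral>\<^sup>+v. ennreal (\<Sum>i<n. norm (q (real k * h) x v i - qt (real k * h) x v i)) \<partial>gauss_config n d)
        \<le> ennreal (h\<^sup>2 * C * (real d * real n + (\<Sum>i<n. norm (x i)) + (\<Sum>i<n. (norm (x i))\<^sup>2)))"
    and "integrable LC (\<lambda>x. exp (- U x)) \<Longrightarrow> invariant_prob LC (hmc_kernel n d T qt) muh \<Longrightarrow>
      wasserstein_l1 n gibbsU muh \<le> ennreal (h\<^sup>2 * inverse (rate L K R T) * prefactor L K R T * C) *
        (ennreal (real d * real n) + (\<integral>\<^sup>+x. ennreal (\<Sum>i<n. norm (x i)) \<partial>gibbsU) + (\<integral>\<^sup>+x. ennreal (\<Sum>i<n. (norm (x i))\<^sup>2) \<partial>gibbsU))"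
proof -
  obtain m where m: "real m * h = T" "\<And>k. real k * h \<le> T \<Longrightarrow> k \<le> m" using grid_index[OF h] by blast
  note E = second_order_expectation[OF hf vf h(1) m(1) _ _ C3 LH less_imp_le[OF C(1)] C(2)]
  show "x \<in> configs n d \<Longrightarrow> real k * h \<le> T \<Longrightarrow>
      (\<integral>\<^sup>+v. ennreal (\<Sum>i<n. norm (q (real k * h) x v i - qt (real k * h) x v i)) \<partial>gauss_config n d)
        \<le> ennreal (h\<^sup>2 * C * (real d * real n + (\<Sum>i<n. norm (x i)) + (\<Sum>i<n. (norm (x i))\<^sup>2)))"
    using E m(2) by blast
  assume int: "integrable LC (\<lambda>x. exp (- U x))" and inv: "invariant_prob LC (hmc_kernel n d T qt) muh"
  interpret hmc_run n d V W eps L Lt K R T h1 q p qt pt h m muh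
    by unfold_locales (fact hf h(1) m(1) vf int inv)+
  have "wasserstein_l1 n gibbsU muh \<le> ennreal (inverse (rate L K R T) * prefactor L K R T * (h\<^sup>2 * C)) *
     (ennreal (real d * real n) + (\<integral>\<^sup>+x. ennreal (\<Sum>i<n. norm (x i)) \<partial>gibbsU) + (\<integral>\<^sup>+x. ennreal (\<Sum>i<n. (norm (x i))\<^sup>2) \<partial>gibbsU))"
  proof (rule wasserstein_error_bound)
    fix x assume x: "x \<in> configs n d"
    have "flow_error x = (\<integral>\<^sup>+v. ennreal (\<Sum>i<n. norm (q (real m * h) x v i - qt (real m * h) x v i)) \<partial>gauss_config n d)"
      unfolding flow_error_def m(1) using qt_eq[OF x] by (intro nn_integral_cong) simp
    also have "\<dots> \<le> ennreal (h\<^sup>2 * C * (real d * real n + (\<Sum>i<n. norm (x i)) + (\<Sum>i<n. (norm (x i))\<^sup>2)))" by (rule E[OF order_refl x])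
    also have "\<dots> = ennreal (h\<^sup>2 * C) * (ennreal (real d * real n) + ennreal (\<Sum>i<n. norm (x i)) + ennreal (\<Sum>i<n. (norm (x i))\<^sup>2))"
      using h C by (simp add: ennreal_plus[symmetric] ennreal_mult[symmetric] sum_nonneg del: ennreal_plus)
    finally show "flow_error x \<le> ennreal (h\<^sup>2 * C) * (ennreal (real d * real n) + ennreal (\<Sum>i<n. norm (x i)) + ennreal (\<Sum>i<n. (norm (x i))\<^sup>2))" .
  next
    show "h\<^sup>2 * C > 0" using h C by simp
  qed (rule norm_sum_measurable(2))
  then show "wasserstein_l1 n gibbsU muh \<le> ennreal (h\<^sup>2 * inverse (rate L K R T) * prefactor L K R T * C) *
     (ennreal (real d * real n) + (\<integral>\<^sup>+x. ennreal (\<Sum>i<n. norm (x i)) \<partial>gibbsU) + (\<integral>\<^sup>+x. ennreal (\<Sum>i<n. (norm (x i))\<^sup>2) \<partial>gibbsU))"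
    by (simp add: mult_ac)
qed

end

lemma hmc_setting_locale:
  assumes "hmc_setting n d V W eps L Lt K R T h1"
  shows "hmc n d V W eps L Lt K R T h1" "integrable (lebesgue_config n d) (\<lambda>x. exp (- potential n V W eps x))"
proof -
  note s = assms[unfolded hmc_setting_def]
  have "grad V 0 = 0"
    by (rule grad_zero_at_min[of d]) (use s in \<open>auto simp: twice_cont_differentiable_def\<close>)
  then show "hmc n d V W eps L Lt K R T h1" using s by unfold_locales auto
  show "integrable (lebesgue_config n d) (\<lambda>x. exp (- potential n V W eps x))" using s by blast
qed

theorem corollary9:
  fixes L Lt eps T LH LtH :: real
  shows
    "(\<exists>C2>0. \<forall>n d V W K R h1 q p.
        hmc_setting n d V W eps L Lt K R T h1 \<and>
        hamiltonian_flow n d (potential n V W eps) q p \<longrightarrow>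
        (\<forall>h qt pt. h > 0 \<and> T / h \<in> \<nat> \<and> verlet_flow n d (potential n V W eps) h qt pt \<longrightarrow>
          (\<forall>x\<in>configs n d. \<forall>k::nat. real k * h \<le> T \<longrightarrow>
            (\<integral>\<^sup>+v. ennreal (\<Sum>i<n. norm (q (real k * h) x v i - qt (real k * h) x v i))
               \<partial>gauss_config n d)
            \<le> ennreal (h * C2 * (sqrt (real d) * real n + (\<Sum>i<n. norm (x i))))) \<and>
          (\<forall>\<mu>h. h \<le> h1 \<and> invariant_prob (lebesgue_config n d) (hmc_kernel n d T qt) \<mu>h \<longrightarrow>
            wasserstein_l1 n (gibbs n d (potential n V W eps)) \<mu>h
            \<le> ennreal (h * inverse (rate L K R T) * prefactor L K R T * C2) *
              (ennreal (sqrt (real d) * real n) +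
               (\<integral>\<^sup>+x. ennreal (\<Sum>i<n. norm (x i)) \<partial>gibbs n d (potential n V W eps)))))) \<and>
     (\<exists>Ct2>0. \<forall>n d V W K R h1 q p.
        hmc_setting n d V W eps L Lt K R T h1 \<and>
        thrice_differentiable V \<and> thrice_differentiable W \<and>
        finite_sup (third_deriv V) LH \<and> finite_sup (third_deriv W) LtH \<and>
        hamiltonian_flow n d (potential n V W eps) q p \<longrightarrow>
        (\<forall>h qt pt. h > 0 \<and> T / h \<in> \<nat> \<and> verlet_flow n d (potential n V W eps) h qt pt \<longrightarrow>
          (\<forall>x\<in>configs n d. \<forall>k::nat. real k * h \<le> T \<longrightarrow>
            (\<integral>\<^sup>+v. ennreal (\<Sum>i<n. norm (q (real k * h) x v i - qt (real k * h) x v i))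
               \<partial>gauss_config n d)
            \<le> ennreal (h\<^sup>2 * Ct2 *
                (real d * real n + (\<Sum>i<n. norm (x i)) + (\<Sum>i<n. (norm (x i))\<^sup>2)))) \<and>
          (\<forall>\<mu>h. h \<le> h1 \<and> invariant_prob (lebesgue_config n d) (hmc_kernel n d T qt) \<mu>h \<longrightarrow>
            wasserstein_l1 n (gibbs n d (potential n V W eps)) \<mu>h
            \<le> ennreal (h\<^sup>2 * inverse (rate L K R T) * prefactor L K R T * Ct2) *
              (ennreal (real d * real n) +
               (\<integral>\<^sup>+x. ennreal (\<Sum>i<n. norm (x i)) \<partial>gibbs n d (potential n V W eps)) +
               (\<integral>\<^sup>+x. ennreal (\<Sum>i<n. (norm (x i))\<^sup>2) \<partial>gibbs n d (potential n V W eps))))))"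
proof (intro conjI)
  \<comment> \<open>The absolute value and the summand one make the constant positive for all values of the parameters.\<close>
  define C2 where "C2 = \<bar>first_order_const (L + 4 * (eps * Lt)) T\<bar> + 1"
  show "\<exists>C2>0. \<forall>n d V W K R h1 q p.
        hmc_setting n d V W eps L Lt K R T h1 \<and>
        hamiltonian_flow n d (potential n V W eps) q p \<longrightarrow>
        (\<forall>h qt pt. h > 0 \<and> T / h \<in> \<nat> \<and> verlet_flow n d (potential n V W eps) h qt pt \<longrightarrow>
          (\<forall>x\<in>configs n d. \<forall>k::nat. real k * h \<le> T \<longrightarrow>
            (\<integral>\<^sup>+v. ennreal (\<Sum>i<n. norm (q (real k * h) x v i - qt (real k * h) x v i))
               \<partial>gauss_config n d)
            \<le> ennreal (h * C2 * (sqrt (real d) * real n + (\<Sum>i<n. norm (x i))))) \<and>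
          (\<forall>\<mu>h. h \<le> h1 \<and> invariant_prob (lebesgue_config n d) (hmc_kernel n d T qt) \<mu>h \<longrightarrow>
            wasserstein_l1 n (gibbs n d (potential n V W eps)) \<mu>h
            \<le> ennreal (h * inverse (rate L K R T) * prefactor L K R T * C2) *
              (ennreal (sqrt (real d) * real n) +
               (\<integral>\<^sup>+x. ennreal (\<Sum>i<n. norm (x i)) \<partial>gibbs n d (potential n V W eps)))))"
  proof (intro exI[of _ C2] conjI allI impI ballI; (elim conjE)?)
    show "C2 > 0" by (simp add: C2_def)
  next
    fix n d V W K R h1 q p h qt pt x and k :: nat
    assume set: "hmc_setting n d V W eps L Lt K R T h1" and hf: "hamiltonian_flow n d (potential n V W eps) q p"
      and h: "h > 0" "T / h \<in> \<nat>" and vf: "verlet_flow n d (potential n V W eps) h qt pt" and x: "x \<in> configs n d" and k: "real k * h \<le> T"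
    interpret hmc n d V W eps L Lt K R T h1 by (rule hmc_setting_locale(1)[OF set])
    have C: "0 < C2" "first_order_const Lip T \<le> C2" by (auto simp: C2_def Lip_def)
    show "(\<integral>\<^sup>+v. ennreal (\<Sum>i<n. norm (q (real k * h) x v i - qt (real k * h) x v i)) \<partial>gauss_config n d) \<le> ennreal (h * C2 * (sqrt (real d) * real n + (\<Sum>i<n. norm (x i))))"
      by (rule first_order_accuracy(1)[OF hf vf h C x k])
  next
    fix n d V W K R h1 q p h qt pt \<mu>h
    assume set: "hmc_setting n d V W eps L Lt K R T h1" and hf: "hamiltonian_flow n d (potential n V W eps) q p"
      and h: "h > 0" "T / h \<in> \<nat>" and vf: "verlet_flow n d (potential n V W eps) h qt pt" and inv: "invariant_prob (lebesgue_config n d) (hmc_kernel n d T qt) \<mu>h"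
    interpret hmc n d V W eps L Lt K R T h1 by (rule hmc_setting_locale(1)[OF set])
    have C: "0 < C2" "first_order_const Lip T \<le> C2" by (auto simp: C2_def Lip_def)
    show "wasserstein_l1 n (gibbs n d (potential n V W eps)) \<mu>h \<le> ennreal (h * inverse (rate L K R T) * prefactor L K R T * C2) *
        (ennreal (sqrt (real d) * real n) + (\<integral>\<^sup>+x. ennreal (\<Sum>i<n. norm (x i)) \<partial>gibbs n d (potential n V W eps)))"
      by (rule first_order_accuracy(2)[OF hf vf h C hmc_setting_locale(2)[OF set] inv])
  qed
next
  define Ct2 where "Ct2 = \<bar>2 * second_order_const (L + 4 * (eps * Lt)) (LH + 8 * (eps * LtH)) T\<bar> + 1"
  show "\<exists>Ct2>0. \<forall>n d V W K R h1 q p.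
        hmc_setting n d V W eps L Lt K R T h1 \<and>
        thrice_differentiable V \<and> thrice_differentiable W \<and>
        finite_sup (third_deriv V) LH \<and> finite_sup (third_deriv W) LtH \<and>
        hamiltonian_flow n d (potential n V W eps) q p \<longrightarrow>
        (\<forall>h qt pt. h > 0 \<and> T / h \<in> \<nat> \<and> verlet_flow n d (potential n V W eps) h qt pt \<longrightarrow>
          (\<forall>x\<in>configs n d. \<forall>k::nat. real k * h \<le> T \<longrightarrow>
            (\<integral>\<^sup>+v. ennreal (\<Sum>i<n. norm (q (real k * h) x v i - qt (real k * h) x v i))
               \<partial>gauss_config n d)
            \<le> ennreal (h\<^sup>2 * Ct2 *
                (real d * real n + (\<Sum>i<n. norm (x i)) + (\<Sum>i<n. (norm (x i))\<^sup>2)))) \<and>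
          (\<forall>\<mu>h. h \<le> h1 \<and> invariant_prob (lebesgue_config n d) (hmc_kernel n d T qt) \<mu>h \<longrightarrow>
            wasserstein_l1 n (gibbs n d (potential n V W eps)) \<mu>h
            \<le> ennreal (h\<^sup>2 * inverse (rate L K R T) * prefactor L K R T * Ct2) *
              (ennreal (real d * real n) +
               (\<integral>\<^sup>+x. ennreal (\<Sum>i<n. norm (x i)) \<partial>gibbs n d (potential n V W eps)) +
               (\<integral>\<^sup>+x. ennreal (\<Sum>i<n. (norm (x i))\<^sup>2) \<partial>gibbs n d (potential n V W eps)))))"
  proof (intro exI[of _ Ct2] conjI allI impI ballI; (elim conjE)?)
    show "Ct2 > 0" by (simp add: Ct2_def)
  next
    fix n d V W K R h1 q p h qt pt x and k :: nat
    assume set: "hmc_setting n d V W eps L Lt K R T h1" and hf: "hamiltonian_flow n d (potential n V W eps) q p"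
      and C3: "thrice_differentiable V" "thrice_differentiable W"
      and LH: "finite_sup (third_deriv V) LH" "finite_sup (third_deriv W) LtH"
      and h: "h > 0" "T / h \<in> \<nat>" and vf: "verlet_flow n d (potential n V W eps) h qt pt" and x: "x \<in> configs n d" and k: "real k * h \<le> T"
    interpret hmc n d V W eps L Lt K R T h1 by (rule hmc_setting_locale(1)[OF set])
    have C: "0 < Ct2" "2 * second_order_const Lip (LH + 8 * (eps * LtH)) T \<le> Ct2" by (auto simp: Ct2_def Lip_def)
    show "(\<integral>\<^sup>+v. ennreal (\<Sum>i<n. norm (q (real k * h) x v i - qt (real k * h) x v i)) \<partial>gauss_config n d) \<le> ennreal (h\<^sup>2 * Ct2 * (real d * real n + (\<Sum>i<n. norm (x i)) + (\<Sum>i<n. (norm (x i))\<^sup>2)))"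
      by (rule second_order_accuracy(1)[OF hf vf h C3 LH C x k])
  next
    fix n d V W K R h1 q p h qt pt \<mu>h
    assume set: "hmc_setting n d V W eps L Lt K R T h1" and hf: "hamiltonian_flow n d (potential n V W eps) q p"
      and C3: "thrice_differentiable V" "thrice_differentiable W"
      and LH: "finite_sup (third_deriv V) LH" "finite_sup (third_deriv W) LtH"
      and h: "h > 0" "T / h \<in> \<nat>" and vf: "verlet_flow n d (potential n V W eps) h qt pt" and inv: "invariant_prob (lebesgue_config n d) (hmc_kernel n d T qt) \<mu>h"
    interpret hmc n d V W eps L Lt K R T h1 by (rule hmc_setting_locale(1)[OF set])
    have C: "0 < Ct2" "2 * second_order_const Lip (LH + 8 * (eps * LtH)) T \<le> Ct2" by (auto simp: Ct2_def Lip_def)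
    show "wasserstein_l1 n (gibbs n d (potential n V W eps)) \<mu>h \<le> ennreal (h\<^sup>2 * inverse (rate L K R T) * prefactor L K R T * Ct2) *
        (ennreal (real d * real n) + (\<integral>\<^sup>+x. ennreal (\<Sum>i<n. norm (x i)) \<partial>gibbs n d (potential n V W eps)) + (\<integral>\<^sup>+x. ennreal (\<Sum>i<n. (norm (x i))\<^sup>2) \<partial>gibbs n d (potential n V W eps)))"
      by (rule second_order_accuracy(2)[OF hf vf h C3 LH C hmc_setting_locale(2)[OF set] inv])
  qed
qed

end
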